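(* Assume all $k_\alpha$ equal to $k\in\mathbb Z_{\ge0}$ and write $P^{(k)}_\lambda$ for the Macdonald polynomials with parameter $k$. Then: (1) for every $\lambda\in P_+$, $G^{(k)}P^{(k)}_{\lambda+\rho}=q^{k|R^+|}c_k(\lambda)P^{(k+1)}_\lambda$, where $c_k(\lambda)=\prod_{\alpha\in R^+}\big(q^{-k+(\alpha^\vee,\lambda+(k+1)\rho)}-q^{k-(\alpha^\vee,\lambda+(k+1)\rho)}\big)$; and $G^{(k)}P^{(k)}_\lambda=0$ whenever $\lambda\in P_+$ and $\lambda-\rho\notin P_+$; (2) for every $\lambda\in P_+$, $\hat G^{(k)}P^{(k+1)}_\lambda=q^{-k|R^+|}\hat c_k(\lambda)P^{(k)}_{\lambda+\rho}$, where $\hat c_k(\lambda)=\prod_{\alpha\in R^+}\big(q^{k+(\alpha^\vee,\lambda+(k+1)\rho)}-q^{-k-(\alpha^\vee,\lambda+(k+1)\rho)}\big)$.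
   Context: Let $V$ be a finite-dimensional real vector space with positive definite inner product $(\cdot,\cdot)$ and $R\subset V$ a reduced irreducible root system with positive roots $R^+$, simple roots $\alpha_1,\dots,\alpha_n$, highest root $\theta$, Weyl group $W$ generated by the simple reflections $s_i$. Put $\alpha^\vee=2\alpha/(\alpha,\alpha)$, $\rho=\frac12\sum_{\alpha\in R^+}\alpha$, $Q_+=\bigoplus\mathbb Z_{\ge0}\alpha_i$, $P=\{\lambda:(\lambda,\alpha_i^\vee)\in\mathbb Z\ \forall i\}$, $P_+=\{\lambda:(\lambda,\alpha_i^\vee)\in\mathbb Z_{\ge0}\}$, $P^\vee=\{\lambda:(\lambda,\alpha_i)\in\mathbb Z\ \forall i\}$, $P^\vee_+=\{\lambda:(\lambda,\alpha_i)\in\mathbb Z_{\ge0}\}$; $\lambda\le\mu$ means $\mu-\lambda\in Q_+$. Let $\hat V=V\oplus\mathbb R\delta$, $\alpha_0=-\theta+\delta$, $\hat R^+=\{\alpha+c\delta:\alpha\in R,c>0\}\cup R^+$, $\hat R^-=-\hat R^+$; $\widetilde W=W\ltimes\tau(P^\vee)$ acts on $\hat V$ by $w(\mu+c\delta)=w\mu+c\delta$, $\tau(\lambda)(\mu+c\delta)=\mu+(c-(\lambda,\mu))\delta$; $s_0=\tau(\theta^\vee)s_\theta$; $l(\tilde w)=|\hat R^+\cap\tilde w^{-1}\hat R^-|$; $\Omega=\{\tilde w:l(\tilde w)=0\}$; reduced expressions $\tilde w=\pi s_{i_l}\cdots s_{i_1}$, $\pi\in\Omega$, $l=l(\tilde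 w)$. For a parameter $k\in\mathbb Z_{\ge0}$: $q$ formal, $t=q^k$, all $t_i=t$; $\mathbb C_q=\mathbb C(q^{1/m})$ with $(P^\vee,P)\subset\frac1m\mathbb Z$. $\mathbb C_q[X]$: group algebra of $P$ with basis $X^\mu$; $\widetilde W$ acts by $wX^\mu=X^{w\mu}$, $\tau(\lambda)X^\mu=q^{2(\lambda,\mu)}X^\mu$, with $X^{\alpha_0}=q^{-2}X^{-\theta}$. $T_i=ts_i+(t-t^{-1})(X^{-\alpha_i}-1)^{-1}(s_i-1)$ ($0\le i\le n$); $T_{\tilde w}=\pi T_{i_l}\cdots T_{i_1}$ for a reduced expression; $Y^\lambda=T_{\tau(\lambda)}$ for $\lambda\in P^\vee_+$ and $Y^\lambda=Y^\mu(Y^\nu)^{-1}$ for $\lambda=\mu-\nu$, $\mu,\nu\in P^\vee_+$ (these depend on $k$). $\mathcal X=\prod_{\alpha\in R^+}(q^{-k}X^{\alpha/2}-q^kX^{-\alpha/2})$, $\mathcal Y=\prod_{\alpha\in R^+}(q^{-k}Y^{\alpha^\vee/2}-q^kY^{-\alpha^\vee/2})$, $\hat{\mathcal Y}=\prod_{\alpha\in R^+}(q^{k}Y^{\alpha^\vee/2}-q^{-k}Y^{-\alpha^\vee/2})$ (products expanded, exponents in $P^\vee$); $G^{(k)}=\mathcal X^{-1}\mathcal Y$, $\hat G^{(k)}=\hat{\mathcal Y}\mathcal X$; these preserve $\mathbb C_q[X]^W$. Bar involution: $\mathbb C_q$-linear, $\overline{X^\mu}=X^{-\mu}$; $[f]_0$: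 coefficient of $X^0$. $\Delta_k=\prod_{\alpha\in R}\prod_{i=0}^{k-1}(1-q^{2i}X^\alpha)$, $\langle f,g\rangle_k=\frac1{|W|}[f\bar g\Delta_k]_0$; $m_\lambda=\sum_{\nu\in W\lambda}X^\nu$. For $\lambda\in P_+$, $P^{(k)}_\lambda$ is the unique element of $\mathbb C_q[X]^W$ with $P^{(k)}_\lambda-m_\lambda\in\operatorname{span}\{m_\nu:\nu\in P_+,\nu<\lambda\}$ and $\langle P^{(k)}_\lambda,P^{(k)}_\mu\rangle_k=0$ for $\lambda\ne\mu$. *)

theory Defs
  imports "HOL-Analysis.Analysis" "HOL-Library.Poly_Mapping"
    "HOL-Computational_Algebra.Polynomial" "HOL-Computational_Algebra.Fraction_Field"
begin

text \<open>Coefficient field C_q = C(q^(1/m)): rational functions in one indeterminate z = q^(1/m).\<close>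
type_synonym K = "complex poly fract"

definition coroot :: "'v::euclidean_space \<Rightarrow> 'v" where
  "coroot a = (2 / (a \<bullet> a)) *\<^sub>R a"

definition rrefl :: "'v::euclidean_space \<Rightarrow> 'v \<Rightarrow> 'v" where
  "rrefl a x = x - (x \<bullet> coroot a) *\<^sub>R a"

definition root_datum :: "'v::euclidean_space set \<Rightarrow> 'v set \<Rightarrow> nat \<Rightarrow> bool" where
  "root_datum R S m \<longleftrightarrow>
     finite R \<and> R \<noteq> {} \<and> 0 \<notin> R \<and> span R = UNIV
   \<and> (\<forall>a\<in>R. \<forall>b\<in>R. rrefl a b \<in> R)
   \<and> (\<forall>a\<in>R. \<forall>b\<in>R. b \<bullet> coroot a \<in> \<int>)
   \<and> (\<forall>a\<in>R. \<forall>c::real. c *\<^sub>R a \<in> R \<longrightarrow> c = 1 \<or> c = -1)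
   \<and> \<not> (\<exists>A B. A \<noteq> {} \<and> B \<noteq> {} \<and> A \<union> B = R \<and> A \<inter> B = {}
             \<and> (\<forall>a\<in>A. \<forall>b\<in>B. a \<bullet> b = 0))
   \<and> S \<subseteq> R \<and> independent S
   \<and> (\<forall>a\<in>R. \<exists>c::'v \<Rightarrow> nat.
          a = (\<Sum>s\<in>S. of_nat (c s) *\<^sub>R s) \<or> a = - (\<Sum>s\<in>S. of_nat (c s) *\<^sub>R s))
   \<and> m > 0
   \<and> (\<forall>l. (\<forall>s\<in>S. l \<bullet> s \<in> \<int>) \<longrightarrow> (\<forall>u. (\<forall>s\<in>S. u \<bullet> coroot s \<in> \<int>) \<longrightarrow>
          of_nat m * (l \<bullet> u) \<in> \<int>))"

locale mac =
  fixes R :: "'v::euclidean_space set" and S :: "'v set" and m :: nat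
begin

definition Qp :: "'v set" where
  "Qp = {(\<Sum>s\<in>S. of_nat (c s) *\<^sub>R s) | c :: 'v \<Rightarrow> nat. True}"

definition rle :: "'v \<Rightarrow> 'v \<Rightarrow> bool" where
  "rle a b \<longleftrightarrow> b - a \<in> Qp"

definition rlt :: "'v \<Rightarrow> 'v \<Rightarrow> bool" where
  "rlt a b \<longleftrightarrow> rle a b \<and> a \<noteq> b"

definition Rp :: "'v set" where
  "Rp = {a \<in> R. rle 0 a}"

definition theta :: 'v where
  "theta = (THE th. th \<in> R \<and> (\<forall>a\<in>R. rle a th))"

definition Pw :: "'v set" where
  "Pw = {l. \<forall>s\<in>S. l \<bullet> coroot s \<in> \<int>}"

definition Ppos :: "'v set" where
  "Ppos = {l. \<forall>s\<in>S. l \<bullet> coroot s \<in> \<int> \<and> l \<bullet> coroot s \<ge> 0}"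

definition Pcw :: "'v set" where
  "Pcw = {l. \<forall>s\<in>S. l \<bullet> s \<in> \<int>}"

definition Pcwpos :: "'v set" where
  "Pcwpos = {l. \<forall>s\<in>S. l \<bullet> s \<in> \<int> \<and> l \<bullet> s \<ge> 0}"

definition rho :: 'v where
  "rho = (1/2) *\<^sub>R (\<Sum>a\<in>Rp. a)"

definition Wg :: "('v \<Rightarrow> 'v) set" where
  "Wg = {fold (\<lambda>s w. rrefl s \<circ> w) ss id | ss. set ss \<subseteq> S}"

text \<open>Affine action on hat V = V \<oplus> R delta, points written (mu, c) = mu + c delta.\<close>
definition wlin :: "('v \<Rightarrow> 'v) \<Rightarrow> 'v \<times> real \<Rightarrow> 'v \<times> real" where
  "wlin w = (\<lambda>(mu, c). (w mu, c))"

definition tau :: "'v \<Rightarrow> 'v \<times> real \<Rightarrow> 'v \<times> real" where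
  "tau l = (\<lambda>(mu, c). (mu, c - l \<bullet> mu))"

definition tW :: "('v \<times> real \<Rightarrow> 'v \<times> real) set" where
  "tW = {wlin w \<circ> tau l | w l. w \<in> Wg \<and> l \<in> Pcw}"

definition Rhat_pos :: "('v \<times> real) set" where
  "Rhat_pos = {(a, real_of_int c) | a c. a \<in> R \<and> c > 0} \<union> {(a, 0) | a. a \<in> Rp}"

definition Rhat_neg :: "('v \<times> real) set" where
  "Rhat_neg = (\<lambda>(a, c). (- a, - c)) ` Rhat_pos"

definition alen :: "('v \<times> real \<Rightarrow> 'v \<times> real) \<Rightarrow> nat" where
  "alen g = card {x \<in> Rhat_pos. g x \<in> Rhat_neg}"

definition Omega :: "('v \<times> real \<Rightarrow> 'v \<times> real) set" where
  "Omega = {g \<in> tW. alen g = 0}"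

text \<open>zq stands for q^(1/m); qpow r stands for q^r (meaningful when m r is an integer).\<close>
definition zq :: K where
  "zq = Fract [:0, 1:] 1"

definition qpow :: "real \<Rightarrow> K" where
  "qpow r = zq powi \<lfloor>real m * r\<rfloor>"

text \<open>Group algebra: finitely supported functions V \<Rightarrow> K; C_q[X] = those supported on P.\<close>
definition Xm :: "'v \<Rightarrow> 'v \<Rightarrow>\<^sub>0 K" where
  "Xm nu = Poly_Mapping.single nu 1"

definition cst :: "K \<Rightarrow> 'v \<Rightarrow>\<^sub>0 K" where
  "cst c = Poly_Mapping.single 0 c"

definition Xh :: "'v \<times> real \<Rightarrow> 'v \<Rightarrow>\<^sub>0 K" where
  "Xh p = Poly_Mapping.single (fst p) (qpow (-2 * snd p))"

definition Palg :: "('v \<Rightarrow>\<^sub>0 K) set" where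
  "Palg = {f. Poly_Mapping.keys f \<subseteq> Pw}"

definition act :: "('v \<times> real \<Rightarrow> 'v \<times> real) \<Rightarrow> ('v \<Rightarrow>\<^sub>0 K) \<Rightarrow> ('v \<Rightarrow>\<^sub>0 K)" where
  "act g f = (\<Sum>mu\<in>Poly_Mapping.keys f. cst (Poly_Mapping.lookup f mu) * Xh (g (mu, 0)))"

text \<open>Affine simple indices: None = 0, Some a = the simple root a.\<close>
definition Idx :: "'v option set" where
  "Idx = insert None (Some ` S)"

definition sa :: "'v option \<Rightarrow> 'v \<times> real \<Rightarrow> 'v \<times> real" where
  "sa i = (case i of None \<Rightarrow> tau (coroot theta) \<circ> wlin (rrefl theta)
                   | Some a \<Rightarrow> wlin (rrefl a))"

definition aroot :: "'v option \<Rightarrow> 'v \<times> real" where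
  "aroot i = (case i of None \<Rightarrow> (- theta, 1) | Some a \<Rightarrow> (a, 0))"

text \<open>Demazure-Lusztig operators T_i with t = q^k.\<close>
definition Top :: "nat \<Rightarrow> 'v option \<Rightarrow> ('v \<Rightarrow>\<^sub>0 K) \<Rightarrow> ('v \<Rightarrow>\<^sub>0 K)" where
  "Top k i f = cst (qpow (real k)) * act (sa i) f
     + cst (qpow (real k) - qpow (- real k)) *
       (THE g. g \<in> Palg \<and> (Xh (- fst (aroot i), - snd (aroot i)) - 1) * g = act (sa i) f - f)"

text \<open>T_w = pi T_(i_l) ... T_(i_1) for a reduced expression w = pi s_(i_l) ... s_(i_1),
  where the list is [i_1, ..., i_l].\<close>
definition Tw :: "nat \<Rightarrow> ('v \<times> real \<Rightarrow> 'v \<times> real) \<Rightarrow> ('v \<Rightarrow>\<^sub>0 K) \<Rightarrow> ('v \<Rightarrow>\<^sub>0 K)" where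
  "Tw k g = (case (SOME p. fst p \<in> Omega \<and> set (snd p) \<subseteq> Idx \<and> length (snd p) = alen g
                       \<and> g = fst p \<circ> fold (\<lambda>i h. sa i \<circ> h) (snd p) id) of
               (pp, is) \<Rightarrow> act pp \<circ> fold (\<lambda>i h. Top k i \<circ> h) is id)"

definition Y :: "nat \<Rightarrow> 'v \<Rightarrow> ('v \<Rightarrow>\<^sub>0 K) \<Rightarrow> ('v \<Rightarrow>\<^sub>0 K)" where
  "Y k l f = (if l \<in> Pcwpos then Tw k (tau l) f
     else (case (SOME p. fst p \<in> Pcwpos \<and> snd p \<in> Pcwpos \<and> l = fst p - snd p) of
             (a, b) \<Rightarrow> (THE g. g \<in> Palg \<and> Tw k (tau b) g = Tw k (tau a) f)))"

definition Xcal :: "nat \<Rightarrow> 'v \<Rightarrow>\<^sub>0 K" where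
  "Xcal k = (\<Sum>A\<in>Pow Rp. cst (qpow (- real k) ^ card A * (- qpow (real k)) ^ card (Rp - A))
                          * Xm ((1/2) *\<^sub>R ((\<Sum>a\<in>A. a) - (\<Sum>a\<in>Rp - A. a))))"

definition Ycal :: "nat \<Rightarrow> ('v \<Rightarrow>\<^sub>0 K) \<Rightarrow> ('v \<Rightarrow>\<^sub>0 K)" where
  "Ycal k f = (\<Sum>A\<in>Pow Rp. cst (qpow (- real k) ^ card A * (- qpow (real k)) ^ card (Rp - A))
       * Y k ((1/2) *\<^sub>R ((\<Sum>a\<in>A. coroot a) - (\<Sum>a\<in>Rp - A. coroot a))) f)"

definition Ycalhat :: "nat \<Rightarrow> ('v \<Rightarrow>\<^sub>0 K) \<Rightarrow> ('v \<Rightarrow>\<^sub>0 K)" where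
  "Ycalhat k f = (\<Sum>A\<in>Pow Rp. cst (qpow (real k) ^ card A * (- qpow (- real k)) ^ card (Rp - A))
       * Y k ((1/2) *\<^sub>R ((\<Sum>a\<in>A. coroot a) - (\<Sum>a\<in>Rp - A. coroot a))) f)"

definition Gop :: "nat \<Rightarrow> ('v \<Rightarrow>\<^sub>0 K) \<Rightarrow> ('v \<Rightarrow>\<^sub>0 K)" where
  "Gop k f = (THE g. g \<in> Palg \<and> Xcal k * g = Ycal k f)"

definition Ghat :: "nat \<Rightarrow> ('v \<Rightarrow>\<^sub>0 K) \<Rightarrow> ('v \<Rightarrow>\<^sub>0 K)" where
  "Ghat k f = Ycalhat k (Xcal k * f)"

definition bar :: "('v \<Rightarrow>\<^sub>0 K) \<Rightarrow> ('v \<Rightarrow>\<^sub>0 K)" where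
  "bar f = (\<Sum>mu\<in>Poly_Mapping.keys f. Poly_Mapping.single (- mu) (Poly_Mapping.lookup f mu))"

definition Delta :: "nat \<Rightarrow> 'v \<Rightarrow>\<^sub>0 K" where
  "Delta k = (\<Prod>a\<in>R. \<Prod>i<k. (1 - Poly_Mapping.single a (qpow (2 * real i))))"

definition ip :: "nat \<Rightarrow> ('v \<Rightarrow>\<^sub>0 K) \<Rightarrow> ('v \<Rightarrow>\<^sub>0 K) \<Rightarrow> K" where
  "ip k f g = Poly_Mapping.lookup (f * bar g * Delta k) 0 / of_nat (card Wg)"

definition Sym :: "('v \<Rightarrow>\<^sub>0 K) set" where
  "Sym = {f \<in> Palg. \<forall>w\<in>Wg. act (wlin w) f = f}"

definition msym :: "'v \<Rightarrow> 'v \<Rightarrow>\<^sub>0 K" where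
  "msym l = (\<Sum>nu\<in>(\<lambda>w. w l) ` Wg. Xm nu)"

definition Pfam :: "nat \<Rightarrow> 'v \<Rightarrow> ('v \<Rightarrow>\<^sub>0 K)" where
  "Pfam k = (THE F. (\<forall>l. l \<notin> Ppos \<longrightarrow> F l = 0)
     \<and> (\<forall>l\<in>Ppos. F l \<in> Sym
          \<and> (\<exists>c::'v \<Rightarrow> K. finite {nu. c nu \<noteq> 0} \<and> (\<forall>nu. c nu \<noteq> 0 \<longrightarrow> nu \<in> Ppos \<and> rlt nu l)
               \<and> F l - msym l = (\<Sum>nu\<in>{nu. c nu \<noteq> 0}. cst (c nu) * msym nu)))
     \<and> (\<forall>l\<in>Ppos. \<forall>l'\<in>Ppos. l \<noteq> l' \<longrightarrow> ip k (F l) (F l') = 0))"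

definition ck :: "nat \<Rightarrow> 'v \<Rightarrow> K" where
  "ck k l = (\<Prod>a\<in>Rp. qpow (- real k + coroot a \<bullet> (l + (real k + 1) *\<^sub>R rho))
                    - qpow (real k - coroot a \<bullet> (l + (real k + 1) *\<^sub>R rho)))"

definition ckhat :: "nat \<Rightarrow> 'v \<Rightarrow> K" where
  "ckhat k l = (\<Prod>a\<in>Rp. qpow (real k + coroot a \<bullet> (l + (real k + 1) *\<^sub>R rho))
                    - qpow (- real k - coroot a \<bullet> (l + (real k + 1) *\<^sub>R rho)))"

end

end

theory Submission
  imports Defs "HOL-Computational_Algebra.Polynomial_Factorial"
begin

text \<open>
  Let \<open>*\<close> invert both \<open>X\<close> and \<open>q\<close>. The operators \<open>T\<^sub>i\<close> are isometries of Cherednik's form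
  \<open>(f, g) \<mapsto> [f g* \<mu>\<^sub>k]\<^sub>0\<close>, which is nondegenerate because modulo \<open>q\<^sup>1\<^sup>/\<^sup>m\<close> its matrix is unitriangular. An isometry that is
  triangular up to a monomial map is determined by its diagonal, so \<open>Y\<^sup>\<lambda>\<close> does not depend on the reduced expression and
  \<open>Y\<^sup>\<lambda> Y\<^sup>\<mu> = Y\<^sup>\<lambda>\<^sup>+\<^sup>\<mu>\<close>; no braid relations are needed. By the Bernstein relations \<open>Ycal\<close> maps symmetric elements to
  elements on which every \<open>T\<^sub>i\<close>, \<open>i > 0\<close>, acts by \<open>-t\<^sup>-\<^sup>1\<close>, and these are exactly the products \<open>Xcal k * g\<close> with \<open>g\<close> symmetric;
  conversely \<open>Ycalhat\<close> maps such products to symmetric elements. Both operators are self-adjoint up to sign.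

  Averaging over \<open>W\<close>, Cherednik's form becomes Macdonald's inner product with parameter \<open>k\<close> on symmetric elements, and with
  parameter \<open>k + 1\<close> when one argument is \<open>Xcal k * g\<close>. Hence the shift operators preserve the orthogonality that characterises
  Macdonald polynomials, and the constants are read off the leading coefficients. Starting from orbit sums at \<open>k = 0\<close>, the same
  argument gives the existence and pairwise orthogonality of the Macdonald polynomials by induction on \<open>k\<close>.
\<close>

text \<open>The definitions rest on unspecified choices and definite descriptions: a reduced
  expression in \<open>Tw\<close>, a splitting in \<open>Y\<close>, quotients in \<open>Top\<close>
  and \<open>Gop\<close>, the whole family in \<open>Pfam\<close>. Rigidity resolves the choices: if
  two isometries are \<open>act g\<close> after triangular operators with equal diagonals, then by
  induction their difference on X^n lies in the \<open>act g\<close> image of lower monomials and is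
  orthogonal to that image, hence zero. Nondegeneracy is accessible because, for integral k,
  Cherednik's weight is a finite product with coefficients polynomial in z, and affine roots of
  positive level contribute 1 modulo z.

  The dominance order is only partial, so orthogonality to lower orbit sums does not by itself give
  orthogonality at incomparable weights. This obstacle forces the induction on k to carry pairwise
  orthogonality as well as existence; self-adjointness of \<open>Ycal\<close> transports both.

  The constants are eigenvalues: on the coefficient at a dominant leading exponent x,
  \<open>Y k l\<close> acts by q^(2(l, x + k rho)). The power q^(k|R+|) in (1) is the inverse of the
  leading coefficient of \<open>Xcal k\<close>.\<close>

abbreviation "lk \<equiv> Poly_Mapping.lookup"
abbreviation "ky \<equiv> Poly_Mapping.keys"
abbreviation "sg \<equiv> Poly_Mapping.single"

subsection \<open>Linear extension from monomials\<close>

lemma pm_decomp: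
  fixes f :: "'a \<Rightarrow>\<^sub>0 'c::comm_monoid_add"
  assumes "finite A" "ky f \<subseteq> A"
  shows "f = (\<Sum>x\<in>A. sg x (lk f x))"
proof (rule poly_mapping_eqI)
  fix k
  have "lk (\<Sum>x\<in>A. sg x (lk f x)) k = (\<Sum>x\<in>A. if x = k then lk f x else 0)"
    by (simp add: lookup_sum lookup_single when_def)
  also have "\<dots> = lk f k" using assms by (auto simp: in_keys_iff)
  finally show "lk f k = lk (\<Sum>x\<in>A. sg x (lk f x)) k" by simp
qed

lemma keys_sum_sub: "(\<And>i. i \<in> I \<Longrightarrow> ky (b i) \<subseteq> A) \<Longrightarrow> ky (sum b I) \<subseteq> A"
  using keys_sum[of b I] by blast

text \<open>Keeping every support inside \<open>A\<close> allows linear statements that hold only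
  for exponents in a lattice to be checked on monomials.\<close>

lemma pm_induct_on [consumes 1, case_names zero single add]:
  fixes f :: "'a \<Rightarrow>\<^sub>0 'c::comm_monoid_add"
  assumes "ky f \<subseteq> A" "P 0" "\<And>a c. a \<in> A \<Longrightarrow> P (sg a c)"
    "\<And>f g. ky f \<subseteq> A \<Longrightarrow> ky g \<subseteq> A \<Longrightarrow> P f \<Longrightarrow> P g \<Longrightarrow> P (f + g)"
  shows "P f"
proof -
  have "ky (\<Sum>x\<in>B. sg x (lk f x)) \<subseteq> A \<and> P (\<Sum>x\<in>B. sg x (lk f x))" if "finite B" "B \<subseteq> A" for B
    using that
  proof (induction B rule: finite_induct)
    case (insert x F)
    have "ky (sg x (lk f x)) \<subseteq> A" using insert.prems by simp
    moreover have "ky (sg x (lk f x) + (\<Sum>x\<in>F. sg x (lk f x))) \<subseteq> A"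
      using insert calculation keys_add[of "sg x (lk f x)"] by blast
    ultimately show ?case using insert assms(3,4) by simp
  qed (use assms in auto)
  from this[of "ky f"] show ?thesis using pm_decomp[of "ky f" f] assms(1) by simp
qed

lemma lookup_single_mult:
  fixes f :: "'a::ab_group_add \<Rightarrow>\<^sub>0 'c::comm_ring_1"
  shows "lk (sg a c * f) n = c * lk f (n - a)"
proof -
  have "ky f \<subseteq> UNIV" by simp
  then show ?thesis
    by (induction f rule: pm_induct_on)
      (auto simp: mult_single lookup_single when_def lookup_add distrib_left)
qed

lemma lookup_cmul [simp]:
  fixes f :: "'a::ab_group_add \<Rightarrow>\<^sub>0 'c::comm_ring_1"
  shows "lk (sg 0 c * f) n = c * lk f n"
  by (simp add: lookup_single_mult)

lemma keys_cmul_subset: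
  fixes f :: "'a::ab_group_add \<Rightarrow>\<^sub>0 'c::comm_ring_1"
  shows "ky (sg 0 c * f) \<subseteq> ky f"
  by (auto simp: in_keys_iff)

text \<open>The linear extension of a map given on exponents. The group action, \<open>bar\<close>,
  the divided differences and the substitution of \<open>Y\<close> for X are all instances of
  it.\<close>

definition ext :: "('a \<Rightarrow> ('b::ab_group_add \<Rightarrow>\<^sub>0 'c::comm_ring_1)) \<Rightarrow> ('a \<Rightarrow>\<^sub>0 'c) \<Rightarrow> ('b \<Rightarrow>\<^sub>0 'c)" where
  "ext \<phi> f = (\<Sum>a\<in>ky f. sg 0 (lk f a) * \<phi> a)"

lemma ext_superset: "finite A \<Longrightarrow> ky f \<subseteq> A \<Longrightarrow> ext \<phi> f = (\<Sum>a\<in>A. sg 0 (lk f a) * \<phi> a)"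
  unfolding ext_def by (rule sum.mono_neutral_left) (auto simp: in_keys_iff)

lemma ext_0 [simp]: "ext \<phi> 0 = 0"
  by (simp add: ext_def)

lemma ext_add: "ext \<phi> (f + g) = ext \<phi> f + ext \<phi> g"
proof -
  let ?A = "ky f \<union> ky g"
  have "ext \<phi> (f + g) = (\<Sum>a\<in>?A. sg 0 (lk (f+g) a) * \<phi> a)"
    by (rule ext_superset) (use keys_add[of f g] in auto)
  also have "\<dots> = (\<Sum>a\<in>?A. sg 0 (lk f a) * \<phi> a) + (\<Sum>a\<in>?A. sg 0 (lk g a) * \<phi> a)"
    by (simp add: lookup_add single_add distrib_right sum.distrib)
  also have "\<dots> = ext \<phi> f + ext \<phi> g" by (simp add: ext_superset[of ?A])
  finally show ?thesis .
qed

lemma ext_single: "ext \<phi> (sg a c) = sg 0 c * \<phi> a"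
  by (subst ext_superset[of "{a}"]) auto

lemma ext_cmul:
  fixes f :: "'a::ab_group_add \<Rightarrow>\<^sub>0 'c::comm_ring_1"
  shows "ext \<phi> (sg 0 c * f) = sg 0 c * ext \<phi> f"
proof -
  have "ext \<phi> (sg 0 c * f) = (\<Sum>a\<in>ky f. sg 0 (lk (sg 0 c * f) a) * \<phi> a)"
    by (rule ext_superset) (auto simp: keys_cmul_subset)
  also have "\<dots> = (\<Sum>a\<in>ky f. sg 0 c * (sg 0 (lk f a) * \<phi> a))"
    by (rule sum.cong) (auto simp: mult_single simp flip: mult.assoc)
  finally show ?thesis by (simp add: ext_def sum_distrib_left)
qed

lemma ext_uminus: "ext \<phi> (- f) = - ext \<phi> f"
  using ext_add[of \<phi> f "- f"] by (simp add: eq_neg_iff_add_eq_0 add.commute)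

lemma ext_diff: "ext \<phi> (f - g) = ext \<phi> f - ext \<phi> g"
  using ext_add[of \<phi> f "- g"] by (simp add: ext_uminus)

lemma ext_sum: "ext \<phi> (\<Sum>i\<in>I. f i) = (\<Sum>i\<in>I. ext \<phi> (f i))"
  by (induction I rule: infinite_finite_induct) (auto simp: ext_add)

lemma keys_ext: "ky (ext \<phi> f) \<subseteq> (\<Union>a\<in>ky f. ky (\<phi> a))"
proof -
  have "ky (ext \<phi> f) \<subseteq> (\<Union>a\<in>ky f. ky (sg 0 (lk f a) * \<phi> a))"
    unfolding ext_def by (rule keys_sum)
  then show ?thesis using keys_cmul_subset by blast
qed

text \<open>Multiplicativity is asked only on the two supports, because the affine action is
  multiplicative on weights only: \<open>qpow\<close> is additive only where its exponent times
  \<open>m\<close> is integral.\<close>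

lemma ext_mult:
  fixes \<phi> :: "'a::ab_group_add \<Rightarrow> ('b::ab_group_add \<Rightarrow>\<^sub>0 'c::comm_ring_1)"
  assumes "\<And>a b. a \<in> ky f \<Longrightarrow> b \<in> ky g \<Longrightarrow> \<phi> (a + b) = \<phi> a * \<phi> b"
  shows "ext \<phi> (f * g) = ext \<phi> f * ext \<phi> g"
proof -
  define A B where "A = ky f" and "B = ky g"
  have "ky f \<subseteq> A" "ky g \<subseteq> B" by (auto simp: A_def B_def)
  note * = assms[folded A_def B_def]
  from \<open>ky f \<subseteq> A\<close> show ?thesis
  proof (induction f rule: pm_induct_on)
    case (single a c)
    from \<open>ky g \<subseteq> B\<close> show ?case
    proof (induction g rule: pm_induct_on)
      case (single b d)
      then show ?case using \<open>a \<in> A\<close>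
        by (simp add: mult_single ext_single * ac_simps flip: mult_single[of 0 c 0 d, simplified])
    qed (auto simp: ext_add distrib_left)
  qed (auto simp: ext_add distrib_right)
qed

lemma keys_mult_sub:
  "(\<And>a b. a \<in> ky f \<Longrightarrow> b \<in> ky g \<Longrightarrow> a + b \<in> C) \<Longrightarrow> ky (f * g) \<subseteq> C"
  using keys_mult[of f g] by auto

lemma keys_add_sub: "ky f \<subseteq> A \<Longrightarrow> ky g \<subseteq> A \<Longrightarrow> ky (f + g) \<subseteq> A"
  using keys_add[of f g] by auto

lemma keys_diff_sub:
  fixes f g :: "'a \<Rightarrow>\<^sub>0 'c::ab_group_add"
  shows "ky f \<subseteq> A \<Longrightarrow> ky g \<subseteq> A \<Longrightarrow> ky (f - g) \<subseteq> A"
  unfolding subset_iff in_keys_iff lookup_minus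
  by (metis cancel_comm_monoid_add_class.diff_cancel)

subsection \<open>Binomials\<close>

text \<open>Choose n in the support of \<open>g\<close> extremal in the direction a - b. Then the
  term at n + a coming from \<open>sg a c\<close> cannot be cancelled by the other one.\<close>

lemma binomial_nonzerodivisor:
  fixes g :: "'a::euclidean_space \<Rightarrow>\<^sub>0 'c::field"
  assumes "(sg a c + sg b d) * g = 0" "a \<noteq> b" "c \<noteq> 0"
  shows "g = 0"
proof (rule ccontr)
  assume "g \<noteq> 0"
  then have ne: "ky g \<noteq> {}" by simp
  obtain n where n: "n \<in> ky g" "\<And>n'. n' \<in> ky g \<Longrightarrow> (a - b) \<bullet> n' \<le> (a - b) \<bullet> n"
  proof -
    let ?I = "(\<lambda>n. (a - b) \<bullet> n) ` ky g"
    have "Max ?I \<in> ?I" using ne by (intro Max_in) auto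
    then obtain n where "n \<in> ky g" "(a - b) \<bullet> n = Max ?I" by force
    then show ?thesis using that by simp
  qed
  have "n + a - b \<notin> ky g"
  proof
    assume "n + a - b \<in> ky g"
    from n(2)[OF this] have "(a - b) \<bullet> (a - b) \<le> 0" by (simp add: algebra_simps inner_diff_left inner_diff_right)
    then show False using \<open>a \<noteq> b\<close> by (metis inner_gt_zero_iff not_le right_minus_eq)
  qed
  then have "lk ((sg a c + sg b d) * g) (n + a) = c * lk g n"
    by (simp add: distrib_right lookup_add lookup_single_mult in_keys_iff)
  then show False using assms n(1) by (simp add: in_keys_iff)
qed

lemma binomial_cancel:
  fixes g :: "'a::euclidean_space \<Rightarrow>\<^sub>0 'c::field"
  assumes "(sg a c + sg b d) * g = (sg a c + sg b d) * h" "a \<noteq> b" "c \<noteq> 0"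
  shows "g = h"
  using binomial_nonzerodivisor[of a c b d "g - h"] assms by (simp add: right_diff_distrib)

text \<open>The sum of \<open>f\<close> over the line \<open>n + \<int>a\<close> with geometric weights is evaluation at \<open>X\<^sup>a = 1/c\<close>;
  it vanishes exactly on the multiples of \<open>1 - c X\<^sup>a\<close>.\<close>
definition line_sum :: "'a::euclidean_space \<Rightarrow> 'c::field \<Rightarrow> ('a \<Rightarrow>\<^sub>0 'c) \<Rightarrow> 'a \<Rightarrow> 'c" where
  "line_sum a c f n = (\<Sum>j\<in>{j::int. n + of_int j *\<^sub>R a \<in> ky f}. (c powi (- j)) * lk f (n + of_int j *\<^sub>R a))"

lemma finite_line:
  fixes a n :: "'a::euclidean_space"
  assumes "a \<noteq> 0" "finite B" shows "finite {j::int. n + of_int j *\<^sub>R a \<in> B}"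
proof -
  have "inj (\<lambda>j::int. n + of_int j *\<^sub>R a)" using assms(1) by (auto simp: inj_on_def)
  from finite_vimageI[OF assms(2) this] show ?thesis by (simp add: vimage_def)
qed

lemma line_sum_superset:
  assumes "finite J" "{j::int. n + of_int j *\<^sub>R a \<in> ky f} \<subseteq> J"
  shows "line_sum a c f n = (\<Sum>j\<in>J. (c powi (- j)) * lk f (n + of_int j *\<^sub>R a))"
  unfolding line_sum_def using assms by (intro sum.mono_neutral_left) (auto simp: in_keys_iff)

lemma line_sum_add:
  assumes "a \<noteq> 0" shows "line_sum a c (f + g) n = line_sum a c f n + line_sum a c g n"
proof -
  define J where "J = {j::int. n + of_int j *\<^sub>R a \<in> ky f \<union> ky g}"
  have J: "finite J" unfolding J_def by (rule finite_line) (use assms in auto)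
  have "{j::int. n + of_int j *\<^sub>R a \<in> ky (f+g)} \<subseteq> J" "{j::int. n + of_int j *\<^sub>R a \<in> ky f} \<subseteq> J"
    "{j::int. n + of_int j *\<^sub>R a \<in> ky g} \<subseteq> J"
    using keys_add[of f g] by (auto simp: J_def)
  from this[THEN line_sum_superset[OF J]] show ?thesis
    by (simp add: lookup_add distrib_left sum.distrib)
qed

lemma line_sum_single_mult:
  assumes "a \<noteq> 0" shows "line_sum a c (sg b d * f) n = d * line_sum a c f (n - b)"
proof -
  define J where "J = {j::int. n - b + of_int j *\<^sub>R a \<in> ky f}"
  have J: "finite J" unfolding J_def by (rule finite_line) (use assms in auto)
  have "{j::int. n + of_int j *\<^sub>R a \<in> ky (sg b d * f)} \<subseteq> J"
  proof
    fix j assume "j \<in> {j::int. n + of_int j *\<^sub>R a \<in> ky (sg b d * f)}"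
    then have "lk (sg b d * f) (n + of_int j *\<^sub>R a) \<noteq> 0" by (simp add: in_keys_iff)
    then have "lk f (n + of_int j *\<^sub>R a - b) \<noteq> 0" unfolding lookup_single_mult by auto
    then show "j \<in> J" by (simp add: J_def in_keys_iff algebra_simps)
  qed
  then have "line_sum a c (sg b d * f) n = (\<Sum>j\<in>J. c powi (- j) * lk (sg b d * f) (n + of_int j *\<^sub>R a))"
    by (rule line_sum_superset[OF J])
  also have "\<dots> = (\<Sum>j\<in>J. d * (c powi (- j) * lk f (n - b + of_int j *\<^sub>R a)))"
    unfolding lookup_single_mult by (simp add: ac_simps add_diff_eq diff_add_eq)
  also have "\<dots> = d * line_sum a c f (n - b)"
    by (simp add: line_sum_def J_def sum_distrib_left)
  finally show ?thesis .
qed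

lemma line_sum_shift:
  assumes "c \<noteq> 0" shows "line_sum a c f (n + of_int i *\<^sub>R a) = c powi i * line_sum a c f n"
proof -
  have "line_sum a c f (n + of_int i *\<^sub>R a) =
     (\<Sum>j\<in>{j. n + of_int j *\<^sub>R a \<in> ky f}. c powi (i - j) * lk f (n + of_int j *\<^sub>R a))"
    unfolding line_sum_def
    by (rule sum.reindex_bij_witness[of _ "\<lambda>j. j - i" "\<lambda>j. j + i"])
      (auto simp: algebra_simps)
  also have "\<dots> = c powi i * line_sum a c f n"
    using assms by (simp add: line_sum_def sum_distrib_left power_int_diff power_int_minus field_simps)
  finally show ?thesis .
qed

lemma line_sum_zero_imp_dvd:
  fixes f :: "'a::euclidean_space \<Rightarrow>\<^sub>0 'c::field"
  assumes "a \<noteq> 0" "c \<noteq> 0" "\<And>n. line_sum a c f n = 0"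
  shows "\<exists>g. (1 - sg a c) * g = f"
proof -
  \<comment> \<open>These are the coefficients of the formal quotient of f by 1 - c X^a, that is, of
    f times the geometric series in c X^a.\<close>
  define G where "G n = (\<Sum>j\<in>{j::int. n + of_int j *\<^sub>R a \<in> ky f \<and> j \<le> 0}. (c powi (- j)) * lk f (n + of_int j *\<^sub>R a))" for n
  have fin: "finite {j::int. n + of_int j *\<^sub>R a \<in> ky f}" for n
    by (rule finite_line) (use assms in auto)
  define E where "E = (\<lambda>(x,y). (x \<bullet> a - y \<bullet> a) / (a \<bullet> a)) ` (ky f \<times> ky f)"
  \<comment> \<open>A nonzero \<open>G n\<close> requires a support point of f at or behind n on its
    line and, since the full line sum vanishes, also one strictly ahead. The distances in
    \<open>E\<close> therefore bound how far n can lie from the support, so the formal quotient is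
    finite.\<close>
  have supp: "\<exists>x\<in>ky f. \<exists>i\<in>{0..nat \<lceil>Max (insert 0 E)\<rceil>}. n = x + real i *\<^sub>R a" if "G n \<noteq> 0" for n
  proof -
    have fE: "finite (insert 0 E)" by (auto simp: E_def)
    have aa: "a \<bullet> a > 0" using assms by simp
    from that obtain j where j: "n + of_int j *\<^sub>R a \<in> ky f" "j \<le> 0"
      unfolding G_def by (metis (mono_tags, lifting) mem_Collect_eq sum.not_neutral_contains_not_neutral)
    have "\<exists>i. n + of_int i *\<^sub>R a \<in> ky f \<and> i > 0"
    proof (rule ccontr)
      assume "\<not> ?thesis"
      then have "{j::int. n + of_int j *\<^sub>R a \<in> ky f \<and> j \<le> 0} = {j::int. n + of_int j *\<^sub>R a \<in> ky f}" by force
      then have "G n = line_sum a c f n" by (simp add: G_def line_sum_def)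
      then show False using that assms(3) by simp
    qed
    then obtain i where i: "n + of_int i *\<^sub>R a \<in> ky f" "i > 0" by blast
    have "of_int (i - j) \<in> E"
      unfolding E_def using aa assms(1)
      by (intro image_eqI[of _ _ "(n + of_int i *\<^sub>R a, n + of_int j *\<^sub>R a)"])
        (use i j in \<open>auto simp: inner_add_left inner_add_right field_simps\<close>)
    then have "of_int (i - j) \<le> Max (insert 0 E)" using fE by simp
    then have "i - j \<le> \<lceil>Max (insert 0 E)\<rceil>" by (metis ceiling_mono ceiling_of_int)
    then have "nat (-j) \<le> nat \<lceil>Max (insert 0 E)\<rceil>" using i(2) by (intro nat_mono) linarith
    moreover have "n = (n + of_int j *\<^sub>R a) + real (nat (-j)) *\<^sub>R a" using j(2)
      by (simp add: algebra_simps)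
    ultimately show ?thesis using j by (metis atLeastAtMost_iff le0)
  qed
  have "{n. G n \<noteq> 0} \<subseteq> (\<Union>x\<in>ky f. (\<lambda>i. x + real i *\<^sub>R a) ` {0..nat \<lceil>Max (insert 0 E)\<rceil>})"
    using supp by fast
  then have finG: "finite {n. G n \<noteq> 0}" by (rule finite_subset) auto
  define g where "g = Abs_poly_mapping G"
  have lg: "lk g n = G n" for n unfolding g_def using finG by simp
  have rec: "G n = lk f n + c * G (n - a)" for n
  proof -
    have "G n = (\<Sum>j\<in>{j::int. n + of_int j *\<^sub>R a \<in> ky f \<and> j \<le> 0} \<union> {0}. (c powi (- j)) * lk f (n + of_int j *\<^sub>R a))"
      unfolding G_def by (rule sum.mono_neutral_left) (auto simp: in_keys_iff intro: finite_subset[OF _ fin[of n]])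
    also have "{j::int. n + of_int j *\<^sub>R a \<in> ky f \<and> j \<le> 0} \<union> {0} = insert 0 {j::int. n + of_int j *\<^sub>R a \<in> ky f \<and> j < 0}" by auto
    also have "(\<Sum>j\<in>insert 0 {j::int. n + of_int j *\<^sub>R a \<in> ky f \<and> j < 0}. (c powi (- j)) * lk f (n + of_int j *\<^sub>R a))
      = lk f n + (\<Sum>j\<in>{j::int. n + of_int j *\<^sub>R a \<in> ky f \<and> j < 0}. (c powi (- j)) * lk f (n + of_int j *\<^sub>R a))"
      by (subst sum.insert) (auto intro: finite_subset[OF _ fin[of n]])
    also have "(\<Sum>j\<in>{j::int. n + of_int j *\<^sub>R a \<in> ky f \<and> j < 0}. (c powi (- j)) * lk f (n + of_int j *\<^sub>R a))
       = (\<Sum>j\<in>{j::int. n - a + of_int j *\<^sub>R a \<in> ky f \<and> j \<le> 0}. c * ((c powi (- j)) * lk f (n - a + of_int j *\<^sub>R a)))"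
      by (rule sum.reindex_bij_witness[of _ "\<lambda>j. j - 1" "\<lambda>j. j + 1"])
        (auto simp: algebra_simps power_int_add power_int_diff assms power_int_minus)
    finally show ?thesis by (simp add: G_def sum_distrib_left)
  qed
  have "(1 - sg a c) * g = f"
  proof (rule poly_mapping_eqI)
    fix n
    show "lk ((1 - sg a c) * g) n = lk f n"
      by (simp add: left_diff_distrib lookup_minus lookup_single_mult lg rec[of n])
  qed
  then show ?thesis by blast
qed

lemma dvd_imp_line_sum_zero:
  fixes g :: "'a::euclidean_space \<Rightarrow>\<^sub>0 'c::field"
  assumes "a \<noteq> 0" "c \<noteq> 0"
  shows "line_sum a c ((1 - sg a c) * g) n = 0"
proof -
  have e: "(1 - sg a c) * g = g + sg a (- c) * g"
    by (simp add: left_diff_distrib single_uminus)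
  show ?thesis unfolding e line_sum_add[OF assms(1)] line_sum_single_mult[OF assms(1)]
    using line_sum_shift[OF assms(2), of a g n "-1"] assms by simp
qed

text \<open>Evaluation at X^a = 1/c turns divisibility into the two-term recurrence
  \<open>rel\<close> between line sums. If b' - b is not parallel to a, a nonzero line sum would
  propagate to infinitely many distinct lines meeting the finite support. If it is an integral
  multiple of a, the binomial evaluates to the nonzero scalar d + d' c^i up to a shift.\<close>

lemma binomial_coprime:
  fixes f :: "'a::euclidean_space \<Rightarrow>\<^sub>0 'c::field"
  assumes "a \<noteq> 0" "c \<noteq> 0" "d \<noteq> 0" "d' \<noteq> 0" "b \<noteq> b'"
    and dv: "\<exists>g. (1 - sg a c) * g = (sg b d + sg b' d') * f"
    and gen: "(\<forall>r. b' - b \<noteq> r *\<^sub>R a) \<or> (\<exists>i::int. b - b' = of_int i *\<^sub>R a \<and> d + d' * c powi i \<noteq> 0)"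
  shows "\<exists>g. (1 - sg a c) * g = f"
proof (rule line_sum_zero_imp_dvd[OF assms(1,2)])
  fix n
  have rel: "d * line_sum a c f (n - b) + d' * line_sum a c f (n - b') = 0" for n
    using dv dvd_imp_line_sum_zero[OF assms(1,2), of _ n]
    by (metis distrib_right line_sum_add[OF assms(1)] line_sum_single_mult[OF assms(1)])
  from gen show "line_sum a c f n = 0"
  proof
    assume np: "\<forall>r. b' - b \<noteq> r *\<^sub>R a"
    have step: "line_sum a c f (n + (b' - b)) \<noteq> 0" if "line_sum a c f n \<noteq> 0" for n
    proof
      assume "line_sum a c f (n + (b' - b)) = 0"
      then have "d' * line_sum a c f n = 0" using rel[of "n + b'"] by (simp add: algebra_simps)
      then show False using that assms by simp
    qed
    show ?thesis
    proof (rule ccontr)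
      assume nz: "line_sum a c f n \<noteq> 0"
      have all: "line_sum a c f (n + real i *\<^sub>R (b' - b)) \<noteq> 0" for i
      proof (induction i)
        case (Suc i)
        from step[OF Suc] show ?case by (simp add: algebra_simps)
      qed (use nz in simp)
      have "\<exists>j::int. n + real i *\<^sub>R (b' - b) + of_int j *\<^sub>R a \<in> ky f" for i
        using all[of i] unfolding line_sum_def
        by (metis (mono_tags, lifting) mem_Collect_eq sum.not_neutral_contains_not_neutral)
      then obtain J where J: "\<And>i. n + real i *\<^sub>R (b' - b) + of_int (J i) *\<^sub>R a \<in> ky f" by metis
      have "inj (\<lambda>i::nat. n + real i *\<^sub>R (b' - b) + of_int (J i) *\<^sub>R a)"
      proof (rule injI, rule ccontr)
        fix i i' :: nat
        assume "n + real i *\<^sub>R (b' - b) + of_int (J i) *\<^sub>R a = n + real i' *\<^sub>R (b' - b) + of_int (J i') *\<^sub>R a"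
          and "i \<noteq> i'"
        then have "(real i - real i') *\<^sub>R (b' - b) = (of_int (J i') - of_int (J i)) *\<^sub>R a"
          by (simp add: algebra_simps)
        moreover define x where "x = real i - real i'"
        moreover have "x \<noteq> 0" using \<open>i \<noteq> i'\<close> by (simp add: x_def)
        ultimately have e: "x *\<^sub>R (b' - b) = (of_int (J i') - of_int (J i)) *\<^sub>R a" and x: "x \<noteq> 0"
          by simp_all
        have "b' - b = inverse x *\<^sub>R (x *\<^sub>R (b' - b))" using x by simp
        then have "b' - b = (inverse x * (of_int (J i') - of_int (J i))) *\<^sub>R a"
          unfolding e by (simp only: scaleR_scaleR)
        then show False using np by blast
      qed
      then have "infinite (range (\<lambda>i::nat. n + real i *\<^sub>R (b' - b) + of_int (J i) *\<^sub>R a))"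
        by (rule range_inj_infinite)
      moreover have "range (\<lambda>i::nat. n + real i *\<^sub>R (b' - b) + of_int (J i) *\<^sub>R a) \<subseteq> ky f"
        using J by (simp add: image_subset_iff)
      ultimately show False using finite_subset[OF _ finite_keys] by metis
    qed
  next
    assume "\<exists>i::int. b - b' = of_int i *\<^sub>R a \<and> d + d' * c powi i \<noteq> 0"
    then obtain i :: int where i: "b - b' = of_int i *\<^sub>R a" "d + d' * c powi i \<noteq> 0" by blast
    have "n + b - b' = n + of_int i *\<^sub>R a" using i(1) by (simp add: algebra_simps)
    then have "(d + d' * c powi i) * line_sum a c f n = 0"
      using rel[of "n + b"] line_sum_shift[OF assms(2), of a f n i] by (simp add: algebra_simps)
    then show ?thesis using i by simp
  qed
qed

subsection \<open>The coefficient field\<close>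

lemma fract_of_nat_nonzero: "n > 0 \<Longrightarrow> (of_nat n :: K) \<noteq> 0"
  by (simp add: of_nat_fract eq_fract Zero_fract_def)

lemma zq_to_fract: "mac.zq = to_fract [:0, 1:]"
  by (simp add: mac.zq_def to_fract_def)

lemma zq_nonzero [simp]: "mac.zq \<noteq> 0"
  by (simp add: zq_to_fract to_fract_eq_0_iff)

lemma zq_power: "mac.zq ^ n = to_fract (monom 1 n)"
  by (induction n) (simp_all add: zq_to_fract monom_Suc monom_0 flip: to_fract_mult one_pCons)

lemma zq_power_int_eq_1: "mac.zq powi n = 1 \<longleftrightarrow> n = 0"
proof -
  have pos: "mac.zq ^ n \<noteq> 1" if "n > 0" for n
  proof
    assume "mac.zq ^ n = 1"
    then have "monom (1::complex) n = 1" by (metis to_fract_1 to_fract_eq_iff zq_power)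
    then have "degree (monom (1::complex) n) = 0" by simp
    then show False using that by (simp add: degree_monom_eq)
  qed
  show ?thesis
  proof
    assume a: "mac.zq powi n = 1"
    show "n = 0"
    proof (rule ccontr)
      assume "n \<noteq> 0"
      have "mac.zq ^ nat \<bar>n\<bar> = 1" using a
        by (cases "n \<ge> 0") (auto simp: power_int_def power_inverse)
      then show False using pos[of "nat \<bar>n\<bar>"] \<open>n \<noteq> 0\<close> by simp
    qed
  qed simp
qed

definition inv_eval :: "complex poly \<Rightarrow> K" where
  "inv_eval p = poly (map_poly (\<lambda>c. to_fract [:c:]) p) (inverse mac.zq)"

lemma inv_eval_0 [simp]: "inv_eval 0 = 0" by (simp add: inv_eval_def)

lemma inv_eval_pCons: "inv_eval (pCons a p) = to_fract [:a:] + inverse mac.zq * inv_eval p"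
  by (cases "p = 0 \<and> a = 0") (auto simp: inv_eval_def map_poly_pCons)

lemma inv_eval_1 [simp]: "inv_eval 1 = 1"
  unfolding one_pCons inv_eval_pCons by (simp flip: one_pCons)

lemma inv_eval_add: "inv_eval (p + q) = inv_eval p + inv_eval q"
  by (induction p q rule: poly_induct2)
    (simp_all add: inv_eval_pCons algebra_simps flip: to_fract_add)

lemma inv_eval_smult: "inv_eval (smult a p) = to_fract [:a:] * inv_eval p"
  by (induction p) (simp_all add: inv_eval_pCons algebra_simps flip: to_fract_mult)

lemma inv_eval_mult: "inv_eval (p * q) = inv_eval p * inv_eval q"
proof (induction p)
  case (pCons a p)
  have "inv_eval (pCons a p * q) = inv_eval (smult a q) + inv_eval (pCons 0 (p * q))"
    by (simp add: inv_eval_add)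
  then show ?case by (simp add: inv_eval_smult inv_eval_pCons pCons.IH algebra_simps)
qed simp

text \<open>Multiplying by z to the degree yields the reversed polynomial, whose constant
  coefficient is the leading coefficient of \<open>p\<close>. This makes \<open>sigma\<close> well
  defined on fractions.\<close>

lemma inv_eval_eq_0: "inv_eval p = 0 \<longleftrightarrow> p = 0"
proof
  assume a: "inv_eval p = 0"
  let ?d = "degree p"
  have "inv_eval p = (\<Sum>i\<le>?d. to_fract [:coeff p i:] * inverse mac.zq ^ i)"
  proof -
    have "degree (map_poly (\<lambda>c. to_fract [:c:]) p) = ?d"
      by (rule degree_map_poly) (simp add: to_fract_eq_0_iff)
    then show ?thesis unfolding inv_eval_def poly_altdef by (simp add: coeff_map_poly)
  qed
  then have "0 = mac.zq ^ ?d * (\<Sum>i\<le>?d. to_fract [:coeff p i:] * inverse mac.zq ^ i)" using a by simp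
  also have "\<dots> = (\<Sum>i\<le>?d. to_fract (monom (coeff p i) (?d - i)))"
    unfolding sum_distrib_left
  proof (rule sum.cong)
    fix i assume "i \<in> {..?d}"
    then have "mac.zq ^ ?d = mac.zq ^ (?d - i) * mac.zq ^ i" by (simp flip: power_add)
    then have "mac.zq ^ ?d * (to_fract [:coeff p i:] * inverse mac.zq ^ i)
      = to_fract [:coeff p i:] * mac.zq ^ (?d - i) * (mac.zq ^ i * inverse mac.zq ^ i)" by (simp only: ac_simps)
    also have "mac.zq ^ i * inverse mac.zq ^ i = 1" by (simp flip: power_mult_distrib)
    also have "to_fract [:coeff p i:] * mac.zq ^ (?d - i) = to_fract (monom (coeff p i) (?d - i))"
      by (simp add: zq_power smult_monom flip: to_fract_mult)
    finally show "mac.zq ^ ?d * (to_fract [:coeff p i:] * inverse mac.zq ^ i)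
      = to_fract (monom (coeff p i) (?d - i))" by simp
  qed simp
  also have "\<dots> = to_fract (\<Sum>i\<le>?d. monom (coeff p i) (?d - i))"
    by (simp add: to_fract_sum)
  finally have "(\<Sum>i\<le>?d. monom (coeff p i) (?d - i)) = 0" by (metis to_fract_eq_0_iff)
  then have "coeff (\<Sum>i\<le>?d. monom (coeff p i) (?d - i)) 0 = 0" by simp
  moreover have "coeff (\<Sum>i\<le>?d. monom (coeff p i) (?d - i)) 0 = (\<Sum>i\<le>?d. if i = ?d then coeff p i else 0)"
    unfolding coeff_sum by (rule sum.cong) auto
  ultimately show "p = 0" by simp
qed simp

text \<open>The automorphism \<open>z \<mapsto> z\<^sup>-\<^sup>1\<close>; the choice of the fraction is immaterial.\<close>
definition sigma :: "K \<Rightarrow> K" where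
  "sigma x = (let p = (SOME p. snd p \<noteq> 0 \<and> x = Fract (fst p) (snd p)) in inv_eval (fst p) / inv_eval (snd p))"

lemma sigma_Fract: assumes "b \<noteq> 0" shows "sigma (Fract a b) = inv_eval a / inv_eval b"
proof -
  let ?P = "\<lambda>p. snd p \<noteq> 0 \<and> Fract a b = Fract (fst p) (snd p)"
  define p where "p = (SOME p. ?P p)"
  have "?P p" unfolding p_def by (rule someI[of ?P "(a, b)"]) (use assms in auto)
  then have p: "snd p \<noteq> 0" "a * snd p = fst p * b" using assms by (auto simp: eq_fract)
  then have "inv_eval a * inv_eval (snd p) = inv_eval (fst p) * inv_eval b"
    by (metis inv_eval_mult)
  then show ?thesis using p assms
    by (simp add: sigma_def flip: p_def) (simp add: field_simps inv_eval_eq_0)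
qed

lemma sigma_add: "sigma (x + y) = sigma x + sigma y"
  by (cases x, cases y)
    (simp add: sigma_Fract inv_eval_add inv_eval_mult inv_eval_eq_0 add_frac_eq)

lemma sigma_mult: "sigma (x * y) = sigma x * sigma y"
  by (cases x, cases y) (simp add: sigma_Fract inv_eval_mult)

lemma sigma_1 [simp]: "sigma 1 = 1"
  using sigma_Fract[of 1 1] by (simp add: fract_collapse)

lemma sigma_0 [simp]: "sigma 0 = 0"
  using sigma_Fract[of 1 0] by (simp add: fract_collapse)

lemma sigma_uminus [simp]: "sigma (- x) = - sigma x"
  using sigma_add[of x "- x"] by (simp add: eq_neg_iff_add_eq_0 add.commute)

lemma sigma_diff: "sigma (x - y) = sigma x - sigma y"
  using sigma_add[of x "- y"] by simp

lemma sigma_power: "sigma (x ^ n) = sigma x ^ n"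
  by (induction n) (auto simp: sigma_mult)

lemma sigma_inverse: "sigma (inverse x) = inverse (sigma x)"
  by (cases "x = 0") (simp, metis sigma_mult right_inverse sigma_1 inverse_unique)

lemma sigma_zq: "sigma mac.zq = inverse mac.zq"
  by (simp add: mac.zq_def sigma_Fract inv_eval_pCons flip: one_pCons)

lemma sigma_zq_powi: "sigma (mac.zq powi n) = mac.zq powi (- n)"
  by (simp add: power_int_def sigma_power sigma_inverse sigma_zq)

subsection \<open>Reduction modulo z\<close>

text \<open>Polynomials in z serve as the integral elements, since all coefficients of the weight
  \<open>mu k\<close> are polynomials in z.\<close>

definition zdiv :: "K \<Rightarrow> bool" where "zdiv x \<longleftrightarrow> (\<exists>p. x = mac.zq * to_fract p)"
definition integral_K :: "K \<Rightarrow> bool" where "integral_K x \<longleftrightarrow> (\<exists>p. x = to_fract p)"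

lemma zdiv_0 [simp]: "zdiv 0" unfolding zdiv_def by (rule exI[of _ 0]) simp
lemma zdiv_add: "zdiv x \<Longrightarrow> zdiv y \<Longrightarrow> zdiv (x + y)"
  unfolding zdiv_def by (metis distrib_left to_fract_add)
lemma zdiv_uminus: "zdiv x \<Longrightarrow> zdiv (- x)"
  unfolding zdiv_def by (metis mult_minus_right to_fract_uminus)
lemma zdiv_mult: "zdiv x \<Longrightarrow> integral_K y \<Longrightarrow> zdiv (x * y)"
  unfolding zdiv_def integral_K_def by (metis mult.assoc to_fract_mult)
lemma zdiv_mult': "integral_K x \<Longrightarrow> zdiv y \<Longrightarrow> zdiv (x * y)"
  using zdiv_mult[of y x] by (simp add: mult.commute)
lemma zdiv_sum: "(\<And>i. i \<in> I \<Longrightarrow> zdiv (f i)) \<Longrightarrow> zdiv (sum f I)"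
  by (induction I rule: infinite_finite_induct) (auto intro: zdiv_add)
lemma zdiv_integral: "zdiv x \<Longrightarrow> integral_K x"
  unfolding zdiv_def integral_K_def by (metis to_fract_mult zq_to_fract)
lemma integral_K_add: "integral_K x \<Longrightarrow> integral_K y \<Longrightarrow> integral_K (x + y)"
  unfolding integral_K_def by (metis to_fract_add)
lemma integral_K_mult: "integral_K x \<Longrightarrow> integral_K y \<Longrightarrow> integral_K (x * y)"
  unfolding integral_K_def by (metis to_fract_mult)
lemma integral_K_uminus: "integral_K x \<Longrightarrow> integral_K (- x)"
  unfolding integral_K_def by (metis to_fract_uminus)
lemma integral_K_0 [simp]: "integral_K 0" unfolding integral_K_def by (metis to_fract_0)
lemma integral_K_1 [simp]: "integral_K 1" unfolding integral_K_def by (metis to_fract_1)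
lemma zdiv_zq_powi: "n > 0 \<Longrightarrow> zdiv (mac.zq powi n)"
  unfolding zdiv_def
  by (rule exI[of _ "monom 1 (nat n - 1)"])
    (simp add: zq_power[symmetric] power_int_def flip: power_Suc)

lemma common_denominator:
  assumes "finite B" shows "\<exists>d. d \<noteq> 0 \<and> (\<forall>j\<in>B. integral_K (to_fract d * (c j :: K)))"
  using assms
proof (induction B rule: finite_induct)
  case empty show ?case by (rule exI[of _ 1]) simp
next
  case (insert j B)
  then obtain d where d: "d \<noteq> 0" "\<forall>j\<in>B. integral_K (to_fract d * c j)" by blast
  obtain a b where ab: "c j = Fract a b" "b \<noteq> 0" by (cases "c j")
  have "to_fract b * c j = to_fract a" using ab by (simp add: to_fract_def eq_fract)
  then have "to_fract (d * b) * c j = to_fract (d * a)" by (simp add: mult.assoc)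
  moreover have "integral_K (to_fract (d * b) * c i)" if "i \<in> B" for i
  proof -
    have "integral_K (to_fract b * (to_fract d * c i))"
      by (rule integral_K_mult) (use d that in \<open>auto simp: integral_K_def\<close>)
    then show ?thesis by (simp add: mult_ac)
  qed
  ultimately show ?case using d ab
    by (intro exI[of _ "d * b"]) (auto simp: integral_K_def simp del: to_fract_mult)
qed

text \<open>Modulo \<open>z\<close> the matrix is unitriangular with respect to \<open>h\<close>, hence regular.\<close>
lemma zadic_regular:
  fixes M :: "'i \<Rightarrow> 'i \<Rightarrow> K" and h :: "'i \<Rightarrow> real"
  assumes fin: "finite B"
    and int: "\<And>i j. i \<in> B \<Longrightarrow> j \<in> B \<Longrightarrow> integral_K (M i j)"
    and diag: "\<And>i. i \<in> B \<Longrightarrow> zdiv (M i i - 1)"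
    and off: "\<And>i j. i \<in> B \<Longrightarrow> j \<in> B \<Longrightarrow> i \<noteq> j \<Longrightarrow> \<not> zdiv (M i j) \<Longrightarrow> h i < h j"
    and eq: "\<And>i. i \<in> B \<Longrightarrow> (\<Sum>j\<in>B. c j * M i j) = 0"
    and j: "j \<in> B"
  shows "c j = 0"
proof -
  obtain d where d: "d \<noteq> 0" "\<forall>j\<in>B. integral_K (to_fract d * c j)" using common_denominator[OF fin] by blast
  \<comment> \<open>Infinite descent: after clearing denominators, each round extracts one more
    factor z from all coordinates, which is possible for arbitrarily many rounds only if they
    vanish.\<close>
  have all: "\<forall>j\<in>B. \<exists>p. to_fract d * c j = mac.zq ^ n * to_fract p" for n
  proof (induction n)
    case 0 then show ?case using d by (simp add: integral_K_def)
  next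
    case (Suc n)
    then obtain p where p: "\<And>j. j \<in> B \<Longrightarrow> to_fract d * c j = mac.zq ^ n * to_fract (p j)" by metis
    have eq': "(\<Sum>j\<in>B. to_fract (p j) * M i j) = 0" if "i \<in> B" for i
    proof -
      have "mac.zq ^ n * (\<Sum>j\<in>B. to_fract (p j) * M i j) = to_fract d * (\<Sum>j\<in>B. c j * M i j)"
        unfolding sum_distrib_left by (rule sum.cong) (simp_all add: p flip: mult.assoc)
      then show ?thesis using eq[OF that] by simp
    qed
    define bad where "bad = {j \<in> B. \<not> zdiv (to_fract (p j))}"
    have "bad = {}"
    proof (rule ccontr)
      assume ne: "bad \<noteq> {}"
      have fb: "finite bad" using fin by (simp add: bad_def)
      have "Max (h ` bad) \<in> h ` bad" using ne fb by (intro Max_in) auto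
      \<comment> \<open>With \<open>h\<close> maximal among the bad indices, every off-diagonal
        entry in row i that survives modulo z meets a coordinate that is already divisible by
        z.\<close>
      then obtain i where i: "i \<in> bad" "h i = Max (h ` bad)" by force
      then have mx: "h j \<le> h i" if "j \<in> bad" for j using that fb by simp
      have iB: "i \<in> B" using i by (simp add: bad_def)
      have rest: "zdiv (\<Sum>j\<in>B - {i}. to_fract (p j) * M i j)"
      proof (rule zdiv_sum)
        fix j assume j: "j \<in> B - {i}"
        show "zdiv (to_fract (p j) * M i j)"
        proof (cases "zdiv (M i j)")
          case True then show ?thesis by (intro zdiv_mult') (auto simp: integral_K_def)
        next
          case False
          then have "h i < h j" using off iB j by auto
          then have "j \<notin> bad" using mx by force
          then show ?thesis using j iB int by (intro zdiv_mult) (auto simp: bad_def)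
        qed
      qed
      have "0 = to_fract (p i) * M i i + (\<Sum>j\<in>B - {i}. to_fract (p j) * M i j)"
        using eq'[OF iB] by (simp add: sum.remove[OF fin iB])
      then have "to_fract (p i) = - (to_fract (p i) * (M i i - 1) + (\<Sum>j\<in>B - {i}. to_fract (p j) * M i j))"
        by (simp add: algebra_simps eq_neg_iff_add_eq_0)
      moreover have "zdiv \<dots>"
        by (intro zdiv_uminus zdiv_add zdiv_mult' rest diag iB) (auto simp: integral_K_def)
      ultimately show False using i by (simp add: bad_def)
    qed
    then have "\<exists>q. to_fract (p j) = mac.zq * to_fract q" if "j \<in> B" for j using that unfolding bad_def zdiv_def by blast
    then obtain q where "\<And>j. j \<in> B \<Longrightarrow> to_fract (p j) = mac.zq * to_fract (q j)" by metis
    then show ?case using p by (intro ballI exI[of _ "q _"]) (simp add: mult_ac)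
  qed
  obtain p where p: "to_fract d * c j = to_fract p" using d j by (auto simp: integral_K_def)
  have "monom 1 n dvd p" for n
  proof -
    obtain r where "to_fract p = mac.zq ^ n * to_fract r" using all[of n] j p by metis
    then have "to_fract p = to_fract (monom 1 n * r)" by (simp add: zq_power)
    then have "p = monom 1 n * r" by (simp only: to_fract_eq_iff)
    then show ?thesis by simp
  qed
  from this[of "Suc (degree p)"] have "p = 0"
    using dvd_imp_degree_le[of "monom 1 (Suc (degree p))" p] by (fastforce simp: degree_monom_eq)
  then show ?thesis using p d by (simp add: to_fract_eq_0_iff)
qed

subsection \<open>Involutions of the group algebra\<close>

definition csig :: "('a \<Rightarrow>\<^sub>0 K) \<Rightarrow> ('a \<Rightarrow>\<^sub>0 K)" where "csig = Poly_Mapping.map sigma"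

lemma lookup_csig [simp]: "lk (csig f) n = sigma (lk f n)"
  by (simp add: csig_def Poly_Mapping.map.rep_eq when_def)

lemma csig_0 [simp]: "csig 0 = 0" by (rule poly_mapping_eqI) simp
lemma csig_single [simp]: "csig (sg a c) = sg a (sigma c)"
  by (rule poly_mapping_eqI) (simp add: lookup_single when_def)
lemma csig_1 [simp]: "csig 1 = 1" by (simp flip: single_one)
lemma csig_add: "csig (f + g) = csig f + csig g"
  by (rule poly_mapping_eqI) (simp add: lookup_add sigma_add)
lemma csig_diff: "csig (f - g) = csig f - csig g"
  by (rule poly_mapping_eqI) (simp add: lookup_minus sigma_diff)
lemma csig_sum: "csig (sum f I) = (\<Sum>i\<in>I. csig (f i))"
  by (induction I rule: infinite_finite_induct) (auto simp: csig_add)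
lemma csig_mult:
  fixes f g :: "'a::ab_group_add \<Rightarrow>\<^sub>0 K"
  shows "csig (f * g) = csig f * csig g"
proof -
  have "ky f \<subseteq> UNIV" by simp
  then show ?thesis
  proof (induction f rule: pm_induct_on)
    case (single a c)
    then show ?case by (intro poly_mapping_eqI) (simp add: lookup_single_mult sigma_mult)
  qed (auto simp: csig_add distrib_right)
qed
lemma csig_prod:
  fixes f :: "'i \<Rightarrow> 'a::ab_group_add \<Rightarrow>\<^sub>0 K"
  shows "csig (prod f I) = (\<Prod>i\<in>I. csig (f i))"
  by (induction I rule: infinite_finite_induct) (auto simp: csig_mult)
lemma keys_csig_subset: "ky (csig f) \<subseteq> ky f" by (auto simp: in_keys_iff)

lemma bar_eq_ext: "mac.bar f = ext (\<lambda>n. sg (- n) 1) f"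
  by (simp add: mac.bar_def ext_def mult_single)

lemma bar_single [simp]: "mac.bar (sg a c) = sg (- a) c"
  by (simp add: bar_eq_ext ext_single mult_single)
lemma bar_0 [simp]: "mac.bar 0 = 0" by (simp add: bar_eq_ext)
lemma bar_1 [simp]: "mac.bar 1 = 1" using bar_single[of 0 1] by simp
lemma bar_add: "mac.bar (f + g) = mac.bar f + mac.bar g" by (simp add: bar_eq_ext ext_add)
lemma bar_diff: "mac.bar (f - g) = mac.bar f - mac.bar g" by (simp add: bar_eq_ext ext_diff)
lemma bar_sum: "mac.bar (sum f I) = (\<Sum>i\<in>I. mac.bar (f i))" by (simp add: bar_eq_ext ext_sum)
lemma bar_mult: "mac.bar (f * g) = mac.bar f * mac.bar g"
  unfolding bar_eq_ext by (rule ext_mult) (simp add: mult_single)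
lemma bar_prod: "mac.bar (prod f I) = (\<Prod>i\<in>I. mac.bar (f i))"
  by (induction I rule: infinite_finite_induct) (auto simp: bar_mult)

lemma lookup_bar [simp]: "lk (mac.bar f) n = lk f (- n)"
proof -
  have "ky f \<subseteq> UNIV" by simp
  then show ?thesis
  proof (induction f rule: pm_induct_on)
    case (single a c) show ?case by (auto simp: lookup_single when_def)
  qed (auto simp: bar_add lookup_add)
qed

lemma bar_bar [simp]: "mac.bar (mac.bar f) = f" by (rule poly_mapping_eqI) simp

definition star :: "('v::euclidean_space \<Rightarrow>\<^sub>0 K) \<Rightarrow> ('v \<Rightarrow>\<^sub>0 K)" where "star f = mac.bar (csig f)"

lemma star_add: "star (f + g) = star f + star g" by (simp add: star_def csig_add bar_add)
lemma star_diff: "star (f - g) = star f - star g" by (simp add: star_def csig_diff bar_diff)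
lemma star_mult: "star (f * g) = star f * star g" by (simp add: star_def csig_mult bar_mult)
lemma star_single [simp]: "star (sg a c) = sg (- a) (sigma c)" by (simp add: star_def)
lemma star_0 [simp]: "star 0 = 0" by (simp add: star_def)
lemma star_1 [simp]: "star 1 = 1" by (simp add: star_def)
lemma lookup_star [simp]: "lk (star f) n = sigma (lk f (- n))" by (simp add: star_def)

lemma CT_mult: "lk (f * g) 0 = (\<Sum>a\<in>ky f. lk f a * lk g (- a))"
  for f :: "'a::ab_group_add \<Rightarrow>\<^sub>0 'c::comm_ring_1"
proof -
  have "f * g = (\<Sum>a\<in>ky f. sg a (lk f a) * g)"
    by (subst pm_decomp[of "ky f" f]) (simp_all add: sum_distrib_right)
  then show ?thesis by (simp add: lookup_sum lookup_single_mult)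
qed

subsection \<open>Root systems\<close>

lemma linear_rrefl: "linear (rrefl a)"
  by (rule linearI) (auto simp: rrefl_def inner_add_left algebra_simps)

lemma rrefl_add: "rrefl a (x + y) = rrefl a x + rrefl a y"
  by (rule linear_add[OF linear_rrefl])

lemma coroot_inner: "x \<bullet> coroot a = 2 * (x \<bullet> a) / (a \<bullet> a)"
  by (simp add: coroot_def)

lemma coroot_self: "a \<noteq> 0 \<Longrightarrow> a \<bullet> coroot a = 2"
  by (simp add: coroot_def)

lemma rrefl_self: "a \<noteq> 0 \<Longrightarrow> rrefl a a = - a"
  by (simp add: rrefl_def coroot_self scaleR_2)

lemma rrefl_rrefl [simp]: "a \<noteq> 0 \<Longrightarrow> rrefl a (rrefl a x) = x"
  by (simp add: rrefl_def inner_diff_left coroot_self algebra_simps)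

lemma rrefl_comp_rrefl: "a \<noteq> 0 \<Longrightarrow> rrefl a \<circ> rrefl a = id"
  by (simp add: fun_eq_iff)

lemma rrefl_inner: "a \<noteq> 0 \<Longrightarrow> rrefl a x \<bullet> rrefl a y = x \<bullet> y"
  by (simp add: rrefl_def coroot_inner inner_diff_left inner_diff_right inner_commute field_simps)

lemma rrefl_inner_left: "a \<noteq> 0 \<Longrightarrow> rrefl a x \<bullet> y = x \<bullet> rrefl a y"
  by (metis rrefl_inner rrefl_rrefl)

lemma coroot_isometry:
  assumes "linear w" "\<And>x y. w x \<bullet> w y = x \<bullet> y" shows "coroot (w a) = w (coroot a)"
  by (simp add: coroot_def assms linear_cmul[OF assms(1)])

lemma rrefl_isometry:
  assumes "linear w" "\<And>x y. w x \<bullet> w y = x \<bullet> y" shows "rrefl (w a) (w x) = w (rrefl a x)"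
  by (simp add: rrefl_def coroot_isometry[OF assms] assms(2) linear_diff[OF assms(1)] linear_cmul[OF assms(1)])

lemma coroot_uminus: "coroot (- a) = - coroot a" by (simp add: coroot_def)
lemma rrefl_uminus_root: "rrefl (- a) = rrefl a" by (simp add: rrefl_def coroot_uminus fun_eq_iff)

lemma floor_bound: fixes y B :: real assumes "\<bar>y\<bar> \<le> B" shows "\<lfloor>y\<rfloor> \<in> {- \<lceil>B\<rceil>..\<lceil>B\<rceil>}"
proof -
  have "y \<le> B" "- B \<le> y" using assms by auto
  then have "\<lfloor>y\<rfloor> \<le> \<lfloor>B\<rfloor>" "\<lfloor>- B\<rfloor> \<le> \<lfloor>y\<rfloor>" by (auto intro: floor_mono)
  then show ?thesis using floor_le_ceiling[of B] by (simp add: ceiling_def)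
qed

locale rd = mac R S m for R S :: "'v::euclidean_space set" and m +
  assumes rd: "root_datum R S m"
begin

lemma finR: "finite R" and Rne: "R \<noteq> {}" and R0: "0 \<notin> R" and spanR: "span R = UNIV"
  and refl_closed: "\<And>a b. a \<in> R \<Longrightarrow> b \<in> R \<Longrightarrow> rrefl a b \<in> R"
  and intR: "\<And>a b. a \<in> R \<Longrightarrow> b \<in> R \<Longrightarrow> b \<bullet> coroot a \<in> \<int>"
  and reduced: "\<And>a c. a \<in> R \<Longrightarrow> c *\<^sub>R a \<in> R \<Longrightarrow> c = 1 \<or> c = -1"
  and irred: "\<not> (\<exists>A B. A \<noteq> {} \<and> B \<noteq> {} \<and> A \<union> B = R \<and> A \<inter> B = {} \<and> (\<forall>a\<in>A. \<forall>b\<in>B. a \<bullet> b = 0))"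
  and SR: "S \<subseteq> R" and indS: "independent S"
  and posneg: "\<And>a. a \<in> R \<Longrightarrow> \<exists>c::'v \<Rightarrow> nat. a = (\<Sum>s\<in>S. of_nat (c s) *\<^sub>R s) \<or> a = - (\<Sum>s\<in>S. of_nat (c s) *\<^sub>R s)"
  and m_pos: "m > 0"
  and m_int: "\<And>l u. (\<forall>s\<in>S. l \<bullet> s \<in> \<int>) \<Longrightarrow> (\<forall>s\<in>S. u \<bullet> coroot s \<in> \<int>) \<Longrightarrow> of_nat m * (l \<bullet> u) \<in> \<int>"
  using rd unfolding root_datum_def by simp_all

lemma Rnz [simp]: "a \<in> R \<Longrightarrow> a \<noteq> 0" using R0 by auto
lemma Snz [simp]: "s \<in> S \<Longrightarrow> s \<noteq> 0" using R0 SR by auto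
lemma finS: "finite S" using finR SR finite_subset by blast

lemma R_uminus: "a \<in> R \<Longrightarrow> - a \<in> R" using refl_closed[of a a] by (simp add: rrefl_self)

section \<open>Simple-root coordinates, heights and positive roots\<close>

lemma spanS: "span S = UNIV"
proof -
  have "R \<subseteq> span S"
  proof
    fix a assume "a \<in> R"
    from posneg[OF this] obtain c :: "'v \<Rightarrow> nat"
      where c: "a = (\<Sum>s\<in>S. of_nat (c s) *\<^sub>R s) \<or> a = - (\<Sum>s\<in>S. of_nat (c s) *\<^sub>R s)" by blast
    have "(\<Sum>s\<in>S. of_nat (c s) *\<^sub>R s) \<in> span S" by (intro span_sum span_scale span_base)
    then show "a \<in> span S" using c span_neg by auto
  qed
  then show ?thesis using spanR span_minimal[of R "span S"] by auto
qed

text \<open>The fundamental coweights. Pairing with them reads off coordinates in the basis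
  \<open>S\<close>, so membership in \<open>Qp\<close> becomes a condition on inner
  products.\<close>

definition omega :: "'v \<Rightarrow> 'v" where
  "omega s = (SOME w. \<forall>s'\<in>S. w \<bullet> s' = (if s' = s then 1 else 0))"

lemma omega: assumes "s \<in> S" "s' \<in> S" shows "omega s \<bullet> s' = (if s' = s then 1 else 0)"
proof -
  define f where "f v = representation S v s" for v
  have "linear f" unfolding f_def
    by (rule linearI) (use indS spanS in \<open>auto simp: real_vector.representation_add real_vector.representation_scale\<close>)
  then have "\<forall>s'\<in>S. adjoint f 1 \<bullet> s' = (if s' = s then 1 else 0)"
    using adjoint_works[of f] indS
    by (auto simp: inner_commute f_def real_vector.representation_basis)
  then have "\<forall>s'\<in>S. omega s \<bullet> s' = (if s' = s then 1 else 0)"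
    unfolding omega_def by (rule someI)
  then show ?thesis using assms by blast
qed

lemma inner_S_ext: assumes "\<And>s. s \<in> S \<Longrightarrow> v \<bullet> s = v' \<bullet> s" shows "v = v'"
proof -
  have "\<forall>x\<in>span S. (v - v') \<bullet> x = 0"
  proof
    fix x assume "x \<in> span S" then show "(v - v') \<bullet> x = 0"
      by (induction rule: span_induct_alt) (auto simp: inner_add_right inner_diff_left assms)
  qed
  then have "(v - v') \<bullet> (v - v') = 0" using spanS by blast
  then show ?thesis by simp
qed

lemma expandS: "v = (\<Sum>s\<in>S. (omega s \<bullet> v) *\<^sub>R s)"
proof -
  have "v \<in> span S" using spanS by auto
  then obtain c where c: "v = (\<Sum>s\<in>S. c s *\<^sub>R s)" using span_finite[OF finS] by auto
  have "omega s \<bullet> v = c s" if "s \<in> S" for s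
  proof -
    have "omega s \<bullet> v = (\<Sum>s'\<in>S. if s' = s then c s' else 0)"
      unfolding c inner_sum_right by (rule sum.cong) (auto simp: omega that)
    then show ?thesis using that finS by simp
  qed
  then show ?thesis using c by simp
qed

lemma omega_ext: "(\<And>s. s \<in> S \<Longrightarrow> omega s \<bullet> v = omega s \<bullet> v') \<Longrightarrow> v = v'"
  by (subst expandS, subst (2) expandS) (rule sum.cong, auto)

lemma omega_sum: assumes "s \<in> S" shows "omega s \<bullet> (\<Sum>s\<in>S. c s *\<^sub>R s) = c s"
proof -
  have "omega s \<bullet> (\<Sum>s\<in>S. c s *\<^sub>R s) = (\<Sum>s'\<in>S. if s' = s then c s' else 0)"
    unfolding inner_sum_right by (rule sum.cong) (auto simp: omega assms)
  then show ?thesis using assms finS by simp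
qed

lemma Qp_iff: "v \<in> Qp \<longleftrightarrow> (\<forall>s\<in>S. omega s \<bullet> v \<in> \<nat>)"
proof
  assume "v \<in> Qp" then show "\<forall>s\<in>S. omega s \<bullet> v \<in> \<nat>" by (auto simp: Qp_def omega_sum)
next
  assume "\<forall>s\<in>S. omega s \<bullet> v \<in> \<nat>"
  then obtain c :: "'v \<Rightarrow> nat" where "\<And>s. s \<in> S \<Longrightarrow> omega s \<bullet> v = of_nat (c s)"
    unfolding Nats_def by (auto simp: image_iff) metis
  then have "v = (\<Sum>s\<in>S. of_nat (c s) *\<^sub>R s)" by (subst expandS) (rule sum.cong, auto)
  then show "v \<in> Qp" by (auto simp: Qp_def)
qed

lemma Qp_0 [simp]: "0 \<in> Qp" by (simp add: Qp_iff)
lemma Qp_add: "x \<in> Qp \<Longrightarrow> y \<in> Qp \<Longrightarrow> x + y \<in> Qp" by (auto simp: Qp_iff inner_add_right)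
lemma Qp_sum: "(\<And>i. i \<in> I \<Longrightarrow> f i \<in> Qp) \<Longrightarrow> sum f I \<in> Qp"
  by (induction I rule: infinite_finite_induct) (auto intro: Qp_add)
lemma Qp_scale: "x \<in> Qp \<Longrightarrow> c \<in> \<nat> \<Longrightarrow> c *\<^sub>R x \<in> Qp" by (auto simp: Qp_iff intro: Nats_mult)
lemma Qp_antisym: "x \<in> Qp \<Longrightarrow> - x \<in> Qp \<Longrightarrow> x = 0"
proof (rule omega_ext)
  fix s assume "x \<in> Qp" "- x \<in> Qp" "s \<in> S"
  then have "omega s \<bullet> x \<in> \<nat>" "- (omega s \<bullet> x) \<in> \<nat>" by (auto simp: Qp_iff)
  then show "omega s \<bullet> x = omega s \<bullet> 0" by (force simp: Nats_altdef2)
qed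

lemma rle_refl [simp]: "rle a a" by (simp add: rle_def)
lemma rle_trans: "rle a b \<Longrightarrow> rle b c \<Longrightarrow> rle a c"
  unfolding rle_def using Qp_add[of "b - a" "c - b"] by (simp add: algebra_simps)
lemma rle_antisym: "rle a b \<Longrightarrow> rle b a \<Longrightarrow> a = b"
  unfolding rle_def using Qp_antisym[of "b - a"] by simp
lemma rle_add: "rle a b \<Longrightarrow> rle c d \<Longrightarrow> rle (a + c) (b + d)"
  unfolding rle_def using Qp_add[of "b - a" "d - c"] by (simp add: algebra_simps)
lemma rle_add_cancel [simp]: "rle (a + c) (b + c) \<longleftrightarrow> rle a b" by (simp add: rle_def)

text \<open>Pairing with \<open>htv\<close> is the height function, strictly positive on nonzero
  elements of \<open>Qp\<close>; it is the measure in most of the extremality arguments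
  below.\<close>

definition htv :: 'v where "htv = (\<Sum>s\<in>S. omega s)"

lemma htv_S: "s \<in> S \<Longrightarrow> htv \<bullet> s = 1"
proof -
  assume s: "s \<in> S"
  have "htv \<bullet> s = (\<Sum>s'\<in>S. if s' = s then 1 else 0)"
    unfolding htv_def inner_sum_left by (rule sum.cong) (auto simp: omega s)
  then show ?thesis using s finS by simp
qed

lemma htv_eq: "htv \<bullet> v = (\<Sum>s\<in>S. omega s \<bullet> v)" by (simp add: htv_def inner_sum_left)

lemma htv_Qp: "v \<in> Qp \<Longrightarrow> htv \<bullet> v \<ge> 0"
  unfolding htv_eq Qp_iff by (rule sum_nonneg) (auto simp: Nats_altdef2)

lemma htv_Qp_pos: assumes "v \<in> Qp" "v \<noteq> 0" shows "htv \<bullet> v > 0"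
proof -
  have nn: "\<forall>s\<in>S. 0 \<le> omega s \<bullet> v" using assms(1) by (auto simp: Qp_iff Nats_altdef2)
  have "\<exists>s\<in>S. omega s \<bullet> v \<noteq> 0" using assms(2) omega_ext[of v 0] by force
  then show ?thesis unfolding htv_eq using nn finS by (metis (no_types, lifting) less_eq_real_def sum_pos2)
qed

lemma R_omega: assumes "a \<in> R"
  shows "(\<forall>s\<in>S. omega s \<bullet> a \<in> \<nat>) \<or> (\<forall>s\<in>S. - (omega s \<bullet> a) \<in> \<nat>)"
  using posneg[OF assms] by (auto simp: omega_sum)

lemma Rp_iff: "a \<in> Rp \<longleftrightarrow> a \<in> R \<and> a \<in> Qp" by (auto simp: Rp_def rle_def)
lemma Rp_R: "a \<in> Rp \<Longrightarrow> a \<in> R" by (simp add: Rp_iff)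
lemma Rp_nz [simp]: "a \<in> Rp \<Longrightarrow> a \<noteq> 0" by (auto simp: Rp_iff)
lemma finRp [simp]: "finite Rp" using finR by (simp add: Rp_def)

lemma R_cases: "a \<in> R \<Longrightarrow> a \<in> Rp \<or> - a \<in> Rp"
  using R_omega[of a] R_uminus[of a] by (auto simp: Rp_iff Qp_iff)

lemma Rp_uminus: "a \<in> Rp \<Longrightarrow> - a \<notin> Rp"
  using Qp_antisym[of a] by (auto simp: Rp_iff)

lemma R_eq: "R = Rp \<union> uminus ` Rp"
  using R_cases R_uminus Rp_R by (force simp: image_iff)

lemma R_int: "a \<in> R \<Longrightarrow> s \<in> S \<Longrightarrow> omega s \<bullet> a \<in> \<int>"
  using R_omega[of a] by (metis Ints_minus Nats_subset_Ints in_mono minus_minus)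

lemma htv_Rp: "a \<in> Rp \<Longrightarrow> htv \<bullet> a > 0" by (simp add: Rp_iff htv_Qp_pos)

lemma S_Rp: "S \<subseteq> Rp"
  using SR by (auto simp: Rp_iff Qp_iff omega)

lemma pos_coeff_Rp: assumes "a \<in> R" "s \<in> S" "omega s \<bullet> a > 0" shows "a \<in> Rp"
proof -
  have "\<not> (\<forall>s\<in>S. - (omega s \<bullet> a) \<in> \<nat>)" using assms by (force simp: Nats_altdef2)
  then show ?thesis using R_omega[OF assms(1)] assms(1) by (auto simp: Rp_iff Qp_iff)
qed

text \<open>Otherwise \<open>a\<close> would be a multiple of \<open>s\<close>, which reducedness
  excludes.\<close>

lemma Rp_other_coeff: assumes "a \<in> Rp" "s \<in> S" "a \<noteq> s"
  shows "\<exists>s'\<in>S. s' \<noteq> s \<and> omega s' \<bullet> a > 0"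
proof (rule ccontr)
  assume "\<not> ?thesis"
  moreover have "\<forall>s'\<in>S. omega s' \<bullet> a \<ge> 0" using assms by (auto simp: Rp_iff Qp_iff Nats_altdef2)
  ultimately have z: "\<forall>s'\<in>S - {s}. omega s' \<bullet> a = 0" by force
  have "a = (omega s \<bullet> a) *\<^sub>R s"
    by (subst expandS, subst sum.remove[OF finS assms(2)]) (use z in simp)
  then have "omega s \<bullet> a = 1 \<or> omega s \<bullet> a = -1" using reduced[of s "omega s \<bullet> a"] assms SR Rp_R by auto
  then show False
    using \<open>a = _\<close> assms(3) \<open>\<forall>s'\<in>S. omega s' \<bullet> a \<ge> 0\<close> assms(2) by force
qed

text \<open>The reflection changes only the coefficient of \<open>s\<close>, and another coefficient
  of \<open>a\<close> is positive; a single positive coefficient already makes a root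
  positive.\<close>

lemma simple_refl_Rp: assumes "a \<in> Rp" "s \<in> S" "a \<noteq> s" shows "rrefl s a \<in> Rp - {s}"
proof -
  obtain s' where s': "s' \<in> S" "s' \<noteq> s" "omega s' \<bullet> a > 0" using Rp_other_coeff[OF assms] by blast
  have "omega s' \<bullet> rrefl s a = omega s' \<bullet> a" using s' assms by (simp add: rrefl_def inner_diff_right omega)
  moreover have "rrefl s a \<in> R" using refl_closed assms SR Rp_R by blast
  ultimately have "rrefl s a \<in> Rp" using pos_coeff_Rp s' by simp
  moreover have "rrefl s a \<noteq> s"
  proof
    assume "rrefl s a = s"
    then have "a = - s" using rrefl_rrefl[of s a] rrefl_self[of s] assms by simp
    then show False using Rp_uminus[of a] S_Rp assms by auto
  qed
  ultimately show ?thesis by simp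
qed

lemma simple_refl_bij: "s \<in> S \<Longrightarrow> bij_betw (rrefl s) (Rp - {s}) (Rp - {s})"
  by (rule bij_betwI[where g = "rrefl s"]) (use simple_refl_Rp in auto)

subsection \<open>The Weyl group\<close>

fun prodw :: "'v list \<Rightarrow> 'v \<Rightarrow> 'v" where
  "prodw [] = id" | "prodw (s # ss) = rrefl s \<circ> prodw ss"

lemma prodw_append: "prodw (xs @ ys) = prodw xs \<circ> prodw ys"
  by (induction xs) auto

lemma fold_prodw: "fold (\<lambda>s w. rrefl s \<circ> w) ss id = prodw (rev ss)"
proof -
  have "fold (\<lambda>s w. rrefl s \<circ> w) ss w = prodw (rev ss) \<circ> w" for w
    by (induction ss arbitrary: w) (auto simp: prodw_append)
  from this[of id] show ?thesis by (simp only: comp_id)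
qed

lemma Wg_eq: "Wg = {prodw ss | ss. set ss \<subseteq> S}"
proof -
  have "(\<exists>ss. w = fold (\<lambda>s w. rrefl s \<circ> w) ss id \<and> set ss \<subseteq> S) \<longleftrightarrow> (\<exists>ss. w = prodw ss \<and> set ss \<subseteq> S)" for w
    unfolding fold_prodw by (metis rev_rev_ident set_rev)
  then show ?thesis unfolding Wg_def by blast
qed

lemma Wg_induct [consumes 1, case_names id step]:
  assumes "w \<in> Wg" "P id" "\<And>s w. s \<in> S \<Longrightarrow> w \<in> Wg \<Longrightarrow> P w \<Longrightarrow> P (rrefl s \<circ> w)" shows "P w"
proof -
  have "P (prodw ss)" if "set ss \<subseteq> S" for ss
    using that by (induction ss) (use assms in \<open>auto simp: Wg_eq\<close>)
  then show ?thesis using assms(1) by (auto simp: Wg_eq)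
qed

lemma id_Wg [simp]: "id \<in> Wg" unfolding Wg_eq by (rule CollectI, rule exI[of _ "[]"]) simp
lemma simple_comp_Wg: "s \<in> S \<Longrightarrow> w \<in> Wg \<Longrightarrow> rrefl s \<circ> w \<in> Wg"
proof -
  assume s: "s \<in> S" and "w \<in> Wg"
  then obtain ss where "w = prodw ss" "set ss \<subseteq> S" by (auto simp: Wg_eq)
  then show ?thesis unfolding Wg_eq using s by (intro CollectI exI[of _ "s # ss"]) simp
qed
lemma simple_Wg: "s \<in> S \<Longrightarrow> rrefl s \<in> Wg" using simple_comp_Wg[of s id] by simp
lemma comp_Wg: "w \<in> Wg \<Longrightarrow> w' \<in> Wg \<Longrightarrow> w \<circ> w' \<in> Wg"
  by (induction w rule: Wg_induct) (auto simp: comp_assoc simple_comp_Wg)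

lemma Wg_linear: "w \<in> Wg \<Longrightarrow> linear w"
  by (induction w rule: Wg_induct) (simp_all only: linear_compose linear_rrefl linear_id)
lemma Wg_add: "w \<in> Wg \<Longrightarrow> w (x + y) = w x + w y" by (rule linear_add[OF Wg_linear])
lemma Wg_diff: "w \<in> Wg \<Longrightarrow> w (x - y) = w x - w y" by (rule linear_diff[OF Wg_linear])
lemma Wg_scale: "w \<in> Wg \<Longrightarrow> w (c *\<^sub>R x) = c *\<^sub>R w x" by (rule linear_cmul[OF Wg_linear])
lemma Wg_uminus: "w \<in> Wg \<Longrightarrow> w (- x) = - w x" by (rule linear_neg[OF Wg_linear])
lemma Wg_0 [simp]: "w \<in> Wg \<Longrightarrow> w 0 = 0" by (rule linear_0[OF Wg_linear])
lemma Wg_sum: "w \<in> Wg \<Longrightarrow> w (sum f I) = (\<Sum>i\<in>I. w (f i))" by (rule linear_sum[OF Wg_linear])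
lemma Wg_inner: "w \<in> Wg \<Longrightarrow> w x \<bullet> w y = x \<bullet> y"
  by (induction w arbitrary: x y rule: Wg_induct) (auto simp: rrefl_inner)
lemma Wg_R: "w \<in> Wg \<Longrightarrow> a \<in> R \<Longrightarrow> w a \<in> R"
  by (induction w rule: Wg_induct) (use refl_closed SR in auto)
lemma Wg_inverse: "w \<in> Wg \<Longrightarrow> \<exists>w'\<in>Wg. w \<circ> w' = id \<and> w' \<circ> w = id"
proof (induction w rule: Wg_induct)
  case (step s w)
  then obtain w' where w': "w' \<in> Wg" "w \<circ> w' = id" "w' \<circ> w = id" by blast
  have "w (w' x) = x" "w' (w x) = x" for x using w' by (simp_all add: fun_eq_iff)
  then show ?case using w'(1) step(1)
    by (intro bexI[of _ "w' \<circ> rrefl s"]) (auto intro: comp_Wg simple_Wg simp: fun_eq_iff)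
next
  case id show ?case by (rule bexI[of _ id]) simp_all
qed
lemma Wg_bij: "w \<in> Wg \<Longrightarrow> bij w" using Wg_inverse o_bij by blast
lemma inv_Wg: "w \<in> Wg \<Longrightarrow> inv w \<in> Wg" using Wg_inverse inv_unique_comp by metis
lemma Wg_inv [simp]: "w \<in> Wg \<Longrightarrow> w (inv w x) = x" "w \<in> Wg \<Longrightarrow> inv w (w x) = x"
  using Wg_bij by (simp_all add: bij_is_surj surj_f_inv_f bij_is_inj)
lemma Wg_eq_iff: "w \<in> Wg \<Longrightarrow> w x = w y \<longleftrightarrow> x = y" using Wg_inv(2) by metis

text \<open>A linear map is determined by its restriction to the finite spanning set
  \<open>R\<close>, which the group permutes.\<close>

lemma finite_Wg [simp]: "finite Wg"
proof -
  have "inj_on (\<lambda>w. restrict w R) Wg"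
  proof (rule inj_onI)
    fix w w' assume w: "w \<in> Wg" "w' \<in> Wg" and e: "restrict w R = restrict w' R"
    have "w x = w' x" for x
    proof (rule linear_eq_on_span[of w w' R])
      show "linear w" "linear w'" using w Wg_linear by auto
      show "w x = w' x" if "x \<in> R" for x using e that by (metis restrict_apply')
      show "x \<in> span R" using spanR by simp
    qed
    then show "w = w'" by auto
  qed
  moreover have "(\<lambda>w. restrict w R) ` Wg \<subseteq> (\<Pi>\<^sub>E a\<in>R. R)" using Wg_R by (auto simp: PiE_iff)
  moreover have "finite (\<Pi>\<^sub>E a\<in>R. R)" by (rule finite_PiE) (use finR in auto)
  ultimately show ?thesis by (metis finite_imageD finite_subset)
qed

lemma card_Wg_pos: "card Wg > 0" using id_Wg by (metis card_gt_0_iff empty_iff finite_Wg)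

lemma Wg_comp_bij: "w \<in> Wg \<Longrightarrow> bij_betw (\<lambda>v. w \<circ> v) Wg Wg"
  by (rule bij_betwI[where g = "\<lambda>v. inv w \<circ> v"]) (auto intro: comp_Wg inv_Wg simp: fun_eq_iff)

lemma Wg_coroot: "w \<in> Wg \<Longrightarrow> coroot (w a) = w (coroot a)"
  by (rule coroot_isometry) (auto simp: Wg_linear Wg_inner)
lemma Wg_rrefl: "w \<in> Wg \<Longrightarrow> rrefl (w a) (w x) = w (rrefl a x)"
  by (rule rrefl_isometry) (auto simp: Wg_linear Wg_inner)

text \<open>Induction on the height: since (a, a) > 0, some simple s has (a, s) > 0, and reflecting
  in it lowers the height while keeping a non-simple root positive.\<close>

lemma root_conj_simple: "a \<in> Rp \<Longrightarrow> \<exists>w\<in>Wg. \<exists>s\<in>S. a = w s"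
proof (induction "nat \<lfloor>htv \<bullet> a\<rfloor>" arbitrary: a rule: less_induct)
  case less
  show ?case
  proof (cases "a \<in> S")
    case True then show ?thesis by (intro bexI[of _ id] bexI[of _ a]) auto
  next
    case False
    have "\<exists>s\<in>S. a \<bullet> s > 0"
    proof (rule ccontr)
      assume "\<not> ?thesis"
      then have np: "a \<bullet> s \<le> 0" if "s \<in> S" for s using that by force
      have "a \<bullet> a = (\<Sum>s\<in>S. (omega s \<bullet> a) * (a \<bullet> s))"
        by (subst (2) expandS) (simp add: inner_sum_right)
      also have "\<dots> \<le> 0" using np less(2)
        by (intro sum_nonpos mult_nonneg_nonpos) (auto simp: Rp_iff Qp_iff Nats_altdef2)
      finally show False using less(2) by (metis Rp_nz inner_gt_zero_iff not_le)
    qed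
    then obtain s where s: "s \<in> S" "a \<bullet> s > 0" by blast
    have b: "rrefl s a \<in> Rp" using simple_refl_Rp[of a s] less(2) s False by auto
    have c: "a \<bullet> coroot s > 0" using s by (simp add: coroot_inner)
    then have "a \<bullet> coroot s \<ge> 1" using intR[of s a] s SR Rp_R[OF less(2)]
      by (metis Ints_cases in_mono int_one_le_iff_zero_less of_int_0_less_iff of_int_1_le_iff)
    then have ht: "htv \<bullet> rrefl s a \<le> htv \<bullet> a - 1" using s by (simp add: rrefl_def inner_diff_right htv_S)
    have "nat \<lfloor>htv \<bullet> rrefl s a\<rfloor> < nat \<lfloor>htv \<bullet> a\<rfloor>"
      using ht htv_Rp[OF b] by linarith
    from less(1)[OF this b] obtain w s' where w: "w \<in> Wg" "s' \<in> S" "rrefl s a = w s'" by blast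
    then have "a = (rrefl s \<circ> w) s'" using s rrefl_rrefl[of s a] by simp
    then show ?thesis using w s simple_comp_Wg by blast
  qed
qed

lemma rrefl_Wg: assumes "a \<in> R" shows "rrefl a \<in> Wg"
proof -
  have "rrefl a \<in> Wg" if pos: "a \<in> Rp" for a
  proof -
    obtain w s where w: "w \<in> Wg" "s \<in> S" "a = w s" using root_conj_simple[OF pos] by blast
    have "rrefl a x = (w \<circ> rrefl s \<circ> inv w) x" for x
      using Wg_rrefl[OF w(1), of s "inv w x"] w by simp
    then have "rrefl a = w \<circ> rrefl s \<circ> inv w" by blast
    then show ?thesis using w by (simp add: comp_Wg inv_Wg simple_Wg)
  qed
  then show ?thesis using R_cases[OF assms] rrefl_uminus_root[of a] by metis
qed

subsection \<open>Weight lattices\<close>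

lemma Pw_add: "x \<in> Pw \<Longrightarrow> y \<in> Pw \<Longrightarrow> x + y \<in> Pw" by (auto simp: Pw_def inner_add_left)
lemma Pw_diff: "x \<in> Pw \<Longrightarrow> y \<in> Pw \<Longrightarrow> x - y \<in> Pw" by (auto simp: Pw_def inner_diff_left)
lemma Pw_uminus: "x \<in> Pw \<Longrightarrow> - x \<in> Pw" by (auto simp: Pw_def)
lemma Pw_0 [simp]: "0 \<in> Pw" by (auto simp: Pw_def)
lemma Pw_scale: "x \<in> Pw \<Longrightarrow> c \<in> \<int> \<Longrightarrow> c *\<^sub>R x \<in> Pw" by (auto simp: Pw_def)
lemma R_Pw: "a \<in> R \<Longrightarrow> a \<in> Pw" using intR SR by (auto simp: Pw_def)
lemma Pw_sum: "(\<And>i. i \<in> I \<Longrightarrow> f i \<in> Pw) \<Longrightarrow> sum f I \<in> Pw"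
  by (induction I rule: infinite_finite_induct) (auto intro: Pw_add)

lemma Wg_Pw: "w \<in> Wg \<Longrightarrow> x \<in> Pw \<Longrightarrow> w x \<in> Pw"
proof (induction w rule: Wg_induct)
  case (step s w)
  then have "w x \<bullet> coroot s \<in> \<int>" by (auto simp: Pw_def)
  moreover have "s \<in> Pw" using step SR R_Pw by blast
  ultimately show ?case using step by (simp add: rrefl_def Pw_diff Pw_scale)
qed auto

lemma Pw_int: assumes "x \<in> Pw" "a \<in> R" shows "x \<bullet> coroot a \<in> \<int>"
proof -
  have "x \<bullet> coroot a \<in> \<int>" if pos: "a \<in> Rp" for a
  proof -
    obtain w s where w: "w \<in> Wg" "s \<in> S" "a = w s" using root_conj_simple[OF pos] by blast
    have "x \<bullet> coroot a = inv w x \<bullet> coroot s"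
      using Wg_inner[OF w(1), of "inv w x" "coroot s"] w by (simp add: Wg_coroot)
    then show ?thesis using Wg_Pw[OF inv_Wg[OF w(1)] assms(1)] w by (simp add: Pw_def)
  qed
  from this[of a] this[of "- a"] show ?thesis using R_cases[OF assms(2)]
    by (auto simp: coroot_uminus)
qed

lemma Pcw_add: "x \<in> Pcw \<Longrightarrow> y \<in> Pcw \<Longrightarrow> x + y \<in> Pcw" by (auto simp: Pcw_def inner_add_left)
lemma Pcw_diff: "x \<in> Pcw \<Longrightarrow> y \<in> Pcw \<Longrightarrow> x - y \<in> Pcw" by (auto simp: Pcw_def inner_diff_left)
lemma Pcw_uminus: "x \<in> Pcw \<Longrightarrow> - x \<in> Pcw" by (auto simp: Pcw_def)
lemma Pcw_0 [simp]: "0 \<in> Pcw" by (auto simp: Pcw_def)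
lemma Pcw_scale: "x \<in> Pcw \<Longrightarrow> c \<in> \<int> \<Longrightarrow> c *\<^sub>R x \<in> Pcw" by (auto simp: Pcw_def)
lemma Pcw_sum: "(\<And>i. i \<in> I \<Longrightarrow> f i \<in> Pcw) \<Longrightarrow> sum f I \<in> Pcw"
  by (induction I rule: infinite_finite_induct) (auto intro: Pcw_add)
lemma Pcw_R: assumes "x \<in> Pcw" "a \<in> R" shows "x \<bullet> a \<in> \<int>"
proof -
  have "x \<bullet> a = (\<Sum>s\<in>S. (omega s \<bullet> a) * (x \<bullet> s))" by (subst expandS) (simp add: inner_sum_right)
  also have "\<dots> \<in> \<int>" using assms R_int by (intro Ints_sum Ints_mult) (auto simp: Pcw_def)
  finally show ?thesis .
qed
lemma coroot_Pcw: "a \<in> R \<Longrightarrow> coroot a \<in> Pcw"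
  using intR SR by (auto simp: Pcw_def inner_commute)
lemma Wg_Pcw: assumes "w \<in> Wg" "x \<in> Pcw" shows "w x \<in> Pcw"
proof -
  have "w x \<bullet> s = x \<bullet> inv w s" for s using Wg_inner[OF assms(1), of x "inv w s"] assms by simp
  then show ?thesis using Pcw_R[OF assms(2)] Wg_R[OF inv_Wg[OF assms(1)]] SR by (auto simp: Pcw_def)
qed
lemma omega_Pcwpos: "s \<in> S \<Longrightarrow> omega s \<in> Pcwpos" by (auto simp: Pcwpos_def omega)
lemma Pcwpos_Pcw: "x \<in> Pcwpos \<Longrightarrow> x \<in> Pcw" by (auto simp: Pcwpos_def Pcw_def)
lemma Pcwpos_Rp: assumes "x \<in> Pcwpos" "a \<in> Rp" shows "x \<bullet> a \<ge> 0"
proof -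
  have "x \<bullet> a = (\<Sum>s\<in>S. (omega s \<bullet> a) * (x \<bullet> s))" by (subst expandS) (simp add: inner_sum_right)
  also have "\<dots> \<ge> 0" using assms by (intro sum_nonneg mult_nonneg_nonneg) (auto simp: Pcwpos_def Rp_iff Qp_iff Nats_altdef2)
  finally show ?thesis .
qed

text \<open>Positive and negative parts in the basis of fundamental coweights. The last clause keeps
  both parts orthogonal to any simple root orthogonal to \<open>l\<close>;
  \<open>Ts_Y_commute\<close> depends on it.\<close>

lemma Pcw_split: assumes "l \<in> Pcw"
  obtains a b where "a \<in> Pcwpos" "b \<in> Pcwpos" "l = a - b" "\<And>s. s \<in> S \<Longrightarrow> l \<bullet> s = 0 \<Longrightarrow> a \<bullet> s = 0 \<and> b \<bullet> s = 0"
proof -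
  define a where "a = (\<Sum>s\<in>S. max 0 (l \<bullet> s) *\<^sub>R omega s)"
  define b where "b = (\<Sum>s\<in>S. max 0 (- (l \<bullet> s)) *\<^sub>R omega s)"
  have i: "(\<Sum>s\<in>S. c s *\<^sub>R omega s) \<bullet> s' = c s'" if "s' \<in> S" for c s'
  proof -
    have "(\<Sum>s\<in>S. c s *\<^sub>R omega s) \<bullet> s' = (\<Sum>s\<in>S. if s = s' then c s else 0)"
      unfolding inner_sum_left by (rule sum.cong) (use that in \<open>auto simp: omega\<close>)
    then show ?thesis using that finS by simp
  qed
  have li: "l \<bullet> s \<in> \<int>" if "s \<in> S" for s using assms that by (auto simp: Pcw_def)
  show ?thesis
  proof (rule that[of a b])
    show "a \<in> Pcwpos" "b \<in> Pcwpos" using li by (auto simp: Pcwpos_def a_def b_def i max_def)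
    show "l = a - b" by (rule inner_S_ext) (auto simp: inner_diff_left a_def b_def i)
    show "\<And>s. s \<in> S \<Longrightarrow> l \<bullet> s = 0 \<Longrightarrow> a \<bullet> s = 0 \<and> b \<bullet> s = 0" by (auto simp: a_def b_def i)
  qed
qed

lemma m_Pcw_Pw: "l \<in> Pcw \<Longrightarrow> u \<in> Pw \<Longrightarrow> real m * (l \<bullet> u) \<in> \<int>"
  using m_int by (auto simp: Pcw_def Pw_def)

text \<open>Serves both \<open>rho\<close> and \<open>rhoc\<close>: a simple reflection permutes the
  positive roots other than its own, so only the summand \<open>x\<close> changes sign.\<close>

lemma half_sum_refl:
  assumes "s \<in> S" "f (s) = x" "\<And>a. a \<in> Rp \<Longrightarrow> f (rrefl s a) = rrefl s (f a)" "rrefl s x = - x"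
  shows "rrefl s ((1/2) *\<^sub>R (\<Sum>a\<in>Rp. f a)) = (1/2) *\<^sub>R (\<Sum>a\<in>Rp. f a) - x"
proof -
  have sR: "s \<in> Rp" using assms S_Rp by auto
  have "rrefl s (\<Sum>a\<in>Rp. f a) = rrefl s x + (\<Sum>a\<in>Rp - {s}. rrefl s (f a))"
    unfolding sum.remove[OF finRp sR] by (simp add: assms rrefl_add linear_sum[OF linear_rrefl])
  also have "(\<Sum>a\<in>Rp - {s}. rrefl s (f a)) = (\<Sum>a\<in>Rp - {s}. f (rrefl s a))"
    by (rule sum.cong) (auto simp: assms(3))
  also have "\<dots> = (\<Sum>a\<in>Rp - {s}. f a)" by (rule sum.reindex_bij_betw[OF simple_refl_bij[OF assms(1)]])
  also have "\<dots> = (\<Sum>a\<in>Rp. f a) - x" unfolding sum.remove[OF finRp sR] by (simp add: assms)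
  finally have "rrefl s (\<Sum>a\<in>Rp. f a) = (\<Sum>a\<in>Rp. f a) - 2 *\<^sub>R x" using assms(4) by (simp add: scaleR_2)
  then show ?thesis by (simp add: linear_cmul[OF linear_rrefl] scaleR_right_diff_distrib)
qed

lemma rho_refl: "s \<in> S \<Longrightarrow> rrefl s rho = rho - s"
  unfolding rho_def by (rule half_sum_refl) (auto simp: rrefl_self)

lemma rho_coroot: "s \<in> S \<Longrightarrow> rho \<bullet> coroot s = 1"
  using rho_refl[of s] scaleR_cancel_right[of "rho \<bullet> coroot s" s 1] by (auto simp: rrefl_def)

lemma rho_Ppos: "rho \<in> Ppos" by (simp add: Ppos_def rho_coroot)
lemma Ppos_Pw: "x \<in> Ppos \<Longrightarrow> x \<in> Pw" by (auto simp: Ppos_def Pw_def)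
lemma rho_Pw: "rho \<in> Pw" using rho_Ppos Ppos_Pw by blast
lemma Ppos_add: "x \<in> Ppos \<Longrightarrow> y \<in> Ppos \<Longrightarrow> x + y \<in> Ppos" by (auto simp: Ppos_def inner_add_left)

definition rhoc :: 'v where "rhoc = (1/2) *\<^sub>R (\<Sum>a\<in>Rp. coroot a)"

lemma simple_refl_coroot: "s \<in> S \<Longrightarrow> coroot (rrefl s a) = rrefl s (coroot a)"
  using Wg_coroot[OF simple_Wg] .

lemma rhoc_refl: "s \<in> S \<Longrightarrow> rrefl s rhoc = rhoc - coroot s"
  unfolding rhoc_def
  by (rule half_sum_refl) (auto simp: simple_refl_coroot rrefl_self coroot_uminus simp flip: simple_refl_coroot)

lemma rhoc_S: "s \<in> S \<Longrightarrow> rhoc \<bullet> s = 1"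
proof -
  assume s: "s \<in> S"
  have "rhoc - (rhoc \<bullet> coroot s) *\<^sub>R s = rhoc - coroot s" using rhoc_refl[OF s] by (simp add: rrefl_def)
  then have "((rhoc \<bullet> coroot s) *\<^sub>R s) \<bullet> s = coroot s \<bullet> s" by simp
  then show ?thesis using s by (simp add: coroot_def)
qed

lemma rhoc_Pcw: "rhoc \<in> Pcw" by (auto simp: Pcw_def rhoc_S)

lemma half_sum_eq:
  fixes f :: "'v \<Rightarrow> 'v"
  assumes "A \<subseteq> Rp"
  shows "(1/2) *\<^sub>R ((\<Sum>a\<in>A. f a) - (\<Sum>a\<in>Rp - A. f a)) = (1/2) *\<^sub>R (\<Sum>a\<in>Rp. f a) - (\<Sum>a\<in>Rp - A. f a)"
proof -
  have "(\<Sum>a\<in>Rp. f a) = (\<Sum>a\<in>A. f a) + (\<Sum>a\<in>Rp - A. f a)"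
    using sum.subset_diff[OF assms finRp, of f] by (simp add: add.commute)
  then have "(\<Sum>a\<in>A. f a) - (\<Sum>a\<in>Rp - A. f a) = (\<Sum>a\<in>Rp. f a) - 2 *\<^sub>R (\<Sum>a\<in>Rp - A. f a)"
    by (simp add: scaleR_2)
  then show ?thesis by (simp add: scaleR_right_diff_distrib)
qed

lemma Ppos_Rp: assumes "x \<in> Ppos" "a \<in> Rp" shows "x \<bullet> a \<ge> 0"
proof -
  have "x \<bullet> a = (\<Sum>s\<in>S. (omega s \<bullet> a) * (x \<bullet> s))" by (subst expandS) (simp add: inner_sum_right)
  moreover have "x \<bullet> s \<ge> 0" if "s \<in> S" for s
  proof -
    have "x \<bullet> s = (x \<bullet> coroot s) * (s \<bullet> s) / 2" using that by (simp add: coroot_inner)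
    moreover have "x \<bullet> coroot s \<ge> 0" using assms that by (simp add: Ppos_def)
    moreover have "(x \<bullet> coroot s) * (s \<bullet> s) / 2 \<ge> 0"
      by (intro divide_nonneg_pos mult_nonneg_nonneg calculation(2)) simp_all
    ultimately show ?thesis by metis
  qed
  moreover have "omega s \<bullet> a \<ge> 0" if "s \<in> S" for s using assms that by (auto simp: Rp_iff Qp_iff Nats_altdef2)
  ultimately show ?thesis by (simp add: sum_nonneg)
qed

lemma Ppos_Qp: assumes "x \<in> Ppos" "v \<in> Qp" shows "x \<bullet> v \<ge> 0"
proof -
  have "x \<bullet> v = (\<Sum>s\<in>S. (omega s \<bullet> v) * (x \<bullet> s))" by (subst expandS) (simp add: inner_sum_right)
  also have "\<dots> \<ge> 0" using assms Ppos_Rp S_Rp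
    by (intro sum_nonneg mult_nonneg_nonneg) (auto simp: Qp_iff Nats_altdef2)
  finally show ?thesis .
qed

text \<open>A weight is determined by its integral pairings with the simple coroots, and
  Cauchy-Schwarz bounds these.\<close>

lemma finite_bounded_Pw: "finite {x \<in> Pw. x \<bullet> x \<le> r}"
proof -
  let ?A = "{x \<in> Pw. x \<bullet> x \<le> r}"
  define f where "f x = (\<lambda>s\<in>S. \<lfloor>x \<bullet> coroot s\<rfloor>)" for x :: 'v
  define N where "N s = \<lceil>sqrt r * norm (coroot s)\<rceil>" for s :: 'v
  have "inj_on f ?A"
  proof (rule inj_onI)
    fix x y assume x: "x \<in> ?A" and y: "y \<in> ?A" and e: "f x = f y"
    show "x = y"
    proof (rule inner_S_ext)
      fix s assume s: "s \<in> S"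
      have "\<lfloor>x \<bullet> coroot s\<rfloor> = \<lfloor>y \<bullet> coroot s\<rfloor>" using fun_cong[OF e, of s] s by (simp add: f_def)
      moreover have "x \<bullet> coroot s \<in> \<int>" "y \<bullet> coroot s \<in> \<int>" using x y s by (auto simp: Pw_def)
      ultimately have "x \<bullet> coroot s = y \<bullet> coroot s" by (metis Ints_cases floor_of_int)
      then show "x \<bullet> s = y \<bullet> s" using s by (simp add: coroot_inner)
    qed
  qed
  moreover have "f ` ?A \<subseteq> (\<Pi>\<^sub>E s\<in>S. {- N s..N s})"
  proof
    fix g assume "g \<in> f ` ?A"
    then obtain x where x: "x \<in> Pw" "x \<bullet> x \<le> r" and g: "g = f x" by auto
    have nx: "norm x \<le> sqrt r" using x(2) by (simp add: norm_eq_sqrt_inner)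
    have "\<lfloor>x \<bullet> coroot s\<rfloor> \<in> {- N s..N s}" for s
    proof -
      have "\<bar>x \<bullet> coroot s\<bar> \<le> norm x * norm (coroot s)" by (rule Cauchy_Schwarz_ineq2)
      also have "\<dots> \<le> sqrt r * norm (coroot s)" using nx by (simp add: mult_right_mono)
      finally show ?thesis unfolding N_def by (rule floor_bound)
    qed
    then show "g \<in> (\<Pi>\<^sub>E s\<in>S. {- N s..N s})" unfolding g f_def by (intro restrict_PiE_iff[THEN iffD2] ballI)
  qed
  moreover have "finite (\<Pi>\<^sub>E s\<in>S. {- N s..N s})" by (rule finite_PiE) (auto simp: finS)
  ultimately show ?thesis by (rule inj_on_finite)
qed

text \<open>The exchange condition. Reading from the right, the image of \<open>s\<close> first
  turns negative at a letter equal to the current image, and that letter cancels against the final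
  reflection in \<open>s\<close>.\<close>

lemma word_shorten:
  assumes "set ss \<subseteq> S" "s \<in> S" "prodw ss s \<notin> Rp"
  shows "\<exists>ts. set ts \<subseteq> S \<and> length ts < length ss \<and> prodw ts = prodw (ss @ [s])"
  using assms
proof (induction ss)
  case Nil then show ?case using S_Rp by auto
next
  case (Cons a ss)
  have W: "prodw ss \<in> Wg" using Cons.prems by (auto simp: Wg_eq)
  show ?case
  proof (cases "prodw ss s \<in> Rp")
    case False
    then obtain ts where "set ts \<subseteq> S" "length ts < length ss" "prodw ts = prodw (ss @ [s])"
      using Cons by auto
    then show ?thesis using Cons.prems by (intro exI[of _ "a # ts"]) auto
  next
    case True
    then have a: "prodw ss s = a" using simple_refl_Rp[of "prodw ss s" a] Cons.prems by auto
    have "prodw ((a # ss) @ [s]) x = prodw ss x" for x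
      using Wg_rrefl[OF W, of s "rrefl s x"] Cons.prems by (simp add: a prodw_append)
    then have "prodw ss = prodw ((a # ss) @ [s])" by auto
    then show ?thesis using Cons.prems by (intro exI[of _ ss]) auto
  qed
qed

text \<open>Induction on word length with w = v s. If v s is positive, x - w x exceeds x - v x by a
  nonnegative integral multiple of it; otherwise the exchange condition gives a shorter word for
  w.\<close>

lemma dominant_max: assumes "x \<in> Ppos" "w \<in> Wg" shows "rle (w x) x"
proof -
  have "x - prodw ss x \<in> Qp" if "set ss \<subseteq> S" for ss
    using that
  proof (induction "length ss" arbitrary: ss rule: less_induct)
    case less
    show ?case
    proof (cases ss rule: rev_cases)
      case (snoc ts s)
      then have s: "s \<in> S" "set ts \<subseteq> S" using less by auto
      show ?thesis
      proof (cases "prodw ts s \<in> Rp")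
        case True
        have W: "prodw ts \<in> Wg" using s by (auto simp: Wg_eq)
        have "x - prodw ss x = (x - prodw ts x) + (x \<bullet> coroot s) *\<^sub>R prodw ts s"
          by (simp add: snoc prodw_append rrefl_def Wg_diff[OF W] Wg_scale[OF W])
        moreover have "x \<bullet> coroot s \<in> \<nat>" using assms s by (auto simp: Ppos_def Nats_altdef2)
        moreover have "x - prodw ts x \<in> Qp" using less(1)[of ts] snoc s by simp
        ultimately show ?thesis using True by (simp only: Qp_add Qp_scale Rp_iff)
      next
        case False
        then obtain us where "set us \<subseteq> S" "length us < length ts" "prodw us = prodw ss"
          using word_shorten[of ts s] s snoc by auto
        then show ?thesis using less(1)[of us] snoc by auto
      qed
    qed simp
  qed
  then show ?thesis using assms(2) by (auto simp: Wg_eq rle_def)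
qed

lemma dominant_rep: assumes "x \<in> Pw" shows "\<exists>w\<in>Wg. w x \<in> Ppos"
proof -
  let ?A = "(\<lambda>w. htv \<bullet> w x) ` Wg"
  have "Wg \<noteq> {}" using id_Wg by blast
  then have "Max ?A \<in> ?A" by (intro Max_in) auto
  then obtain w where w: "w \<in> Wg" "htv \<bullet> w x = Max ?A" by auto
  have "w x \<bullet> coroot s \<ge> 0" if s: "s \<in> S" for s
  proof -
    have "htv \<bullet> rrefl s (w x) \<le> Max ?A" using imageI[OF simple_comp_Wg[OF s w(1)], of "\<lambda>w. htv \<bullet> w x"] by (intro Max_ge) simp_all
    then show ?thesis using w s by (simp add: rrefl_def inner_diff_right htv_S)
  qed
  then show ?thesis using w Wg_Pw[OF w(1) assms] by (auto simp: Ppos_def Pw_def)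
qed

lemma dominant_unique: "x \<in> Ppos \<Longrightarrow> w \<in> Wg \<Longrightarrow> w x \<in> Ppos \<Longrightarrow> w x = x"
  using dominant_max[of x w] dominant_max[of "w x" "inv w"] by (auto intro: rle_antisym simp: inv_Wg)

subsection \<open>The highest root\<close>

lemma simple_obtuse: assumes "s \<in> S" "s' \<in> S" "s \<noteq> s'" shows "s' \<bullet> s \<le> 0"
proof -
  have "rrefl s s' \<in> Rp" using simple_refl_Rp[of s' s] assms S_Rp by auto
  then have "omega s \<bullet> rrefl s s' \<ge> 0" using assms by (auto simp: Rp_iff Qp_iff Nats_altdef2)
  then have "s' \<bullet> coroot s \<le> 0" using assms by (simp add: rrefl_def inner_diff_right omega)
  moreover have "s \<bullet> s > 0" using assms by simp
  ultimately show ?thesis by (auto simp add: coroot_inner divide_le_0_iff)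
qed

text \<open>If \<open>A\<close> and its complement in \<open>S\<close> were orthogonal, W would
  preserve both spans. Every root is conjugate to a simple one up to sign, so \<open>R\<close>
  itself would split.\<close>

lemma irreducible_simple:
  assumes "A \<subseteq> S" "A \<noteq> {}" "S - A \<noteq> {}" shows "\<exists>s\<in>A. \<exists>s'\<in>S - A. s \<bullet> s' \<noteq> 0"
proof (rule ccontr)
  assume "\<not> ?thesis"
  then have orth: "s \<bullet> s' = 0" if "s \<in> A" "s' \<in> S - A" for s s' using that by blast
  have sub: "a \<bullet> b = 0" if "a \<in> span A" "b \<in> span (S - A)" for a b
  proof -
    have "\<forall>b\<in>span (S - A). orthogonal a b"
    proof
      fix b assume b: "b \<in> span (S - A)"
      have "orthogonal b a" by (rule orthogonal_to_span[OF that(1)])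
        (use orthogonal_to_span[OF b] orth in \<open>auto simp: orthogonal_def inner_commute\<close>)
      then show "orthogonal a b" by (simp add: orthogonal_commute)
    qed
    then show ?thesis using that by (auto simp: orthogonal_def)
  qed
  have stable: "w a \<in> span B" if "w \<in> Wg" "a \<in> span B" "B = A \<or> B = S - A" for w a B
    using that(1)
  proof (induction w rule: Wg_induct)
    case (step s w)
    show ?case
    proof (cases "s \<in> B")
      case True
      then show ?thesis using step by (simp add: rrefl_def span_diff span_scale span_base)
    next
      case False
      then have "w a \<bullet> s = 0" using that(3) step sub[of "w a" s] sub[of s "w a"] assms(1)
        by (auto simp: inner_commute span_base)
      then show ?thesis using step by (simp add: rrefl_def coroot_inner)
    qed
  qed (use that in simp)
  let ?A = "R \<inter> span A" and ?B = "R \<inter> span (S - A)"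
  have pos: "a \<in> span A \<or> a \<in> span (S - A)" if "a \<in> Rp" for a
  proof -
    obtain w s where "w \<in> Wg" "s \<in> S" "a = w s" using root_conj_simple[OF \<open>a \<in> Rp\<close>] by blast
    then show ?thesis using stable[of w s A] stable[of w s "S - A"] by (cases "s \<in> A") (auto simp: span_base)
  qed
  have "R = ?A \<union> ?B" using pos R_cases by (auto dest: span_neg) (metis minus_minus span_neg)
  moreover have "?A \<inter> ?B = {}" using sub R0 by (metis (no_types, lifting) Int_iff disjoint_iff inner_eq_zero_iff)
  moreover have "?A \<noteq> {}" "?B \<noteq> {}" using assms SR by (auto intro: span_base)
  moreover have "\<forall>a\<in>?A. \<forall>b\<in>?B. a \<bullet> b = 0" using sub by blast
  ultimately show False using irred by metis
qed

text \<open>Both Cartan integers are positive; if both were at least 2, then |a - b|^2 would be at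
  most 0. So one of them is 1, and the corresponding reflection produces the difference up to
  sign.\<close>

lemma root_difference: assumes "a \<in> R" "b \<in> R" "a \<noteq> b" "a \<bullet> b > 0" shows "a - b \<in> R"
proof -
  have p: "a \<bullet> coroot b > 0" "b \<bullet> coroot a > 0" using assms by (auto simp: coroot_inner inner_commute)
  have i: "a \<bullet> coroot b \<in> \<int>" "b \<bullet> coroot a \<in> \<int>" using assms intR by auto
  have "a \<bullet> coroot b = 1 \<or> b \<bullet> coroot a = 1"
  proof (rule ccontr)
    assume "\<not> ?thesis"
    then have "a \<bullet> coroot b \<ge> 2" "b \<bullet> coroot a \<ge> 2" using p i by (auto elim!: Ints_cases)
    then have "a \<bullet> b \<ge> b \<bullet> b" "a \<bullet> b \<ge> a \<bullet> a" using assms by (auto simp: coroot_inner inner_commute field_simps)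
    then have "(a - b) \<bullet> (a - b) \<le> 0" by (simp add: inner_diff_left inner_diff_right inner_commute)
    then show False using assms(3) by (metis inner_gt_zero_iff not_le right_minus_eq)
  qed
  then show ?thesis
  proof
    assume "a \<bullet> coroot b = 1" then show ?thesis using refl_closed[of b a] assms by (simp add: rrefl_def)
  next
    assume "b \<bullet> coroot a = 1" then have "b - a \<in> R" using refl_closed[of a b] assms by (simp add: rrefl_def)
    then show ?thesis using R_uminus[of "b - a"] by simp
  qed
qed

text \<open>Take \<open>th\<close> of maximal height; it is dominant with all coefficients positive.
  A maximal root b above a given root is dominant too, so (b, th) > 0; then b - th would be a root
  unless b = th, and comparing heights forces equality.\<close>

lemma highest_root_exists: "\<exists>!th. th \<in> R \<and> (\<forall>a\<in>R. rle a th)"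
proof -
  have mx: "\<exists>b\<in>B. \<forall>a\<in>B. htv \<bullet> a \<le> htv \<bullet> b" if "finite B" "B \<noteq> {}" for B
  proof -
    have "Max ((\<bullet>) htv ` B) \<in> (\<bullet>) htv ` B" using that by (intro Max_in) auto
    then obtain b where b: "b \<in> B" "htv \<bullet> b = Max ((\<bullet>) htv ` B)" by auto
    show ?thesis by (rule bexI[OF _ b(1)]) (use that b in auto)
  qed
  obtain th where th: "th \<in> R" "\<And>a. a \<in> R \<Longrightarrow> htv \<bullet> a \<le> htv \<bullet> th" using mx[OF finR Rne] by blast
  have thp: "th \<in> Rp" using th R_cases[of th] htv_Rp[of "- th"] th(2)[of "- th"] R_uminus by fastforce
  have dom: "b \<bullet> s \<ge> 0" if "b \<in> R" "s \<in> S" "\<And>a. a \<in> R \<Longrightarrow> rle b a \<Longrightarrow> htv \<bullet> a \<le> htv \<bullet> b" for b s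
  proof (rule ccontr)
    assume "\<not> ?thesis"
    then have n: "b \<bullet> coroot s < 0" using that by (simp add: coroot_inner divide_neg_pos)
    have r: "rrefl s b \<in> R" using refl_closed that SR by auto
    have "- (b \<bullet> coroot s) \<in> \<nat>" using intR[of s b] that SR n by (auto simp: Nats_altdef2)
    then have "- (b \<bullet> coroot s) *\<^sub>R s \<in> Qp" using that S_Rp by (intro Qp_scale) (auto simp: Rp_iff)
    then have "rle b (rrefl s b)" by (simp add: rle_def rrefl_def)
    from that(3)[OF r this] show False using n that by (simp add: rrefl_def inner_diff_right htv_S)
  qed
  have thd: "th \<bullet> s \<ge> 0" if "s \<in> S" for s using dom[OF th(1) that] th(2) by blast
  \<comment> \<open>If the support of \<open>th\<close> were proper, irreducibility would give a
    simple root outside it but not orthogonal to it, and obtuseness would make \<open>th\<close>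
    pair negatively with that root, against dominance.\<close>
  have coeff: "omega s \<bullet> th > 0" if "s \<in> S" for s
  proof -
    define A where "A = {s\<in>S. omega s \<bullet> th > 0}"
    have nn: "\<And>s. s \<in> S \<Longrightarrow> omega s \<bullet> th \<ge> 0" using thp by (auto simp: Rp_iff Qp_iff Nats_altdef2)
    have "A \<noteq> {}"
    proof
      assume "A = {}"
      then have "omega s \<bullet> th = omega s \<bullet> 0" if "s \<in> S" for s using nn[OF that] that by (force simp: A_def)
      then show False using omega_ext[of th 0] th R0 by auto
    qed
    moreover have "\<not> (\<exists>s\<in>A. \<exists>s'\<in>S - A. s \<bullet> s' \<noteq> 0)"
    proof safe
      fix s s' assume s: "s \<in> A" "s' \<in> S" "s' \<notin> A" "s \<bullet> s' \<noteq> 0"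
      have "th \<bullet> s' = (\<Sum>r\<in>S. (omega r \<bullet> th) * (r \<bullet> s'))" by (subst expandS) (simp add: inner_sum_left)
      also have "\<dots> < 0"
      proof -
        have sS: "s \<in> S" using s by (simp add: A_def)
        have "s \<noteq> s'" using s by auto
        then have "s \<bullet> s' \<le> 0" using simple_obtuse[of s' s] s sS by blast
        then have "omega s \<bullet> th * (s \<bullet> s') < 0" using s
          by (auto simp: A_def mult_less_0_iff)
        moreover have "omega r \<bullet> th * (r \<bullet> s') \<le> 0" if "r \<in> S" for r
          using nn[of r] s nn[of s'] simple_obtuse[of s' r] that by (cases "r = s'") (auto simp: A_def mult_le_0_iff)
        ultimately have "0 < (\<Sum>r\<in>S. - (omega r \<bullet> th * (r \<bullet> s')))"
          by (intro sum_pos2[OF finS sS]) force+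
        then show ?thesis by (simp add: sum_negf)
      qed
      finally show False using thd[OF s(2)] by simp
    qed
    ultimately have "S - A = {}" using irreducible_simple[of A] by (auto simp: A_def)
    then show ?thesis using that by (auto simp: A_def)
  qed
  have "rle a th" if a: "a \<in> R" for a
  proof -
    have "finite {b\<in>R. rle a b}" "{b\<in>R. rle a b} \<noteq> {}" using finR a by auto
    from mx[OF this] obtain b where b: "b \<in> R" "rle a b" "\<And>c. c \<in> R \<Longrightarrow> rle a c \<Longrightarrow> htv \<bullet> c \<le> htv \<bullet> b" by blast
    have bd: "b \<bullet> s \<ge> 0" if "s \<in> S" for s using dom[OF b(1) that] b rle_trans by blast
    have "\<exists>s\<in>S. b \<bullet> s \<noteq> 0" using inner_S_ext[of b 0] b R0 by auto
    then obtain s where s: "s \<in> S" "b \<bullet> s > 0" using bd by (metis less_eq_real_def)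
    have "b \<bullet> th = (\<Sum>r\<in>S. (omega r \<bullet> th) * (b \<bullet> r))" by (subst expandS) (simp add: inner_sum_right)
    also have "\<dots> > 0"
    proof (rule sum_pos2[where i = s, OF finS s(1)])
      show "0 < omega s \<bullet> th * (b \<bullet> s)" using coeff[OF s(1)] s(2) by simp
      show "0 \<le> omega r \<bullet> th * (b \<bullet> r)" if "r \<in> S" for r
        using coeff[OF that] bd[OF that] by simp
    qed
    finally have pos: "b \<bullet> th > 0" .
    have "b = th"
    proof (rule ccontr)
      assume "b \<noteq> th"
      then have d: "b - th \<in> R" using root_difference b th pos by blast
      from R_cases[OF d] show False
      proof
        assume "b - th \<in> Rp" then show False using htv_Rp[of "b - th"] th(2)[OF b(1)] by (simp add: inner_diff_right)
      next
        assume p: "- (b - th) \<in> Rp"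
        then have "rle b th" by (simp add: rle_def Rp_iff)
        then have "htv \<bullet> th \<le> htv \<bullet> b" using b rle_trans th by blast
        then show False using htv_Rp[OF p] by (simp add: inner_diff_right)
      qed
    qed
    then show ?thesis using b by simp
  qed
  then show ?thesis using th by (auto intro: rle_antisym)
qed

lemma theta_R: "theta \<in> R" and theta_max: "a \<in> R \<Longrightarrow> rle a theta"
  using theI'[OF highest_root_exists] unfolding theta_def by auto

lemma theta_Rp: "theta \<in> Rp"
proof (rule ccontr)
  assume "theta \<notin> Rp"
  then have p: "- theta \<in> Rp" using R_cases theta_R by blast
  have "htv \<bullet> (theta - (- theta)) \<ge> 0" using theta_max[OF R_uminus[OF theta_R]] by (intro htv_Qp) (simp only: rle_def)
  then show False using htv_Rp[OF p] by (simp add: inner_diff_right inner_add_right)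
qed

text \<open>A negative pairing n would put a + |n| theta among the roots. Being at most theta, it
  would force -a into \<open>Qp\<close>.\<close>

lemma theta_coroot_nonneg: assumes "a \<in> Rp" shows "a \<bullet> coroot theta \<ge> 0"
proof (rule ccontr)
  assume "\<not> ?thesis"
  then have n: "a \<bullet> coroot theta < 0" by simp
  have "a \<bullet> coroot theta \<in> \<int>" using intR theta_R assms Rp_R by blast
  then have n1: "- (a \<bullet> coroot theta) - 1 \<in> \<nat>" using n by (auto simp: Nats_altdef2 elim!: Ints_cases)
  have "rle (rrefl theta a) theta" using theta_max refl_closed theta_R assms Rp_R by blast
  then have "theta - rrefl theta a \<in> Qp" by (simp add: rle_def)
  moreover have "(- (a \<bullet> coroot theta) - 1) *\<^sub>R theta \<in> Qp" using n1 theta_Rp by (intro Qp_scale) (auto simp: Rp_iff)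
  ultimately have "(theta - rrefl theta a) + (- (a \<bullet> coroot theta) - 1) *\<^sub>R theta \<in> Qp" by (rule Qp_add)
  then have "- a \<in> Qp" by (simp add: rrefl_def algebra_simps)
  then show False using Qp_antisym[of a] assms by (auto simp: Rp_iff)
qed

lemma theta_coroot_le1: assumes "a \<in> Rp" "a \<noteq> theta" shows "a \<bullet> coroot theta \<le> 1"
proof (rule ccontr)
  assume "\<not> ?thesis"
  moreover have "a \<bullet> coroot theta \<in> \<int>" using intR theta_R assms Rp_R by blast
  ultimately have n: "a \<bullet> coroot theta - 2 \<in> \<nat>" by (auto simp: Nats_altdef2 elim!: Ints_cases)
  have "- rrefl theta a \<in> R" using refl_closed theta_R assms Rp_R R_uminus by blast
  then have "theta + rrefl theta a \<in> Qp" using theta_max[of "- rrefl theta a"] by (simp add: rle_def)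
  moreover have "(a \<bullet> coroot theta - 2) *\<^sub>R theta \<in> Qp" using n theta_Rp by (intro Qp_scale) (auto simp: Rp_iff)
  ultimately have "(theta + rrefl theta a) + (a \<bullet> coroot theta - 2) *\<^sub>R theta \<in> Qp" by (rule Qp_add)
  then have "a - theta \<in> Qp" by (simp add: rrefl_def algebra_simps scaleR_2)
  then have "rle theta a" by (simp add: rle_def)
  then show False using theta_max[of a] assms Rp_R rle_antisym by blast
qed

subsection \<open>The extended affine Weyl group\<close>

abbreviation aff :: "('v \<Rightarrow> 'v) \<Rightarrow> 'v \<Rightarrow> 'v \<times> real \<Rightarrow> 'v \<times> real" where "aff w l \<equiv> wlin w \<circ> tau l"

lemma aff_apply: "aff w l x = (w (fst x), snd x - l \<bullet> fst x)"
  by (simp add: wlin_def tau_def split: prod.split)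

lemma tW_E: assumes "g \<in> tW" obtains w l where "w \<in> Wg" "l \<in> Pcw" "\<And>x. g x = (w (fst x), snd x - l \<bullet> fst x)"
  using assms unfolding tW_def by (auto simp: aff_apply simp del: o_apply)

lemma tW_I: "w \<in> Wg \<Longrightarrow> l \<in> Pcw \<Longrightarrow> (\<And>x. g x = (w (fst x), snd x - l \<bullet> fst x)) \<Longrightarrow> g \<in> tW"
  unfolding tW_def by (rule CollectI, rule exI[of _ w], rule exI[of _ l]) (auto simp: fun_eq_iff wlin_def tau_def)

lemma tW_comp: assumes "g \<in> tW" "h \<in> tW" shows "g \<circ> h \<in> tW"
proof -
  obtain w l where g: "w \<in> Wg" "l \<in> Pcw" "\<And>x. g x = (w (fst x), snd x - l \<bullet> fst x)" using tW_E[OF assms(1)] by blast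
  obtain w' l' where h: "w' \<in> Wg" "l' \<in> Pcw" "\<And>x. h x = (w' (fst x), snd x - l' \<bullet> fst x)" using tW_E[OF assms(2)] by blast
  have i: "inv w' l \<bullet> x = l \<bullet> w' x" for x using Wg_inner[OF h(1), of "inv w' l" x] h by simp
  show ?thesis
    by (rule tW_I[of "w \<circ> w'" "l' + inv w' l"])
      (auto simp: g h i comp_Wg inv_Wg Wg_Pcw Pcw_add inner_add_left)
qed

lemma id_tW [simp]: "id \<in> tW" by (rule tW_I[of id 0]) auto
lemma tau_tW: "l \<in> Pcw \<Longrightarrow> tau l \<in> tW" by (rule tW_I[of id l]) (auto simp: tau_def split: prod.split)
lemma wlin_tW: "w \<in> Wg \<Longrightarrow> wlin w \<in> tW" by (rule tW_I[of w 0]) (auto simp: wlin_def split: prod.split)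

lemma tW_inverse: assumes "g \<in> tW" shows "\<exists>h\<in>tW. g \<circ> h = id \<and> h \<circ> g = id"
proof -
  obtain w l where g: "w \<in> Wg" "l \<in> Pcw" "\<And>x. g x = (w (fst x), snd x - l \<bullet> fst x)" using tW_E[OF assms(1)] by blast
  define h :: "'v \<times> real \<Rightarrow> 'v \<times> real" where "h x = (inv w (fst x), snd x - (- w l) \<bullet> fst x)" for x
  have i: "w l \<bullet> x = l \<bullet> inv w x" for x using Wg_inner[OF g(1), of l "inv w x"] g by simp
  show ?thesis
    by (rule bexI[of _ h], use g in \<open>auto simp: fun_eq_iff h_def i\<close>)
      (rule tW_I[of "inv w" "- w l"], auto simp: h_def inv_Wg Wg_Pcw Pcw_uminus)
qed

lemma inv_tW: "g \<in> tW \<Longrightarrow> inv g \<in> tW" using tW_inverse inv_unique_comp by metis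
lemma tW_bij: "g \<in> tW \<Longrightarrow> bij g" using tW_inverse o_bij by blast
lemma tW_inv [simp]: "g \<in> tW \<Longrightarrow> g (inv g x) = x" "g \<in> tW \<Longrightarrow> inv g (g x) = x"
  using tW_bij by (simp_all add: bij_is_surj surj_f_inv_f bij_is_inj)

lemma tW_add: assumes "g \<in> tW" shows "g (x + y) = g x + g y"
  by (rule tW_E[OF assms]) (auto simp: Wg_add inner_add_right)
lemma tW_scale: assumes "g \<in> tW" shows "g (c *\<^sub>R x) = c *\<^sub>R g x"
  by (rule tW_E[OF assms]) (auto simp: Wg_scale algebra_simps)
lemma tW_uminus: "g \<in> tW \<Longrightarrow> g (- x) = - g x" using tW_scale[of g "-1" x] by simp
lemma tW_diff: "g \<in> tW \<Longrightarrow> g (x - y) = g x - g y" using tW_add[of g x "- y"] by (simp add: tW_uminus)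
lemma tW_delta: assumes "g \<in> tW" shows "g (0, c) = (0, c)"
  by (rule tW_E[OF assms]) auto

definition Rhat :: "('v \<times> real) set" where "Rhat = {x. fst x \<in> R \<and> snd x \<in> \<int>}"

lemma Rhat_pos_iff: "x \<in> Rhat_pos \<longleftrightarrow> x \<in> Rhat \<and> (snd x > 0 \<or> snd x = 0 \<and> fst x \<in> Rp)"
  unfolding Rhat_pos_def Rhat_def by (cases x) (auto simp: Rp_R elim!: Ints_cases)

lemma Rhat_neg_uminus: "x \<in> Rhat_neg \<longleftrightarrow> - x \<in> Rhat_pos"
  unfolding Rhat_neg_def by (cases x) (force simp: image_iff)

lemma Rhat_uminus: "x \<in> Rhat \<longleftrightarrow> - x \<in> Rhat"
  using R_uminus[of "fst x"] R_uminus[of "- fst x"] by (auto simp: Rhat_def minus_in_Ints_iff)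

lemma Rhat_neg_iff: "x \<in> Rhat_neg \<longleftrightarrow> x \<in> Rhat \<and> (snd x < 0 \<or> snd x = 0 \<and> - fst x \<in> Rp)"
  unfolding Rhat_neg_uminus Rhat_pos_iff using Rhat_uminus by auto

lemma Rhat_cases: "x \<in> Rhat \<Longrightarrow> x \<in> Rhat_pos \<or> x \<in> Rhat_neg"
  using R_cases[of "fst x"] by (auto simp: Rhat_pos_iff Rhat_neg_iff Rhat_def)

lemma Rhat_pos_neg: "x \<in> Rhat_pos \<Longrightarrow> x \<notin> Rhat_neg"
  using Rp_uminus by (auto simp: Rhat_pos_iff Rhat_neg_iff)

lemma tW_Rhat: assumes "g \<in> tW" "x \<in> Rhat" shows "g x \<in> Rhat"
  by (rule tW_E[OF assms(1)]) (use assms Wg_R Pcw_R in \<open>auto simp: Rhat_def intro: Ints_diff\<close>)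

lemma sa_None: "sa None x = (rrefl theta (fst x), snd x + coroot theta \<bullet> fst x)"
proof -
  have "coroot theta \<bullet> rrefl theta v = - (coroot theta \<bullet> v)" for v
    by (simp add: rrefl_def inner_diff_right inner_commute coroot_self theta_R)
  then show ?thesis by (simp add: sa_def tau_def wlin_def split: prod.split)
qed
lemma sa_Some: "sa (Some a) x = (rrefl a (fst x), snd x)"
  by (simp add: sa_def wlin_def split: prod.split)

lemma sa_tW: assumes "i \<in> Idx" shows "sa i \<in> tW"
proof (cases i)
  case None
  show ?thesis unfolding None
    by (rule tW_I[of "rrefl theta" "- coroot theta"]) (auto simp: sa_None rrefl_Wg theta_R coroot_Pcw Pcw_uminus)
next
  case (Some a)
  then have "a \<in> S" using assms by (auto simp: Idx_def)
  then show ?thesis unfolding Some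
    by (intro tW_I[of "rrefl a" 0]) (auto simp: sa_Some simple_Wg)
qed

lemma aroot_R: "i \<in> Idx \<Longrightarrow> fst (aroot i) \<in> R"
  using SR theta_R R_uminus by (auto simp: aroot_def Idx_def)
lemma aroot_pos: "i \<in> Idx \<Longrightarrow> aroot i \<in> Rhat_pos"
  using SR S_Rp theta_R R_uminus by (auto simp: aroot_def Idx_def Rhat_pos_iff Rhat_def)

lemma sa_eq: assumes "i \<in> Idx" shows "sa i x = x - (fst x \<bullet> coroot (fst (aroot i))) *\<^sub>R aroot i"
proof (cases i)
  case None
  then show ?thesis
    by (cases x) (auto simp: sa_None aroot_def rrefl_def coroot_uminus inner_commute)
next
  case (Some a)
  then show ?thesis by (cases x) (auto simp: sa_Some aroot_def rrefl_def)
qed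

lemma sa_aroot: "i \<in> Idx \<Longrightarrow> sa i (aroot i) = - aroot i"
  using aroot_R[of i] by (simp add: sa_eq coroot_self scaleR_2)

lemma sa_sa: "i \<in> Idx \<Longrightarrow> sa i (sa i x) = x"
  using aroot_R[of i] by (simp add: sa_eq coroot_self inner_diff_left algebra_simps)

text \<open>For the affine index, a positive root other than \<open>theta\<close> pairs to 0 or 1
  with \<open>coroot theta\<close>. So the level cannot become negative, and when it drops to 0 the
  finite part is theta minus a positive root, which is again positive.\<close>

lemma sa_pos: assumes "i \<in> Idx" "x \<in> Rhat_pos" "x \<noteq> aroot i" shows "sa i x \<in> Rhat_pos"
proof (cases i)
  case (Some a)
  then have a: "a \<in> S" using assms by (auto simp: Idx_def)
  have r: "sa i x \<in> Rhat" using assms tW_Rhat sa_tW by (auto simp: Rhat_pos_iff)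
  have "fst x \<noteq> a" if "snd x = 0" using assms(3) that by (cases x) (auto simp: Some aroot_def)
  then show ?thesis using r assms(2) simple_refl_Rp[of "fst x" a] a
    unfolding Rhat_pos_iff Some sa_Some by auto
next
  case None
  have r: "sa i x \<in> Rhat" using assms tW_Rhat sa_tW by (auto simp: Rhat_pos_iff)
  have xR: "fst x \<in> R" "snd x \<in> \<int>" using assms by (auto simp: Rhat_pos_iff Rhat_def)
  let ?n = "fst x \<bullet> coroot theta"
  have ni: "?n \<in> \<int>" using intR theta_R xR by auto
  have sx: "sa i x = (fst x - ?n *\<^sub>R theta, snd x + ?n)" by (simp add: None sa_None rrefl_def inner_commute)
  show ?thesis
  proof (cases "fst x \<in> Rp")
    case True
    have n0: "?n \<ge> 0" by (rule theta_coroot_nonneg[OF True])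
    have x0: "snd x \<ge> 0" using assms(2) by (auto simp: Rhat_pos_iff)
    show ?thesis
    proof (cases "snd x + ?n > 0")
      case True then show ?thesis using r sx by (simp add: Rhat_pos_iff)
    next
      case False
      then have "?n = 0" "snd x = 0" using n0 x0 by auto
      then show ?thesis using r sx True by (simp add: Rhat_pos_iff)
    qed
  next
    case False
    then have m: "- fst x \<in> Rp" using R_cases xR by blast
    have x1: "snd x \<ge> 1" using assms(2) False xR(2) by (auto simp: Rhat_pos_iff elim!: Ints_cases)
    show ?thesis
    proof (cases "- fst x = theta")
      case True
      then have f: "fst x = - theta" by (metis minus_minus)
      then have "?n = - 2" using theta_R by (simp add: coroot_self)
      moreover have "snd x \<noteq> 1" using assms(3) f by (cases x) (auto simp: None aroot_def)
      then have "snd x \<ge> 2" using x1 xR(2) by (auto elim!: Ints_cases)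
      ultimately show ?thesis using r sx f theta_Rp by (auto simp: Rhat_pos_iff scaleR_2)
    next
      case ne: False
      have n1: "?n \<ge> -1" "?n \<le> 0" using theta_coroot_le1[OF m ne] theta_coroot_nonneg[OF m] by auto
      show ?thesis
      proof (cases "snd x + ?n > 0")
        case True then show ?thesis using r sx by (simp add: Rhat_pos_iff)
      next
        case False
        then have n: "?n = -1" "snd x = 1" using n1 x1 by auto
        have "fst x + theta \<in> R" using r sx n by (simp add: Rhat_def)
        moreover have "fst x + theta \<in> Qp" using theta_max[of "- fst x"] m Rp_R by (simp add: rle_def add.commute)
        ultimately show ?thesis using r sx n by (auto simp: Rhat_pos_iff Rp_iff)
      qed
    qed
  qed
qed

lemma sa_neg: "i \<in> Idx \<Longrightarrow> x \<in> Rhat_neg \<Longrightarrow> x \<noteq> - aroot i \<Longrightarrow> sa i x \<in> Rhat_neg"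
  using sa_pos[of i "- x"] minus_equation_iff[of x "aroot i"] by (auto simp: Rhat_neg_uminus tW_uminus sa_tW)

section \<open>Inversion sets, lengths and reduced expressions\<close>

definition Inv :: "('v \<times> real \<Rightarrow> 'v \<times> real) \<Rightarrow> ('v \<times> real) set" where
  "Inv g = {x \<in> Rhat_pos. g x \<in> Rhat_neg}"

lemma alen_Inv: "alen g = card (Inv g)" by (simp add: alen_def Inv_def)

lemma finite_Inv: assumes "g \<in> tW" shows "finite (Inv g)"
proof -
  obtain w l where g: "w \<in> Wg" "l \<in> Pcw" "\<And>x. g x = (w (fst x), snd x - l \<bullet> fst x)" using tW_E[OF assms(1)] by blast
  have "Inv g \<subseteq> (\<Union>a\<in>R. (\<lambda>c. (a, real_of_int c)) ` {0..\<lceil>l \<bullet> a\<rceil>})"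
  proof
    fix x assume "x \<in> Inv g"
    then have x: "fst x \<in> R" "snd x \<in> \<int>" "snd x \<ge> 0" "snd x \<le> l \<bullet> fst x"
      by (auto simp: Inv_def Rhat_pos_iff Rhat_neg_iff Rhat_def g)
    then obtain c where c: "snd x = of_int c" by (auto elim!: Ints_cases)
    then have "c \<in> {0..\<lceil>l \<bullet> fst x\<rceil>}" using x by (auto, linarith)
    then show "x \<in> (\<Union>a\<in>R. (\<lambda>c. (a, real_of_int c)) ` {0..\<lceil>l \<bullet> a\<rceil>})"
      using x c by (intro UN_I[of "fst x"] image_eqI[of _ _ c]) (auto simp: prod_eq_iff)
  qed
  then show ?thesis by (rule finite_subset) (use finR in auto)
qed

lemma Inv_left_pos:
  assumes "g \<in> tW" "i \<in> Idx" "inv g (aroot i) \<in> Rhat_pos"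
  shows "Inv (sa i \<circ> g) = insert (inv g (aroot i)) (Inv g)" "inv g (aroot i) \<notin> Inv g"
proof -
  have ar: "aroot i \<in> Rhat_pos" using aroot_pos assms by simp
  show ni: "inv g (aroot i) \<notin> Inv g" using assms ar Rhat_pos_neg by (auto simp: Inv_def)
  show "Inv (sa i \<circ> g) = insert (inv g (aroot i)) (Inv g)"
  proof (intro equalityI subsetI)
    fix x assume "x \<in> Inv (sa i \<circ> g)"
    then have x: "x \<in> Rhat_pos" "sa i (g x) \<in> Rhat_neg" by (auto simp: Inv_def)
    have gx: "g x \<in> Rhat" using x tW_Rhat assms by (auto simp: Rhat_pos_iff)
    show "x \<in> insert (inv g (aroot i)) (Inv g)"
    proof (cases "g x = aroot i")
      case True then show ?thesis using assms(1) by (metis insertI1 tW_inv(2))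
    next
      case False
      then have "g x \<notin> Rhat_pos" using sa_pos[OF assms(2)] x(2) Rhat_pos_neg by blast
      then have "g x \<in> Rhat_neg" using Rhat_cases[OF gx] by blast
      then show ?thesis using x by (simp add: Inv_def)
    qed
  next
    fix x assume "x \<in> insert (inv g (aroot i)) (Inv g)"
    then show "x \<in> Inv (sa i \<circ> g)"
    proof
      assume "x = inv g (aroot i)"
      then show ?thesis using assms ar by (auto simp: Inv_def sa_aroot Rhat_neg_uminus)
    next
      assume x: "x \<in> Inv g"
      have "g x \<noteq> - aroot i"
      proof
        assume "g x = - aroot i"
        then have "inv g (aroot i) = - x" using assms(1) by (metis inv_tW minus_minus tW_inv(2) tW_uminus)
        then show False using assms(3) x Rhat_pos_neg[of x] by (simp add: Inv_def Rhat_neg_uminus)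
      qed
      then show ?thesis using x sa_neg[OF assms(2)] by (auto simp: Inv_def)
    qed
  qed
qed

lemma Inv_left_neg:
  assumes "g \<in> tW" "i \<in> Idx" "inv g (aroot i) \<in> Rhat_neg"
  shows "Inv g = insert (- inv g (aroot i)) (Inv (sa i \<circ> g))"
proof -
  let ?h = "sa i \<circ> g"
  have h: "?h \<in> tW" using assms tW_comp sa_tW by blast
  have "?h (- inv g (aroot i)) = aroot i" using assms by (simp add: tW_uminus sa_tW sa_aroot)
  then have ih: "inv ?h (aroot i) = - inv g (aroot i)" using h by (metis tW_inv(2))
  have "sa i \<circ> ?h = g" using assms by (auto simp: sa_sa)
  then show ?thesis using Inv_left_pos(1)[OF h assms(2)] ih assms(3) by (simp add: Rhat_neg_uminus)
qed

lemma Inv_right_neg: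
  assumes "g \<in> tW" "i \<in> Idx" "g (aroot i) \<in> Rhat_neg"
  shows "Inv (g \<circ> sa i) = sa i ` (Inv g - {aroot i})" "aroot i \<in> Inv g"
proof -
  show "aroot i \<in> Inv g" using assms aroot_pos by (auto simp: Inv_def)
  have P: "Rhat_neg \<inter> Rhat_pos = {}" using Rhat_pos_neg by auto
  have "g (sa i (aroot i)) \<notin> Rhat_neg" using assms P by (auto simp: sa_aroot tW_uminus Rhat_neg_uminus)
  then show "Inv (g \<circ> sa i) = sa i ` (Inv g - {aroot i})"
  proof (intro equalityI subsetI)
    fix x assume "x \<in> Inv (g \<circ> sa i)" and na: "g (sa i (aroot i)) \<notin> Rhat_neg"
    then have x: "x \<in> Rhat_pos" "g (sa i x) \<in> Rhat_neg" "x \<noteq> aroot i" by (auto simp: Inv_def)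
    have "sa i x \<noteq> aroot i" using x(1) sa_sa[OF assms(2), of x] sa_aroot[OF assms(2)] aroot_pos[OF assms(2)] Rhat_pos_neg Rhat_neg_uminus by metis
    then have "sa i x \<in> Inv g - {aroot i}" using sa_pos[OF assms(2)] x by (auto simp: Inv_def)
    then show "x \<in> sa i ` (Inv g - {aroot i})" using sa_sa[OF assms(2), of x] by (metis imageI)
  next
    fix x assume "x \<in> sa i ` (Inv g - {aroot i})"
    then show "x \<in> Inv (g \<circ> sa i)" using sa_pos[OF assms(2)] sa_sa[OF assms(2)] by (auto simp: Inv_def)
  qed
qed

lemma alen_right_neg:
  assumes "g \<in> tW" "i \<in> Idx" "g (aroot i) \<in> Rhat_neg"
  shows "alen g = Suc (alen (g \<circ> sa i))"
proof -
  have "inj_on (sa i) A" for A by (metis inj_on_def sa_sa assms(2))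
  then have "alen (g \<circ> sa i) = card (Inv g - {aroot i})" by (simp add: alen_Inv Inv_right_neg[OF assms] card_image)
  moreover have "card (Inv g) > 0" using Inv_right_neg(2)[OF assms] finite_Inv[OF assms(1)] by (auto simp: card_gt_0_iff)
  ultimately show ?thesis using Inv_right_neg(2)[OF assms] by (simp add: alen_Inv)
qed

text \<open>If every affine simple root had positive image, so would all their nonnegative integral
  combinations, leaving no inversions.\<close>

lemma exists_descent: assumes "g \<in> tW" "alen g > 0" shows "\<exists>i\<in>Idx. g (aroot i) \<in> Rhat_neg"
proof (rule ccontr)
  assume "\<not> ?thesis"
  then have pos: "g (aroot i) \<in> Rhat_pos" if "i \<in> Idx" for i
  proof -
    have "aroot i \<in> Rhat" using aroot_pos[OF that] by (simp add: Rhat_pos_iff)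
    then show ?thesis using Rhat_cases[OF tW_Rhat[OF assms(1)]] \<open>\<not> (\<exists>i\<in>Idx. _ i)\<close> that by blast
  qed
  \<comment> \<open>A cone, ordered first by level and then by \<open>Qp\<close>, that contains all
    positive and no negative affine roots and is stable under nonnegative integral
    combinations.\<close>
  define C where "C = {x::'v \<times> real. snd x > 0 \<or> snd x = 0 \<and> fst x \<in> Qp}"
  have C0: "0 \<in> C" by (simp add: C_def)
  have Cadd: "x + y \<in> C" if "x \<in> C" "y \<in> C" for x y using that Qp_add by (auto simp: C_def)
  have Csc: "c *\<^sub>R x \<in> C" if "x \<in> C" "c \<in> \<nat>" for x c
    using that Qp_scale by (cases "c = 0") (auto simp: C_def Nats_altdef2)
  have Csum: "(\<Sum>i\<in>I. f i) \<in> C" if "\<And>i. i \<in> I \<Longrightarrow> f i \<in> C" for I and f :: "'v \<Rightarrow> 'v \<times> real"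
    using that by (induction I rule: infinite_finite_induct) (auto intro: C0 Cadd)
  have PC: "x \<in> C" if "x \<in> Rhat_pos" for x using that by (auto simp: Rhat_pos_iff C_def Rp_iff)
  have gsum: "g (\<Sum>i\<in>I. f i) = (\<Sum>i\<in>I. g (f i))" for I and f :: "'v \<Rightarrow> 'v \<times> real"
    by (induction I rule: infinite_finite_induct) (use tW_delta[OF assms(1), of 0] in \<open>auto simp: tW_add[OF assms(1)] zero_prod_def\<close>)
  obtain x where x: "x \<in> Rhat_pos" "g x \<in> Rhat_neg" using assms(2) by (auto simp: alen_Inv Inv_def card_gt_0_iff)
  have n: "snd x \<in> \<nat>" and xR: "fst x \<in> R" using x(1) by (auto simp: Rhat_pos_iff Rhat_def Nats_altdef2)
  \<comment> \<open>In simple affine coordinates the affine simple root occurs \<open>snd x\<close>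
    times; each occurrence contributes -theta, which \<open>?v\<close> compensates.\<close>
  let ?v = "fst x + snd x *\<^sub>R theta"
  have v: "?v \<in> Qp"
  proof (cases "snd x = 0")
    case True then show ?thesis using x(1) by (auto simp: Rhat_pos_iff Rp_iff)
  next
    case False
    then have "snd x - 1 \<in> \<nat>" using n by (auto simp: Nats_altdef2 elim!: Ints_cases)
    then have "(snd x - 1) *\<^sub>R theta \<in> Qp" using theta_Rp by (intro Qp_scale) (auto simp: Rp_iff)
    moreover have "theta - - fst x \<in> Qp" using theta_max[OF R_uminus[OF xR]] by (simp only: rle_def)
    ultimately have "(snd x - 1) *\<^sub>R theta + (theta - - fst x) \<in> Qp" by (rule Qp_add)
    then show ?thesis by (simp add: algebra_simps)
  qed
  have s1: "(\<Sum>s\<in>S. (omega s \<bullet> ?v) *\<^sub>R aroot (Some s)) = (?v, 0)"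
    by (simp add: aroot_def prod_eq_iff fst_sum snd_sum flip: expandS)
  have "x = (\<Sum>s\<in>S. (omega s \<bullet> ?v) *\<^sub>R aroot (Some s)) + snd x *\<^sub>R aroot None"
    unfolding s1 by (cases x) (simp add: aroot_def)
  then have "g x = (\<Sum>s\<in>S. (omega s \<bullet> ?v) *\<^sub>R g (aroot (Some s))) + snd x *\<^sub>R g (aroot None)"
    by (metis (no_types, lifting) gsum tW_add[OF assms(1)] tW_scale[OF assms(1)] sum.cong)
  moreover have "(\<Sum>s\<in>S. (omega s \<bullet> ?v) *\<^sub>R g (aroot (Some s))) \<in> C"
    by (intro Csum Csc PC pos) (use v in \<open>auto simp: Qp_iff Idx_def\<close>)
  moreover have "snd x *\<^sub>R g (aroot None) \<in> C" by (intro Csc PC pos n) (simp add: Idx_def)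
  ultimately have "g x \<in> C" using Cadd by simp
  then show False using x(2) R0 Qp_antisym[of "fst (g x)"] by (auto simp: C_def Rhat_neg_iff Rp_iff Rhat_def)
qed

abbreviation "prods is \<equiv> fold (\<lambda>i h. sa i \<circ> h) is id"

lemma prods_snoc: "prods (is @ [i]) = sa i \<circ> prods is" by simp
lemma prods_Cons: "prods (i # is) = prods is \<circ> sa i"
proof -
  have "fold (\<lambda>i h. sa i \<circ> h) is h = prods is \<circ> h" for h :: "'v \<times> real \<Rightarrow> 'v \<times> real"
    by (induction "is" rule: rev_induct) (auto simp: comp_assoc)
  from this[of "sa i"] show ?thesis by simp
qed
lemma prods_tW: "set is \<subseteq> Idx \<Longrightarrow> prods is \<in> tW"
  by (induction "is" rule: rev_induct) (auto intro: tW_comp sa_tW)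

definition redexp :: "('v \<times> real \<Rightarrow> 'v \<times> real) \<Rightarrow> ('v \<times> real \<Rightarrow> 'v \<times> real) \<Rightarrow> 'v option list \<Rightarrow> bool" where
  "redexp g p is \<longleftrightarrow> p \<in> Omega \<and> set is \<subseteq> Idx \<and> length is = alen g \<and> g = p \<circ> prods is"

lemma redexp_Cons:
  assumes "g \<in> tW" "i \<in> Idx" "g (aroot i) \<in> Rhat_neg" "redexp (g \<circ> sa i) p is"
  shows "redexp g p (i # is)"
proof -
  have "g = g \<circ> sa i \<circ> sa i" using assms by (auto simp: sa_sa)
  moreover have "g \<circ> sa i = p \<circ> prods is" using assms(4) by (simp add: redexp_def)
  ultimately have "g = p \<circ> prods (i # is)" unfolding prods_Cons by (metis comp_assoc)
  moreover have "length (i # is) = alen g" using assms(4) by (simp add: redexp_def alen_right_neg[OF assms(1-3)])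
  moreover have "p \<in> Omega" "set (i # is) \<subseteq> Idx" using assms by (auto simp: redexp_def)
  ultimately show ?thesis unfolding redexp_def by blast
qed

lemma redexp_exists: "g \<in> tW \<Longrightarrow> \<exists>p is. redexp g p is"
proof (induction "alen g" arbitrary: g)
  case 0
  then have "redexp g g []" by (auto simp: redexp_def Omega_def)
  then show ?case by blast
next
  case (Suc n)
  then obtain i where i: "i \<in> Idx" "g (aroot i) \<in> Rhat_neg" using exists_descent[of g] by auto
  have "alen (g \<circ> sa i) = n" "g \<circ> sa i \<in> tW" using alen_right_neg[OF Suc(3) i] Suc i tW_comp sa_tW by auto
  then obtain p "is" where p: "redexp (g \<circ> sa i) p is" using Suc by blast
  then show ?case using redexp_Cons[OF Suc(3) i] by blast
qed

lemma alen_left_le: "g \<in> tW \<Longrightarrow> i \<in> Idx \<Longrightarrow> alen (sa i \<circ> g) \<le> Suc (alen g)"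
proof -
  assume g: "g \<in> tW" "i \<in> Idx"
  have "inv g (aroot i) \<in> Rhat" using tW_Rhat[OF inv_tW[OF g(1)]] aroot_pos[OF g(2)] by (auto simp: Rhat_pos_iff)
  then consider "inv g (aroot i) \<in> Rhat_pos" | "inv g (aroot i) \<in> Rhat_neg" using Rhat_cases by blast
  then show ?thesis
  proof cases
    case 1 then show ?thesis using Inv_left_pos[OF g 1] finite_Inv[OF g(1)] by (simp add: alen_Inv)
  next
    case 2
    then have "alen (sa i \<circ> g) \<le> alen g" using Inv_left_neg[OF g 2] finite_Inv[OF g(1)]
      unfolding alen_Inv by (intro card_mono) auto
    then show ?thesis by simp
  qed
qed

lemma alen_prods_le: "set is \<subseteq> Idx \<Longrightarrow> alen (prods is) \<le> length is"
proof (induction "is" rule: rev_induct)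
  case Nil
  have "Inv (\<lambda>x. x) = {}" using Rhat_pos_neg unfolding Inv_def by blast
  then show ?case by (simp add: alen_Inv id_def)
next
  case (snoc i "is")
  have "set is \<subseteq> Idx" "i \<in> Idx" using snoc.prems by simp_all
  moreover from snoc.IH[OF this(1)] prods_tW[OF this(1)] have "alen (prods is) \<le> length is" "prods is \<in> tW" .
  ultimately show ?case using alen_left_le[of "prods is" i] unfolding prods_snoc length_append_singleton by linarith
qed

text \<open>Each letter of a reduced word adds exactly one inversion. In \<open>tri_wordT\<close>
  that inversion supplies the triangular factor of the letter.\<close>

lemma reduced_snoc:
  assumes "set (is @ [i]) \<subseteq> Idx" "alen (prods (is @ [i])) = length (is @ [i])"
  shows "alen (prods is) = length is" "inv (prods is) (aroot i) \<in> Rhat_pos"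
    "Inv (prods (is @ [i])) = insert (inv (prods is) (aroot i)) (Inv (prods is))"
    "inv (prods is) (aroot i) \<notin> Inv (prods is)"
proof -
  have g: "prods is \<in> tW" "i \<in> Idx" using assms prods_tW by auto
  show l: "alen (prods is) = length is"
    using alen_left_le[OF g] alen_prods_le[of "is"] assms by auto
  have "inv (prods is) (aroot i) \<in> Rhat" using tW_Rhat[OF inv_tW[OF g(1)]] aroot_pos[OF g(2)] by (auto simp: Rhat_pos_iff)
  moreover have "inv (prods is) (aroot i) \<notin> Rhat_neg"
  proof
    assume n: "inv (prods is) (aroot i) \<in> Rhat_neg"
    have "alen (sa i \<circ> prods is) \<le> alen (prods is)" using Inv_left_neg[OF g n] finite_Inv[OF g(1)]
      unfolding alen_Inv by (intro card_mono) auto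
    then show False using assms l by simp
  qed
  ultimately show p: "inv (prods is) (aroot i) \<in> Rhat_pos" using Rhat_cases by blast
  show "Inv (prods (is @ [i])) = insert (inv (prods is) (aroot i)) (Inv (prods is))"
    "inv (prods is) (aroot i) \<notin> Inv (prods is)" using Inv_left_pos[OF g p] by simp_all
qed

lemma Omega_tW: "p \<in> Omega \<Longrightarrow> p \<in> tW" by (simp add: Omega_def)
lemma Omega_Inv: "p \<in> Omega \<Longrightarrow> Inv p = {}"
  using finite_Inv by (auto simp: Omega_def alen_Inv)
lemma Omega_pos: assumes "p \<in> Omega" "x \<in> Rhat_pos" shows "p x \<in> Rhat_pos"
proof -
  have "p x \<in> Rhat" using assms tW_Rhat[of p x] by (auto simp: Omega_def Rhat_pos_iff)
  moreover have "p x \<notin> Rhat_neg" using Omega_Inv[OF assms(1)] assms unfolding Inv_def by blast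
  ultimately show ?thesis using Rhat_cases by blast
qed
lemma Omega_pos_iff: assumes "p \<in> Omega" "x \<in> Rhat" shows "p x \<in> Rhat_pos \<longleftrightarrow> x \<in> Rhat_pos"
  using Omega_pos[OF assms(1), of x] Omega_pos[OF assms(1), of "- x"] Rhat_cases[OF assms(2)] Rhat_pos_neg[of "p x"]
  by (auto simp: Rhat_neg_uminus tW_uminus Omega_tW[OF assms(1)])

lemma Inv_Omega_comp: assumes "p \<in> Omega" "g \<in> tW" shows "Inv (p \<circ> g) = Inv g"
proof -
  have "p (g x) \<in> Rhat_neg \<longleftrightarrow> g x \<in> Rhat_neg" if "x \<in> Rhat_pos" for x
  proof -
    have "- g x \<in> Rhat" using tW_Rhat[OF assms(2)] that Rhat_uminus by (auto simp: Rhat_pos_iff)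
    then show ?thesis using Omega_pos_iff[OF assms(1), of "- g x"]
      by (simp add: Rhat_neg_uminus tW_uminus Omega_tW[OF assms(1)])
  qed
  then show ?thesis by (auto simp: Inv_def)
qed

text \<open>Exactly (l, a) inversions lie over each positive root a; this multiplicity reappears in
  the exponent of \<open>ydiag\<close>.\<close>

lemma Inv_tau: assumes "l \<in> Pcwpos"
  shows "Inv (tau l) = {(a, c) | a c. a \<in> Rp \<and> c \<in> \<int> \<and> 0 \<le> c \<and> c < l \<bullet> a}"
proof -
  have "(a, c) \<in> Inv (tau l) \<longleftrightarrow> a \<in> Rp \<and> c \<in> \<int> \<and> 0 \<le> c \<and> c < l \<bullet> a" for a c
  proof (cases "a \<in> R")
    case True
    have li: "l \<bullet> a \<in> \<int>" using Pcw_R Pcwpos_Pcw assms True by blast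
    show ?thesis
    proof (cases "a \<in> Rp")
      case a: True
      show ?thesis using a True li Rp_uminus[OF a] Ints_diff[of c "l \<bullet> a"]
        by (auto simp: Inv_def tau_def Rhat_pos_iff Rhat_neg_iff Rhat_def)
    next
      case False
      then have "l \<bullet> - a \<ge> 0" using Pcwpos_Rp[OF assms, of "- a"] R_cases True by blast
      then show ?thesis using False by (auto simp: Inv_def tau_def Rhat_pos_iff Rhat_neg_iff)
    qed
  next
    case False then show ?thesis using Rp_R by (auto simp: Inv_def Rhat_pos_iff Rhat_def)
  qed
  then show ?thesis by auto
qed

end

lemma fract_double_zero: assumes "x + x = (0::K)" shows "x = 0"
proof -
  have "of_nat (Suc (Suc 0)) * x = x + x" by (simp only: of_nat_Suc of_nat_0 add_0_right distrib_right mult_1)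
  then show ?thesis using assms fract_of_nat_nonzero[of "Suc (Suc 0)"]
    by (metis mult_eq_0_iff zero_less_Suc)
qed

lemma sum_telescope_int_pos:
  fixes F :: "int \<Rightarrow> 'a::ab_group_add"
  assumes "n \<ge> 0" shows "(\<Sum>j\<in>{1..n}. F (j - 1) - F j) = F 0 - F n"
  using assms
proof (induction n rule: int_ge_induct)
  case (step i)
  have "{1..i + 1} = insert (i + 1) {1..i}" using step by auto
  then show ?case using step by simp
qed simp

lemma sum_telescope_int_neg:
  fixes F :: "int \<Rightarrow> 'a::ab_group_add"
  assumes "n \<le> 0" shows "(\<Sum>j\<in>{n + 1..0}. F (j - 1) - F j) = F n - F 0"
  using assms
proof (induction n rule: int_le_induct)
  case (step i)
  have "{i - 1 + 1..0} = insert i {i + 1..0}" using step by auto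
  then show ?case using step by simp
qed simp

section \<open>Ring identities for Demazure-Lusztig operators; x and y stand for X^-a and X^a, t and
  u for q^k and q^-k\<close>

context
  fixes t u x y :: "'a::comm_ring_1"
  assumes xy: "x * y = 1" and tu: "t * u = 1"
begin

lemma unit_cancel: "x * (y * z) = z" "t * (u * z) = z"
  by (simp_all add: xy tu flip: mult.assoc)

text \<open>\<open>F\<close>, \<open>P\<close> represent f and its quotient \<open>Pop\<close>,
  \<open>G\<close>, \<open>Q\<close> the starred data of the second argument, \<open>m\<close> and
  \<open>n\<close> the weight and its reflection. The two summands are the defect of isometry and
  its reflected image; both contain the factor \<open>B\<close>, and the weight relation makes them
  cancel.\<close>

lemma demazure_lusztig_antisymmetry:
  assumes smu: "n * (u * x - t) = m * (t * x - u)"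
  shows "((t * F + (t * x - u) * P) * (u * G + (u * y - t) * Q) - F * G) * m
     + ((t * (F + (x - 1) * P) + (t * y - u) * (x * P)) * (u * (G + (y - 1) * Q) + (u * x - t) * (y * Q))
        - (F + (x - 1) * P) * (G + (y - 1) * Q)) * n = 0"
proof -
  define B where "B = u * (P * G) - t * (y * (F * Q)) - y * ((t * x - u) * (P * Q))"
  have e1: "(t * F + (t * x - u) * P) * (u * G + (u * y - t) * Q) - F * G = (t * x - u) * B"
    unfolding B_def by (simp add: algebra_simps xy tu unit_cancel)
  have e2: "(t * (F + (x - 1) * P) + (t * y - u) * (x * P)) * (u * (G + (y - 1) * Q) + (u * x - t) * (y * Q))
        - (F + (x - 1) * P) * (G + (y - 1) * Q) = - ((u * x - t) * B)"
    unfolding B_def by (simp add: algebra_simps xy tu unit_cancel)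
  have "(t * x - u) * B * m + - ((u * x - t) * B) * n = B * (m * (t * x - u) - n * (u * x - t))"
    by (simp add: algebra_simps)
  then show ?thesis unfolding e1 e2 smu by simp
qed

lemma demazure_lusztig_quotient:
  assumes "(y - 1) * P' = - (x - 1) * P" shows "(x - 1) * P' = (x - 1) * (x * P)"
proof -
  have "(x - 1) * P' = - (x * ((y - 1) * P'))" by (simp add: algebra_simps xy tu unit_cancel)
  then show ?thesis unfolding assms by (simp add: algebra_simps)
qed

lemma demazure_lusztig_quadratic1:
  "(x - 1) * ((- u) * P) = (t * (F + (x - 1) * P) + (t * y - u) * (x * P)) - (t * F + (t * x - u) * P)"
  by (simp add: algebra_simps xy tu unit_cancel)

lemma demazure_lusztig_quadratic2:
  "t * (t * F + (t * x - u) * P) + (t * x - u) * ((- u) * P) = F + (t - u) * (t * F + (t * x - u) * P)"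
  by (simp add: algebra_simps xy tu unit_cancel)

lemma weight_ratio:
  "((1 - y) * ((1 - t * t * x) * M)) * (u * x - t) = ((1 - x) * ((1 - t * t * y) * M)) * (t * x - u)"
  by (simp add: algebra_simps xy tu unit_cancel)

end

context rd begin

subsection \<open>Powers of q\<close>

text \<open>For other exponents the floor in the definition of \<open>qpow\<close> makes it non-additive.\<close>
definition mz :: "real \<Rightarrow> bool" where "mz r \<longleftrightarrow> real m * r \<in> \<int>"

lemma mz_add: "mz r \<Longrightarrow> mz s \<Longrightarrow> mz (r + s)" by (auto simp: mz_def distrib_left)
lemma mz_uminus [simp]: "mz (- r) \<longleftrightarrow> mz r" by (auto simp: mz_def minus_in_Ints_iff)
lemma mz_diff: "mz r \<Longrightarrow> mz s \<Longrightarrow> mz (r - s)" using mz_add[of r "- s"] by simp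
lemma mz_Ints: "r \<in> \<int> \<Longrightarrow> mz r" by (auto simp: mz_def)
lemma mz_nat [simp]: "mz (real n)" by (simp add: mz_Ints)
lemma mz_0 [simp]: "mz 0" by (simp add: mz_def)
lemma mz_times: "r \<in> \<int> \<Longrightarrow> mz s \<Longrightarrow> mz (r * s)"
  by (simp add: mz_def mult.left_commute)
lemma mz_pair: "l \<in> Pcw \<Longrightarrow> u \<in> Pw \<Longrightarrow> mz (l \<bullet> u)" using m_Pcw_Pw by (simp add: mz_def)

lemma qpow_add: assumes "mz r" shows "qpow (r + s) = qpow r * qpow s"
proof -
  have "\<lfloor>real m * (r + s)\<rfloor> = \<lfloor>real m * r\<rfloor> + \<lfloor>real m * s\<rfloor>"
    using assms by (auto simp: mz_def distrib_left elim!: Ints_cases)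
  then show ?thesis by (simp add: qpow_def power_int_add)
qed
lemma qpow_0 [simp]: "qpow 0 = 1" by (simp add: qpow_def)
lemma qpow_nonzero [simp]: "qpow r \<noteq> 0" by (simp add: qpow_def)
lemma qpow_uminus: "mz r \<Longrightarrow> qpow r * qpow (- r) = 1"
  using qpow_add[of r "- r"] by simp
lemma sigma_qpow: assumes "mz r" shows "sigma (qpow r) = qpow (- r)"
proof -
  have "\<lfloor>real m * - r\<rfloor> = - \<lfloor>real m * r\<rfloor>" using assms by (auto simp: mz_def elim!: Ints_cases)
  then show ?thesis by (simp add: qpow_def sigma_zq_powi)
qed
lemma qpow_eq_1: assumes "mz r" shows "qpow r = 1 \<longleftrightarrow> r = 0"
  using assms m_pos by (auto simp: qpow_def zq_power_int_eq_1 mz_def elim!: Ints_cases)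
lemma qpow_sum: "(\<And>i. i \<in> I \<Longrightarrow> mz (f i)) \<Longrightarrow> qpow (sum f I) = (\<Prod>i\<in>I. qpow (f i))"
  by (induction I rule: infinite_finite_induct) (auto simp: qpow_add)
lemma qpow_power: assumes "mz r" shows "qpow r ^ n = qpow (real n * r)"
  by (induction n) (use assms qpow_add[OF assms] in \<open>auto simp: distrib_right\<close>)
lemma zdiv_qpow: "r > 0 \<Longrightarrow> mz r \<Longrightarrow> zdiv (qpow r)"
proof -
  assume r: "r > 0" "mz r"
  then obtain z where z: "real m * r = of_int z" by (auto simp: mz_def elim!: Ints_cases)
  moreover have "real m * r > 0" using r m_pos by simp
  ultimately have "z > 0" by simp
  then show ?thesis unfolding qpow_def z by (intro zdiv_zq_powi) simp
qed

subsection \<open>The group algebra and the action of the extended affine Weyl group\<close>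

definition L :: "'v set \<Rightarrow> ('v \<Rightarrow>\<^sub>0 K) set" where "L Z = {f. ky f \<subseteq> Z}"

lemma Palg_L: "Palg = L Pw" by (simp add: Palg_def L_def)
lemma L_0 [simp]: "0 \<in> L Z" by (simp add: L_def)
lemma L_add: "f \<in> L Z \<Longrightarrow> g \<in> L Z \<Longrightarrow> f + g \<in> L Z" by (auto simp: L_def intro: keys_add_sub[THEN subsetD])
lemma L_diff: "f \<in> L Z \<Longrightarrow> g \<in> L Z \<Longrightarrow> f - g \<in> L Z" using keys_diff_sub[of f Z g] by (simp add: L_def)
lemma L_uminus: "f \<in> L Z \<Longrightarrow> - f \<in> L Z" using L_diff[of 0 Z f] by simp
lemma L_cst: "f \<in> L Z \<Longrightarrow> cst c * f \<in> L Z" using keys_cmul_subset[of c f] by (auto simp: L_def cst_def)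
lemma L_sum: "(\<And>i. i \<in> I \<Longrightarrow> f i \<in> L Z) \<Longrightarrow> sum f I \<in> L Z"
  by (induction I rule: infinite_finite_induct) (auto intro: L_add)
lemma L_single: "a \<in> Z \<Longrightarrow> sg a c \<in> L Z" by (simp add: L_def)
lemma L_mono: "f \<in> L Z \<Longrightarrow> Z \<subseteq> Z' \<Longrightarrow> f \<in> L Z'" by (auto simp: L_def)
lemma L_lookup: "f \<in> L Z \<Longrightarrow> lk f n \<noteq> 0 \<Longrightarrow> n \<in> Z" by (auto simp: L_def in_keys_iff)
lemma L_csig: "f \<in> L Z \<Longrightarrow> csig f \<in> L Z" using keys_csig_subset[of f] by (auto simp: L_def)

lemma Palg_mult: "f \<in> Palg \<Longrightarrow> g \<in> Palg \<Longrightarrow> f * g \<in> Palg"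
  unfolding Palg_def using keys_mult_sub[of f g Pw] Pw_add by blast
lemma Palg_single: "a \<in> Pw \<Longrightarrow> sg a c \<in> Palg" by (simp add: Palg_L L_single)
lemma Palg_cst [simp]: "cst c \<in> Palg" by (simp add: cst_def Palg_single)
lemma Palg_1 [simp]: "1 \<in> Palg" using Palg_single[of 0 1] by simp
lemma Palg_prod: "(\<And>i. i \<in> I \<Longrightarrow> f i \<in> Palg) \<Longrightarrow> prod f I \<in> Palg"
  by (induction I rule: infinite_finite_induct) (auto intro: Palg_mult)
lemmas Palg_add = L_add[of _ Pw, folded Palg_L] and Palg_diff = L_diff[of _ Pw, folded Palg_L]
  and Palg_sum = L_sum[of _ _ Pw, folded Palg_L] and Palg_uminus = L_uminus[of _ Pw, folded Palg_L]
  and Palg_cmul = L_cst[of _ Pw, folded Palg_L] and Palg_0 [simp] = L_0[of Pw, folded Palg_L]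

lemma Palg_star: "f \<in> Palg \<Longrightarrow> star f \<in> Palg"
proof -
  assume f: "f \<in> Palg"
  have "ky (star f) \<subseteq> Pw"
  proof
    fix n assume "n \<in> ky (star f)"
    then have "- n \<in> ky f" by (auto simp: in_keys_iff)
    then show "n \<in> Pw" using f Pw_uminus[of "- n"] by (auto simp: Palg_def)
  qed
  then show ?thesis by (simp add: Palg_def)
qed

lemma cst_mult: "cst (a * b) = cst a * cst b" by (simp add: cst_def mult_single)
lemma cst_add: "cst (a + b) = cst a + cst b" by (simp add: cst_def single_add)
lemma cst_diff: "cst (a - b) = cst a - cst b" by (simp add: cst_def single_diff)
lemma cst_uminus: "cst (- b) = - cst b" by (simp add: cst_def single_uminus)
lemma cst_0 [simp]: "cst 0 = 0" by (simp add: cst_def)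
lemma cst_1 [simp]: "cst 1 = 1" by (simp add: cst_def)
lemma cst_power: "cst (a ^ n) = cst a ^ n" by (induction n) (auto simp: cst_mult)
lemma lookup_cst_mult [simp]: "lk (cst c * f) n = c * lk f n" by (simp add: cst_def)
lemma star_cst [simp]: "star (cst c) = cst (sigma c)" by (simp add: cst_def)
lemma bar_cst [simp]: "bar (cst c) = cst c" by (simp add: cst_def)
lemma cst_Xm: "cst c * Xm n = sg n c" by (simp add: cst_def Xm_def mult_single)
lemma cst_single: "cst c * sg n d = sg n (c * d)" by (simp add: cst_def mult_single)

text \<open>The affine weights for which the required powers of q are exact, so that
  \<open>Xh\<close> is multiplicative and compatible with the group action.\<close>

definition PH :: "('v \<times> real) set" where "PH = {p. fst p \<in> Pw \<and> mz (snd p)}"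

lemma PH_add: "p \<in> PH \<Longrightarrow> p' \<in> PH \<Longrightarrow> p + p' \<in> PH" by (auto simp: PH_def Pw_add mz_add)
lemma PH_uminus: "p \<in> PH \<Longrightarrow> - p \<in> PH" by (auto simp: PH_def Pw_uminus)
lemma PH_diff: "p \<in> PH \<Longrightarrow> p' \<in> PH \<Longrightarrow> p - p' \<in> PH" using PH_add[of p "- p'"] PH_uminus by simp
lemma PH_scale: "c \<in> \<int> \<Longrightarrow> p \<in> PH \<Longrightarrow> c *\<^sub>R p \<in> PH" by (auto simp: PH_def Pw_scale mz_times)
lemma PH_Pw: "n \<in> Pw \<Longrightarrow> (n, 0) \<in> PH" by (simp add: PH_def)
lemma PH_Rhat: "b \<in> Rhat \<Longrightarrow> b \<in> PH" by (auto simp: PH_def Rhat_def R_Pw mz_Ints)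
lemma PH_tW: assumes "g \<in> tW" "p \<in> PH" shows "g p \<in> PH"
  by (rule tW_E[OF assms(1)]) (use assms in \<open>auto simp: PH_def Wg_Pw mz_pair intro: mz_diff\<close>)

lemma Xh_add: "p \<in> PH \<Longrightarrow> Xh (p + p') = Xh p * Xh p'"
  using qpow_add[of "- 2 * snd p" "- 2 * snd p'"] mz_times[of "-2" "snd p"]
  by (simp add: Xh_def PH_def mult_single algebra_simps)
lemma Xh_0 [simp]: "Xh (n, 0) = Xm n" by (simp add: Xh_def Xm_def)
lemma Xh_zero [simp]: "Xh 0 = 1" by (simp add: Xh_def)
lemma Xh_inv: "p \<in> PH \<Longrightarrow> Xh (- p) * Xh p = 1"
  using Xh_add[of "- p" p] PH_uminus by simp
lemma Xh_Palg: "p \<in> PH \<Longrightarrow> Xh p \<in> Palg" by (simp add: Xh_def PH_def Palg_single)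
lemma Xm_Palg: "n \<in> Pw \<Longrightarrow> Xm n \<in> Palg" by (simp add: Xm_def Palg_single)
lemma star_Xh: assumes "p \<in> PH" shows "star (Xh p) = Xh (- p)"
proof -
  have "mz (2 * snd p)" using assms by (auto simp: PH_def intro: mz_times)
  then show ?thesis using sigma_qpow[of "2 * snd p"] sigma_qpow[of "- (2 * snd p)"] by (simp add: Xh_def)
qed

lemma act_ext: "act g = ext (\<lambda>n. Xh (g (n, 0)))"
  by (auto simp: act_def ext_def cst_def)
lemma act_add: "act g (f + f') = act g f + act g f'" by (simp add: act_ext ext_add)
lemma act_diff: "act g (f - f') = act g f - act g f'" by (simp add: act_ext ext_diff)
lemma act_uminus: "act g (- f) = - act g f" by (simp add: act_ext ext_uminus)
lemma act_0 [simp]: "act g 0 = 0" by (simp add: act_ext)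
lemma act_sum: "act g (sum f I) = (\<Sum>i\<in>I. act g (f i))" by (simp add: act_ext ext_sum)
lemma act_cmul: "act g (cst c * f) = cst c * act g f" by (simp add: act_ext ext_cmul cst_def)
lemma act_single: "act g (sg n c) = cst c * Xh (g (n, 0))" by (simp add: act_ext ext_single cst_def)
lemma act_Xm: "act g (Xm n) = Xh (g (n, 0))" by (simp add: Xm_def act_single)

lemma tW_split: "g \<in> tW \<Longrightarrow> g (n, c) = g (n, 0) + (0, c)"
  using tW_add[of g "(n, 0)" "(0, c)"] tW_delta[of g c] by simp

lemma act_Xh: assumes "g \<in> tW" "p \<in> PH" shows "act g (Xh p) = Xh (g p)"
proof -
  obtain n c where p: "p = (n, c)" by (cases p)
  have "(0, c) \<in> PH" using assms p by (auto simp: PH_def)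
  then have "Xh (g p) = Xh (0, c) * Xh (g (n, 0))"
    unfolding p tW_split[OF assms(1), of n c] by (subst add.commute) (rule Xh_add)
  moreover have "Xh (0, c) = cst (qpow (- 2 * c))" by (simp add: Xh_def cst_def)
  moreover have "act g (Xh p) = cst (qpow (- 2 * c)) * Xh (g (n, 0))"
    unfolding p using act_single[of g n "qpow (- 2 * c)"] by (simp add: Xh_def[of "(n, c)"])
  ultimately show ?thesis by simp
qed

lemma act_Palg: assumes "g \<in> tW" "f \<in> Palg" shows "act g f \<in> Palg"
proof -
  have "ky (act g f) \<subseteq> (\<Union>a\<in>ky f. ky (Xh (g (a, 0))))" unfolding act_ext by (rule keys_ext)
  moreover have "ky (Xh (g (a, 0))) \<subseteq> Pw" if "a \<in> ky f" for a
    using Xh_Palg[OF PH_tW[OF assms(1) PH_Pw]] that assms by (auto simp: Palg_def)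
  ultimately show ?thesis unfolding Palg_def by blast
qed

lemma act_mult: assumes "g \<in> tW" "f \<in> Palg" "f' \<in> Palg" shows "act g (f * f') = act g f * act g f'"
  unfolding act_ext
proof (rule ext_mult)
  fix a b assume "a \<in> ky f" "b \<in> ky f'"
  then have "(a, 0) \<in> PH" using assms by (auto simp: PH_def Palg_def)
  then show "Xh (g (a + b, 0)) = Xh (g (a, 0)) * Xh (g (b, 0))"
    using tW_add[OF assms(1), of "(a, 0)" "(b, 0)"] Xh_add[OF PH_tW[OF assms(1)]] by simp
qed

lemma act_cst [simp]: "g \<in> tW \<Longrightarrow> act g (cst c) = cst c"
  using tW_delta[of g 0] by (simp add: cst_def act_single mult_single Xm_def)
lemma act_1 [simp]: "g \<in> tW \<Longrightarrow> act g 1 = 1" using act_cst[of g 1] by simp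

lemma Palg_induct [consumes 1, case_names zero single add]:
  assumes "f \<in> Palg" "P 0" "\<And>n c. n \<in> Pw \<Longrightarrow> P (sg n c)"
    "\<And>f g. f \<in> Palg \<Longrightarrow> g \<in> Palg \<Longrightarrow> P f \<Longrightarrow> P g \<Longrightarrow> P (f + g)"
  shows "P f"
  using pm_induct_on[of f Pw P] assms by (auto simp: Palg_def)

lemma act_comp: assumes "g \<in> tW" "h \<in> tW" "f \<in> Palg" shows "act g (act h f) = act (g \<circ> h) f"
  using assms(3)
proof (induction f rule: Palg_induct)
  case (single n c)
  then show ?case using act_Xh[OF assms(1) PH_tW[OF assms(2) PH_Pw]] by (simp add: act_single act_cmul)
qed (auto simp: act_add)

lemma act_id: "f \<in> Palg \<Longrightarrow> act id f = f"
  by (induction f rule: Palg_induct) (auto simp: act_add act_single cst_Xm)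

lemma act_star: assumes "g \<in> tW" "f \<in> Palg" shows "act g (star f) = star (act g f)"
  using assms(2)
proof (induction f rule: Palg_induct)
  case (single n c)
  have "g (- n, 0) = - g (n, 0)" using tW_uminus[OF assms(1), of "(n, 0)"] by simp
  then show ?case using star_Xh[OF PH_tW[OF assms(1) PH_Pw[OF single]]]
    by (simp add: act_single star_mult)
qed (auto simp: act_add star_add)

text \<open>The finite part sends only the exponent 0 to 0, and a translation multiplies X^0 by
  q^0.\<close>

lemma CT_act: assumes "g \<in> tW" shows "lk (act g f) 0 = lk f 0"
proof (rule tW_E[OF assms])
  fix w l assume w: "w \<in> Wg" and g: "\<And>x. g x = (w (fst x), snd x - l \<bullet> fst x)"
  have "ky f \<subseteq> UNIV" by simp
  then show ?thesis
  proof (induction f rule: pm_induct_on)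
    case (single n c)
    have "w n = 0 \<longleftrightarrow> n = 0" using Wg_eq_iff[OF w, of n 0] w by simp
    then show ?case by (auto simp: act_single g Xh_def cst_single lookup_single when_def)
  qed (auto simp: act_add lookup_add)
qed

abbreviation wact :: "('v \<Rightarrow> 'v) \<Rightarrow> ('v \<Rightarrow>\<^sub>0 K) \<Rightarrow> ('v \<Rightarrow>\<^sub>0 K)" where "wact w \<equiv> act (wlin w)"

lemma wact_single [simp]: "wact w (sg n c) = sg (w n) c"
  by (simp add: act_single wlin_def cst_Xm)

text \<open>The linear action introduces no powers of q, so in contrast to \<open>act_mult\<close>
  it is multiplicative on all finitely supported functions on the vector space. Later products with
  half-roots as exponents rely on this.\<close>

lemma wact_mult: assumes "w \<in> Wg" shows "wact w (f * f') = wact w f * wact w f'"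
  unfolding act_ext
  by (rule ext_mult) (simp add: wlin_def Wg_add[OF assms] Xm_def mult_single)

lemma wact_prod: "w \<in> Wg \<Longrightarrow> wact w (prod f I) = (\<Prod>i\<in>I. wact w (f i))"
  by (induction I rule: infinite_finite_induct) (auto simp: wact_mult wlin_tW)

lemma wact_comp: "wact w (wact w' f) = wact (w \<circ> w') f"
proof -
  have "ky f \<subseteq> UNIV" by simp
  then show ?thesis by (induction f rule: pm_induct_on) (auto simp: act_add)
qed

lemma wact_id [simp]: "wact id f = f"
proof -
  have "ky f \<subseteq> UNIV" by simp
  then show ?thesis by (induction f rule: pm_induct_on) (auto simp: act_add)
qed

lemma lookup_wact: assumes "w \<in> Wg" shows "lk (wact w f) (w n) = lk f n"
proof -
  have "ky f \<subseteq> UNIV" by simp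
  then show ?thesis
    by (induction f rule: pm_induct_on) (use Wg_eq_iff[OF assms] in \<open>auto simp: act_add lookup_add lookup_single when_def\<close>)
qed

lemma wact_csig: "wact w (csig f) = csig (wact w f)"
proof -
  have "ky f \<subseteq> UNIV" by simp
  then show ?thesis by (induction f rule: pm_induct_on) (auto simp: act_add csig_add)
qed

lemma wact_bar: assumes "w \<in> Wg" shows "wact w (bar f) = bar (wact w f)"
proof -
  have "ky f \<subseteq> UNIV" by simp
  then show ?thesis by (induction f rule: pm_induct_on) (auto simp: act_add bar_add Wg_uminus[OF assms])
qed

lemma wact_inv: "w \<in> Wg \<Longrightarrow> wact w (wact (inv w) f) = f" "w \<in> Wg \<Longrightarrow> wact (inv w) (wact w f) = f"
  by (simp_all add: wact_comp Wg_bij bij_is_surj bij_is_inj flip: surj_iff inj_iff)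
     (simp_all add: surj_iff[THEN iffD1] inj_iff[THEN iffD1] Wg_bij bij_is_surj bij_is_inj)

subsection \<open>Demazure--Lusztig operators\<close>

text \<open>\<open>Nop b f\<close> is the divided difference \<open>(f - s\<^sub>b f) / (X\<^sup>b - 1)\<close>, given on monomials by a geometric sum.\<close>
definition Nmono :: "'v \<times> real \<Rightarrow> 'v \<Rightarrow> ('v \<Rightarrow>\<^sub>0 K)" where
  "Nmono b n = (let e = \<lfloor>n \<bullet> coroot (fst b)\<rfloor> in
     if e > 0 then (\<Sum>j\<in>{1..e}. Xh ((n, 0) - of_int j *\<^sub>R b))
     else - (\<Sum>j\<in>{e + 1..0}. Xh ((n, 0) - of_int j *\<^sub>R b)))"

definition Nop :: "'v \<times> real \<Rightarrow> ('v \<Rightarrow>\<^sub>0 K) \<Rightarrow> ('v \<Rightarrow>\<^sub>0 K)" where "Nop b = ext (Nmono b)"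

definition srefl :: "'v \<times> real \<Rightarrow> 'v \<times> real \<Rightarrow> 'v \<times> real" where
  "srefl b x = x - (fst x \<bullet> coroot (fst b)) *\<^sub>R b"

lemma sa_srefl: "i \<in> Idx \<Longrightarrow> sa i = srefl (aroot i)" by (rule ext) (simp add: sa_eq srefl_def)

lemma PH_string: "n \<in> Pw \<Longrightarrow> b \<in> Rhat \<Longrightarrow> (n, 0) - of_int j *\<^sub>R b \<in> PH"
  by (intro PH_diff PH_scale PH_Pw PH_Rhat) auto

lemma Nmono_eq: assumes "b \<in> Rhat" "n \<in> Pw" shows "(Xh b - 1) * Nmono b n = Xm n - Xh (srefl b (n, 0))"
proof -
  define F where "F j = Xh ((n, 0) - of_int j *\<^sub>R b)" for j :: int
  define e where "e = \<lfloor>n \<bullet> coroot (fst b)\<rfloor>"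
  have ei: "of_int e = n \<bullet> coroot (fst b)" using Pw_int[OF assms(2), of "fst b"] assms by (auto simp: e_def Rhat_def elim!: Ints_cases)
  have step: "(Xh b - 1) * F j = F (j - 1) - F j" for j
  proof -
    have "b + ((n, 0) - of_int j *\<^sub>R b) = (n, 0) - of_int (j - 1) *\<^sub>R b" by (simp add: algebra_simps)
    then have "Xh b * F j = F (j - 1)"
      using Xh_add[OF PH_Rhat[OF assms(1)], of "(n, 0) - of_int j *\<^sub>R b"] unfolding F_def by metis
    then show ?thesis by (simp add: left_diff_distrib)
  qed
  have "F 0 = Xm n" "F e = Xh (srefl b (n, 0))" by (auto simp: F_def srefl_def ei)
  moreover have "(Xh b - 1) * Nmono b n = F 0 - F e"
  proof (cases "e > 0")
    case True
    then have "(Xh b - 1) * Nmono b n = (\<Sum>j\<in>{1..e}. F (j - 1) - F j)"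
      by (simp add: Nmono_def Let_def sum_distrib_left step flip: e_def F_def)
    then show ?thesis using sum_telescope_int_pos[of e F] True by simp
  next
    case False
    then have "(Xh b - 1) * Nmono b n = - (\<Sum>j\<in>{e + 1..0}. F (j - 1) - F j)"
      by (simp add: Nmono_def Let_def sum_distrib_left step flip: e_def F_def)
    then show ?thesis using sum_telescope_int_neg[of e F] False by simp
  qed
  ultimately show ?thesis by simp
qed

lemma Nmono_Palg: "b \<in> Rhat \<Longrightarrow> n \<in> Pw \<Longrightarrow> Nmono b n \<in> Palg"
  unfolding Nmono_def Let_def by (auto intro!: Palg_uminus Palg_sum Xh_Palg PH_string)

lemma Nop_add: "Nop b (f + f') = Nop b f + Nop b f'" by (simp add: Nop_def ext_add)
lemma Nop_cmul: "Nop b (cst c * f) = cst c * Nop b f" by (simp add: Nop_def ext_cmul cst_def)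
lemma Nop_single: "Nop b (sg n c) = cst c * Nmono b n" by (simp add: Nop_def ext_single cst_def)
lemma Nop_0 [simp]: "Nop b 0 = 0" by (simp add: Nop_def)

lemma Nop_Palg: assumes "b \<in> Rhat" "f \<in> Palg" shows "Nop b f \<in> Palg"
  using assms(2) by (induction f rule: Palg_induct)
    (auto simp: Nop_add Nop_single intro: Palg_add Palg_cmul Nmono_Palg assms(1))

lemma Nop_eq: assumes "b \<in> Rhat" "f \<in> Palg" shows "(Xh b - 1) * Nop b f = f - act (srefl b) f"
  using assms(2)
proof (induction f rule: Palg_induct)
  case (single n c)
  have "(Xh b - 1) * Nop b (sg n c) = cst c * ((Xh b - 1) * Nmono b n)" by (simp add: Nop_single mult_ac)
  then show ?case using single by (simp add: Nmono_eq assms(1) act_single right_diff_distrib cst_Xm)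
qed (auto simp: Nop_add act_add distrib_left)

text \<open>\<open>T\<^sub>i = s\<^sub>i G\<^sub>i\<close>, and in a product of \<open>T\<^sub>i\<close>'s the reflections can be moved to the left,
  which leaves a product of triangular operators \<open>G\<^sub>b\<close> for affine roots \<open>b\<close>.\<close>
definition Gt :: "nat \<Rightarrow> 'v \<times> real \<Rightarrow> ('v \<Rightarrow>\<^sub>0 K) \<Rightarrow> ('v \<Rightarrow>\<^sub>0 K)" where
  "Gt k b f = cst (qpow (real k)) * f + cst (qpow (real k) - qpow (- real k)) * Nop b f"

lemma Xh_cancel: assumes "b \<in> Rhat" "(Xh b - 1) * f = (Xh b - 1) * g" shows "f = g"
proof (rule binomial_cancel)
  show "(sg (fst b) (qpow (- 2 * snd b)) + sg 0 (-1)) * f = (sg (fst b) (qpow (- 2 * snd b)) + sg 0 (-1)) * g"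
    using assms(2) by (simp add: Xh_def single_uminus)
  show "fst b \<noteq> 0" using assms by (auto simp: Rhat_def)
qed simp

lemma aroot_Rhat: "i \<in> Idx \<Longrightarrow> aroot i \<in> Rhat" using aroot_pos by (simp add: Rhat_pos_iff)

text \<open>The quotient described by \<open>THE\<close> in \<open>Top\<close>, constructed here by
  reflecting the divided difference.\<close>

definition Pop :: "'v option \<Rightarrow> ('v \<Rightarrow>\<^sub>0 K) \<Rightarrow> ('v \<Rightarrow>\<^sub>0 K)" where "Pop i f = act (sa i) (Nop (aroot i) f)"

lemma Pop_Palg: "i \<in> Idx \<Longrightarrow> f \<in> Palg \<Longrightarrow> Pop i f \<in> Palg"
  by (simp add: Pop_def act_Palg sa_tW Nop_Palg aroot_Rhat)

lemma Pop_eq: assumes "i \<in> Idx" "f \<in> Palg" shows "(Xh (- aroot i) - 1) * Pop i f = act (sa i) f - f"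
proof -
  have "act (sa i) ((Xh (aroot i) - 1) * Nop (aroot i) f) = act (sa i) (f - act (sa i) f)"
    using Nop_eq[OF aroot_Rhat[OF assms(1)] assms(2)] sa_srefl[OF assms(1)] by simp
  moreover have "act (sa i) (act (sa i) f) = f"
  proof -
    have "sa i \<circ> sa i = id" using sa_sa assms by (simp add: fun_eq_iff)
    then show ?thesis using act_comp[of "sa i" "sa i" f] sa_tW assms by (simp add: act_id)
  qed
  ultimately show ?thesis using assms
    by (simp add: act_mult act_diff sa_tW Palg_diff Xh_Palg PH_Rhat aroot_Rhat Nop_Palg act_Xh sa_aroot Pop_def)
qed

lemma Top_eq: assumes "i \<in> Idx" "f \<in> Palg"
  shows "Top k i f = cst (qpow (real k)) * act (sa i) f + cst (qpow (real k) - qpow (- real k)) * Pop i f"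
proof -
  have e: "Xh (- fst (aroot i), - snd (aroot i)) = Xh (- aroot i)" by (simp add: Xh_def)
  have "(THE g. g \<in> Palg \<and> (Xh (- aroot i) - 1) * g = act (sa i) f - f) = Pop i f"
  proof (rule the_equality)
    fix g assume "g \<in> Palg \<and> (Xh (- aroot i) - 1) * g = act (sa i) f - f"
    then show "g = Pop i f" using Xh_cancel[of "- aroot i" g "Pop i f"] Pop_eq[OF assms] aroot_Rhat[OF assms(1)] Rhat_uminus by auto
  qed (use Pop_eq[OF assms] Pop_Palg[OF assms] in auto)
  then show ?thesis unfolding Top_def e by simp
qed

lemma Top_Gt: assumes "i \<in> Idx" "f \<in> Palg" shows "Top k i f = act (sa i) (Gt k (aroot i) f)"
  using assms by (simp add: Top_eq Gt_def act_add act_cmul Pop_def)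

lemma Gt_Palg: "b \<in> Rhat \<Longrightarrow> f \<in> Palg \<Longrightarrow> Gt k b f \<in> Palg"
  by (simp add: Gt_def Palg_add Palg_cmul Nop_Palg)

text \<open>Conjugation preserves the pairing that bounds the geometric sum; the translation part of
  \<open>g\<close> contributes only a common power of q, which factors out of the whole
  string.\<close>

lemma Nop_conj: assumes "g \<in> tW" "b \<in> Rhat" "f \<in> Palg" shows "act g (Nop b f) = Nop (g b) (act g f)"
  using assms(3)
proof (induction f rule: Palg_induct)
  case (single n c)
  obtain w l where w: "w \<in> Wg" "l \<in> Pcw" and g: "\<And>x. g x = (w (fst x), snd x - l \<bullet> fst x)" using tW_E[OF assms(1)] by blast
  define n' c' where "n' = fst (g (n, 0))" and "c' = snd (g (n, 0))"
  have gn: "g (n, 0) = (n', 0) + (0, c')" by (simp add: n'_def c'_def)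
  have c'PH: "(0, c') \<in> PH" using PH_tW[OF assms(1) PH_Pw[OF single]] by (auto simp: PH_def c'_def)
  have e: "n' \<bullet> coroot (fst (g b)) = n \<bullet> coroot (fst b)" by (simp add: n'_def g Wg_coroot[OF w(1)] Wg_inner[OF w(1)])
  have s: "act g (Xh ((n, 0) - of_int j *\<^sub>R b)) = Xh (0, c') * Xh ((n', 0) - of_int j *\<^sub>R g b)" for j
  proof -
    have "act g (Xh ((n, 0) - of_int j *\<^sub>R b)) = Xh (g (n, 0) - of_int j *\<^sub>R g b)"
      by (simp add: act_Xh[OF assms(1) PH_string[OF single assms(2)]] tW_diff[OF assms(1)] tW_scale[OF assms(1)])
    also have "g (n, 0) - of_int j *\<^sub>R g b = (0, c') + ((n', 0) - of_int j *\<^sub>R g b)" by (simp add: gn)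
    finally show ?thesis using Xh_add[OF c'PH] by simp
  qed
  have "act g (Nmono b n) = Xh (0, c') * Nmono (g b) n'"
    unfolding Nmono_def Let_def e by (simp add: act_sum act_uminus s sum_distrib_left)
  moreover have "act g (sg n c) = sg n' (c * qpow (-2 * c'))"
    by (simp add: act_single Xh_def n'_def c'_def cst_single)
  ultimately show ?case by (simp add: Nop_single act_cmul cst_mult Xh_def mult_ac) (simp add: cst_def)
qed (auto simp: Nop_add act_add)

lemma Gt_conj: "g \<in> tW \<Longrightarrow> b \<in> Rhat \<Longrightarrow> f \<in> Palg \<Longrightarrow> act g (Gt k b f) = Gt k (g b) (act g f)"
  by (simp add: Gt_def act_add act_cmul Nop_conj)

text \<open>With \<open>P = (s f - f) / (X\<^sup>-\<^sup>\<alpha> - 1)\<close> both \<open>s f\<close> and \<open>T f\<close> become polynomial expressions.\<close>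
lemma act_sa_Pop: assumes "i \<in> Idx" "f \<in> Palg"
  shows "act (sa i) f = f + (Xh (- aroot i) - 1) * Pop i f"
    and "act (sa i) (Pop i f) = Xh (- aroot i) * Pop i f"
    and "Top k i f = cst (qpow (real k)) * f + (cst (qpow (real k)) * Xh (- aroot i) - cst (qpow (- real k))) * Pop i f"
proof -
  let ?x = "Xh (- aroot i)" and ?y = "Xh (aroot i)" and ?s = "act (sa i)"
  note tW = sa_tW[OF assms(1)] and ar = aroot_Rhat[OF assms(1)]
  have nar: "- aroot i \<in> Rhat" using ar Rhat_uminus by blast
  have xy: "?x * ?y = 1" using Xh_inv[OF PH_Rhat[OF ar]] .
  show e1: "?s f = f + (?x - 1) * Pop i f" using Pop_eq[OF assms] by simp
  have ss: "?s (?s f) = f"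
  proof -
    have "sa i \<circ> sa i = id" using sa_sa assms by (simp add: fun_eq_iff)
    then show ?thesis using act_comp[of "sa i" "sa i" f] tW assms by (simp add: act_id)
  qed
  have sx: "?s ?x = ?y" using act_Xh[OF tW PH_Rhat[OF nar]] by (simp add: tW_uminus[OF tW] sa_aroot assms)
  have "f = ?s f + (?y - 1) * ?s (Pop i f)"
    using arg_cong[OF e1, of ?s] ss sx
    by (simp add: act_add act_mult tW Palg_diff Xh_Palg PH_Rhat nar Pop_Palg assms act_diff)
  then have "(?y - 1) * ?s (Pop i f) = - (?x - 1) * Pop i f" using e1 by (simp add: algebra_simps)
  then have "(?x - 1) * ?s (Pop i f) = (?x - 1) * (?x * Pop i f)"
    by (rule demazure_lusztig_quotient[OF xy mult_1_left[of 1]])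
  then show "?s (Pop i f) = ?x * Pop i f" using Xh_cancel[OF nar] by blast
  show "Top k i f = cst (qpow (real k)) * f + (cst (qpow (real k)) * ?x - cst (qpow (- real k))) * Pop i f"
    unfolding Top_eq[OF assms] e1 cst_diff by (simp add: algebra_simps)
qed

lemma Top_Palg: "i \<in> Idx \<Longrightarrow> f \<in> Palg \<Longrightarrow> Top k i f \<in> Palg"
  by (simp add: Top_Gt act_Palg sa_tW Gt_Palg aroot_Rhat)

lemma t_ti: "cst (qpow (real k)) * cst (qpow (- real k)) = 1"
  by (simp add: qpow_uminus flip: cst_mult)

lemma Top_add: "i \<in> Idx \<Longrightarrow> f \<in> Palg \<Longrightarrow> g \<in> Palg \<Longrightarrow> Top k i (f + g) = Top k i f + Top k i g"
  by (simp add: Top_Gt Palg_add Gt_def Nop_add act_add distrib_left)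
lemma Top_cmul: "i \<in> Idx \<Longrightarrow> f \<in> Palg \<Longrightarrow> Top k i (cst c * f) = cst c * Top k i f"
proof -
  assume a: "i \<in> Idx" "f \<in> Palg"
  have "Gt k b (cst c * f) = cst c * Gt k b f" for b
    by (simp add: Gt_def Nop_cmul distrib_left mult.left_commute)
  then show ?thesis using a by (simp add: Top_Gt Palg_cmul act_cmul)
qed

lemma Pop_unique: assumes "i \<in> Idx" "f \<in> Palg" "(Xh (- aroot i) - 1) * g = act (sa i) f - f" shows "g = Pop i f"
  using Xh_cancel[of "- aroot i" g "Pop i f"] Pop_eq[OF assms(1,2)] assms aroot_Rhat[OF assms(1)] Rhat_uminus by auto

lemma Top_quadratic: assumes "i \<in> Idx" "f \<in> Palg"
  shows "Top k i (Top k i f) = f + cst (qpow (real k) - qpow (- real k)) * Top k i f"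
proof -
  let ?x = "Xh (- aroot i)" and ?y = "Xh (aroot i)" and ?s = "act (sa i)" and ?P = "Pop i f"
  let ?t = "cst (qpow (real k))" and ?ti = "cst (qpow (- real k))"
  note tW = sa_tW[OF assms(1)] and ar = aroot_Rhat[OF assms(1)]
  have nar: "- aroot i \<in> Rhat" using ar Rhat_uminus by blast
  have xP: "?x \<in> Palg" by (simp add: Xh_Palg PH_Rhat nar)
  have xy: "?x * ?y = 1" using Xh_inv[OF PH_Rhat[OF ar]] .
  have sx: "?s ?x = ?y" using act_Xh[OF tW PH_Rhat[OF nar]] by (simp add: tW_uminus[OF tW] sa_aroot assms)
  note TP = act_sa_Pop[OF assms]
  have PP: "?P \<in> Palg" using Pop_Palg[OF assms] .
  have h: "Top k i f = ?t * f + (?t * ?x - ?ti) * ?P" by (rule TP(3))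
  have sh: "?s (Top k i f) = ?t * (f + (?x - 1) * ?P) + (?t * ?y - ?ti) * (?x * ?P)"
    unfolding h by (simp add: act_add act_mult act_diff tW Palg_diff Palg_mult xP PP TP(1,2) sx assms)
  \<comment> \<open>The quotient attached to T f is -t^-1 times that of f; substituting it into the
    formula for T gives the quadratic relation.\<close>
  have "(- ?ti) * ?P = Pop i (Top k i f)"
  proof (rule Pop_unique[OF assms(1) Top_Palg[OF assms]])
    show "(?x - 1) * ((- ?ti) * ?P) = ?s (Top k i f) - Top k i f"
      unfolding sh unfolding h by (rule demazure_lusztig_quadratic1[OF xy t_ti])
  qed
  then have "Top k i (Top k i f) = ?t * (Top k i f) + (?t * ?x - ?ti) * ((- ?ti) * ?P)"
    using act_sa_Pop(3)[OF assms(1) Top_Palg[OF assms], of k k] by simp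
  then show ?thesis unfolding h cst_diff demazure_lusztig_quadratic2[OF xy t_ti] .
qed

subsection \<open>The weight function and Cherednik's inner product\<close>

text \<open>Cherednik's weight is the product of (1 - X^-b)/(1 - t^2 X^-b) over the positive affine
  roots. Since t^2 X^-b is X^-(b + k delta), the denominators cancel all numerators except those of
  the roots collected here.\<close>

definition Dk :: "nat \<Rightarrow> ('v \<times> real) set" where
  "Dk k = {b \<in> Rhat_pos. b - (0, real k) \<notin> Rhat_pos}"

definition mu :: "nat \<Rightarrow> ('v \<Rightarrow>\<^sub>0 K)" where "mu k = (\<Prod>b\<in>Dk k. 1 - Xh (- b))"

lemma Rhat_shift: "b \<in> Rhat \<Longrightarrow> b - (0, real k) \<in> Rhat" by (auto simp: Rhat_def)

lemma Dk_iff: "b \<in> Dk k \<longleftrightarrow> b \<in> Rhat \<and> (fst b \<in> Rp \<and> 0 \<le> snd b \<and> snd b < real k \<or> - fst b \<in> Rp \<and> 0 < snd b \<and> snd b \<le> real k)"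
  using R_cases[of "fst b"] Rp_uminus[of "fst b"] unfolding Dk_def mem_Collect_eq Rhat_pos_iff
  by (auto simp: Rhat_def)

lemma finite_Dk: "finite (Dk k)"
proof -
  have "Dk k \<subseteq> (\<Union>a\<in>R. (\<lambda>c. (a, real_of_int c)) ` {0..int k})"
  proof
    fix x assume "x \<in> Dk k"
    then have x: "fst x \<in> R" "snd x \<in> \<int>" "snd x \<ge> 0" "snd x \<le> real k"
      by (auto simp: Dk_iff Rhat_def)
    then obtain c where c: "snd x = of_int c" by (auto elim!: Ints_cases)
    then have "c \<in> {0..int k}" using x by auto
    then show "x \<in> (\<Union>a\<in>R. (\<lambda>c. (a, real_of_int c)) ` {0..int k})"
      using x c by (intro UN_I[of "fst x"] image_eqI[of _ _ c]) (auto simp: prod_eq_iff)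
  qed
  then show ?thesis by (rule finite_subset) (use finR in auto)
qed

lemma Dk_Rhat: "b \<in> Dk k \<Longrightarrow> b \<in> Rhat" by (simp add: Dk_iff)

lemma mu_factor_Palg: "b \<in> Rhat \<Longrightarrow> 1 - Xh (- b) \<in> Palg"
  using Rhat_uminus[of b] by (intro Palg_diff Xh_Palg PH_Rhat) simp_all
lemma mu_Palg: "mu k \<in> Palg" unfolding mu_def by (intro Palg_prod mu_factor_Palg Dk_Rhat)

lemma act_factor: "g \<in> tW \<Longrightarrow> b \<in> Rhat \<Longrightarrow> act g (1 - Xh (- b)) = 1 - Xh (- g b)"
  using Rhat_uminus[of b] by (simp add: act_diff act_Xh PH_Rhat tW_uminus)

lemma act_prod: "g \<in> tW \<Longrightarrow> (\<And>i. i \<in> I \<Longrightarrow> f i \<in> Palg) \<Longrightarrow> act g (prod f I) = (\<Prod>i\<in>I. act g (f i))"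
  by (induction I rule: infinite_finite_induct) (auto simp: act_mult Palg_prod)

lemma act_mu_Omega: assumes "p \<in> Omega" shows "act p (mu k) = mu k"
proof -
  have p: "p \<in> tW" using Omega_tW assms by simp
  have img: "p ` Dk k = Dk k"
  proof (rule card_subset_eq[OF finite_Dk])
    show "p ` Dk k \<subseteq> Dk k"
    proof
      fix y assume "y \<in> p ` Dk k"
      then obtain b where b: "b \<in> Dk k" "y = p b" by blast
      have "p (b - (0, real k)) = p b - (0, real k)" by (simp add: tW_diff p tW_delta)
      moreover have "p (b - (0, real k)) \<notin> Rhat_pos"
        using b Omega_pos_iff[OF assms Rhat_shift[OF Dk_Rhat[OF b(1)]]] by (simp add: Dk_def)
      ultimately show "y \<in> Dk k" using b Omega_pos[OF assms] by (simp add: Dk_def)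
    qed
    show "card (p ` Dk k) = card (Dk k)" by (rule card_image) (meson bij_is_inj inj_on_subset subset_UNIV tW_bij[OF p])
  qed
  have "act p (mu k) = (\<Prod>b\<in>Dk k. 1 - Xh (- p b))"
    unfolding mu_def by (simp add: act_prod[OF p mu_factor_Palg[OF Dk_Rhat]] act_factor[OF p Dk_Rhat])
  also have "\<dots> = (\<Prod>b\<in>p ` Dk k. 1 - Xh (- b))"
    by (subst prod.reindex) (auto intro: inj_on_subset[OF bij_is_inj[OF tW_bij[OF p]]])
  finally show ?thesis unfolding img mu_def .
qed

text \<open>For k > 0 the reflection permutes \<open>Dk k\<close> except for the simple root a and k
  delta - a. Only the factors 1 - X^-a and 1 - t^2 X^a change, and their ratio is the stated
  cross-multiplied identity.\<close>

lemma act_mu_sa: assumes "i \<in> Idx"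
  shows "act (sa i) (mu k) * (cst (qpow (- real k)) * Xh (- aroot i) - cst (qpow (real k)))
    = mu k * (cst (qpow (real k)) * Xh (- aroot i) - cst (qpow (- real k)))"
proof (cases "k = 0")
  case True
  then have "Dk k = {}" by (auto simp: Dk_iff)
  then show ?thesis using True by (simp add: mu_def sa_tW assms)
next
  case False
  let ?a = "aroot i" let ?b = "(0, real k) - aroot i"
  note tW = sa_tW[OF assms] and ar = aroot_Rhat[OF assms] and ap = aroot_pos[OF assms]
  have nar: "- ?a \<in> Rhat" using ar Rhat_uminus by blast
  have bR: "?b \<in> Rhat" using nar by (auto simp: Rhat_def)
  have nb: "- ?a \<notin> Rhat_pos" using ap Rhat_pos_neg Rhat_neg_uminus by auto
  have na: "?a - (0, real k) \<notin> Rhat_pos"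
  proof (cases i)
    case None
    have "- theta \<notin> Rp" using theta_Rp Rp_uminus by blast
    then show ?thesis using False None by (auto simp: aroot_def Rhat_pos_iff)
  qed (use False in \<open>auto simp: aroot_def Rhat_pos_iff\<close>)
  have aD: "?a \<in> Dk k" using ap na by (simp add: Dk_def)
  have "- (?a - (0, real k)) \<in> Rhat_pos" using na Rhat_cases[OF Rhat_shift[OF ar, of k]] Rhat_neg_uminus by blast
  then have bD: "?b \<in> Dk k" using nb by (simp add: Dk_def)
  have ab: "?a \<noteq> ?b"
  proof
    assume "?a = ?b"
    then have "fst ?a = - fst ?a" by (metis diff_0 fst_conv fst_diff)
    then have "2 *\<^sub>R fst ?a = 0" unfolding scaleR_2 by (metis add.right_inverse)
    then show False using aroot_R[OF assms] by auto
  qed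
  define D' where "D' = Dk k - {?a, ?b}"
  have Deq: "Dk k = insert ?a (insert ?b D')" using aD bD by (auto simp: D'_def)
  have fD': "finite D'" by (simp add: D'_def finite_Dk)
  have sb: "sa i ?b = (0, real k) + ?a" by (simp add: tW_diff tW tW_delta sa_aroot assms)
  have sub: "sa i x \<in> D'" if x: "x \<in> D'" for x
  proof -
    have xp: "x \<in> Rhat_pos" "x - (0, real k) \<notin> Rhat_pos" "x \<noteq> ?a" "x \<noteq> ?b" using x by (auto simp: D'_def Dk_def)
    have xR: "x \<in> Rhat" using xp by (simp add: Rhat_pos_iff)
    have s1: "sa i x \<in> Rhat_pos" using sa_pos[OF assms xp(1,3)] .
    have xn: "x - (0, real k) \<in> Rhat_neg" using Rhat_cases[OF Rhat_shift[OF xR]] xp(2) by blast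
    have "x - (0, real k) \<noteq> - ?a" using xp(4) by (metis add_diff_cancel_left' diff_add_cancel diff_conv_add_uminus add.commute)
    then have "sa i (x - (0, real k)) \<in> Rhat_neg" using sa_neg[OF assms xn] by blast
    then have s2: "sa i x - (0, real k) \<notin> Rhat_pos" using Rhat_pos_neg by (simp add: tW_diff tW tW_delta) blast
    have s3: "sa i x \<noteq> ?a"
    proof
      assume "sa i x = ?a"
      then have "x = - ?a" using sa_sa[OF assms, of x] sa_aroot[OF assms] by simp
      then show False using xp nb by simp
    qed
    have s4: "sa i x \<noteq> ?b"
    proof
      assume "sa i x = ?b"
      then have "x = (0, real k) + ?a" using sa_sa[OF assms, of x] sb by simp
      then have "x - (0, real k) = ?a" by simp
      then show False using xp ap by simp
    qed
    show ?thesis using s1 s2 s3 s4 by (simp add: D'_def Dk_def)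
  qed
  have inj: "inj_on (sa i) A" for A by (metis inj_on_def sa_sa assms)
  have img: "sa i ` D' = D'" using sub by (intro card_subset_eq[OF fD'] card_image inj) auto
  define M where "M = (\<Prod>b\<in>D'. 1 - Xh (- b))"
  have D'R: "b \<in> Rhat" if "b \<in> D'" for b using that Dk_Rhat[of b k] by (simp add: D'_def)
  have MP: "M \<in> Palg" unfolding M_def by (intro Palg_prod mu_factor_Palg D'R)
  have sM: "act (sa i) M = M"
  proof -
    have "act (sa i) M = (\<Prod>b\<in>D'. 1 - Xh (- sa i b))"
      unfolding M_def by (simp add: act_prod[OF tW mu_factor_Palg[OF D'R]] act_factor[OF tW D'R])
    also have "\<dots> = (\<Prod>b\<in>sa i ` D'. 1 - Xh (- b))" by (simp add: prod.reindex[OF inj])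
    finally show ?thesis unfolding img M_def .
  qed
  let ?x = "Xh (- ?a)" and ?y = "Xh ?a" and ?t = "cst (qpow (real k))" and ?ti = "cst (qpow (- real k))"
  have kPH: "(0, - real k) \<in> PH" by (simp add: PH_def)
  have q2: "qpow (2 * real k) = qpow (real k) * qpow (real k)" unfolding mult_2 by (rule qpow_add) simp
  \<comment> \<open>Shifting an exponent by -k delta multiplies by q^(2k) = t^2, because X^delta is
    q^-2.\<close>
  have Xk: "Xh (0, - real k) = ?t * ?t"
    unfolding cst_mult[symmetric] q2[symmetric] by (simp add: Xh_def cst_def)
  have e1: "- ?b = (0, - real k) + ?a" "- (sa i ?b) = (0, - real k) + - ?a"
    unfolding sb by (simp_all add: prod_eq_iff)
  have X1: "Xh (- ?b) = ?t * ?t * ?y" "Xh (- (sa i ?b)) = ?t * ?t * ?x"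
    unfolding e1 Xh_add[OF kPH] Xk by (rule refl)+
  have mu: "mu k = (1 - ?x) * ((1 - ?t * ?t * ?y) * M)"
    unfolding mu_def Deq M_def using ab fD' X1(1) by (subst prod.insert; simp add: D'_def)+
  have smu: "act (sa i) (mu k) = (1 - ?y) * ((1 - ?t * ?t * ?x) * M)"
  proof -
    have P: "1 - ?t * ?t * ?y \<in> Palg" using mu_factor_Palg[OF bR] X1 by simp
    have "act (sa i) (1 - ?t * ?t * ?y) = 1 - ?t * ?t * ?x" using act_factor[OF tW bR] X1 by simp
    moreover have "act (sa i) (1 - ?x) = 1 - ?y" using act_factor[OF tW ar] by (simp add: sa_aroot assms)
    ultimately show ?thesis unfolding mu using P MP mu_factor_Palg[OF ar]
      by (simp add: act_mult tW Palg_mult sM)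
  qed
  have xy: "?x * ?y = 1" using Xh_inv[OF PH_Rhat[OF ar]] .
  show ?thesis unfolding smu unfolding mu by (rule weight_ratio[OF xy t_ti])
qed

definition form :: "nat \<Rightarrow> ('v \<Rightarrow>\<^sub>0 K) \<Rightarrow> ('v \<Rightarrow>\<^sub>0 K) \<Rightarrow> K" where
  "form k f g = lk (f * star g * mu k) 0"

lemma form_add_left: "form k (f + f') g = form k f g + form k f' g"
  by (simp add: form_def distrib_right lookup_add)
lemma form_add_right: "form k f (g + g') = form k f g + form k f g'"
  by (simp add: form_def star_add distrib_right distrib_left lookup_add)
lemma form_diff_left: "form k (f - f') g = form k f g - form k f' g"
  by (simp add: form_def left_diff_distrib lookup_minus)
lemma form_cmul_left: "form k (cst c * f) g = c * form k f g"
  by (simp add: form_def mult.assoc)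
lemma form_cmul_right: "form k f (cst c * g) = sigma c * form k f g"
proof -
  have "f * star (cst c * g) * mu k = cst (sigma c) * (f * star g * mu k)" by (simp add: star_mult mult_ac)
  then show ?thesis by (simp add: form_def)
qed
lemma form_0_left [simp]: "form k 0 g = 0" by (simp add: form_def)
lemma form_0_right [simp]: "form k f 0 = 0" by (simp add: form_def)

definition uni :: "nat \<Rightarrow> (('v \<Rightarrow>\<^sub>0 K) \<Rightarrow> ('v \<Rightarrow>\<^sub>0 K)) \<Rightarrow> bool" where
  "uni k F \<longleftrightarrow> (\<forall>f\<in>Palg. \<forall>g\<in>Palg. form k (F f) (F g) = form k f g)"

lemma uni_Omega: assumes "p \<in> Omega" shows "uni k (act p)"
  unfolding uni_def
proof (intro ballI)
  fix f g assume fg: "f \<in> Palg" "g \<in> Palg"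
  have p: "p \<in> tW" using Omega_tW assms by simp
  have "act p (f * star g * mu k) = act p f * star (act p g) * mu k"
    by (simp add: act_mult p fg Palg_star Palg_mult mu_Palg act_mu_Omega assms act_star)
  then show "form k (act p f) (act p g) = form k f g"
    using CT_act[OF p, of "f * star g * mu k"] by (simp add: form_def)
qed

text \<open>The integrand \<open>E\<close> measuring the defect of isometry satisfies E + s E = 0.
  The constant term is invariant under s, so twice it vanishes.\<close>

lemma uni_Top: assumes "i \<in> Idx" shows "uni k (Top k i)"
  unfolding uni_def
proof (intro ballI)
  fix f g assume fg: "f \<in> Palg" "g \<in> Palg"
  let ?x = "Xh (- aroot i)" and ?y = "Xh (aroot i)" and ?s = "act (sa i)"
  let ?t = "cst (qpow (real k))" and ?ti = "cst (qpow (- real k))"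
  let ?P = "Pop i f" and ?Q = "star (Pop i g)" and ?G = "star g"
  note tW = sa_tW[OF assms(1)] and ar = aroot_Rhat[OF assms(1)]
  have nar: "- aroot i \<in> Rhat" using ar Rhat_uminus by blast
  have xP: "?x \<in> Palg" "?y \<in> Palg" by (simp_all add: Xh_Palg PH_Rhat nar ar)
  have xy: "?x * ?y = 1" using Xh_inv[OF PH_Rhat[OF ar]] .
  have sx: "?s ?x = ?y" "?s ?y = ?x" using act_Xh[OF tW PH_Rhat[OF nar]] act_Xh[OF tW PH_Rhat[OF ar]]
    by (simp_all add: tW_uminus[OF tW] sa_aroot assms)
  have stx: "star ?x = ?y" using star_Xh[OF PH_Rhat[OF nar]] by simp
  have PP: "?P \<in> Palg" "?Q \<in> Palg" "?G \<in> Palg" using Pop_Palg assms fg Palg_star by auto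
  have h: "Top k i f = ?t * f + (?t * ?x - ?ti) * ?P" using act_sa_Pop(3)[OF assms fg(1)] .
  have e: "star (Top k i g) = ?ti * ?G + (?ti * ?y - ?t) * ?Q"
    unfolding act_sa_Pop(3)[OF assms fg(2)]
    using sigma_qpow[of "real k"] sigma_qpow[of "- real k"] by (simp add: star_add star_mult star_diff stx)
  have sG: "?s ?G = ?G + (?y - 1) * ?Q"
    using act_star[OF tW fg(2)] by (simp add: act_sa_Pop(1)[OF assms fg(2)] star_add star_mult star_diff stx)
  have sQ: "?s ?Q = ?y * ?Q"
    using act_star[OF tW Pop_Palg[OF assms fg(2)]] by (simp add: act_sa_Pop(2)[OF assms fg(2)] star_mult stx)
  define E where "E = (Top k i f * star (Top k i g) - f * ?G) * mu k"
  have sE: "?s E = ((?t * (f + (?x - 1) * ?P) + (?t * ?y - ?ti) * (?x * ?P)) * (?ti * (?G + (?y - 1) * ?Q) + (?ti * ?x - ?t) * (?y * ?Q))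
        - (f + (?x - 1) * ?P) * (?G + (?y - 1) * ?Q)) * ?s (mu k)"
    unfolding E_def h e
    by (simp add: act_add act_mult act_diff tW Palg_add Palg_diff Palg_mult xP PP fg mu_Palg
        act_sa_Pop(1,2)[OF assms fg(1)] sx sG sQ)
  have "E + ?s E = 0" unfolding sE unfolding E_def h e
    by (rule demazure_lusztig_antisymmetry[OF xy t_ti act_mu_sa[OF assms]])
  from arg_cong[OF this, of "\<lambda>f. lk f 0"] have "lk E 0 + lk (?s E) 0 = 0" unfolding lookup_add lookup_zero .
  then have "lk E 0 = 0" unfolding CT_act[OF tW] by (rule fract_double_zero)
  then show "form k (Top k i f) (Top k i g) = form k f g"
    by (simp add: form_def E_def left_diff_distrib lookup_minus)
qed

lemma zdiv_diff: "zdiv x \<Longrightarrow> zdiv y \<Longrightarrow> zdiv (x - y)"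
  using zdiv_add[OF _ zdiv_uminus, of x y] by simp
lemma integral_K_diff: "integral_K x \<Longrightarrow> integral_K y \<Longrightarrow> integral_K (x - y)"
  using integral_K_add[OF _ integral_K_uminus, of x y] by simp

text \<open>Modulo \<open>z\<close> only the factors \<open>1 - X\<^sup>-\<^sup>\<alpha>\<close>, \<open>\<alpha> > 0\<close>, of the weight survive.\<close>
definition zgood :: "('v \<Rightarrow>\<^sub>0 K) \<Rightarrow> bool" where
  "zgood f \<longleftrightarrow> (\<forall>n. integral_K (lk f n)) \<and> zdiv (lk f 0 - 1) \<and> (\<forall>n. - n \<notin> Qp \<longrightarrow> zdiv (lk f n))"

lemma zgood_mu: "zgood (mu k)"
proof -
  have 1: "zgood 1"
  proof -
    have "n \<noteq> 0" if "- n \<notin> Qp" for n :: 'v using that by auto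
    then show ?thesis by (auto simp: zgood_def lookup_one when_def)
  qed
  have step: "zgood ((1 - Xh (- b)) * f)" if f: "zgood f" and b: "b \<in> Rhat_pos" for f b
  proof -
    let ?q = "qpow (2 * snd b)"
    have lk: "lk ((1 - Xh (- b)) * f) n = lk f n - ?q * lk f (n + fst b)" for n
      by (simp add: left_diff_distrib lookup_minus Xh_def lookup_single_mult)
    have lk0: "lk ((1 - Xh (- b)) * f) 0 - 1 = (lk f 0 - 1) - ?q * lk f (0 + fst b)" unfolding lk by simp
    have bz: "mz (2 * snd b)" using b by (auto simp: Rhat_pos_iff Rhat_def intro!: mz_Ints)
    have fi: "integral_K (lk f n)" and f0: "zdiv (lk f 0 - 1)" and fn: "- n \<notin> Qp \<Longrightarrow> zdiv (lk f n)" for n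
      using f by (auto simp: zgood_def)
    have "zdiv ?q \<or> ?q = 1 \<and> fst b \<in> Rp" using zdiv_qpow[OF _ bz] b by (auto simp: Rhat_pos_iff)
    then show ?thesis
    proof
      assume q: "zdiv ?q"
      then have qn: "zdiv (?q * lk f n)" for n using fi by (intro zdiv_mult)
      show ?thesis unfolding zgood_def lk0 unfolding lk
        using zdiv_diff[OF f0 qn] integral_K_diff[OF fi zdiv_integral[OF qn]] zdiv_diff[OF fn qn] by blast
    next
      assume q: "?q = 1 \<and> fst b \<in> Rp"
      have nq: "- (n + fst b) \<notin> Qp" if "- n \<notin> Qp" for n
      proof
        assume "- (n + fst b) \<in> Qp"
        then have "- (n + fst b) + fst b \<in> Qp" using q by (intro Qp_add) (auto simp: Rp_iff)
        then show False using that by simp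
      qed
      have "- (0 + fst b) \<notin> Qp" using q Qp_antisym[of "fst b"] by (auto simp: Rp_iff)
      then show ?thesis unfolding zgood_def lk0 unfolding lk q[THEN conjunct1] mult_1
        using zdiv_diff[OF f0 fn] integral_K_diff[OF fi fi] zdiv_diff[OF fn fn] nq by blast
    qed
  qed
  have "zgood (\<Prod>b\<in>B. 1 - Xh (- b))" if "finite B" "B \<subseteq> Rhat_pos" for B
    using that by (induction B rule: finite_induct) (auto simp: 1 step)
  then show ?thesis unfolding mu_def using finite_Dk by (auto simp: Dk_def)
qed

text \<open>The test exponents are those of \<open>f\<close>, so the matrix is square: its entries
  are the coefficients of \<open>mu k\<close> at i - j, and modulo z it is unitriangular for the
  height.\<close>

lemma form_nondegenerate:
  assumes "\<And>n. n \<in> ky f \<Longrightarrow> form k f (Xm n) = 0" shows "f = 0"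
proof -
  have good: "zgood (mu k)" by (rule zgood_mu)
  have eq: "form k f (Xm n) = (\<Sum>j\<in>ky f. lk f j * lk (mu k) (n - j))" for n
  proof -
    have "form k f (Xm n) = (\<Sum>j\<in>ky f. lk f j * lk (sg (- n) 1 * mu k) (- j))"
      by (simp add: form_def Xm_def mult.assoc CT_mult)
    then show ?thesis by (simp add: lookup_single_mult)
  qed
  have "lk f j = 0" if j: "j \<in> ky f" for j
  proof (rule zadic_regular[where M = "\<lambda>i j. lk (mu k) (i - j)" and h = "\<lambda>i. htv \<bullet> i", OF finite_keys _ _ _ _ j])
    fix i j assume "i \<noteq> j" and nz: "\<not> zdiv (lk (mu k) (i - j))"
    then have "j - i \<in> Qp" using good unfolding zgood_def by (metis minus_diff_eq)
    then show "htv \<bullet> i < htv \<bullet> j" using htv_Qp_pos[of "j - i"] \<open>i \<noteq> j\<close> by (simp add: inner_diff_right)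
  qed (use good assms eq in \<open>auto simp: zgood_def\<close>)
  then show ?thesis by (intro poly_mapping_eqI) (auto simp: in_keys_iff)
qed

subsection \<open>Triangular operators\<close>

definition lop :: "(('v \<Rightarrow>\<^sub>0 K) \<Rightarrow> ('v \<Rightarrow>\<^sub>0 K)) \<Rightarrow> bool" where
  "lop F \<longleftrightarrow> (\<forall>f\<in>Palg. F f \<in> Palg) \<and> (\<forall>f\<in>Palg. \<forall>g\<in>Palg. F (f + g) = F f + F g)
    \<and> (\<forall>c. \<forall>f\<in>Palg. F (cst c * f) = cst c * F f)"

lemma lop_Palg: "lop F \<Longrightarrow> f \<in> Palg \<Longrightarrow> F f \<in> Palg" by (simp add: lop_def)
lemma lop_add: "lop F \<Longrightarrow> f \<in> Palg \<Longrightarrow> g \<in> Palg \<Longrightarrow> F (f + g) = F f + F g" by (simp add: lop_def)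
lemma lop_cmul: "lop F \<Longrightarrow> f \<in> Palg \<Longrightarrow> F (cst c * f) = cst c * F f" by (simp add: lop_def)
lemma lop_0: "lop F \<Longrightarrow> F 0 = 0" using lop_cmul[of F 0 0] by simp
lemma lop_uminus: "lop F \<Longrightarrow> f \<in> Palg \<Longrightarrow> F (- f) = - F f"
  using lop_cmul[of F f "-1"] by (simp add: cst_uminus)
lemma lop_diff: "lop F \<Longrightarrow> f \<in> Palg \<Longrightarrow> g \<in> Palg \<Longrightarrow> F (f - g) = F f - F g"
  using lop_add[of F f "- g"] by (simp add: lop_uminus Palg_uminus)
lemma lop_sum: "lop F \<Longrightarrow> (\<And>i. i \<in> I \<Longrightarrow> f i \<in> Palg) \<Longrightarrow> F (sum f I) = (\<Sum>i\<in>I. F (f i))"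
  by (induction I rule: infinite_finite_induct) (auto simp: lop_0 lop_add Palg_sum)

lemma lop_expand: assumes "lop F" "f \<in> Palg" shows "F f = (\<Sum>n\<in>ky f. cst (lk f n) * F (Xm n))"
proof -
  have n: "Xm n \<in> Palg" if "n \<in> ky f" for n by (rule Xm_Palg) (use assms(2) that in \<open>auto simp: Palg_def\<close>)
  have "f = (\<Sum>n\<in>ky f. cst (lk f n) * Xm n)" unfolding cst_Xm by (rule pm_decomp) auto
  then have "F f = F (\<Sum>n\<in>ky f. cst (lk f n) * Xm n)" by (rule arg_cong)
  also have "\<dots> = (\<Sum>n\<in>ky f. F (cst (lk f n) * Xm n))" by (rule lop_sum[OF assms(1)]) (simp add: Palg_cmul n)
  also have "\<dots> = (\<Sum>n\<in>ky f. cst (lk f n) * F (Xm n))" by (rule sum.cong) (simp_all add: lop_cmul assms(1) n)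
  finally show ?thesis .
qed

lemma lop_eqI: assumes "lop F" "lop F'" "Z \<subseteq> Pw" "\<And>n. n \<in> Z \<Longrightarrow> F (Xm n) = F' (Xm n)" "f \<in> L Z" shows "F f = F' f"
proof -
  have "f \<in> Palg" using assms by (auto simp: L_def Palg_def)
  then show ?thesis using assms by (simp add: lop_expand L_def subset_iff cong: sum.cong)
qed

lemma lop_L: assumes "lop F" "Z \<subseteq> Pw" "\<And>n. n \<in> Z \<Longrightarrow> F (Xm n) \<in> L Z'" "f \<in> L Z" shows "F f \<in> L Z'"
proof -
  have "f \<in> Palg" using assms by (auto simp: L_def Palg_def)
  then show ?thesis using assms by (auto simp: lop_expand L_def[of Z] intro!: L_sum L_cst)
qed

lemma lop_comp: "lop F \<Longrightarrow> lop G \<Longrightarrow> lop (\<lambda>f. F (G f))" by (simp add: lop_def)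
lemma lop_act: "g \<in> tW \<Longrightarrow> lop (act g)" by (simp add: lop_def act_Palg act_add act_cmul)
lemma lop_Gt: "b \<in> Rhat \<Longrightarrow> lop (Gt k b)"
  by (simp add: lop_def Gt_Palg) (simp add: Gt_def Nop_add Nop_cmul distrib_left mult.left_commute)
lemma lop_Top: "i \<in> Idx \<Longrightarrow> lop (Top k i)" by (simp add: lop_def Top_Palg Top_add Top_cmul)
lemma lop_id: "lop (\<lambda>f. f)" by (simp add: lop_def)

text \<open>Norm first, then height: for this order the operators \<open>G\<^sub>b\<close> and \<open>Y\<close> are triangular.\<close>
definition low :: "'v \<Rightarrow> 'v set" where
  "low n = {x \<in> Pw. x \<bullet> x < n \<bullet> n \<or> x \<bullet> x = n \<bullet> n \<and> htv \<bullet> x < htv \<bullet> n}"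

lemma low_Pw: "low n \<subseteq> Pw" by (auto simp: low_def)
lemma finite_low: "finite (low n)" by (rule finite_subset[OF _ finite_bounded_Pw[of "n \<bullet> n"]]) (auto simp: low_def)
lemma low_trans: "x \<in> low n \<Longrightarrow> low x \<subseteq> low n" by (auto simp: low_def)
lemma low_irrefl [simp]: "n \<notin> low n" by (auto simp: low_def)
lemma low_card: "x \<in> low n \<Longrightarrow> card (low x) < card (low n)"
  using low_trans[of x n] low_irrefl[of x] by (intro psubset_card_mono finite_low) blast

lemma low_induct [consumes 1, case_names less]:
  assumes "n \<in> Pw" "\<And>n. n \<in> Pw \<Longrightarrow> (\<And>x. x \<in> low n \<Longrightarrow> P x) \<Longrightarrow> P n" shows "P n"
  using assms(1)
proof (induction "card (low n)" arbitrary: n rule: less_induct)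
  case less
  then show ?case using assms(2) low_card low_Pw by blast
qed

definition tri :: "(('v \<Rightarrow>\<^sub>0 K) \<Rightarrow> ('v \<Rightarrow>\<^sub>0 K)) \<Rightarrow> ('v \<Rightarrow> K) \<Rightarrow> bool" where
  "tri F d \<longleftrightarrow> (\<forall>n\<in>Pw. F (Xm n) - cst (d n) * Xm n \<in> L (low n))"

lemma Xm_L: "n \<in> Z \<Longrightarrow> Xm n \<in> L Z" by (simp add: Xm_def L_single)
lemma L_low_Palg: "f \<in> L (low n) \<Longrightarrow> f \<in> Palg" using low_Pw[of n] by (auto simp: L_def Palg_def)

lemma tri_cong: "tri F d \<Longrightarrow> (\<And>n. n \<in> Pw \<Longrightarrow> F (Xm n) = F' (Xm n)) \<Longrightarrow> (\<And>n. n \<in> Pw \<Longrightarrow> d n = d' n) \<Longrightarrow> tri F' d'"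
  by (simp add: tri_def)

lemma tri_low: assumes "lop F" "tri F d" "f \<in> L (low n)" shows "F f \<in> L (low n)"
proof (rule lop_L[OF assms(1) low_Pw _ assms(3)])
  fix x assume x: "x \<in> low n"
  have "F (Xm x) = (F (Xm x) - cst (d x) * Xm x) + cst (d x) * Xm x" by simp
  also have "\<dots> \<in> L (low n)"
    using assms(2) x low_Pw low_trans[OF x] by (intro L_add L_cst Xm_L) (auto simp: tri_def intro: L_mono)
  finally show "F (Xm x) \<in> L (low n)" .
qed

lemma tri_comp: assumes "lop F" "tri F d" "lop G" "tri G d'" shows "tri (\<lambda>f. F (G f)) (\<lambda>n. d n * d' n)"
  unfolding tri_def
proof
  fix n assume n: "n \<in> Pw"
  define r where "r = G (Xm n) - cst (d' n) * Xm n"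
  have r: "r \<in> L (low n)" using assms n by (simp add: r_def tri_def)
  have "G (Xm n) = cst (d' n) * Xm n + r" by (simp add: r_def)
  then have "F (G (Xm n)) = cst (d' n) * F (Xm n) + F r"
    using n L_low_Palg[OF r] assms(1) by (simp add: lop_add lop_cmul Xm_Palg Palg_cmul)
  then have "F (G (Xm n)) - cst (d n * d' n) * Xm n = cst (d' n) * (F (Xm n) - cst (d n) * Xm n) + F r"
    by (simp add: cst_mult algebra_simps)
  also have "\<dots> \<in> L (low n)" using assms n tri_low[OF assms(1,2) r] by (intro L_add L_cst) (auto simp: tri_def)
  finally show "F (G (Xm n)) - cst (d n * d' n) * Xm n \<in> L (low n)" .
qed

lemma tri_id: "tri (\<lambda>f. f) (\<lambda>n. 1)" by (simp add: tri_def)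

text \<open>Back substitution along \<open>low\<close>. The set \<open>Z\<close> is instantiated
  with all weights, with \<open>low n\<close> and with saturated sets, so preimages inherit the
  bounds on supports.\<close>

lemma tri_surj:
  assumes "lop F" "tri F d" "\<And>n. n \<in> Pw \<Longrightarrow> d n \<noteq> 0" "Z \<subseteq> Pw" "\<And>n. n \<in> Z \<Longrightarrow> F (Xm n) \<in> L Z" "f \<in> L Z"
  shows "\<exists>g\<in>L Z. F g = f"
proof -
  have LP: "g \<in> Palg" if "g \<in> L Z" for g using that assms(4) by (auto simp: L_def Palg_def)
  have ext: "\<exists>g\<in>L Z. F g = h" if h: "\<And>n. n \<in> ky h \<Longrightarrow> \<exists>g\<in>L Z. F g = Xm n" for h
  proof -
    obtain G where G: "\<And>n. n \<in> ky h \<Longrightarrow> G n \<in> L Z \<and> F (G n) = Xm n" using h by metis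
    have "F (\<Sum>n\<in>ky h. cst (lk h n) * G n) = (\<Sum>n\<in>ky h. cst (lk h n) * Xm n)"
      using assms(1) G LP by (subst lop_sum) (auto simp: lop_cmul Palg_cmul)
    also have "\<dots> = h" unfolding cst_Xm by (rule pm_decomp[symmetric]) auto
    finally show ?thesis using G by (intro bexI[of _ "\<Sum>n\<in>ky h. cst (lk h n) * G n"] L_sum L_cst) auto
  qed
  have mono: "n \<in> Z \<Longrightarrow> \<exists>g\<in>L Z. F g = Xm n" if "n \<in> Pw" for n
    using that
  proof (induction n rule: low_induct)
    case (less n)
    define r where "r = F (Xm n) - cst (d n) * Xm n"
    have r: "r \<in> L (low n)" "r \<in> L Z" using assms less by (auto simp: r_def tri_def intro!: L_diff L_cst Xm_L)
    have "\<exists>g\<in>L Z. F g = r" by (rule ext) (use r less in \<open>auto simp: L_def\<close>)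
    then obtain g where g: "g \<in> L Z" "F g = r" by blast
    let ?c = "inverse (d n)"
    have "F (cst ?c * (Xm n - g)) = cst ?c * (F (Xm n) - r)"
      using assms(1) LP g less by (simp add: lop_cmul lop_diff Palg_diff Xm_Palg)
    also have "\<dots> = Xm n" using assms(3)[of n] less by (simp add: r_def flip: cst_mult mult.assoc)
    finally show ?case using g less by (intro bexI[of _ "cst ?c * (Xm n - g)"] L_cst L_diff Xm_L) auto
  qed
  show ?thesis
  proof (rule ext)
    fix n assume "n \<in> ky f"
    then have "n \<in> Z" using assms(6) by (auto simp: L_def)
    then show "\<exists>g\<in>L Z. F g = Xm n" using mono assms(4) by blast
  qed
qed

lemma tri_surj_low:
  assumes "lop F" "tri F d" "\<And>n. n \<in> Pw \<Longrightarrow> d n \<noteq> 0" "f \<in> L (low n)" shows "\<exists>g\<in>L (low n). F g = f"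
  by (rule tri_surj[OF assms(1,2) _ low_Pw _ assms(4)]) (auto intro: tri_low[OF assms(1,2)] Xm_L simp: assms(3))

lemma uni_inj: assumes "lop F" "uni k F" "f \<in> Palg" "F f = 0" shows "f = 0"
proof (rule form_nondegenerate)
  fix n assume "n \<in> ky f"
  then have "n \<in> Pw" using assms(3) by (auto simp: Palg_def)
  then have "Xm n \<in> Palg" by (rule Xm_Palg)
  then have "form k (F f) (F (Xm n)) = form k f (Xm n)" using assms(2,3) by (simp add: uni_def)
  then show "form k f (Xm n) = 0" using assms by simp
qed

lemma uni_comp: "lop G \<Longrightarrow> uni k F \<Longrightarrow> uni k G \<Longrightarrow> uni k (\<lambda>f. F (G f))"
  by (simp add: uni_def lop_Palg)

text \<open>This replaces the braid relations.\<close>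
lemma unitary_triangular_unique:
  assumes g: "g \<in> tW"
    and D1: "lop D1" "uni k D1" "\<And>f. f \<in> Palg \<Longrightarrow> D1 f = act g (M1 f)" "lop M1" "tri M1 d"
    and D2: "lop D2" "uni k D2" "\<And>f. f \<in> Palg \<Longrightarrow> D2 f = act g (M2 f)" "lop M2" "tri M2 d"
    and d: "\<And>n. n \<in> Pw \<Longrightarrow> d n \<noteq> 0" and f: "f \<in> Palg"
  shows "D1 f = D2 f"
proof (rule lop_eqI[OF D1(1) D2(1) subset_refl])
  show "f \<in> L Pw" using f by (simp add: Palg_L)
  fix n assume "n \<in> Pw"
  then show "D1 (Xm n) = D2 (Xm n)"
  proof (induction n rule: low_induct)
    case (less n)
    have IH: "D1 v = D2 v" if "v \<in> L (low n)" for v by (rule lop_eqI[OF D1(1) D2(1) low_Pw less(2) that])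
    define e where "e = M1 (Xm n) - M2 (Xm n)"
    define u where "u = D1 (Xm n) - D2 (Xm n)"
    have "e = (M1 (Xm n) - cst (d n) * Xm n) - (M2 (Xm n) - cst (d n) * Xm n)" by (simp add: e_def)
    also have "\<dots> \<in> L (low n)" by (rule L_diff) (use D1(5) D2(5) less(1) in \<open>auto simp: tri_def\<close>)
    finally have e: "e \<in> L (low n)" .
    have ue: "u = act g e" using less(1) by (simp add: u_def e_def D1(3) D2(3) Xm_Palg act_diff)
    \<comment> \<open>Writing \<open>h\<close> as M1 v with v lower, both operators send v to
      \<open>act g h\<close>; by isometry each pairs its image of X^n with that element to the same
      value, namely the form of X^n and v.\<close>
    have orth: "form k u (act g h) = 0" if h: "h \<in> L (low n)" for h
    proof -
      obtain v where v: "v \<in> L (low n)" "M1 v = h" using tri_surj_low[OF D1(4,5) d h] by blast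
      have vP: "v \<in> Palg" "Xm n \<in> Palg" using L_low_Palg v less(1) Xm_Palg by auto
      have "act g h = D1 v" using D1(3) vP v by simp
      then have "form k u (act g h) = form k (D1 (Xm n)) (D1 v) - form k (D2 (Xm n)) (D2 v)"
        using IH[OF v(1)] by (simp add: u_def form_diff_left)
      then show ?thesis using D1(2) D2(2) vP by (simp add: uni_def)
    qed
    \<comment> \<open>Up to a scalar, each exponent of u comes from the image under
      \<open>act g\<close> of a lower monomial, so \<open>orth\<close> covers all tests required by
      \<open>form_nondegenerate\<close>.\<close>
    have "u = 0"
    proof (rule form_nondegenerate)
      fix x assume "x \<in> ky u"
      then obtain y where y: "y \<in> ky e" "x \<in> ky (Xh (g (y, 0)))"
        using keys_ext[of "\<lambda>n. Xh (g (n, 0))" e] unfolding ue act_ext by blast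
      then have x: "x = fst (g (y, 0))" by (simp add: Xh_def split: if_splits)
      let ?q = "qpow (-2 * snd (g (y, 0)))"
      have "Xm x = cst (inverse ?q) * act g (Xm y)"
        unfolding act_Xm Xh_def x cst_single by (simp add: Xm_def)
      moreover have "Xm y \<in> L (low n)" using y e by (auto simp: L_def Xm_def)
      ultimately show "form k u (Xm x) = 0" using orth by (simp add: form_cmul_right)
    qed
    then show ?case by (simp add: u_def)
  qed
qed

text \<open>The value 1 on the wall is the correct convention: there the divided difference of X^n
  is 0 and \<open>Gt\<close> multiplies X^n by t.\<close>

definition eps :: "'v \<Rightarrow> 'v \<Rightarrow> real" where "eps a n = (if n \<bullet> a \<ge> 0 then 1 else -1)"

lemma eps_Ints: "eps a n \<in> \<int>" by (simp add: eps_def)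
lemma eps_coroot: "a \<noteq> 0 \<Longrightarrow> eps (coroot a) n = eps a n"
proof -
  assume "a \<noteq> 0"
  then obtain c where "c > 0" "coroot a = c *\<^sub>R a" unfolding coroot_def by (metis divide_pos_pos inner_gt_zero_iff zero_less_numeral)
  then show ?thesis by (simp add: eps_def zero_le_mult_iff)
qed

lemma string_norm: assumes "a \<noteq> 0"
  shows "(n - j *\<^sub>R a) \<bullet> (n - j *\<^sub>R a) = n \<bullet> n - (a \<bullet> a) * (j * (n \<bullet> coroot a - j))"
  using assms by (simp add: coroot_inner inner_diff_left inner_diff_right inner_commute algebra_simps)

lemma string_low: assumes "n \<in> Pw" "a \<in> Rp" "0 < j \<and> of_int j \<le> n \<bullet> coroot a \<or> n \<bullet> coroot a < of_int j \<and> j < 0"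
  shows "n - of_int j *\<^sub>R a \<in> low n"
proof -
  have nz: "a \<noteq> 0" "a \<bullet> a > 0" using assms(2) by auto
  have P: "n - of_int j *\<^sub>R a \<in> Pw" using assms R_Pw[OF Rp_R] by (simp add: Pw_diff Pw_scale)
  show ?thesis
  proof (cases "of_int j = n \<bullet> coroot a")
    case True
    then have "j > 0" using assms(3) by auto
    then have "htv \<bullet> (n - of_int j *\<^sub>R a) < htv \<bullet> n" using htv_Rp[OF assms(2)] by (simp add: inner_diff_right)
    then show ?thesis using P True by (simp add: low_def string_norm[OF nz(1)])
  next
    case False
    then have "of_int j * (n \<bullet> coroot a - of_int j) > 0" using assms(3) by (auto simp: zero_less_mult_iff)
    then have "(a \<bullet> a) * (of_int j * (n \<bullet> coroot a - of_int j)) > 0" using nz by simp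
    then show ?thesis using P by (simp add: low_def string_norm[OF nz(1)])
  qed
qed

lemma Xh_string_L: "fst b = a \<Longrightarrow> n - of_int j *\<^sub>R a \<in> Z \<Longrightarrow> Xh ((n, 0) - of_int j *\<^sub>R b) \<in> L Z"
  by (simp add: Xh_def L_single)

lemma tri_Gt: assumes "b \<in> Rhat" "fst b \<in> Rp" shows "tri (Gt k b) (\<lambda>n. qpow (real k * eps (fst b) n))"
  unfolding tri_def
proof
  fix n assume n: "n \<in> Pw"
  let ?a = "fst b" let ?t = "qpow (real k)" and ?ti = "qpow (- real k)"
  define e where "e = \<lfloor>n \<bullet> coroot ?a\<rfloor>"
  have ei: "n \<bullet> coroot ?a = of_int e" using Pw_int[OF n, of ?a] assms by (auto simp: e_def Rhat_def elim!: Ints_cases)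
  have G: "Gt k b (Xm n) = cst ?t * Xm n + cst (?t - ?ti) * Nmono b n"
    unfolding Gt_def by (simp add: Xm_def Nop_single)
  have ep: "eps ?a n = (if e \<ge> 0 then 1 else -1)"
    using eps_coroot[of ?a n] assms ei by (simp add: eps_def)
  consider "e > 0" | "e = 0" | "e < 0" by linarith
  then show "Gt k b (Xm n) - cst (qpow (real k * eps ?a n)) * Xm n \<in> L (low n)"
  proof cases
    case 1
    have "Nmono b n \<in> L (low n)" unfolding Nmono_def Let_def e_def[symmetric] using 1
      by (auto intro!: L_sum Xh_string_L[OF refl] string_low[OF n assms(2)] simp: ei)
    then show ?thesis using 1 by (simp add: G ep L_cst)
  next
    case 2
    have "Nmono b n = 0" by (simp add: Nmono_def Let_def e_def[symmetric] 2)
    then show ?thesis using 2 by (simp add: G ep)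
  next
    case 3
    define r where "r = (\<Sum>j\<in>{e + 1..-1}. Xh ((n, 0) - of_int j *\<^sub>R b))"
    \<comment> \<open>The term j = 0 is X^n itself, entering with a minus sign; it changes the
      diagonal entry from t to t - (t - t^-1) = t^-1.\<close>
    have "{e + 1..0} = insert 0 {e + 1..-1}" using 3 by auto
    then have Nm: "Nmono b n = - (Xm n + r)" using 3 by (simp add: Nmono_def Let_def e_def[symmetric] r_def)
    have "Gt k b (Xm n) - cst ?ti * Xm n = - (cst (?t - ?ti) * r)"
      unfolding G Nm cst_diff by (simp add: algebra_simps)
    moreover have "r \<in> L (low n)" unfolding r_def
      by (auto intro!: L_sum Xh_string_L[OF refl] string_low[OF n assms(2)] simp: ei)
    ultimately show ?thesis using 3 by (simp add: ep L_cst L_uminus)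
  qed
qed

section \<open>Words in the operators T, and the operators Y\<close>

definition wordT :: "nat \<Rightarrow> 'v option list \<Rightarrow> ('v \<Rightarrow>\<^sub>0 K) \<Rightarrow> ('v \<Rightarrow>\<^sub>0 K)" where
  "wordT k is = fold (\<lambda>i h. Top k i \<circ> h) is id"

lemma wordT_Nil: "wordT k [] f = f" by (simp add: wordT_def)
lemma wordT_snoc: "wordT k (is @ [i]) f = Top k i (wordT k is f)" by (simp add: wordT_def)
lemma wordT_Cons: "wordT k (i # is) f = wordT k is (Top k i f)"
proof -
  have "fold (\<lambda>i h. Top k i \<circ> h) is h f = wordT k is (h f)" for h
    by (induction "is" rule: rev_induct) (auto simp: wordT_def)
  from this[of "Top k i \<circ> id"] show ?thesis by (simp add: wordT_def)
qed

lemma lop_wordT: "set is \<subseteq> Idx \<Longrightarrow> lop (wordT k is)"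
proof (induction "is" rule: rev_induct)
  case (snoc i "is")
  then have "lop (Top k i)" "lop (wordT k is)" using lop_Top by auto
  then have "lop (\<lambda>f. Top k i (wordT k is f))" by (rule lop_comp)
  moreover have "wordT k (is @ [i]) = (\<lambda>f. Top k i (wordT k is f))" by (rule HOL.ext) (rule wordT_snoc)
  ultimately show ?case by (simp only:)
next
  case Nil
  have "wordT k [] = (\<lambda>f. f)" by (rule HOL.ext) (rule wordT_Nil)
  then show ?case using lop_id by (simp only:)
qed

lemma uni_wordT: "set is \<subseteq> Idx \<Longrightarrow> uni k (wordT k is)"
proof (induction "is" rule: rev_induct)
  case (snoc i "is")
  then have "lop (wordT k is)" "uni k (Top k i)" "uni k (wordT k is)" using uni_Top lop_wordT by auto
  then have "uni k (\<lambda>f. Top k i (wordT k is f))" by (rule uni_comp)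
  moreover have "wordT k (is @ [i]) = (\<lambda>f. Top k i (wordT k is f))" by (rule HOL.ext) (rule wordT_snoc)
  ultimately show ?case by (simp only:)
next
  case Nil
  have "wordT k [] = (\<lambda>f. f)" by (rule HOL.ext) (rule wordT_Nil)
  then show ?case by (simp add: uni_def)
qed

text \<open>When the reflections are moved to the left, each letter leaves a factor
  \<open>Gt\<close> at the inversion it adds. Conjugation by \<open>v\<close> is allowed as long as
  all inversions keep positive finite part; a simple reflection as \<open>v\<close> is needed to
  commute T with Y.\<close>

lemma tri_wordT:
  assumes "set is \<subseteq> Idx" "alen (prods is) = length is" "v \<in> Wg" "\<And>b. b \<in> Inv (prods is) \<Longrightarrow> v (fst b) \<in> Rp"
  shows "tri (\<lambda>f. act (wlin v \<circ> inv (prods is)) (wordT k is (wact (inv v) f)))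
    (\<lambda>n. \<Prod>b\<in>Inv (prods is). qpow (real k * eps (v (fst b)) n))"
  using assms(1,2,4)
proof (induction "is" rule: rev_induct)
  case Nil
  have I: "Inv id = {}" using Rhat_pos_neg by (auto simp: Inv_def)
  have "wlin v \<in> tW" "wlin (inv v) \<in> tW" using assms(3) wlin_tW inv_Wg by auto
  show ?case
  proof (rule tri_cong[OF tri_id])
    fix n assume n: "n \<in> Pw"
    show "Xm n = act (wlin v \<circ> inv (prods [])) (wordT k [] (wact (inv v) (Xm n)))"
      by (simp add: wordT_Nil Xm_def assms(3))
    show "1 = (\<Prod>b\<in>Inv (prods []). qpow (real k * eps (v (fst b)) n))" using I by simp
  qed
next
  case (snoc i "is")
  define g where "g = prods is"
  define b where "b = inv g (aroot i)"
  have i: "i \<in> Idx" "set is \<subseteq> Idx" using snoc by auto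
  note red = reduced_snoc[OF snoc(2,3)]
  have gW: "g \<in> tW" using prods_tW i by (simp add: g_def)
  have sW: "sa i \<in> tW" by (rule sa_tW[OF i(1)])
  have vW: "wlin v \<in> tW" "wlin (inv v) \<in> tW" using assms(3) wlin_tW inv_Wg by auto
  have bI: "Inv (prods (is @ [i])) = insert b (Inv g)" "b \<notin> Inv g" "b \<in> Rhat_pos" using red by (simp_all add: b_def g_def)
  have bR: "b \<in> Rhat" using bI by (simp add: Rhat_pos_iff)
  have vb: "wlin v b \<in> Rhat" "fst (wlin v b) = v (fst b)" using tW_Rhat[OF vW(1) bR] by (auto simp: wlin_def split: prod.split)
  have vbp: "v (fst b) \<in> Rp" by (rule snoc.prems(3), unfold bI(1), rule insertI1)
  define F where "F = (\<lambda>f. act (wlin v \<circ> inv g) (wordT k is (wact (inv v) f)))"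
  have vg: "wlin v \<circ> inv g \<in> tW" by (intro tW_comp vW inv_tW gW)
  have lF: "lop F" unfolding F_def
    by (rule lop_comp[OF lop_act[OF vg] lop_comp[OF lop_wordT[OF i(2)] lop_act[OF vW(2)]]])
  have "tri F (\<lambda>n. \<Prod>b\<in>Inv g. qpow (real k * eps (v (fst b)) n))"
    unfolding F_def g_def
    by (rule snoc.IH[OF i(2) red(1)], rule snoc.prems(3), unfold bI(1), unfold g_def, rule insertI2)
  from tri_comp[OF lop_Gt[OF vb(1)] tri_Gt[OF vb(1) vbp[folded vb(2)]] lF this]
  have "tri (\<lambda>f. Gt k (wlin v b) (F f)) (\<lambda>n. qpow (real k * eps (v (fst b)) n) * (\<Prod>b\<in>Inv g. qpow (real k * eps (v (fst b)) n)))"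
    by (simp add: vb(2))
  then show ?case
  proof (rule tri_cong)
    fix n assume n: "n \<in> Pw"
    show "qpow (real k * eps (v (fst b)) n) * (\<Prod>b\<in>Inv g. qpow (real k * eps (v (fst b)) n))
      = (\<Prod>b\<in>Inv (prods (is @ [i])). qpow (real k * eps (v (fst b)) n))"
      unfolding bI using finite_Inv[OF gW] bI(2) by simp
    let ?h = "wordT k is (wact (inv v) (Xm n))"
    have h: "?h \<in> Palg" using n by (intro lop_Palg[OF lop_wordT] i act_Palg vW Xm_Palg)
    have e0: "inv (sa i \<circ> g) = inv g \<circ> sa i"
      by (rule inv_unique_comp) (use gW i in \<open>auto simp: fun_eq_iff sa_sa\<close>)
    have e: "wlin v \<circ> inv (prods (is @ [i])) \<circ> sa i = wlin v \<circ> inv g"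
      unfolding prods_snoc g_def[symmetric] e0 by (rule HOL.ext) (simp add: sa_sa i)
    have pW: "wlin v \<circ> inv (prods (is @ [i])) \<in> tW" by (intro tW_comp vW inv_tW prods_tW snoc(2))
    have "act (wlin v \<circ> inv (prods (is @ [i]))) (wordT k (is @ [i]) (wact (inv v) (Xm n)))
      = act (wlin v \<circ> inv (prods (is @ [i]))) (act (sa i) (Gt k (aroot i) ?h))"
      unfolding wordT_snoc by (simp add: Top_Gt i h)
    also have "\<dots> = act (wlin v \<circ> inv g) (Gt k (aroot i) ?h)"
      by (simp only: act_comp[OF pW sW Gt_Palg[OF aroot_Rhat[OF i(1)] h]] e)
    also have "\<dots> = Gt k (wlin v b) (F (Xm n))"
      by (simp add: Gt_conj[OF vg aroot_Rhat[OF i(1)] h] b_def F_def)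
    finally show "Gt k (wlin v b) (F (Xm n)) = act (wlin v \<circ> inv (prods (is @ [i]))) (wordT k (is @ [i]) (wact (inv v) (Xm n)))" by simp
  qed
qed

text \<open>The first factor comes from the translation, the second collects t or t^-1 from each
  inversion of \<open>tau l\<close>. The formula is additive in l and so also gives the diagonal for
  non-dominant l.\<close>

definition ydiag :: "nat \<Rightarrow> 'v \<Rightarrow> 'v \<Rightarrow> K" where
  "ydiag k l n = qpow (2 * (l \<bullet> n)) * qpow (real k * (\<Sum>a\<in>Rp. (l \<bullet> a) * eps a n))"

lemma ydiag_nonzero [simp]: "ydiag k l n \<noteq> 0" by (simp add: ydiag_def)

lemma ydiag_add: assumes "l \<in> Pcw" "l' \<in> Pcw" "n \<in> Pw" shows "ydiag k (l + l') n = ydiag k l n * ydiag k l' n"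
proof -
  have "mz (2 * (l \<bullet> n))" using mz_pair[OF assms(1,3)] by (intro mz_times) auto
  moreover have "mz (real k * (\<Sum>a\<in>Rp. (l \<bullet> a) * eps a n))"
    using assms Pcw_R Rp_R eps_Ints by (intro mz_Ints Ints_mult Ints_sum) auto
  ultimately show ?thesis
    by (simp add: ydiag_def inner_add_left distrib_right distrib_left sum.distrib qpow_add mult_ac)
qed

lemma tri_tau: assumes "l \<in> Pcw" shows "tri (act (tau l)) (\<lambda>n. qpow (2 * (l \<bullet> n)))"
  unfolding tri_def act_Xm by (simp add: tau_def Xh_def Xm_def cst_single)

lemma sum_Inv_tau:
  assumes "l \<in> Pcwpos" shows "(\<Sum>b\<in>Inv (tau l). f (fst b)) = (\<Sum>a\<in>Rp. (l \<bullet> a) * (f a :: real))"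
proof -
  have "Inv (tau l) = (SIGMA a:Rp. {c \<in> \<int>. 0 \<le> c \<and> c < l \<bullet> a})" unfolding Inv_tau[OF assms] by auto
  moreover have c: "finite {c \<in> \<int>. 0 \<le> c \<and> c < l \<bullet> a} \<and> real (card {c \<in> \<int>. 0 \<le> c \<and> c < l \<bullet> a}) = l \<bullet> a" if a: "a \<in> Rp" for a
  proof -
    obtain z where z: "l \<bullet> a = of_int z" using Pcw_R[OF Pcwpos_Pcw[OF assms] Rp_R[OF a]] by (auto elim: Ints_cases)
    have z0: "z \<ge> 0" using Pcwpos_Rp[OF assms a] z by simp
    have e: "{c \<in> \<int>. 0 \<le> c \<and> c < l \<bullet> a} = real_of_int ` {0..<z}" unfolding z by (auto elim!: Ints_cases)
    show ?thesis unfolding e using z0 by (simp add: card_image inj_on_def z)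
  qed
  moreover have "(\<Sum>a\<in>Rp. \<Sum>c\<in>{c \<in> \<int>. 0 \<le> c \<and> c < l \<bullet> a}. f a)
      = (\<Sum>(a, c)\<in>(SIGMA a:Rp. {c \<in> \<int>. 0 \<le> c \<and> c < l \<bullet> a}). f a)"
    by (rule sum.Sigma) (use c in auto)
  ultimately have "(\<Sum>b\<in>Inv (tau l). f (fst b)) = (\<Sum>a\<in>Rp. \<Sum>c\<in>{c \<in> \<int>. 0 \<le> c \<and> c < l \<bullet> a}. f a)"
    by (simp only: split_def)
  also have "\<dots> = (\<Sum>a\<in>Rp. (l \<bullet> a) * f a)" by (rule sum.cong) (use c in auto)
  finally show ?thesis .
qed

lemma prod_qpow_eps: "finite B \<Longrightarrow> (\<Prod>b\<in>B. qpow (real k * eps (h b) n)) = qpow (real k * (\<Sum>b\<in>B. eps (h b) n))"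
  by (simp add: sum_distrib_left qpow_sum mz_Ints eps_Ints)

lemma redexp_tau:
  assumes l: "l \<in> Pcwpos" and r: "redexp (tau l) p is" and v: "v \<in> Wg" "\<And>a. a \<in> Rp \<Longrightarrow> l \<bullet> a \<noteq> 0 \<Longrightarrow> v a \<in> Rp"
  shows "lop (\<lambda>f. act p (wordT k is f))" "uni k (\<lambda>f. act p (wordT k is f))"
    "tri (\<lambda>f. wact v (act p (wordT k is (wact (inv v) f)))) (\<lambda>n. qpow (2 * (v l \<bullet> n)) * qpow (real k * (\<Sum>a\<in>Rp. (l \<bullet> a) * eps (v a) n)))"
proof -
  have p: "p \<in> Omega" "p \<in> tW" "set is \<subseteq> Idx" "length is = alen (tau l)" "tau l = p \<circ> prods is"
    using r Omega_tW by (auto simp: redexp_def)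
  have lP: "l \<in> Pcw" using l Pcwpos_Pcw by simp
  have tW: "tau l \<in> tW" "prods is \<in> tW" using tau_tW[OF lP] prods_tW p by auto
  show "lop (\<lambda>f. act p (wordT k is f))" by (rule lop_comp[OF lop_act[OF p(2)] lop_wordT[OF p(3)]])
  show "uni k (\<lambda>f. act p (wordT k is f))"
    by (rule uni_comp[OF lop_wordT[OF p(3)] uni_Omega[OF p(1)] uni_wordT[OF p(3)]])
  have I: "Inv (prods is) = Inv (tau l)" using Inv_Omega_comp[OF p(1) tW(2)] p by simp
  have "v (fst b) \<in> Rp" if "b \<in> Inv (prods is)" for b using that v(2)[of "fst b"] unfolding I Inv_tau[OF l] by force
  note T = tri_wordT[OF p(3) _ v(1) this, of k]
  have vl: "v l \<in> Pcw" using Wg_Pcw v lP by simp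
  have vW: "wlin v \<in> tW" "wlin (inv v) \<in> tW" using wlin_tW v inv_Wg by auto
  have vi: "wlin v \<circ> inv (prods is) \<in> tW" by (intro tW_comp vW inv_tW tW)
  have lo: "lop (\<lambda>f. act (wlin v \<circ> inv (prods is)) (wordT k is (wact (inv v) f)))"
    by (rule lop_comp[OF lop_act[OF vi] lop_comp[OF lop_wordT[OF p(3)] lop_act[OF vW(2)]]])
  have al: "alen (prods is) = length is" using p(4) I by (simp add: alen_Inv)
  from tri_comp[OF lop_act[OF tau_tW[OF vl]] tri_tau[OF vl] lo T[OF al]]
  show "tri (\<lambda>f. wact v (act p (wordT k is (wact (inv v) f)))) (\<lambda>n. qpow (2 * (v l \<bullet> n)) * qpow (real k * (\<Sum>a\<in>Rp. (l \<bullet> a) * eps (v a) n)))"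
  proof (rule tri_cong)
    fix n assume n: "n \<in> Pw"
    have h: "wordT k is (wact (inv v) (Xm n)) \<in> Palg" by (intro lop_Palg[OF lop_wordT] act_Palg Xm_Palg n p vW)
    have e: "tau (v l) \<circ> (wlin v \<circ> inv (prods is)) = wlin v \<circ> p"
    proof
      fix x
      have "p x = tau l (inv (prods is) x)" using p(5) tW(2) by (metis comp_apply tW_inv(1))
      then show "(tau (v l) \<circ> (wlin v \<circ> inv (prods is))) x = (wlin v \<circ> p) x"
        by (simp add: tau_def wlin_def Wg_inner[OF v(1)] split: prod.split)
    qed
    show "act (tau (v l)) (act (wlin v \<circ> inv (prods is)) (wordT k is (wact (inv v) (Xm n))))
      = wact v (act p (wordT k is (wact (inv v) (Xm n))))"
      using h by (simp only: act_comp[OF tau_tW[OF vl] vi h] act_comp[OF vW(1) p(2) h] e)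
    show "qpow (2 * (v l \<bullet> n)) * (\<Prod>b\<in>Inv (prods is). qpow (real k * eps (v (fst b)) n))
      = qpow (2 * (v l \<bullet> n)) * qpow (real k * (\<Sum>a\<in>Rp. (l \<bullet> a) * eps (v a) n))"
      using sum_Inv_tau[OF l, of "\<lambda>a. eps (v a) n"] finite_Inv[OF tW(1)]
      by (simp add: I prod_qpow_eps)
  qed
qed

lemma wact_id_eq [simp]: "wact (\<lambda>x. x) f = f" using wact_id[of f] by (simp add: id_def)

lemma redexp_tau_props:
  assumes "l \<in> Pcwpos" "redexp (tau l) p is"
  shows "lop (\<lambda>f. act p (wordT k is f))" "uni k (\<lambda>f. act p (wordT k is f))" "tri (\<lambda>f. act p (wordT k is f)) (ydiag k l)"
  using redexp_tau[OF assms id_Wg, of k] by (simp_all add: ydiag_def[abs_def] id_def)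

text \<open>The choice in \<open>Tw\<close> is known only to be some reduced expression; for
  dominant translations its irrelevance follows from \<open>Y_unique\<close>.\<close>

lemma Tw_redexp: assumes "g \<in> tW" shows "\<exists>p is. redexp g p is \<and> Tw k g = (\<lambda>f. act p (wordT k is f))"
proof -
  let ?P = "\<lambda>p. fst p \<in> Omega \<and> set (snd p) \<subseteq> Idx \<and> length (snd p) = alen g \<and> g = fst p \<circ> fold (\<lambda>i h. sa i \<circ> h) (snd p) id"
  obtain p "is" where "redexp g p is" using redexp_exists[OF assms] by blast
  then have "?P (p, is)" by (simp add: redexp_def)
  then have "?P (SOME p. ?P p)" by (rule someI)
  define q where "q = (SOME p. ?P p)"
  have "?P q" unfolding q_def by fact
  then have "redexp g (fst q) (snd q)" by (simp add: redexp_def)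
  moreover have "Tw k g = (\<lambda>f. act (fst q) (wordT k (snd q) f))"
    unfolding Tw_def q_def[symmetric] wordT_def case_prod_unfold by (rule HOL.ext) (rule comp_apply)
  ultimately show ?thesis by blast
qed

lemma Y_dominant: assumes "l \<in> Pcwpos" shows "\<exists>p is. redexp (tau l) p is \<and> Y k l = (\<lambda>f. act p (wordT k is f))"
  using Tw_redexp[OF tau_tW[OF Pcwpos_Pcw[OF assms]], of k] assms unfolding Y_def[abs_def] by auto

lemma Y_dominant_props: assumes "l \<in> Pcwpos" shows "lop (Y k l)" "uni k (Y k l)" "tri (Y k l) (ydiag k l)"
  using Y_dominant[OF assms, of k] redexp_tau_props[OF assms, of _ _ k] by auto

text \<open>Resolves the choices in \<open>Y\<close>: for the splitting selected there,
  \<open>Y k b\<close> is surjective as a triangular operator with nonzero diagonal and injective as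
  an isometry, so the described preimage exists and is unique.\<close>

lemma Y_nondominant:
  assumes "l \<in> Pcw" "l \<notin> Pcwpos"
  shows "\<exists>a\<in>Pcwpos. \<exists>b\<in>Pcwpos. l = a - b \<and> (\<forall>f\<in>Palg. Y k l f \<in> Palg \<and> Y k b (Y k l f) = Y k a f)"
proof -
  let ?P = "\<lambda>p. fst p \<in> Pcwpos \<and> snd p \<in> Pcwpos \<and> l = fst p - snd p"
  obtain a0 b0 where "a0 \<in> Pcwpos" "b0 \<in> Pcwpos" "l = a0 - b0" using Pcw_split[OF assms(1)] by metis
  then have "?P (a0, b0)" by simp
  then have P: "?P (SOME p. ?P p)" by (rule someI)
  define a b where "a = fst (SOME p. ?P p)" and "b = snd (SOME p. ?P p)"
  have ab: "a \<in> Pcwpos" "b \<in> Pcwpos" "l = a - b" using P by (simp_all add: a_def b_def)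
  have Yl: "Y k l f = (THE g. g \<in> Palg \<and> Y k b g = Y k a f)" for f
    using assms(2) ab(1,2) by (simp add: Y_def split_def a_def b_def)
  note B = Y_dominant_props[OF ab(2), of k]
  have "Y k l f \<in> Palg \<and> Y k b (Y k l f) = Y k a f" if f: "f \<in> Palg" for f
  proof -
    have Yf: "Y k a f \<in> L Pw" using lop_Palg[OF Y_dominant_props(1)[OF ab(1)] f] by (simp add: Palg_L)
    have "\<exists>g\<in>L Pw. Y k b g = Y k a f"
      by (rule tri_surj[OF B(1,3) _ subset_refl _ Yf]) (use lop_Palg[OF B(1) Xm_Palg] in \<open>auto simp: Palg_L\<close>)
    then obtain g where g: "g \<in> Palg" "Y k b g = Y k a f" by (auto simp: Palg_L)
    have uq: "g' = g" if "g' \<in> Palg \<and> Y k b g' = Y k a f" for g'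
      using uni_inj[OF B(1,2), of "g' - g"] that g by (simp add: Palg_diff lop_diff B(1))
    have "(THE g. g \<in> Palg \<and> Y k b g = Y k a f) = g"
    proof (rule the_equality)
      show "g \<in> Palg \<and> Y k b g = Y k a f" using g by blast
    qed (rule uq)
    then show ?thesis using g Yl by simp
  qed
  then show ?thesis using ab by blast
qed

lemma Y_props: assumes "l \<in> Pcw" shows "lop (Y k l)" "uni k (Y k l)" "tri (Y k l) (ydiag k l)"
proof -
  have "lop (Y k l) \<and> uni k (Y k l) \<and> tri (Y k l) (ydiag k l)"
  proof (cases "l \<in> Pcwpos")
    case True then show ?thesis using Y_dominant_props by blast
  next
    case False
    then obtain a b where ab: "a \<in> Pcwpos" "b \<in> Pcwpos" "l = a - b"
      and E: "\<And>f. f \<in> Palg \<Longrightarrow> Y k l f \<in> Palg" "\<And>f. f \<in> Palg \<Longrightarrow> Y k b (Y k l f) = Y k a f"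
      using Y_nondominant[OF assms, of k] by blast
    note A = Y_dominant_props[OF ab(1), of k] and B = Y_dominant_props[OF ab(2), of k]
    have inj: "g = g'" if "g \<in> Palg" "g' \<in> Palg" "Y k b g = Y k b g'" for g g'
      using uni_inj[OF B(1,2), of "g - g'"] that by (simp add: Palg_diff lop_diff B(1))
    have lop: "lop (Y k l)" unfolding lop_def
    proof (intro conjI ballI allI)
      fix f g assume "f \<in> Palg" "g \<in> Palg"
      then show "Y k l (f + g) = Y k l f + Y k l g"
        using inj[of "Y k l (f + g)" "Y k l f + Y k l g"] by (simp add: E Palg_add lop_add[OF A(1)] lop_add[OF B(1)])
    next
      fix c f assume "f \<in> Palg"
      then show "Y k l (cst c * f) = cst c * Y k l f"
        using inj[of "Y k l (cst c * f)" "cst c * Y k l f"] by (simp add: E Palg_cmul lop_cmul[OF A(1)] lop_cmul[OF B(1)])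
    qed (rule E)
    have uni: "uni k (Y k l)" unfolding uni_def
    proof (intro ballI)
      fix f g assume fg: "f \<in> Palg" "g \<in> Palg"
      have "form k (Y k l f) (Y k l g) = form k (Y k b (Y k l f)) (Y k b (Y k l g))"
        using B(2) E(1) fg by (simp add: uni_def)
      then show "form k (Y k l f) (Y k l g) = form k f g" using A(2) E(2) fg by (simp add: uni_def)
    qed
    have tri: "tri (Y k l) (ydiag k l)" unfolding tri_def
    proof
      fix n assume n: "n \<in> Pw"
      have d: "ydiag k a n = ydiag k l n * ydiag k b n"
        using ydiag_add[OF assms Pcwpos_Pcw[OF ab(2)] n] ab(3) by simp
      let ?r = "Y k l (Xm n) - cst (ydiag k l n) * Xm n"
      have rP: "?r \<in> Palg" using n by (simp add: Palg_diff Palg_cmul E Xm_Palg)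
      have "Y k b ?r = Y k a (Xm n) - cst (ydiag k l n) * Y k b (Xm n)"
        using n by (simp add: lop_diff[OF B(1)] lop_cmul[OF B(1)] E Xm_Palg Palg_cmul)
      also have "\<dots> = (Y k a (Xm n) - cst (ydiag k a n) * Xm n) - cst (ydiag k l n) * (Y k b (Xm n) - cst (ydiag k b n) * Xm n)"
        by (simp add: d cst_mult algebra_simps)
      also have "\<dots> \<in> L (low n)"
        using A(3) B(3) n unfolding tri_def by (metis L_diff L_cst)
      finally obtain g where g: "g \<in> L (low n)" "Y k b g = Y k b ?r"
        using tri_surj_low[OF B(1,3)] by (metis ydiag_nonzero)
      then have "g = ?r" using inj[OF L_low_Palg[OF g(1)] rP] by simp
      then show "?r \<in> L (low n)" using g by simp
    qed
    show ?thesis using lop uni tri by blast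
  qed
  then show "lop (Y k l)" "uni k (Y k l)" "tri (Y k l) (ydiag k l)" by auto
qed

text \<open>The rigidity statement with g = id: an isometry with the diagonal of
  \<open>Y k l\<close> is \<open>Y k l\<close>.\<close>

lemma Y_unique:
  assumes "l \<in> Pcw" "lop D" "uni k D" "tri D (ydiag k l)" "f \<in> Palg" shows "D f = Y k l f"
  by (rule unitary_triangular_unique[OF id_tW assms(2,3) _ assms(2,4) Y_props(1,2)[OF assms(1)] _ Y_props(1,3)[OF assms(1)] _ assms(5)])
    (use assms(2) Y_props(1)[OF assms(1)] in \<open>auto simp: act_id lop_Palg\<close>)

text \<open>The composite is again a triangular isometry, and diagonals multiply by
  \<open>ydiag_add\<close>.\<close>

lemma Y_mult: assumes "l \<in> Pcw" "l' \<in> Pcw" "f \<in> Palg" shows "Y k (l + l') f = Y k l (Y k l' f)"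
proof (rule Y_unique[symmetric, OF Pcw_add[OF assms(1,2)] _ _ _ assms(3)])
  note A = Y_props[OF assms(1), of k] and B = Y_props[OF assms(2), of k]
  show "lop (\<lambda>f. Y k l (Y k l' f))" by (rule lop_comp[OF A(1) B(1)])
  show "uni k (\<lambda>f. Y k l (Y k l' f))" by (rule uni_comp[OF B(1) A(2) B(2)])
  show "tri (\<lambda>f. Y k l (Y k l' f)) (ydiag k (l + l'))"
    by (rule tri_cong[OF tri_comp[OF A(1,3) B(1,3)]]) (simp_all add: ydiag_add assms)
qed

lemma Y_0: assumes "f \<in> Palg" shows "Y k 0 f = f"
  using Y_unique[OF Pcw_0 lop_id _ _ assms, of k] by (simp add: uni_def tri_def ydiag_def)

end

lemma sigma_to_fract: "sigma (to_fract p) = inv_eval p"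
  unfolding to_fract_def by (simp add: sigma_Fract)

lemma sigma_inv_eval: "sigma (inv_eval p) = to_fract p"
proof (induction p)
  case (pCons a p)
  have "sigma (to_fract [:a:]) = to_fract [:a:]" unfolding sigma_to_fract by (simp add: inv_eval_pCons)
  then have "sigma (inv_eval (pCons a p)) = to_fract [:a:] + mac.zq * to_fract p"
    using pCons by (simp add: inv_eval_pCons sigma_add sigma_mult sigma_inverse sigma_zq)
  then show ?case by (simp add: zq_to_fract flip: to_fract_mult to_fract_add)
qed simp

lemma sigma_sigma: "sigma (sigma c) = c"
proof -
  obtain a b where "c = Fract a b" "b \<noteq> 0" by (cases c)
  then have "c = to_fract a * inverse (to_fract b)" by (simp add: to_fract_def)
  then show ?thesis by (simp add: sigma_mult sigma_inverse sigma_to_fract sigma_inv_eval)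
qed

context rd begin

subsection \<open>Bernstein relations\<close>

abbreviation Ts :: "nat \<Rightarrow> 'v \<Rightarrow> ('v \<Rightarrow>\<^sub>0 K) \<Rightarrow> ('v \<Rightarrow>\<^sub>0 K)" where "Ts k s \<equiv> Top k (Some s)"

lemma Some_Idx [simp]: "s \<in> S \<Longrightarrow> Some s \<in> Idx" by (simp add: Idx_def)
lemma aroot_Some [simp]: "aroot (Some s) = (s, 0)" by (simp add: aroot_def)
lemma sa_wlin: "sa (Some s) = wlin (rrefl s)" by (simp add: sa_def)

lemma wact_invol: "s \<in> S \<Longrightarrow> wact (rrefl s) (wact (rrefl s) f) = f"
  by (simp add: wact_comp rrefl_comp_rrefl)

lemma inv_rrefl: "s \<in> S \<Longrightarrow> inv (rrefl s) = rrefl s"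
  by (rule inv_unique_comp) (auto simp: fun_eq_iff)

lemma Ts_Gt: "s \<in> S \<Longrightarrow> f \<in> Palg \<Longrightarrow> Ts k s f = wact (rrefl s) (Gt k (s, 0) f)"
  using Top_Gt[of "Some s" f k] by (simp add: sa_wlin)

lemma simple_Rhat: "s \<in> S \<Longrightarrow> (s, 0) \<in> Rhat" using SR by (auto simp: Rhat_def)

lemma sum_reflect:
  assumes "s \<in> S" "l \<bullet> s = 0 \<or> f s = 0"
  shows "(\<Sum>a\<in>Rp. (l \<bullet> a) * f (rrefl s a)) = (\<Sum>a\<in>Rp - {s}. (rrefl s l \<bullet> a) * (f a :: real)) + (l \<bullet> s) * f (- s)"
proof -
  have sR: "s \<in> Rp" using assms S_Rp by auto
  have "(\<Sum>a\<in>Rp. (l \<bullet> a) * f (rrefl s a)) = (l \<bullet> s) * f (- s) + (\<Sum>a\<in>Rp - {s}. (l \<bullet> a) * f (rrefl s a))"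
    unfolding sum.remove[OF finRp sR] using assms by (simp add: rrefl_self)
  also have "(\<Sum>a\<in>Rp - {s}. (l \<bullet> a) * f (rrefl s a)) = (\<Sum>a\<in>Rp - {s}. (rrefl s l \<bullet> rrefl s a) * f (rrefl s a))"
    using assms by (simp add: rrefl_inner)
  also have "\<dots> = (\<Sum>a\<in>Rp - {s}. (rrefl s l \<bullet> a) * f a)"
    by (rule sum.reindex_bij_betw[OF simple_refl_bij[OF assms(1)]])
  finally show ?thesis by simp
qed

text \<open>Both products are s after a triangular operator: T Y = s (G Y) and Y T = s ((s Y s) G).
  Since (l, s) = 0, the reflection preserves positivity of all roots a > 0 with (l, a) nonzero, so s
  Y s is triangular with the diagonal of Y.\<close>

lemma Ts_Y_commute_dominant:
  assumes s: "s \<in> S" and l: "l \<in> Pcwpos" "l \<bullet> s = 0" and f: "f \<in> Palg"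
  shows "Ts k s (Y k l f) = Y k l (Ts k s f)"
proof -
  note Y = Y_dominant_props[OF l(1), of k]
  note sI = Some_Idx[OF s] and W = simple_Wg[OF s] and sR = simple_Rhat[OF s]
  have sp: "fst (s, 0::real) \<in> Rp" using s S_Rp by auto
  have lT: "lop (Ts k s)" "uni k (Ts k s)" using lop_Top[OF sI] uni_Top[OF sI] by auto
  obtain p "is" where r: "redexp (tau l) p is" "Y k l = (\<lambda>f. act p (wordT k is f))" using Y_dominant[OF l(1)] by blast
  have sl: "rrefl s l = l" using l by (simp add: rrefl_def coroot_inner)
  let ?C = "\<lambda>f. wact (rrefl s) (Y k l (wact (rrefl s) f))"
  have tC: "tri ?C (\<lambda>n. qpow (2 * (l \<bullet> n)) * qpow (real k * (\<Sum>a\<in>Rp. (l \<bullet> a) * eps (rrefl s a) n)))"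
  proof -
    have "rrefl s a \<in> Rp" if "a \<in> Rp" "l \<bullet> a \<noteq> 0" for a
      using simple_refl_Rp[of a s] that s l by (cases "a = s") auto
    from redexp_tau(3)[OF l(1) r(1) W this, of k] show ?thesis unfolding inv_rrefl[OF s] sl r(2) .
  qed
  have e: "(\<Sum>a\<in>Rp. (l \<bullet> a) * eps (rrefl s a) n) = (\<Sum>a\<in>Rp. (l \<bullet> a) * eps a n)" for n
    using sum_reflect[OF s, of l "\<lambda>a. eps a n"] s S_Rp l sum.remove[OF finRp, of s "\<lambda>a. (l \<bullet> a) * eps a n"]
    by (auto simp: sl)
  have lC: "lop ?C" by (rule lop_comp[OF lop_act[OF wlin_tW[OF W]] lop_comp[OF Y(1) lop_act[OF wlin_tW[OF W]]]])
  let ?d = "\<lambda>n. qpow (real k * eps s n) * ydiag k l n"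
  show ?thesis
  proof (rule unitary_triangular_unique[where ?D1.0 = "\<lambda>f. Ts k s (Y k l f)" and ?D2.0 = "\<lambda>f. Y k l (Ts k s f)"
        and ?M1.0 = "\<lambda>f. Gt k (s, 0) (Y k l f)" and ?M2.0 = "\<lambda>f. ?C (Gt k (s, 0) f)" and d = ?d,
        OF wlin_tW[OF W] _ _ _ _ _ _ _ _ _ _ _ f])
    show "lop (\<lambda>f. Ts k s (Y k l f))" "uni k (\<lambda>f. Ts k s (Y k l f))"
      by (rule lop_comp[OF lT(1) Y(1)]) (rule uni_comp[OF Y(1) lT(2) Y(2)])
    show "lop (\<lambda>f. Y k l (Ts k s f))" "uni k (\<lambda>f. Y k l (Ts k s f))"
      by (rule lop_comp[OF Y(1) lT(1)]) (rule uni_comp[OF lT(1) Y(2) lT(2)])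
    show "lop (\<lambda>f. Gt k (s, 0) (Y k l f))" by (rule lop_comp[OF lop_Gt[OF sR] Y(1)])
    show "tri (\<lambda>f. Gt k (s, 0) (Y k l f)) ?d"
      using tri_comp[OF lop_Gt[OF sR] tri_Gt[OF sR sp] Y(1,3)] by simp
    show "lop (\<lambda>f. ?C (Gt k (s, 0) f))" by (rule lop_comp[OF lC lop_Gt[OF sR]])
    show "tri (\<lambda>f. ?C (Gt k (s, 0) f)) ?d"
      by (rule tri_cong[OF tri_comp[OF lC tC lop_Gt[OF sR] tri_Gt[OF sR sp]]]) (simp_all add: e ydiag_def mult_ac)
  qed (use s lop_Palg[OF Y(1)] in \<open>auto simp: Ts_Gt wact_invol\<close>)
qed

text \<open>Because (l, s) > 0, the translation has a reduced expression that applies the reflection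
  in s first, so Y^l = D T. Both D and T Y^(s l) are s after a triangular operator with the same
  diagonal, hence they are equal.\<close>

lemma Ts_Y_Ts:
  assumes s: "s \<in> S" and l: "l \<in> Pcwpos" "l \<bullet> s = 1" and f: "f \<in> Palg"
  shows "Y k l f = Ts k s (Y k (rrefl s l) (Ts k s f))"
proof -
  note sI = Some_Idx[OF s] and W = simple_Wg[OF s] and sR = simple_Rhat[OF s]
  have sp: "s \<in> Rp" using s S_Rp by auto
  have lP: "l \<in> Pcw" "rrefl s l \<in> Pcw" using Pcwpos_Pcw l Wg_Pcw[OF W] by auto
  note Y = Y_props[OF lP(2), of k]
  have lT: "lop (Ts k s)" "uni k (Ts k s)" using lop_Top[OF sI] uni_Top[OF sI] by auto
  define g where "g = tau l \<circ> sa (Some s)"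
  have gW: "g \<in> tW" unfolding g_def by (intro tW_comp tau_tW lP sa_tW sI)
  have neg: "tau l (aroot (Some s)) \<in> Rhat_neg" using s SR l by (auto simp: tau_def Rhat_neg_iff Rhat_def)
  obtain p "is" where r: "redexp g p is" using redexp_exists[OF gW] by blast
  then have p: "p \<in> Omega" "p \<in> tW" "set is \<subseteq> Idx" "length is = alen g" "g = p \<circ> prods is"
    using Omega_tW by (auto simp: redexp_def)
  have gi: "prods is \<in> tW" by (rule prods_tW[OF p(3)])
  have r': "redexp (tau l) p (Some s # is)" by (rule redexp_Cons[OF tau_tW[OF lP(1)] sI neg r[unfolded g_def]])
  let ?D = "\<lambda>f. act p (wordT k is f)"
  have lD: "lop ?D" "uni k ?D"
    by (rule lop_comp[OF lop_act[OF p(2)] lop_wordT[OF p(3)]])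
       (rule uni_comp[OF lop_wordT[OF p(3)] uni_Omega[OF p(1)] uni_wordT[OF p(3)]])
  have Yl: "Y k l h = ?D (Ts k s h)" if "h \<in> Palg" for h
    using Y_unique[OF lP(1) redexp_tau_props[OF l(1) r'] that] by (simp add: wordT_Cons)
  have Ig: "Inv (prods is) = Inv g" using Inv_Omega_comp[OF p(1) gi] p by simp
  have I: "Inv (prods is) = sa (Some s) ` (Inv (tau l) - {(s, 0)})"
    unfolding Ig g_def using Inv_right_neg(1)[OF tau_tW[OF lP(1)] sI neg] by simp
  have mem: "fst b \<noteq> s \<and> fst b \<in> Rp" if bI: "b \<in> Inv (tau l) - {(s, 0)}" for b
  proof -
    obtain a c where b: "b = (a, c)" "a \<in> Rp" "c \<in> \<int>" "0 \<le> c" "c < l \<bullet> a" using bI unfolding Inv_tau[OF l(1)] by auto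
    have "a \<noteq> s" using b l bI by (auto elim!: Ints_cases)
    then show ?thesis using b by simp
  qed
  have pos: "id (fst b) \<in> Rp" if b: "b \<in> Inv (prods is)" for b
  proof -
    obtain b' where b': "b' \<in> Inv (tau l) - {(s, 0)}" "b = sa (Some s) b'" using b unfolding I by blast
    then show ?thesis using mem[OF b'(1)] simple_refl_Rp[of "fst b'" s] s by (simp add: sa_Some)
  qed
  have al: "alen (prods is) = length is" using p(4) Ig by (simp add: alen_Inv)
  let ?F = "\<lambda>f. act (inv (prods is)) (wordT k is f)"
  have lF: "lop ?F" by (rule lop_comp[OF lop_act[OF inv_tW[OF gi]] lop_wordT[OF p(3)]])
  have tF: "tri ?F (\<lambda>n. \<Prod>b\<in>Inv (prods is). qpow (real k * eps (fst b) n))"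
  proof -
    have w: "wlin id = (id :: 'v \<times> real \<Rightarrow> _)" by (simp add: wlin_def fun_eq_iff)
    have "tri (\<lambda>f. act (wlin id \<circ> inv (prods is)) (wordT k is (wact (inv id) f)))
        (\<lambda>n. \<Prod>b\<in>Inv (prods is). qpow (real k * eps (id (fst b)) n))"
      by (rule tri_wordT[OF p(3) al id_Wg pos])
    then show ?thesis unfolding inv_id wact_id unfolding w id_comp
      by (rule tri_cong) (simp_all only: id_apply)
  qed
  let ?M = "\<lambda>f. act (tau (rrefl s l)) (?F f)"
  have lM: "lop ?M" by (rule lop_comp[OF lop_act[OF tau_tW[OF lP(2)]] lF])
  have DM: "?D h = wact (rrefl s) (?M h)" if h: "h \<in> Palg" for h
  proof -
    have h': "wordT k is h \<in> Palg" using lop_Palg[OF lop_wordT[OF p(3)] h] .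
    have e: "wlin (rrefl s) \<circ> (tau (rrefl s l) \<circ> inv (prods is)) = p"
    proof
      fix x
      have px: "p x = tau l (wlin (rrefl s) (inv (prods is) x))"
        using p(5) gi unfolding g_def sa_wlin by (metis comp_apply tW_inv(1))
      show "(wlin (rrefl s) \<circ> (tau (rrefl s l) \<circ> inv (prods is))) x = p x"
        unfolding px using s by (simp add: tau_def wlin_def rrefl_inner_left split: prod.split)
    qed
    have "wact (rrefl s) (?M h) = act (wlin (rrefl s) \<circ> (tau (rrefl s l) \<circ> inv (prods is))) (wordT k is h)"
      using h' by (simp only: act_comp[OF tau_tW[OF lP(2)] inv_tW[OF gi] h']
          act_comp[OF wlin_tW[OF W] tW_comp[OF tau_tW[OF lP(2)] inv_tW[OF gi]] h'])
    then show ?thesis unfolding e by simp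
  qed
  \<comment> \<open>As (l, s) = 1, the only inversion over s is (s, 0), and it is removed.
    Reflecting the others turns (l, a) into (s l, a); the term at s, where s l pairs to -1, accounts
    for the extra \<open>eps s n\<close>.\<close>
  have sums: "(\<Sum>b\<in>Inv (prods is). eps (fst b) n) = eps s n + (\<Sum>a\<in>Rp. (rrefl s l \<bullet> a) * eps a n)" for n
  proof -
    have inj: "inj_on (sa (Some s)) A" for A using sa_sa[OF sI] by (metis inj_on_def)
    have fI: "finite (Inv (tau l))" by (rule finite_Inv[OF tau_tW[OF lP(1)]])
    have sI': "(s, 0) \<in> Inv (tau l)" unfolding Inv_tau[OF l(1)] using sp l by auto
    have "(\<Sum>b\<in>Inv (prods is). eps (fst b) n) = (\<Sum>b\<in>Inv (tau l) - {(s, 0)}. eps (rrefl s (fst b)) n)"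
      unfolding I sum.reindex[OF inj] by (simp add: sa_Some)
    also have "\<dots> = (\<Sum>b\<in>Inv (tau l). eps (rrefl s (fst b)) n) - eps (rrefl s s) n"
      using sum.remove[OF fI sI', of "\<lambda>b. eps (rrefl s (fst b)) n"] by simp
    also have "(\<Sum>b\<in>Inv (tau l). eps (rrefl s (fst b)) n) = (\<Sum>a\<in>Rp. (l \<bullet> a) * eps (rrefl s a) n)"
      by (rule sum_Inv_tau[OF l(1)])
    also have "\<dots> = eps (rrefl s s) n + (\<Sum>a\<in>Rp - {s}. (l \<bullet> a) * eps (rrefl s a) n)"
      using sum.remove[OF finRp sp, of "\<lambda>a. (l \<bullet> a) * eps (rrefl s a) n"] l by simp
    also have "(\<Sum>a\<in>Rp - {s}. (l \<bullet> a) * eps (rrefl s a) n) = (\<Sum>a\<in>Rp - {s}. (rrefl s l \<bullet> rrefl s a) * eps (rrefl s a) n)"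
      using s by (simp add: rrefl_inner)
    also have "\<dots> = (\<Sum>a\<in>Rp - {s}. (rrefl s l \<bullet> a) * eps a n)"
      by (rule sum.reindex_bij_betw[OF simple_refl_bij[OF s]])
    also have "\<dots> = (\<Sum>a\<in>Rp. (rrefl s l \<bullet> a) * eps a n) - (rrefl s l \<bullet> s) * eps s n"
      using sum.remove[OF finRp sp, of "\<lambda>a. (rrefl s l \<bullet> a) * eps a n"] by simp
    also have "rrefl s l \<bullet> s = - 1" using s l by (simp add: rrefl_inner_left rrefl_self)
    also have "eps (rrefl s s) n + ((\<Sum>a\<in>Rp. (rrefl s l \<bullet> a) * eps a n) - (- 1) * eps s n) - eps (rrefl s s) n
      = eps s n + (\<Sum>a\<in>Rp. (rrefl s l \<bullet> a) * eps a n)" by simp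
    finally show ?thesis .
  qed
  let ?d = "\<lambda>n. qpow (real k * eps s n) * ydiag k (rrefl s l) n"
  have "?D h = Ts k s (Y k (rrefl s l) h)" if h: "h \<in> Palg" for h
  proof (rule unitary_triangular_unique[where ?D1.0 = ?D and ?D2.0 = "\<lambda>f. Ts k s (Y k (rrefl s l) f)"
        and ?M1.0 = ?M and ?M2.0 = "\<lambda>f. Gt k (s, 0) (Y k (rrefl s l) f)" and d = ?d,
        OF wlin_tW[OF W] lD DM lM _ _ _ _ _ _ _ h])
    show "tri ?M ?d"
    proof (rule tri_cong[OF tri_comp[OF lop_act[OF tau_tW[OF lP(2)]] tri_tau[OF lP(2)] lF tF]])
      fix n assume "n \<in> Pw"
      have "(\<Prod>b\<in>Inv (prods is). qpow (real k * eps (fst b) n)) = qpow (real k * (eps s n + (\<Sum>a\<in>Rp. (rrefl s l \<bullet> a) * eps a n)))"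
        unfolding prod_qpow_eps[OF finite_Inv[OF gi]] sums ..
      also have "\<dots> = qpow (real k * eps s n) * qpow (real k * (\<Sum>a\<in>Rp. (rrefl s l \<bullet> a) * eps a n))"
        unfolding distrib_left by (rule qpow_add) (simp add: mz_Ints eps_Ints)
      finally show "qpow (2 * (rrefl s l \<bullet> n)) * (\<Prod>b\<in>Inv (prods is). qpow (real k * eps (fst b) n)) = ?d n"
        by (simp add: ydiag_def mult_ac)
    qed simp
    show "lop (\<lambda>f. Ts k s (Y k (rrefl s l) f))" "uni k (\<lambda>f. Ts k s (Y k (rrefl s l) f))"
      by (rule lop_comp[OF lT(1) Y(1)]) (rule uni_comp[OF Y(1) lT(2) Y(2)])
    show "lop (\<lambda>f. Gt k (s, 0) (Y k (rrefl s l) f))" by (rule lop_comp[OF lop_Gt[OF sR] Y(1)])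
    show "tri (\<lambda>f. Gt k (s, 0) (Y k (rrefl s l) f)) ?d"
      using tri_comp[OF lop_Gt[OF sR] tri_Gt[OF sR, of k] Y(1,3)] sp by simp
  qed (use s lop_Palg[OF Y(1)] in \<open>auto simp: Ts_Gt\<close>)
  from this[OF lop_Palg[OF lT(1) f]] show ?thesis using Yl[OF f] by simp
qed

lemma Ts_Y_commute:
  assumes s: "s \<in> S" and l: "l \<in> Pcw" "l \<bullet> s = 0" and f: "f \<in> Palg"
  shows "Ts k s (Y k l f) = Y k l (Ts k s f)"
proof -
  have lT: "lop (Ts k s)" using lop_Top[OF Some_Idx[OF s]] .
  obtain a b where ab: "a \<in> Pcwpos" "b \<in> Pcwpos" "l = a - b" "a \<bullet> s = 0" "b \<bullet> s = 0"
    using Pcw_split[OF l(1)] s l(2) by metis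
  have bP: "b \<in> Pcw" "- b \<in> Pcw" "a \<in> Pcw" using ab Pcwpos_Pcw Pcw_uminus by auto
  have inv: "Y k b (Y k (- b) h) = h" "Y k (- b) (Y k b h) = h" if "h \<in> Palg" for h
    using Y_mult[OF bP(1,2) that, of k] Y_mult[OF bP(2,1) that, of k] Y_0[OF that] by simp_all
  note YP = lop_Palg[OF Y_props(1)] and TP = lop_Palg[OF lT]
  have nb: "Ts k s (Y k (- b) h) = Y k (- b) (Ts k s h)" if h: "h \<in> Palg" for h
    using Ts_Y_commute_dominant[OF s ab(2,5) YP[OF bP(2) h, of k], of k] inv(1)[OF h] inv(2)[OF TP[OF YP[OF bP(2) h, of k]]]
    by simp
  show ?thesis
    using Y_mult[OF bP(3,2) f, of k] Y_mult[OF bP(3,2) TP[OF f], of k] nb[OF f]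
      Ts_Y_commute_dominant[OF s ab(1,4) YP[OF bP(2) f, of k], of k] ab(3) by simp
qed

text \<open>The operator g(Y) applied to f, with \<open>g\<close> in the group algebra of
  coweights.\<close>

definition evY :: "nat \<Rightarrow> ('v \<Rightarrow>\<^sub>0 K) \<Rightarrow> ('v \<Rightarrow>\<^sub>0 K) \<Rightarrow> ('v \<Rightarrow>\<^sub>0 K)" where
  "evY k g f = ext (\<lambda>l. Y k l f) g"

lemma evY_add: "evY k (g + g') f = evY k g f + evY k g' f" by (simp add: evY_def ext_add)
lemma evY_uminus: "evY k (- g) f = - evY k g f" by (simp add: evY_def ext_uminus)
lemma evY_0 [simp]: "evY k 0 f = 0" by (simp add: evY_def)
lemma evY_sum: "evY k (sum g I) f = (\<Sum>i\<in>I. evY k (g i) f)" by (simp add: evY_def ext_sum)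
lemma evY_cmul: "evY k (cst c * g) f = cst c * evY k g f" by (simp add: evY_def ext_cmul cst_def)
lemma evY_single: "evY k (sg l c) f = cst c * Y k l f" by (simp add: evY_def ext_single cst_def)

lemma lop_evY: assumes "g \<in> L Pcw" shows "lop (evY k g)"
proof -
  have "ky g \<subseteq> Pcw" using assms by (simp add: L_def)
  then show ?thesis
  proof (induction g rule: pm_induct_on)
    case zero show ?case by (simp add: lop_def)
  next
    case (single l c)
    then show ?case using Y_props(1)[of l k] by (simp add: lop_def evY_single Palg_cmul distrib_left mult.left_commute)
  next
    case (add g g')
    then show ?case by (simp add: lop_def evY_add Palg_add distrib_left)
  qed
qed

lemma L_Pcw_mult: "g \<in> L Pcw \<Longrightarrow> g' \<in> L Pcw \<Longrightarrow> g * g' \<in> L Pcw"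
  unfolding L_def using keys_mult_sub[of g g' Pcw] Pcw_add by blast

lemma evY_mult: assumes "g \<in> L Pcw" "g' \<in> L Pcw" "f \<in> Palg" shows "evY k (g * g') f = evY k g (evY k g' f)"
proof -
  have "ky g \<subseteq> Pcw" using assms by (simp add: L_def)
  then show ?thesis
  proof (induction g rule: pm_induct_on)
    case (single l c)
    have lY: "lop (Y k l)" using Y_props single by blast
    have "ky g' \<subseteq> Pcw" using assms by (simp add: L_def)
    then show ?case
    proof (induction g' rule: pm_induct_on)
      case zero show ?case using lop_0[OF lY] by (simp add: evY_single)
    next
      case (single l' c')
      then have "Y k l' f \<in> Palg" using lop_Palg[OF Y_props(1)] assms by blast
      then show ?case using single \<open>l \<in> Pcw\<close> lY assms
        by (simp add: mult_single evY_single Y_mult lop_cmul cst_mult mult.assoc)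
    next
      case (add g g')
      then have "evY k g f \<in> Palg" "evY k g' f \<in> Palg" using lop_Palg[OF lop_evY] assms by (auto simp: L_def)
      then show ?case using add lop_add[OF lY] by (simp add: evY_single evY_add distrib_left)
    qed
  qed (simp_all add: evY_add distrib_right)
qed

text \<open>The relation \<open>T g(Y) = (s g)(Y) T + (t - t\<^sup>-\<^sup>1) h(Y)\<close> with \<open>h\<close> the divided difference of \<open>g\<close>.\<close>
definition bern :: "nat \<Rightarrow> 'v \<Rightarrow> ('v \<Rightarrow>\<^sub>0 K) \<Rightarrow> ('v \<Rightarrow>\<^sub>0 K) \<Rightarrow> bool" where
  "bern k s g h \<longleftrightarrow> g \<in> L Pcw \<and> h \<in> L Pcw \<and> (1 - sg (- coroot s) 1) * h = g - wact (rrefl s) g \<and>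
    (\<forall>f\<in>Palg. Ts k s (evY k g f) = evY k (wact (rrefl s) g) (Ts k s f) + cst (qpow (real k) - qpow (- real k)) * evY k h f)"

lemma wact_L_Pcw: assumes "w \<in> Wg" "g \<in> L Pcw" shows "wact w g \<in> L Pcw"
proof -
  have "ky g \<subseteq> Pcw" using assms by (simp add: L_def)
  then show ?thesis by (induction g rule: pm_induct_on) (auto simp: act_add L_add L_single Wg_Pcw assms)
qed

lemma bern_add: assumes "s \<in> S" "bern k s g h" "bern k s g' h'" shows "bern k s (g + g') (h + h')"
proof -
  have "evY k g f \<in> Palg" "evY k g' f \<in> Palg" if "f \<in> Palg" for f
    using assms that lop_Palg[OF lop_evY] by (auto simp: bern_def)
  note P = this
  have "(1 - sg (- coroot s) 1) * (h + h') = (g - wact (rrefl s) g) + (g' - wact (rrefl s) g')"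
    using assms(2,3) unfolding bern_def distrib_left by metis
  then have "(1 - sg (- coroot s) 1) * (h + h') = g + g' - wact (rrefl s) (g + g')" by (simp add: act_add)
  then show ?thesis using assms P
    by (auto simp: bern_def L_add act_add evY_add Top_add distrib_left add_ac)
qed

text \<open>The twisted Leibniz rule for divided differences. It reduces the relation for arbitrary
  elements to generators of the coweight lattice.\<close>

lemma bern_mult: assumes s: "s \<in> S" and "bern k s g h" "bern k s g' h'"
  shows "bern k s (g * g') (h * g' + wact (rrefl s) g * h')"
proof -
  note W = simple_Wg[OF s]
  have L: "g \<in> L Pcw" "h \<in> L Pcw" "g' \<in> L Pcw" "h' \<in> L Pcw" "wact (rrefl s) g \<in> L Pcw" "wact (rrefl s) g' \<in> L Pcw"
    using assms wact_L_Pcw[OF W] by (auto simp: bern_def)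
  note P = lop_Palg[OF lop_evY]
  have lT: "lop (Ts k s)" using lop_Top[OF Some_Idx[OF s]] .
  let ?c = "cst (qpow (real k) - qpow (- real k))"
  show ?thesis unfolding bern_def
  proof (intro conjI ballI)
    show "g * g' \<in> L Pcw" "h * g' + wact (rrefl s) g * h' \<in> L Pcw" using L by (simp_all add: L_Pcw_mult L_add)
    have "(1 - sg (- coroot s) 1) * (h * g' + wact (rrefl s) g * h')
      = ((1 - sg (- coroot s) 1) * h) * g' + wact (rrefl s) g * ((1 - sg (- coroot s) 1) * h')"
      by (simp add: algebra_simps)
    also have "\<dots> = g * g' - wact (rrefl s) (g * g')"
    proof -
      have e: "(1 - sg (- coroot s) 1) * h = g - wact (rrefl s) g" "(1 - sg (- coroot s) 1) * h' = g' - wact (rrefl s) g'"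
        using assms by (simp_all only: bern_def)
      show ?thesis unfolding e wact_mult[OF W] by (simp add: algebra_simps)
    qed
    finally show "(1 - sg (- coroot s) 1) * (h * g' + wact (rrefl s) g * h') = g * g' - wact (rrefl s) (g * g')" .
    fix f assume f: "f \<in> Palg"
    have fP: "Ts k s f \<in> Palg" using lop_Palg[OF lT f] .
    have "Ts k s (evY k (g * g') f) = evY k (wact (rrefl s) g) (Ts k s (evY k g' f)) + ?c * evY k h (evY k g' f)"
      using assms P[OF L(3) f] by (simp add: evY_mult L f bern_def)
    also have "Ts k s (evY k g' f) = evY k (wact (rrefl s) g') (Ts k s f) + ?c * evY k h' f"
      using assms f by (simp add: bern_def)
    also have "evY k (wact (rrefl s) g) \<dots> = evY k (wact (rrefl s) g) (evY k (wact (rrefl s) g') (Ts k s f)) + ?c * evY k (wact (rrefl s) g) (evY k h' f)"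
      using lop_evY[OF L(5), of k] P[OF L(6) fP] P[OF L(4) f] by (simp add: lop_add lop_cmul Palg_cmul)
    finally show "Ts k s (evY k (g * g') f) = evY k (wact (rrefl s) (g * g')) (Ts k s f) + ?c * evY k (h * g' + wact (rrefl s) g * h') f"
      by (simp add: evY_add evY_mult L L_Pcw_mult f fP wact_mult[OF W] distrib_left add_ac)
  qed
qed

lemma bern_fixed: assumes "s \<in> S" "l \<in> Pcw" "l \<bullet> s = 0" shows "bern k s (sg l c) 0"
proof -
  have "rrefl s l = l" using assms by (simp add: rrefl_def coroot_inner)
  then show ?thesis using assms lop_cmul[OF lop_Top[OF Some_Idx[OF assms(1)]]] lop_Palg[OF Y_props(1)[OF assms(2)]]
    by (simp add: bern_def L_single evY_single Ts_Y_commute)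
qed

text \<open>For \<open>omega s\<close>, which pairs to 1 with s, the relation is
  \<open>Ts_Y_Ts\<close> combined with the quadratic relation. The inverse is handled by
  substituting Y^(-omega) f and solving.\<close>

lemma bern_omega: assumes s: "s \<in> S"
  shows "bern k s (sg (omega s) 1) (sg (omega s) 1)" "bern k s (sg (- omega s) 1) (- sg (- rrefl s (omega s)) 1)"
proof -
  let ?o = "omega s" let ?o' = "rrefl s (omega s)"
  let ?c = "cst (qpow (real k) - qpow (- real k))"
  have os: "?o \<bullet> s = 1" using omega[OF s s] by simp
  have oP: "?o \<in> Pcwpos" "?o \<in> Pcw" "?o' \<in> Pcw" "- ?o \<in> Pcw" "- ?o' \<in> Pcw"
    using omega_Pcwpos[OF s] Pcwpos_Pcw Wg_Pcw[OF simple_Wg[OF s]] Pcw_uminus by auto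
  have o': "?o' = ?o - coroot s" using os by (simp add: rrefl_def coroot_def)
  note TP = lop_Palg[OF lop_Top[OF Some_Idx[OF s]]] and YP = lop_Palg[OF Y_props(1)]
  have 1: "Ts k s (Y k ?o f) = Y k ?o' (Ts k s f) + ?c * Y k ?o f" if f: "f \<in> Palg" for f
  proof -
    have "Ts k s (Y k ?o f) = Ts k s (Ts k s (Y k ?o' (Ts k s f)))" using Ts_Y_Ts[OF s oP(1) os f] by simp
    also have "\<dots> = Y k ?o' (Ts k s f) + ?c * Ts k s (Y k ?o' (Ts k s f))"
      by (rule Top_quadratic[OF Some_Idx[OF s] YP[OF oP(3) TP[OF f]]])
    finally show ?thesis using Ts_Y_Ts[OF s oP(1) os f] by simp
  qed
  have 2: "Ts k s (Y k (- ?o) f) = Y k (- ?o') (Ts k s f) - ?c * Y k (- ?o') f" if f: "f \<in> Palg" for f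
  proof -
    let ?g = "Y k (- ?o) f"
    have g: "?g \<in> Palg" using YP[OF oP(4) f] .
    have e: "Y k ?o ?g = f" using Y_mult[OF oP(2,4) f, of k] Y_0[OF f] by simp
    have "Ts k s f = Y k ?o' (Ts k s ?g) + ?c * f" using 1[OF g] e by simp
    then have "Y k (- ?o') (Ts k s f) = Y k (- ?o') (Y k ?o' (Ts k s ?g)) + ?c * Y k (- ?o') f"
      using Y_props(1)[OF oP(5), of k] YP[OF oP(3) TP[OF g]] f by (simp add: lop_add lop_cmul Palg_cmul)
    also have "Y k (- ?o') (Y k ?o' (Ts k s ?g)) = Ts k s ?g"
      using Y_mult[OF oP(5,3) TP[OF g], of k] Y_0[OF TP[OF g]] by simp
    finally show ?thesis by simp
  qed
  have n: "rrefl s (- ?o) = - ?o'" by (rule linear_neg[OF linear_rrefl])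
  show "bern k s (sg ?o 1) (sg ?o 1)" unfolding bern_def
    using 1 oP by (simp add: L_single evY_single left_diff_distrib mult_single o')
  show "bern k s (sg (- ?o) 1) (- sg (- ?o') 1)" unfolding bern_def
    using 2 oP by (simp add: L_single L_uminus evY_single evY_uminus left_diff_distrib mult_single n) (simp add: o')
qed

lemma bern_omega_power: assumes s: "s \<in> S" shows "\<exists>h. bern k s (sg (of_int z *\<^sub>R omega s) 1) h"
proof -
  have nat: "\<exists>h. bern k s (sg (real n *\<^sub>R l) 1) h" if l: "\<exists>h. bern k s (sg l 1) h" for n l
  proof (induction n)
    case 0 show ?case using bern_fixed[OF s Pcw_0, of k 1] by auto
  next
    case (Suc n)
    have "sg (real (Suc n) *\<^sub>R l) (1::K) = sg l 1 * sg (real n *\<^sub>R l) 1" by (simp add: mult_single algebra_simps)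
    then show ?case using l Suc bern_mult[OF s] by metis
  qed
  show ?thesis
  proof (cases "z \<ge> 0")
    case True then show ?thesis using nat[of "omega s" "nat z"] bern_omega[OF s] by auto
  next
    case False then show ?thesis using nat[of "- omega s" "nat (- z)"] bern_omega[OF s] by auto
  qed
qed

text \<open>Every coweight is an integral multiple of \<open>omega s\<close> plus a coweight
  orthogonal to s, for which T and Y commute.\<close>

lemma bern_exists: assumes s: "s \<in> S" and g: "g \<in> L Pcw" shows "\<exists>h. bern k s g h"
proof -
  have "ky g \<subseteq> Pcw" using g by (simp add: L_def)
  then show ?thesis
  proof (induction g rule: pm_induct_on)
    case zero show ?case using bern_fixed[OF s Pcw_0, of k 0] by auto
  next
    case (single l c)
    obtain z where z: "l \<bullet> s = of_int z" using single s by (auto simp: Pcw_def elim!: Ints_cases)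
    let ?l = "l - of_int z *\<^sub>R omega s"
    have "?l \<in> Pcw" "?l \<bullet> s = 0" using single omega_Pcwpos[OF s] Pcwpos_Pcw z omega[OF s s]
      by (auto simp: Pcw_diff Pcw_scale inner_diff_left)
    from bern_fixed[OF s this, of k c] bern_omega_power[OF s, of k z]
    obtain h where "bern k s (sg ?l c * sg (of_int z *\<^sub>R omega s) 1) h" using bern_mult[OF s] by metis
    then show ?case by (auto simp: mult_single)
  next
    case (add g g')
    then show ?case using bern_add[OF s] by blast
  qed
qed

subsection \<open>The elements defining the shift operators\<close>

text \<open>The common product form of \<open>Xcal\<close> and of the elements that define
  \<open>Ycal\<close> and \<open>Ycalhat\<close>. Half-roots need not be weights, so the factors
  live in the group algebra of the whole space; only the expanded product has exponents in the
  lattice.\<close>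

definition hprod :: "('v \<Rightarrow> 'v) \<Rightarrow> K \<Rightarrow> K \<Rightarrow> ('v \<Rightarrow>\<^sub>0 K)" where
  "hprod h u v = (\<Prod>a\<in>Rp. cst u * sg ((1/2) *\<^sub>R h a) 1 - cst v * sg (- (1/2) *\<^sub>R h a) 1)"

lemma prod_single: "(\<Prod>i\<in>I. sg (f i) (1::K)) = sg (sum f I) 1"
  by (induction I rule: infinite_finite_induct) (auto simp: mult_single)

lemma hprod_expand: "hprod h u v = (\<Sum>A\<in>Pow Rp. cst (u ^ card A * (- v) ^ card (Rp - A))
   * Xm ((1/2) *\<^sub>R ((\<Sum>a\<in>A. h a) - (\<Sum>a\<in>Rp - A. h a))))"
proof -
  have "hprod h u v = (\<Prod>a\<in>Rp. cst u * sg ((1/2) *\<^sub>R h a) 1 + cst (- v) * sg (- (1/2) *\<^sub>R h a) 1)"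
    by (simp add: hprod_def cst_uminus)
  also have "\<dots> = (\<Sum>A\<in>Pow Rp. (\<Prod>a\<in>A. cst u * sg ((1/2) *\<^sub>R h a) 1) * (\<Prod>a\<in>Rp - A. cst (- v) * sg (- (1/2) *\<^sub>R h a) 1))"
    by (rule prod_add[OF finRp])
  also have "\<dots> = (\<Sum>A\<in>Pow Rp. cst (u ^ card A * (- v) ^ card (Rp - A))
   * Xm ((1/2) *\<^sub>R ((\<Sum>a\<in>A. h a) - (\<Sum>a\<in>Rp - A. h a))))"
  proof (rule sum.cong[OF refl])
    fix A
    have "(1/2) *\<^sub>R ((\<Sum>a\<in>A. h a) - (\<Sum>a\<in>Rp - A. h a)) = (\<Sum>a\<in>A. (1/2) *\<^sub>R h a) + (\<Sum>a\<in>Rp - A. - (1/2) *\<^sub>R h a)"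
      by (simp add: scaleR_sum_right scaleR_right_diff_distrib sum_negf)
    then show "(\<Prod>a\<in>A. cst u * sg ((1/2) *\<^sub>R h a) 1) * (\<Prod>a\<in>Rp - A. cst (- v) * sg (- (1/2) *\<^sub>R h a) 1)
      = cst (u ^ card A * (- v) ^ card (Rp - A)) * Xm ((1/2) *\<^sub>R ((\<Sum>a\<in>A. h a) - (\<Sum>a\<in>Rp - A. h a)))"
      unfolding prod.distrib prod_single prod_constant
      by (simp add: cst_mult Xm_def mult_ac flip: cst_power)
         (simp add: mult_single flip: mult.assoc)
  qed
  finally show ?thesis .
qed

lemma half_coroot_Pcw: "A \<subseteq> Rp \<Longrightarrow> (1/2) *\<^sub>R ((\<Sum>a\<in>A. coroot a) - (\<Sum>a\<in>Rp - A. coroot a)) \<in> Pcw"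
  unfolding half_sum_eq rhoc_def[symmetric]
  by (intro Pcw_diff rhoc_Pcw Pcw_sum coroot_Pcw) (auto intro: Rp_R)

lemma half_root_Pw: "A \<subseteq> Rp \<Longrightarrow> (1/2) *\<^sub>R ((\<Sum>a\<in>A. a) - (\<Sum>a\<in>Rp - A. a)) \<in> Pw"
  unfolding half_sum_eq rho_def[symmetric]
  by (intro Pw_diff rho_Pw Pw_sum R_Pw) (auto intro: Rp_R)

lemma hprod_coroot_L: "hprod coroot u v \<in> L Pcw"
  unfolding hprod_expand by (intro L_sum L_cst Xm_L half_coroot_Pcw) auto

lemma hprod_Palg: "hprod (\<lambda>a. a) u v \<in> Palg"
  unfolding hprod_expand Palg_L by (intro L_sum L_cst Xm_L half_root_Pw) auto

lemma Xcal_hprod: "Xcal k = hprod (\<lambda>a. a) (qpow (- real k)) (qpow (real k))"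
  by (simp add: Xcal_def hprod_expand)

lemma Ycal_evY: "Ycal k f = evY k (hprod coroot (qpow (- real k)) (qpow (real k))) f"
  unfolding Ycal_def hprod_expand evY_sum evY_cmul by (simp add: Xm_def evY_single)

lemma Ycalhat_evY: "Ycalhat k f = evY k (hprod coroot (qpow (real k)) (qpow (- real k))) f"
  unfolding Ycalhat_def hprod_expand evY_sum evY_cmul by (simp add: Xm_def evY_single)

text \<open>Splitting off the factor of a simple root; the rest is reflection invariant.\<close>
lemma hprod_simple:
  assumes s: "s \<in> S" and h: "\<And>a. h (rrefl s a) = rrefl s (h a)" "h (- s) = - h s"
  obtains E where "hprod h u v = (cst u - cst v * sg (- h s) 1) * E"
    "wact (rrefl s) (hprod h u v) = (cst u * sg (- h s) 1 - cst v) * E"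
proof -
  define Psi where "Psi = (\<Prod>a\<in>Rp - {s}. cst u * sg ((1/2) *\<^sub>R h a) 1 - cst v * sg (- (1/2) *\<^sub>R h a) 1)"
  note W = simple_Wg[OF s]
  have rs: "rrefl s (c *\<^sub>R h a) = c *\<^sub>R h (rrefl s a)" for c a using Wg_scale[OF W] h by simp
  have sP: "wact (rrefl s) Psi = Psi"
  proof -
    have "wact (rrefl s) Psi = (\<Prod>a\<in>Rp - {s}. cst u * sg ((1/2) *\<^sub>R h (rrefl s a)) 1 - cst v * sg (- (1/2) *\<^sub>R h (rrefl s a)) 1)"
      unfolding Psi_def by (simp add: wact_prod W act_diff act_cmul rs del: scaleR_minus_left)
    also have "\<dots> = Psi" unfolding Psi_def
      by (rule prod.reindex_bij_betw[OF simple_refl_bij[OF s]])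
    finally show ?thesis .
  qed
  have sp: "s \<in> Rp" using s S_Rp by auto
  have H: "hprod h u v = (cst u * sg ((1/2) *\<^sub>R h s) 1 - cst v * sg (- (1/2) *\<^sub>R h s) 1) * Psi"
    unfolding hprod_def Psi_def by (rule prod.remove[OF finRp sp])
  have hh: "sg (- h s) 1 * sg ((1/2) *\<^sub>R h s) 1 = sg (- (1/2) *\<^sub>R h s) (1::K)"
  proof -
    have "- x + (1/2) *\<^sub>R x = - (1/2) *\<^sub>R x" for x :: 'v
    proof -
      have "- x + (1/2) *\<^sub>R x = (- 1 + 1/2) *\<^sub>R x" by (simp only: scaleR_add_left scaleR_minus1_left)
      then show ?thesis by simp
    qed
    then show ?thesis unfolding mult_single by simp
  qed
  have rh: "rrefl s (h s) = - h s" using h s by (metis rrefl_self Snz)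
  have "wact (rrefl s) (hprod h u v) = (cst u * sg (- (1/2) *\<^sub>R h s) 1 - cst v * sg ((1/2) *\<^sub>R h s) 1) * Psi"
    unfolding H wact_mult[OF W] sP
    by (simp add: act_diff act_cmul Wg_scale[OF W] Wg_uminus[OF W] rh)
  then have w: "wact (rrefl s) (hprod h u v) = (cst u * sg (- h s) 1 - cst v) * (sg ((1/2) *\<^sub>R h s) 1 * Psi)"
    unfolding hh[symmetric] by (simp add: left_diff_distrib mult.assoc)
  have "hprod h u v = (cst u - cst v * sg (- h s) 1) * (sg ((1/2) *\<^sub>R h s) 1 * Psi)"
    unfolding H hh[symmetric] by (simp add: left_diff_distrib mult.assoc)
  from that[OF this w] show ?thesis .
qed

lemma coroot_ne_uminus: "s \<in> S \<Longrightarrow> - coroot s \<noteq> 0" by (simp add: coroot_def)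

text \<open>With x = X^(-coroot s), (u - v x) E minus its reflection (u x - v) E is (1 - x)(u + v)
  E. This identifies the divided difference in the Bernstein relation.\<close>

lemma hprod_bern:
  assumes s: "s \<in> S" and f: "f \<in> Palg"
  obtains E where "hprod coroot u v = (cst u - cst v * sg (- coroot s) 1) * E"
    "wact (rrefl s) (hprod coroot u v) = (cst u * sg (- coroot s) 1 - cst v) * E"
    "cst (u + v) * E \<in> L Pcw"
    "Ts k s (evY k (hprod coroot u v) f) = evY k (wact (rrefl s) (hprod coroot u v)) (Ts k s f)
      + cst (qpow (real k) - qpow (- real k)) * evY k (cst (u + v) * E) f"
proof -
  obtain E where E: "hprod coroot u v = (cst u - cst v * sg (- coroot s) 1) * E"
    "wact (rrefl s) (hprod coroot u v) = (cst u * sg (- coroot s) 1 - cst v) * E"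
    using hprod_simple[OF s, of coroot u v] simple_refl_coroot[OF s] coroot_uminus by metis
  obtain h where h: "bern k s (hprod coroot u v) h" using bern_exists[OF s hprod_coroot_L] by blast
  have "(1 - sg (- coroot s) 1) * h = hprod coroot u v - wact (rrefl s) (hprod coroot u v)"
    using h by (simp only: bern_def)
  also have "\<dots> = (1 - sg (- coroot s) 1) * (cst (u + v) * E)"
    unfolding E(2) unfolding E(1) by (simp add: cst_add algebra_simps)
  finally have "(1 - sg (- coroot s) 1) * h = (1 - sg (- coroot s) 1) * (cst (u + v) * E)" .
  then have "(sg (- coroot s) (-1) + sg 0 1) * h = (sg (- coroot s) (-1) + sg 0 1) * (cst (u + v) * E)"
    by (simp add: single_uminus)
  then have "h = cst (u + v) * E" by (rule binomial_cancel) (use coroot_ne_uminus[OF s] in auto)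
  then show ?thesis using that[of E] E h f by (simp add: bern_def)
qed

lemma Ycal_antisymmetric:
  assumes s: "s \<in> S" and f: "f \<in> Palg" "Ts k s f = cst (qpow (real k)) * f"
  shows "Ts k s (Ycal k f) = - cst (qpow (- real k)) * Ycal k f"
proof -
  let ?t = "qpow (real k)" and ?u = "qpow (- real k)" let ?g = "hprod coroot ?u ?t"
  obtain E where E: "?g = (cst ?u - cst ?t * sg (- coroot s) 1) * E"
    "wact (rrefl s) ?g = (cst ?u * sg (- coroot s) 1 - cst ?t) * E"
    "cst (?u + ?t) * E \<in> L Pcw"
    "Ts k s (evY k ?g f) = evY k (wact (rrefl s) ?g) (Ts k s f) + cst (?t - ?u) * evY k (cst (?u + ?t) * E) f"
    using hprod_bern[OF s f(1)] by metis
  have wL: "wact (rrefl s) ?g \<in> L Pcw" by (rule wact_L_Pcw[OF simple_Wg[OF s] hprod_coroot_L])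
  have "Ts k s (evY k ?g f) = evY k (cst ?t * wact (rrefl s) ?g + cst (?t - ?u) * (cst (?u + ?t) * E)) f"
    unfolding E(4) f(2) lop_cmul[OF lop_evY[OF wL] f(1)] evY_add evY_cmul ..
  \<comment> \<open>The identity t(u x - t) + (t - u)(t + u) = -u(u - t x) is where the particular
    factors of \<open>Ycal\<close> matter.\<close>
  also have "cst ?t * wact (rrefl s) ?g + cst (?t - ?u) * (cst (?u + ?t) * E) = cst (- ?u) * ?g"
    unfolding E(2) unfolding E(1) cst_diff cst_add cst_uminus by (simp add: algebra_simps)
  finally have "Ts k s (evY k ?g f) = cst (- ?u) * evY k ?g f" unfolding evY_cmul .
  then show ?thesis unfolding Ycal_evY cst_uminus .
qed

lemma Ycalhat_symmetric:
  assumes s: "s \<in> S" and f: "f \<in> Palg" "Ts k s f = - cst (qpow (- real k)) * f"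
  shows "Ts k s (Ycalhat k f) = cst (qpow (real k)) * Ycalhat k f"
proof -
  let ?t = "qpow (real k)" and ?u = "qpow (- real k)" let ?g = "hprod coroot ?t ?u"
  obtain E where E: "?g = (cst ?t - cst ?u * sg (- coroot s) 1) * E"
    "wact (rrefl s) ?g = (cst ?t * sg (- coroot s) 1 - cst ?u) * E"
    "cst (?t + ?u) * E \<in> L Pcw"
    "Ts k s (evY k ?g f) = evY k (wact (rrefl s) ?g) (Ts k s f) + cst (?t - ?u) * evY k (cst (?t + ?u) * E) f"
    using hprod_bern[OF s f(1)] by metis
  have wL: "wact (rrefl s) ?g \<in> L Pcw" by (rule wact_L_Pcw[OF simple_Wg[OF s] hprod_coroot_L])
  have f': "Ts k s f = cst (- ?u) * f" using f(2) by (simp add: cst_uminus)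
  have "Ts k s (evY k ?g f) = evY k (cst (- ?u) * wact (rrefl s) ?g + cst (?t - ?u) * (cst (?t + ?u) * E)) f"
    unfolding E(4) f' lop_cmul[OF lop_evY[OF wL] f(1)] evY_add evY_cmul ..
  \<comment> \<open>Dual to the case of \<open>Ycal\<close>: -u(t x - u) + (t - u)(t + u) = t(t - u
    x).\<close>
  also have "cst (- ?u) * wact (rrefl s) ?g + cst (?t - ?u) * (cst (?t + ?u) * E) = cst ?t * ?g"
    unfolding E(2) unfolding E(1) cst_diff cst_add cst_uminus by (simp add: algebra_simps)
  finally show ?thesis by (simp add: Ycalhat_evY evY_cmul)
qed

lemma form_Y: assumes "l \<in> Pcw" "f \<in> Palg" "g \<in> Palg" shows "form k (Y k l f) g = form k f (Y k (- l) g)"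
proof -
  have g': "Y k (- l) g \<in> Palg" using lop_Palg[OF Y_props(1)[OF Pcw_uminus[OF assms(1)]] assms(3)] .
  have "Y k l (Y k (- l) g) = g" using Y_mult[OF assms(1) Pcw_uminus[OF assms(1)] assms(3), of k] Y_0[OF assms(3)] by simp
  then show ?thesis using Y_props(2)[OF assms(1), of k] assms(2) g' unfolding uni_def by metis
qed

lemma form_evY: assumes "g \<in> L Pcw" "f \<in> Palg" "h \<in> Palg" shows "form k (evY k g f) h = form k f (evY k (star g) h)"
proof -
  have "ky g \<subseteq> Pcw" using assms by (simp add: L_def)
  then show ?thesis
  proof (induction g rule: pm_induct_on)
    case (single l c)
    then show ?case using form_Y[OF single assms(2,3)]
      by (simp add: evY_single form_cmul_left form_cmul_right sigma_sigma)
  qed (simp_all add: evY_add form_add_left form_add_right star_add)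
qed

text \<open>Inverting the exponents and exchanging u with v negates each factor. This is the sign in
  the self-adjointness of \<open>Ycal\<close> and \<open>Ycalhat\<close>.\<close>

lemma star_hprod: assumes "sigma u = v" "sigma v = u" shows "star (hprod h u v) = cst ((-1) ^ card Rp) * hprod h u v"
proof -
  have "star (\<Prod>a\<in>A. cst u * sg ((1/2) *\<^sub>R h a) 1 - cst v * sg (- (1/2) *\<^sub>R h a) 1)
     = (\<Prod>a\<in>A. - (cst u * sg ((1/2) *\<^sub>R h a) 1 - cst v * sg (- (1/2) *\<^sub>R h a) 1))" if "finite A" for A
    using that by (induction A rule: finite_induct) (auto simp: star_mult star_diff assms)
  from this[OF finRp] show ?thesis unfolding hprod_def prod_uminus by (simp only: cst_power cst_uminus cst_1)
qed

lemma form_Ycal: assumes "f \<in> Palg" "h \<in> Palg" shows "form k (Ycal k f) h = (-1) ^ card Rp * form k f (Ycal k h)"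
proof -
  have st: "star (hprod coroot (qpow (- real k)) (qpow (real k))) = cst ((-1) ^ card Rp) * hprod coroot (qpow (- real k)) (qpow (real k))"
    by (rule star_hprod) (use sigma_qpow[of "real k"] sigma_qpow[of "- real k"] in auto)
  show ?thesis unfolding Ycal_evY form_evY[OF hprod_coroot_L assms] st evY_cmul form_cmul_right
    by (simp add: sigma_power)
qed

lemma form_Ycalhat: assumes "f \<in> Palg" "h \<in> Palg" shows "form k (Ycalhat k f) h = (-1) ^ card Rp * form k f (Ycalhat k h)"
proof -
  have st: "star (hprod coroot (qpow (real k)) (qpow (- real k))) = cst ((-1) ^ card Rp) * hprod coroot (qpow (real k)) (qpow (- real k))"
    by (rule star_hprod) (use sigma_qpow[of "real k"] sigma_qpow[of "- real k"] in auto)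
  show ?thesis unfolding Ycalhat_evY form_evY[OF hprod_coroot_L assms] st evY_cmul form_cmul_right
    by (simp add: sigma_power)
qed

subsection \<open>Saturated sets of weights\<close>

text \<open>Stable under W and closed under root strings, hence preserved by every T and Y. It
  bounds supports in the dominance order, whereas \<open>low\<close> orders only by norm and
  height.\<close>

definition sat :: "'v \<Rightarrow> 'v set" where "sat x = {n \<in> Pw. \<forall>w\<in>Wg. rle (w n) x}"

lemma sat_Pw: "sat x \<subseteq> Pw" by (auto simp: sat_def)
lemma L_sat_Palg: "f \<in> L (sat x) \<Longrightarrow> f \<in> Palg" using sat_Pw[of x] by (auto simp: L_def Palg_def)
lemma sat_W: "w \<in> Wg \<Longrightarrow> n \<in> sat x \<Longrightarrow> w n \<in> sat x"
  unfolding sat_def using comp_Wg[of _ w] Wg_Pw by fastforce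
lemma sat_rle: "n \<in> sat x \<Longrightarrow> rle n x" proof -
  assume "n \<in> sat x"
  then have "\<forall>w\<in>Wg. rle (w n) x" by (simp add: sat_def)
  from bspec[OF this id_Wg] show ?thesis by simp
qed
lemma sat_dominant: "x \<in> Ppos \<Longrightarrow> x \<in> sat x" by (simp add: sat_def Ppos_Pw dominant_max)
lemma sat_mono: "rle x y \<Longrightarrow> sat x \<subseteq> sat y" unfolding sat_def using rle_trans by blast

lemma rle_root: assumes "rle n x" "a \<in> Rp" "c \<ge> 0" shows "rle (n - of_int c *\<^sub>R a) x"
proof -
  have "of_int c *\<^sub>R a \<in> Qp" using assms by (intro Qp_scale) (auto simp: Rp_iff Nats_altdef2)
  then have "(x - n) + of_int c *\<^sub>R a \<in> Qp" using assms by (intro Qp_add) (simp_all add: rle_def)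
  then show ?thesis by (simp add: rle_def algebra_simps)
qed

text \<open>After applying w, every point of the string is reached from one of the two end points by
  subtracting a nonnegative multiple of a positive root; both end points are images of n under W and
  so lie below x.\<close>

lemma sat_string:
  assumes n: "n \<in> sat x" and a: "a \<in> R" and e: "n \<bullet> coroot a = of_int e"
    and j: "0 \<le> j \<and> j \<le> e \<or> e \<le> j \<and> j \<le> 0"
  shows "n - of_int j *\<^sub>R a \<in> sat x"
  unfolding sat_def
proof (intro CollectI conjI ballI)
  show "n - of_int j *\<^sub>R a \<in> Pw" using n a sat_Pw R_Pw by (intro Pw_diff Pw_scale) auto
  fix w assume w: "w \<in> Wg"
  let ?b = "w a"
  have b: "?b \<in> R" using Wg_R w a by blast
  have wn: "w (n - of_int j *\<^sub>R a) = w n - of_int j *\<^sub>R ?b" by (simp add: Wg_diff w Wg_scale)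
  have r1: "rle (w n) x" using n w by (simp add: sat_def)
  have "rle ((rrefl ?b \<circ> w) n) x" using n comp_Wg[OF rrefl_Wg[OF b] w] unfolding sat_def by blast
  then have r2: "rle (w n - of_int e *\<^sub>R ?b) x" using e by (simp add: rrefl_def Wg_coroot[OF w] Wg_inner[OF w])
  have s: "w n - of_int j *\<^sub>R ?b = w n - of_int (- j) *\<^sub>R (- ?b)"
     "w n - of_int j *\<^sub>R ?b = (w n - of_int e *\<^sub>R ?b) - of_int (j - e) *\<^sub>R ?b"
     "w n - of_int j *\<^sub>R ?b = (w n - of_int e *\<^sub>R ?b) - of_int (e - j) *\<^sub>R (- ?b)"
    by (simp_all add: algebra_simps)
  have "rle (w n - of_int j *\<^sub>R ?b) x"
  proof (cases "?b \<in> Rp")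
    case True
    show ?thesis
    proof (cases "j \<ge> 0")
      case True then show ?thesis using rle_root[OF r1 \<open>?b \<in> Rp\<close>] by blast
    next
      case False then show ?thesis unfolding s(2) using rle_root[OF r2 \<open>?b \<in> Rp\<close>, of "j - e"] j by linarith
    qed
  next
    case False
    then have m: "- ?b \<in> Rp" using R_cases b by blast
    show ?thesis
    proof (cases "j \<le> 0")
      case True then show ?thesis unfolding s(1) using rle_root[OF r1 m, of "- j"] by simp
    next
      case False then show ?thesis unfolding s(3) using rle_root[OF r2 m, of "e - j"] j by linarith
    qed
  qed
  then show "rle (w (n - of_int j *\<^sub>R a)) x" unfolding wn .
qed

lemma Gt_sat: assumes "b \<in> Rhat" "f \<in> L (sat x)" shows "Gt k b f \<in> L (sat x)"
proof (rule lop_L[OF lop_Gt[OF assms(1)] sat_Pw _ assms(2)])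
  fix n assume n: "n \<in> sat x"
  have bR: "fst b \<in> R" using assms by (simp add: Rhat_def)
  define e where "e = \<lfloor>n \<bullet> coroot (fst b)\<rfloor>"
  have "n \<in> Pw" using n sat_Pw by blast
  then have ei: "n \<bullet> coroot (fst b) = of_int e" using Pw_int[OF _ bR, of n] by (auto simp: e_def elim!: Ints_cases)
  have "Nmono b n \<in> L (sat x)" unfolding Nmono_def Let_def e_def[symmetric]
    by (auto intro!: L_sum L_uminus Xh_string_L[OF refl] sat_string[OF n bR ei])
  then show "Gt k b (Xm n) \<in> L (sat x)" unfolding Gt_def
    using n by (auto simp: Xm_def Nop_single intro!: L_add L_cst L_single)
qed

lemma act_sat: assumes "g \<in> tW" "f \<in> L (sat x)" shows "act g f \<in> L (sat x)"
proof (rule lop_L[OF lop_act[OF assms(1)] sat_Pw _ assms(2)])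
  fix n assume n: "n \<in> sat x"
  obtain w l where "w \<in> Wg" "\<And>x. g x = (w (fst x), snd x - l \<bullet> fst x)" using tW_E[OF assms(1)] by metis
  then show "act g (Xm n) \<in> L (sat x)" using sat_W n by (simp add: act_Xm Xh_def L_single)
qed

lemma Top_sat: "i \<in> Idx \<Longrightarrow> f \<in> L (sat x) \<Longrightarrow> Top k i f \<in> L (sat x)"
  using L_sat_Palg by (simp add: Top_Gt act_sat sa_tW Gt_sat aroot_Rhat)

lemma wordT_sat: "set is \<subseteq> Idx \<Longrightarrow> f \<in> L (sat x) \<Longrightarrow> wordT k is f \<in> L (sat x)"
  by (induction "is" rule: rev_induct) (auto simp: wordT_Nil wordT_snoc Top_sat)

lemma Y_sat: assumes "l \<in> Pcw" "f \<in> L (sat x)" shows "Y k l f \<in> L (sat x)"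
proof -
  have dom: "Y k l f \<in> L (sat x)" if l: "l \<in> Pcwpos" and f: "f \<in> L (sat x)" for l f
  proof -
    obtain p "is" where r: "redexp (tau l) p is" "Y k l = (\<lambda>f. act p (wordT k is f))" using Y_dominant[OF l] by blast
    then show ?thesis using f by (simp add: redexp_def act_sat Omega_tW wordT_sat)
  qed
  show ?thesis
  proof (cases "l \<in> Pcwpos")
    case True then show ?thesis using dom assms by blast
  next
    case False
    then obtain a b where ab: "a \<in> Pcwpos" "b \<in> Pcwpos" "l = a - b"
      and E: "\<And>f. f \<in> Palg \<Longrightarrow> Y k l f \<in> Palg" "\<And>f. f \<in> Palg \<Longrightarrow> Y k b (Y k l f) = Y k a f"
      using Y_nondominant[OF assms(1), of k] by blast
    note B = Y_dominant_props[OF ab(2), of k]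
    have "\<exists>g\<in>L (sat x). Y k b g = Y k a f"
      by (rule tri_surj[OF B(1,3) _ sat_Pw _ dom[OF ab(1) assms(2)]]) (auto intro: dom ab Xm_L)
    then obtain g where g: "g \<in> L (sat x)" "Y k b g = Y k b (Y k l f)" using E(2)[OF L_sat_Palg[OF assms(2)]] by metis
    have "g - Y k l f = 0"
      using uni_inj[OF B(1,2), of "g - Y k l f"] g L_sat_Palg[OF g(1)] E(1)[OF L_sat_Palg[OF assms(2)]]
      by (simp add: Palg_diff lop_diff[OF B(1)])
    then show ?thesis using g by simp
  qed
qed

lemma evY_sat: assumes "g \<in> L Pcw" "f \<in> L (sat x)" shows "evY k g f \<in> L (sat x)"
  unfolding evY_def ext_def cst_def[symmetric]
  using assms by (intro L_sum L_cst Y_sat) (auto simp: L_def)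

lemma Ycal_sat: "f \<in> L (sat x) \<Longrightarrow> Ycal k f \<in> L (sat x)"
  and Ycalhat_sat: "f \<in> L (sat x) \<Longrightarrow> Ycalhat k f \<in> L (sat x)"
  by (simp_all add: Ycal_evY Ycalhat_evY evY_sat hprod_coroot_L)

text \<open>For the dominant conjugate w n, the sum x + w n is dominant and x - w n lies in
  \<open>Qp\<close>, so their product |x|^2 - |n|^2 is nonnegative; the height decides ties.\<close>

lemma sat_low: assumes "x \<in> Ppos" "n \<in> sat x" "n \<noteq> x" shows "n \<in> low x"
proof -
  have nP: "n \<in> Pw" using assms sat_Pw by blast
  obtain w where w: "w \<in> Wg" "w n \<in> Ppos" using dominant_rep[OF nP] by blast
  have d: "x - w n \<in> Qp" using assms w by (auto simp: sat_def rle_def)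
  have "(x + w n) \<bullet> (x - w n) \<ge> 0" using Ppos_Qp[OF Ppos_add[OF assms(1) w(2)] d] .
  then have "n \<bullet> n \<le> x \<bullet> x" using Wg_inner[OF w(1), of n n] inner_commute[of x "w n"]
    unfolding inner_add_left inner_diff_right by simp
  moreover have "x - n \<in> Qp" using sat_rle[OF assms(2)] by (simp add: rle_def)
  then have "htv \<bullet> n < htv \<bullet> x" using htv_Qp_pos[of "x - n"] assms(3) by (simp add: inner_diff_right)
  ultimately show ?thesis using nP by (auto simp: low_def)
qed

lemma finite_sat: "x \<in> Ppos \<Longrightarrow> finite (sat x)"
  by (rule finite_subset[of _ "insert x (low x)"]) (use sat_low finite_low in auto)

lemma lead_tri:
  assumes "lop F" "tri F d" "x \<in> Ppos" "f \<in> L (sat x)" shows "lk (F f) x = d x * lk f x"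
proof -
  define r where "r = f - cst (lk f x) * Xm x"
  have xP: "x \<in> Pw" using assms Ppos_Pw by blast
  have fP: "f \<in> Palg" using L_sat_Palg assms by blast
  have "ky r \<subseteq> low x"
  proof
    fix n assume n: "n \<in> ky r"
    have "n \<noteq> x" using n by (auto simp: r_def in_keys_iff lookup_minus Xm_def)
    moreover then have "lk f n \<noteq> 0" using n by (auto simp: r_def in_keys_iff lookup_minus Xm_def lookup_single when_def)
    then have "n \<in> sat x" using assms(4) L_lookup by blast
    ultimately show "n \<in> low x" using sat_low assms(3) by blast
  qed
  then have r: "r \<in> L (low x)" by (simp add: L_def)
  have z: "lk h x = 0" if "h \<in> L (low x)" for h using L_lookup[OF that, of x] by auto
  define e where "e = F (Xm x) - cst (d x) * Xm x"
  have e: "e \<in> L (low x)" using assms(2) xP by (simp add: tri_def e_def)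
  have "f = cst (lk f x) * Xm x + r" by (simp add: r_def)
  then have "F f = cst (lk f x) * F (Xm x) + F r"
    using lop_add[OF assms(1), of "cst (lk f x) * Xm x" r] lop_cmul[OF assms(1) Xm_Palg[OF xP]] L_low_Palg[OF r] Palg_cmul Xm_Palg[OF xP] by metis
  moreover have "F (Xm x) = cst (d x) * Xm x + e" by (simp add: e_def)
  ultimately have "lk (F f) x = lk f x * (d x * lk (Xm x) x + lk e x) + lk (F r) x"
    by (simp add: lookup_add)
  then show ?thesis using z[OF e] z[OF tri_low[OF assms(1,2) r]] by (simp add: Xm_def)
qed

lemma sum_Rp: "(\<Sum>a\<in>Rp. a) = 2 *\<^sub>R rho" by (simp add: rho_def)

lemma ydiag_dominant: assumes "l \<in> Pcw" "x \<in> Ppos" shows "ydiag k l x = qpow (2 * (l \<bullet> (x + real k *\<^sub>R rho)))"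
proof -
  have "(\<Sum>a\<in>Rp. (l \<bullet> a) * eps a x) = (\<Sum>a\<in>Rp. l \<bullet> a)"
    by (rule sum.cong) (use Ppos_Rp[OF assms(2)] in \<open>auto simp: eps_def\<close>)
  also have "\<dots> = 2 * (l \<bullet> rho)" using sum_Rp by (simp flip: inner_sum_right)
  finally show ?thesis using mz_times[OF _ mz_pair[OF assms(1) Ppos_Pw[OF assms(2)]], of 2]
    unfolding ydiag_def by (simp add: inner_add_right distrib_left qpow_add mult_ac)
qed

lemma hprod_eval:
  fixes c :: "'v \<Rightarrow> real"
  assumes "\<And>a. a \<in> Rp \<Longrightarrow> c a \<in> \<int>"
  shows "(\<Sum>A\<in>Pow Rp. u ^ card A * (- v) ^ card (Rp - A) * qpow (sum c A - sum c (Rp - A)))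
    = (\<Prod>a\<in>Rp. u * qpow (c a) - v * qpow (- c a))"
proof -
  have "(\<Prod>a\<in>Rp. u * qpow (c a) - v * qpow (- c a)) = (\<Prod>a\<in>Rp. u * qpow (c a) + (- v) * qpow (- c a))" by simp
  also have "\<dots> = (\<Sum>A\<in>Pow Rp. (\<Prod>a\<in>A. u * qpow (c a)) * (\<Prod>a\<in>Rp - A. (- v) * qpow (- c a)))"
    by (rule prod_add[OF finRp])
  also have "\<dots> = (\<Sum>A\<in>Pow Rp. u ^ card A * (- v) ^ card (Rp - A) * qpow (sum c A - sum c (Rp - A)))"
  proof (rule sum.cong[OF refl])
    fix A assume "A \<in> Pow Rp"
    then have m: "\<And>a. a \<in> A \<Longrightarrow> mz (c a)" "\<And>a. a \<in> Rp - A \<Longrightarrow> mz (- c a)" using assms by (auto simp: mz_Ints)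
    have mA: "mz (sum c A)" using assms \<open>A \<in> Pow Rp\<close> by (intro mz_Ints Ints_sum) auto
    have "qpow (sum c A - sum c (Rp - A)) = qpow (sum c A) * qpow (\<Sum>a\<in>Rp - A. - c a)"
      using qpow_add[OF mA, of "\<Sum>a\<in>Rp - A. - c a"] by (simp add: sum_negf)
    also have "\<dots> = (\<Prod>a\<in>A. qpow (c a)) * (\<Prod>a\<in>Rp - A. qpow (- c a))"
      using qpow_sum[of A c, OF m(1)] qpow_sum[of "Rp - A" "\<lambda>a. - c a", OF m(2)] by simp
    finally show "(\<Prod>a\<in>A. u * qpow (c a)) * (\<Prod>a\<in>Rp - A. (- v) * qpow (- c a))
      = u ^ card A * (- v) ^ card (Rp - A) * qpow (sum c A - sum c (Rp - A))"
      unfolding prod.distrib prod_constant by (simp add: mult_ac)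
  qed
  finally show ?thesis ..
qed

text \<open>The origin of \<open>ck\<close> and \<open>ckhat\<close>: on the coefficient at x, Y^l
  acts by q^(2(l, x + k rho)), so half a coroot contributes q to the power (coroot a, x + k
  rho).\<close>

lemma lead_hprod:
  assumes x: "x \<in> Ppos" and f: "f \<in> L (sat x)"
  shows "lk (evY k (hprod coroot u v) f) x
    = (\<Prod>a\<in>Rp. u * qpow (coroot a \<bullet> (x + real k *\<^sub>R rho)) - v * qpow (- (coroot a \<bullet> (x + real k *\<^sub>R rho)))) * lk f x"
proof -
  let ?c = "\<lambda>a. coroot a \<bullet> (x + real k *\<^sub>R rho)"
  have ci: "?c a \<in> \<int>" if "a \<in> Rp" for a
    using Pw_int[OF Ppos_Pw[OF x] Rp_R[OF that]] Pw_int[OF rho_Pw Rp_R[OF that]]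
    by (simp add: inner_add_right inner_commute Ints_add Ints_mult)
  have "lk (evY k (hprod coroot u v) f) x
    = (\<Sum>A\<in>Pow Rp. u ^ card A * (- v) ^ card (Rp - A) * qpow (sum ?c A - sum ?c (Rp - A)) * lk f x)"
    unfolding hprod_expand evY_sum evY_cmul lookup_sum
  proof (rule sum.cong[OF refl])
    fix A assume A: "A \<in> Pow Rp"
    let ?h = "(1/2) *\<^sub>R ((\<Sum>a\<in>A. coroot a) - (\<Sum>a\<in>Rp - A. coroot a))"
    have h: "?h \<in> Pcw" using half_coroot_Pcw A by blast
    have "2 * (?h \<bullet> (x + real k *\<^sub>R rho)) = sum ?c A - sum ?c (Rp - A)"
      by (simp add: inner_diff_left inner_sum_left)
    then have q: "ydiag k ?h x = qpow (sum ?c A - sum ?c (Rp - A))" using ydiag_dominant[OF h x, of k] by (simp only:)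
    show "lk (cst (u ^ card A * (- v) ^ card (Rp - A)) * evY k (Xm ?h) f) x
      = u ^ card A * (- v) ^ card (Rp - A) * qpow (sum ?c A - sum ?c (Rp - A)) * lk f x"
      by (simp only: Xm_def evY_single cst_1 mult_1_left lookup_cst_mult lead_tri[OF Y_props(1,3)[OF h] x f] q mult.assoc)
  qed
  then show ?thesis using hprod_eval[OF ci, where u = u and v = v] by (simp add: sum_distrib_right[symmetric])
qed

subsection \<open>Symmetric and antisymmetric elements\<close>

lemma Sym_Palg: "f \<in> Sym \<Longrightarrow> f \<in> Palg" by (simp add: Sym_def)
lemma Sym_wact: "f \<in> Sym \<Longrightarrow> w \<in> Wg \<Longrightarrow> wact w f = f" by (simp add: Sym_def)
lemma Sym_simple: assumes "f \<in> Palg" "\<And>s. s \<in> S \<Longrightarrow> wact (rrefl s) f = f" shows "f \<in> Sym"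
proof -
  have "wact w f = f" if "w \<in> Wg" for w
    using that
  proof (induction w rule: Wg_induct)
    case (step s w)
    then show ?case using assms(2)[OF step(1)] by (simp only: wact_comp[symmetric])
  qed simp
  then show ?thesis using assms by (simp add: Sym_def)
qed

lemma Sym_lookup: "f \<in> Sym \<Longrightarrow> w \<in> Wg \<Longrightarrow> lk f (w n) = lk f n"
  using lookup_wact[of w f n] by (simp add: Sym_wact)

lemma Sym_diff: "f \<in> Sym \<Longrightarrow> g \<in> Sym \<Longrightarrow> f - g \<in> Sym" by (simp add: Sym_def Palg_diff act_diff)
lemma Sym_cmul: "f \<in> Sym \<Longrightarrow> cst c * f \<in> Sym" by (simp add: Sym_def Palg_cmul act_cmul)
lemma Sym_csig: "f \<in> Sym \<Longrightarrow> csig f \<in> Sym"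
  using keys_csig_subset[of f] by (auto simp: Sym_def Palg_def wact_csig)
lemma Sym_1 [simp]: "1 \<in> Sym" by (simp add: Sym_def wlin_tW)

lemma Ts_P:
  assumes "s \<in> S" "f \<in> Palg"
  obtains P where "P \<in> Palg" "wact (rrefl s) f = f + (sg (- s) 1 - 1) * P"
    "Ts k s f = cst (qpow (real k)) * f + (cst (qpow (real k)) * sg (- s) 1 - cst (qpow (- real k))) * P"
proof -
  have x: "Xh (- aroot (Some s)) = sg (- s) 1" by (simp add: Xh_def)
  from act_sa_Pop(1,3)[OF Some_Idx[OF assms(1)] assms(2)] show ?thesis
    by (intro that[OF Pop_Palg[OF Some_Idx[OF assms(1)] assms(2)]]) (simp_all add: sa_wlin x[symmetric])
qed

lemma x_cancel: "s \<in> S \<Longrightarrow> (sg (- s) (1::K) - 1) * f = 0 \<Longrightarrow> f = 0"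
  using binomial_nonzerodivisor[of "- s" 1 0 "-1" f] by (simp add: single_uminus)

lemma Ts_sym_iff: assumes "s \<in> S" "f \<in> Palg"
  shows "Ts k s f = cst (qpow (real k)) * f \<longleftrightarrow> wact (rrefl s) f = f"
proof -
  obtain P where P: "wact (rrefl s) f = f + (sg (- s) 1 - 1) * P"
    "Ts k s f = cst (qpow (real k)) * f + (cst (qpow (real k)) * sg (- s) 1 - cst (qpow (- real k))) * P"
    using Ts_P[OF assms] by metis
  have "P = 0" if "(cst (qpow (real k)) * sg (- s) 1 - cst (qpow (- real k))) * P = 0"
  proof -
    have "cst (qpow (real k)) * sg (- s) 1 - cst (qpow (- real k)) = sg (- s) (qpow (real k)) + sg 0 (- qpow (- real k))"
      by (simp add: cst_def mult_single single_uminus)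
    then show ?thesis using binomial_nonzerodivisor[of "- s" "qpow (real k)" 0 "- qpow (- real k)" P] that assms by simp
  qed
  then show ?thesis using P x_cancel[OF assms(1), of P] by auto
qed

lemma Xcal_simple: assumes "s \<in> S" obtains E where "hprod (\<lambda>a. a) u v = (cst u - cst v * sg (- s) 1) * E"
    "wact (rrefl s) (hprod (\<lambda>a. a) u v) = (cst u * sg (- s) 1 - cst v) * E"
  using hprod_simple[OF assms, of "\<lambda>a. a" u v] by auto

lemma antisym_expand:
  fixes x t u E f g sf P :: "'a::comm_ring_1"
  shows "(x - 1) * ((t * f + (t * x - u) * P) + u * f) = (t * x - u) * (f + (x - 1) * P) + (u * x - t) * f"
  by (simp add: algebra_simps)

text \<open>The eigenvalue -t^-1 says that f and \<open>Xcal k\<close> are multiplied by the same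
  fraction under s; cross-multiplication expresses this in the group algebra.\<close>

lemma Ts_antisym_imp: assumes "s \<in> S" "f \<in> Palg" "Ts k s f = - cst (qpow (- real k)) * f"
  shows "wact (rrefl s) f * Xcal k = f * wact (rrefl s) (Xcal k)"
proof -
  let ?t = "cst (qpow (real k))" and ?u = "cst (qpow (- real k))" let ?x = "sg (- s) 1"
  obtain P where P: "wact (rrefl s) f = f + (?x - 1) * P"
    "Ts k s f = ?t * f + (?t * ?x - ?u) * P"
    using Ts_P[OF assms(1,2)] by metis
  obtain E where E: "Xcal k = (?u - ?t * ?x) * E" "wact (rrefl s) (Xcal k) = (?u * ?x - ?t) * E"
    unfolding Xcal_hprod using Xcal_simple[OF assms(1)] by metis
  have "0 = (?x - 1) * (Ts k s f + ?u * f)" using assms(3) by simp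
  also have "\<dots> = (?t * ?x - ?u) * wact (rrefl s) f + (?u * ?x - ?t) * f"
    unfolding P(2) antisym_expand unfolding P(1)[symmetric] ..
  finally have "(?u - ?t * ?x) * wact (rrefl s) f = (?u * ?x - ?t) * f" by (simp add: algebra_simps)
  then have "(?u - ?t * ?x) * wact (rrefl s) f * E = (?u * ?x - ?t) * f * E" by simp
  then show ?thesis unfolding E(2) unfolding E(1) by (simp add: mult_ac)
qed

lemma Ts_Xcal_Sym: assumes "s \<in> S" "g \<in> Sym" shows "Ts k s (Xcal k * g) = - cst (qpow (- real k)) * (Xcal k * g)"
proof -
  let ?t = "cst (qpow (real k))" and ?u = "cst (qpow (- real k))" let ?x = "sg (- s) 1" let ?f = "Xcal k * g"
  have fP: "?f \<in> Palg" unfolding Xcal_hprod using Sym_Palg assms by (intro Palg_mult hprod_Palg) auto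
  obtain P where P: "wact (rrefl s) ?f = ?f + (?x - 1) * P"
    "Ts k s ?f = ?t * ?f + (?t * ?x - ?u) * P"
    using Ts_P[OF assms(1) fP] by metis
  obtain E where E: "Xcal k = (?u - ?t * ?x) * E" "wact (rrefl s) (Xcal k) = (?u * ?x - ?t) * E"
    unfolding Xcal_hprod using Xcal_simple[OF assms(1)] by metis
  have w: "wact (rrefl s) ?f = (?u * ?x - ?t) * E * g"
    using assms by (simp add: wact_mult simple_Wg Sym_wact E(2))
  have "(?x - 1) * (Ts k s ?f + ?u * ?f) = (?t * ?x - ?u) * wact (rrefl s) ?f + (?u * ?x - ?t) * ?f"
    unfolding P(2) antisym_expand unfolding P(1)[symmetric] ..
  also have "\<dots> = 0" unfolding w unfolding E(1) by (simp add: algebra_simps)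
  finally have "Ts k s ?f + ?u * ?f = 0" by (rule x_cancel[OF assms(1)])
  then show ?thesis by (simp add: eq_neg_iff_add_eq_0)
qed

section \<open>Divisibility by \<open>Xcal\<close>\<close>

lemma hprod_cancel: assumes "u \<noteq> 0" "hprod (\<lambda>a. a) u v * f = 0" shows "f = 0"
proof -
  have "(\<Prod>a\<in>A. cst u * sg ((1/2) *\<^sub>R a) 1 - cst v * sg (- (1/2) *\<^sub>R a) 1) * f = 0 \<Longrightarrow> f = 0" if "finite A" "A \<subseteq> Rp" for A
    using that
  proof (induction A rule: finite_induct)
    case (insert a A)
    have e: "cst u * sg ((1/2) *\<^sub>R a) 1 - cst v * sg (- (1/2) *\<^sub>R a) 1 = sg ((1/2) *\<^sub>R a) u + sg (- (1/2) *\<^sub>R a) (- v)"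
      by (simp add: cst_def mult_single single_uminus)
    have a0: "a \<noteq> 0" using insert(5) by auto
    have "(1/2) *\<^sub>R a \<noteq> - (1/2) *\<^sub>R a"
    proof
      assume "(1/2) *\<^sub>R a = - (1/2) *\<^sub>R a"
      then have "(1/2) *\<^sub>R a + (1/2) *\<^sub>R a = 0" by (metis add.right_inverse scaleR_minus_left)
      then show False using a0 by (simp flip: scaleR_add_left)
    qed
    moreover have "(sg ((1/2) *\<^sub>R a) u + sg (- (1/2) *\<^sub>R a) (- v)) * ((\<Prod>a\<in>A. cst u * sg ((1/2) *\<^sub>R a) 1 - cst v * sg (- (1/2) *\<^sub>R a) 1) * f) = 0"
      using insert(4) unfolding prod.insert[OF insert(1,2)] e mult.assoc .
    ultimately have "(\<Prod>a\<in>A. cst u * sg ((1/2) *\<^sub>R a) 1 - cst v * sg (- (1/2) *\<^sub>R a) 1) * f = 0"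
      using assms(1) by (blast intro: binomial_nonzerodivisor)
    then show ?case using insert by blast
  qed simp
  from this[OF finRp] show ?thesis using assms by (simp add: hprod_def)
qed

lemma Xcal_cancel: "Xcal k * f = Xcal k * g \<Longrightarrow> f = g"
  using hprod_cancel[of "qpow (- real k)" "qpow (real k)" "f - g"] by (simp add: Xcal_hprod right_diff_distrib)

lemma wact_Xcal_cancel: assumes "w \<in> Wg" "wact w (Xcal k) * f = wact w (Xcal k) * g" shows "f = g"
proof -
  have "wact (inv w) (wact w (Xcal k) * f) = wact (inv w) (wact w (Xcal k) * g)" using assms by simp
  then have "wact (inv w) f = wact (inv w) g"
    using assms(1) Xcal_cancel by (simp add: wact_mult inv_Wg wact_inv)
  then show ?thesis using wact_inv(1)[OF assms(1)] by metis
qed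

lemma Xcal_Palg: "Xcal k \<in> Palg" by (simp add: Xcal_hprod hprod_Palg)

text \<open>In effect, h / \<open>Xcal k\<close> is invariant under W. Working with cross-multiplied
  identities and cancellation avoids forming the quotient before divisibility is known.\<close>

lemma antisym_all:
  assumes "\<And>s. s \<in> S \<Longrightarrow> wact (rrefl s) h * Xcal k = h * wact (rrefl s) (Xcal k)" "w \<in> Wg"
  shows "wact w h * Xcal k = h * wact w (Xcal k)"
  using assms(2)
proof (induction w rule: Wg_induct)
  case (step s w)
  note W = simple_Wg[OF step(1)]
  let ?s = "wact (rrefl s)" let ?X = "Xcal k"
  have 1: "?s (wact w h) * ?s ?X = ?s h * ?s (wact w ?X)" using arg_cong[OF step(3), of ?s] by (simp add: wact_mult W)
  have "?s ?X * (?s (wact w h) * ?X) = (?s (wact w h) * ?s ?X) * ?X" by (simp add: mult_ac)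
  also have "\<dots> = (?s h * ?X) * ?s (wact w ?X)" unfolding 1 by (simp add: mult_ac)
  also have "\<dots> = ?s ?X * (h * ?s (wact w ?X))" unfolding assms(1)[OF step(1)] by (simp add: mult_ac)
  finally have "?s (wact w h) * ?X = h * ?s (wact w ?X)" by (rule wact_Xcal_cancel[OF W])
  then show ?case by (simp only: wact_comp)
qed simp

lemma strip_binomials:
  fixes b b' :: "'i \<Rightarrow> 'v" and d d' :: "'i \<Rightarrow> K"
  assumes "finite I" "a \<noteq> 0" "c \<noteq> 0"
    and "\<And>i. i \<in> I \<Longrightarrow> d i \<noteq> 0 \<and> d' i \<noteq> 0 \<and> b i \<noteq> b' i \<and>
      ((\<forall>r. b' i - b i \<noteq> r *\<^sub>R a) \<or> (\<exists>j::int. b i - b' i = of_int j *\<^sub>R a \<and> d i + d' i * c powi j \<noteq> 0))"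
    and "\<exists>g. (1 - sg a c) * g = (\<Prod>i\<in>I. sg (b i) (d i) + sg (b' i) (d' i)) * f"
  shows "\<exists>g. (1 - sg a c) * g = f"
  using assms(1,4,5)
proof (induction I rule: finite_induct)
  case (insert i I)
  have "\<exists>g. (1 - sg a c) * g = (sg (b i) (d i) + sg (b' i) (d' i)) * ((\<Prod>i\<in>I. sg (b i) (d i) + sg (b' i) (d' i)) * f)"
    using insert by (simp add: mult.assoc)
  note dv = this
  have I: "d i \<noteq> 0" "d' i \<noteq> 0" "b i \<noteq> b' i"
    "(\<forall>r. b' i - b i \<noteq> r *\<^sub>R a) \<or> (\<exists>j::int. b i - b' i = of_int j *\<^sub>R a \<and> d i + d' i * c powi j \<noteq> 0)"
    using insert.prems(1)[of i] by blast+
  show ?case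
    by (rule insert.IH[OF insert.prems(1) binomial_coprime[OF assms(2,3) I(1-3) dv I(4)]]) simp
qed simp

lemma root_multiple: assumes "a \<in> R" "b \<in> R" "b = r *\<^sub>R a" shows "b = a \<or> b = - a"
  using reduced[OF assms(1), of r] assms by auto

lemma Xcal_factor: "Xcal k = cst (qpow (- real k) ^ card Rp) * sg rho 1 * (\<Prod>a\<in>Rp. 1 - sg (- a) (qpow (2 * real k)))"
proof -
  have q: "qpow (real k) = qpow (- real k) * qpow (2 * real k)"
    using qpow_add[of "- real k" "2 * real k"] by simp
  have "cst (qpow (- real k)) * sg ((1/2) *\<^sub>R a) 1 - cst (qpow (real k)) * sg (- (1/2) *\<^sub>R a) 1
    = cst (qpow (- real k)) * sg ((1/2) *\<^sub>R a) 1 * (1 - sg (- a) (qpow (2 * real k)))" for a :: 'v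
  proof -
    have "(1/2) *\<^sub>R a + - a = - (1/2) *\<^sub>R a"
    proof -
      have "(1/2) *\<^sub>R a + - a = (1/2 + - 1) *\<^sub>R a" by (simp only: scaleR_add_left scaleR_minus1_left)
      then show ?thesis by simp
    qed
    then show ?thesis unfolding q by (simp add: right_diff_distrib cst_def mult_single)
  qed
  then have "Xcal k = (\<Prod>a\<in>Rp. cst (qpow (- real k)) * sg ((1/2) *\<^sub>R a) 1 * (1 - sg (- a) (qpow (2 * real k))))"
    by (simp add: Xcal_hprod hprod_def)
  also have "\<dots> = cst (qpow (- real k) ^ card Rp) * sg (\<Sum>a\<in>Rp. (1/2) *\<^sub>R a) 1 * (\<Prod>a\<in>Rp. 1 - sg (- a) (qpow (2 * real k)))"
    unfolding prod.distrib prod_single by (simp add: cst_power)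
  finally show ?thesis by (simp add: rho_def scaleR_sum_right)
qed

lemma Xcal_0_simple: assumes "s \<in> S" shows "wact (rrefl s) (Xcal 0) = - Xcal 0"
proof -
  obtain E where E: "Xcal 0 = (cst 1 - cst 1 * sg (- s) 1) * E" "wact (rrefl s) (Xcal 0) = (cst 1 * sg (- s) 1 - cst 1) * E"
    unfolding Xcal_hprod using Xcal_simple[OF assms, of 1 1] by auto
  show ?thesis unfolding E(2) unfolding E(1) by (simp add: algebra_simps)
qed

text \<open>Apply the cross-multiplied relation to the reflection in \<open>a\<close>: 1 - t^2 X^-a
  divides \<open>Xcal k\<close>, hence also h times the reflected \<open>Xcal k\<close>. For k > 0
  it is coprime to every factor of the latter and can only divide h.\<close>

lemma antisym_root_dvd:
  assumes h: "h \<in> Palg" "\<And>s. s \<in> S \<Longrightarrow> wact (rrefl s) h * Xcal k = h * wact (rrefl s) (Xcal k)" and a: "a \<in> Rp"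
  shows "\<exists>g. (1 - sg (- a) (qpow (2 * real k))) * g = h"
proof (cases "k = 0")
  case False
  let ?t = "qpow (real k)" and ?u = "qpow (- real k)" and ?c = "qpow (2 * real k)"
  have aR: "a \<in> R" using a Rp_R by blast
  note W = rrefl_Wg[OF aR]
  have c: "?c = ?t * ?t" using qpow_add[of "real k" "real k"] unfolding mult_2 by simp
  have tu: "?t * ?u = 1" by (rule qpow_uminus) simp
  have wX: "wact (rrefl a) (Xcal k) = (\<Prod>b\<in>Rp. sg ((1/2) *\<^sub>R rrefl a b) ?u + sg (- (1/2) *\<^sub>R rrefl a b) (- ?t))"
  proof -
    have "wact (rrefl a) (cst ?u * sg ((1/2) *\<^sub>R b) 1 - cst ?t * sg (- (1/2) *\<^sub>R b) 1)
      = sg ((1/2) *\<^sub>R rrefl a b) ?u + sg (- (1/2) *\<^sub>R rrefl a b) (- ?t)" for b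
      unfolding act_diff act_cmul wact_single Wg_scale[OF W] cst_single by (simp add: single_uminus)
    then show ?thesis unfolding Xcal_hprod hprod_def wact_prod[OF W] by simp
  qed
  have dv: "\<exists>g. (1 - sg (- a) ?c) * g = (\<Prod>b\<in>Rp. sg ((1/2) *\<^sub>R rrefl a b) ?u + sg (- (1/2) *\<^sub>R rrefl a b) (- ?t)) * h"
  proof -
    have Xe: "Xcal k = (1 - sg (- a) ?c) * (cst (?u ^ card Rp) * sg rho 1 * (\<Prod>a\<in>Rp - {a}. 1 - sg (- a) ?c))"
      unfolding Xcal_factor prod.remove[OF finRp a] by (simp add: mult_ac)
    have "h * wact (rrefl a) (Xcal k) = wact (rrefl a) h * Xcal k" by (rule antisym_all[OF h(2) W, symmetric])
    also have "\<dots> = (1 - sg (- a) ?c) * (wact (rrefl a) h * (cst (?u ^ card Rp) * sg rho 1 * (\<Prod>a\<in>Rp - {a}. 1 - sg (- a) ?c)))"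
      unfolding Xe by (rule mult.left_commute)
    finally have "h * wact (rrefl a) (Xcal k) = (1 - sg (- a) ?c) * (wact (rrefl a) h * (cst (?u ^ card Rp) * sg rho 1 * (\<Prod>a\<in>Rp - {a}. 1 - sg (- a) ?c)))" .
    then show ?thesis unfolding wX[symmetric] by (intro exI) (simp only: mult.commute[of _ h])
  qed
  show ?thesis
  proof (rule strip_binomials[OF finRp _ _ _ dv])
    show "- a \<noteq> 0" "?c \<noteq> 0" using a by auto
    fix b assume b: "b \<in> Rp"
    let ?b = "rrefl a b"
    have bR: "?b \<in> R" using refl_closed aR b Rp_R by blast
    have d: "(1/2) *\<^sub>R ?b - - (1/2) *\<^sub>R ?b = ?b" "- (1/2) *\<^sub>R ?b - (1/2) *\<^sub>R ?b = - ?b"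
    proof -
      have "(1/2) *\<^sub>R ?b - - (1/2) *\<^sub>R ?b = (1/2 - - (1/2)) *\<^sub>R ?b" by (simp only: scaleR_left_diff_distrib)
      then show "(1/2) *\<^sub>R ?b - - (1/2) *\<^sub>R ?b = ?b" by simp
      then show "- (1/2) *\<^sub>R ?b - (1/2) *\<^sub>R ?b = - ?b" by (metis minus_diff_eq)
    qed
    have ne: "(1/2) *\<^sub>R ?b \<noteq> - (1/2) *\<^sub>R ?b"
    proof
      assume e: "(1/2) *\<^sub>R ?b = - (1/2) *\<^sub>R ?b"
      have "?b = 0" using d(1) unfolding e by simp
      then show False using bR R0 by simp
    qed
    have "(\<forall>r. - ?b \<noteq> r *\<^sub>R (- a)) \<or> (\<exists>j::int. ?b = of_int j *\<^sub>R (- a) \<and> ?u + (- ?t) * ?c powi j \<noteq> 0)"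
    proof (cases "\<exists>r. - ?b = r *\<^sub>R (- a)")
      case True
      then obtain r where "?b = r *\<^sub>R a" by auto
      then consider "?b = a" | "?b = - a" using root_multiple[OF aR bR] by blast
      then have "?b = - a"
      proof cases
        case 1
        then have "b = - a" using rrefl_rrefl[of a b] rrefl_self[of a] a by simp
        then show ?thesis using b a Rp_uminus by auto
      qed
      \<comment> \<open>The only factor parallel to a is the reflected factor of a itself; at X^-a =
        t^-2 it vanishes only if q^(4k) = 1.\<close>
      moreover have "?u + (- ?t) * ?c \<noteq> 0"
      proof
        assume "?u + (- ?t) * ?c = 0"
        then have u: "?u = ?t * ?c" by simp
        have "1 = ?t * ?u" by (rule tu[symmetric])
        also have "\<dots> = (?t * ?t) * ?c" unfolding u by (rule mult.assoc[symmetric])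
        also have "\<dots> = ?c * ?c" by (simp only: c)
        also have "\<dots> = qpow (2 * real k + 2 * real k)" by (rule qpow_add[symmetric]) (simp add: mz_Ints)
        finally have "2 * real k + 2 * real k = 0" using qpow_eq_1[of "2 * real k + 2 * real k"] by (simp add: mz_Ints)
        then show False using False by simp
      qed
      ultimately show ?thesis by (intro disjI2 exI[of _ 1]) simp
    qed blast
    then show "?u \<noteq> 0 \<and> - ?t \<noteq> 0 \<and> (1/2) *\<^sub>R ?b \<noteq> - (1/2) *\<^sub>R ?b \<and>
      ((\<forall>r. - (1/2) *\<^sub>R ?b - (1/2) *\<^sub>R ?b \<noteq> r *\<^sub>R (- a)) \<or>
       (\<exists>j::int. (1/2) *\<^sub>R ?b - - (1/2) *\<^sub>R ?b = of_int j *\<^sub>R (- a) \<and> ?u + (- ?t) * ?c powi j \<noteq> 0))"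
      unfolding d using ne by simp
  qed
next
  \<comment> \<open>At k = 0 the reflected \<open>Xcal\<close> is again divisible by 1 - X^-a, so
    coprimality fails. Instead h is plainly antisymmetric, and the coefficients along each line in
    direction a cancel in pairs.\<close>
  case True
  have aR: "a \<in> R" using a Rp_R by blast
  have ss: "wact (rrefl s) h = - h" if s: "s \<in> S" for s
  proof -
    have "wact (rrefl s) (Xcal k) = - Xcal k" unfolding True by (rule Xcal_0_simple[OF s])
    then have "Xcal k * wact (rrefl s) h = Xcal k * (- h)" using h(2)[OF s] by (simp add: mult.commute)
    then show ?thesis by (rule Xcal_cancel)
  qed
  have pm: "wact w h = h \<or> wact w h = - h" if "w \<in> Wg" for w
    using that
  proof (induction w rule: Wg_induct)
    case (step s w)
    then show ?case unfolding wact_comp[symmetric] using ss[OF step(1)] by (auto simp: act_uminus)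
  qed simp
  have "wact (rrefl a) h = - h"
  proof -
    obtain w s where w: "w \<in> Wg" "s \<in> S" "a = w s" using root_conj_simple[OF a] by blast
    have "rrefl a = w \<circ> rrefl s \<circ> inv w"
    proof
      fix x show "rrefl a x = (w \<circ> rrefl s \<circ> inv w) x" using Wg_rrefl[OF w(1), of s "inv w x"] w by simp
    qed
    then have e: "wact (rrefl a) h = wact w (wact (rrefl s) (wact (inv w) h))" by (simp only: wact_comp comp_assoc)
    have "wact w (wact (inv w) h) = h" by (rule wact_inv(1)[OF w(1)])
    then show ?thesis using pm[OF inv_Wg[OF w(1)]] e ss[OF w(2)] by (metis act_uminus minus_minus)
  qed
  then have anti: "lk h (rrefl a n) = - lk h n" for n
    using lookup_wact[OF rrefl_Wg[OF aR], of h n] by (metis lookup_uminus minus_minus)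
  show ?thesis unfolding True
  proof (rule line_sum_zero_imp_dvd)
    show "- a \<noteq> 0" using a by simp
    show "qpow (2 * real 0) \<noteq> 0" by simp
    fix n
    show "line_sum (- a) (qpow (2 * real 0)) h n = 0"
    proof (cases "n \<in> Pw")
      case nP: True
      obtain e where e: "n \<bullet> coroot a = of_int e" using Pw_int[OF nP aR] by (auto elim: Ints_cases)
      have r: "rrefl a (n + of_int j *\<^sub>R (- a)) = n + of_int (e - j) *\<^sub>R (- a)" for j
        by (simp add: rrefl_def e inner_diff_left coroot_self a algebra_simps) (simp only: mult_2_right scaleR_left_distrib)
      let ?J = "{j::int. n + of_int j *\<^sub>R (- a) \<in> ky h}"
      have sum: "line_sum (- a) (qpow (2 * real 0)) h n = (\<Sum>j\<in>?J. lk h (n + of_int j *\<^sub>R (- a)))"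
        by (simp add: line_sum_def)
      have flip: "lk h (n + of_int (e - j) *\<^sub>R (- a)) = - lk h (n + of_int j *\<^sub>R (- a))" for j
        using anti[of "n + of_int j *\<^sub>R (- a)"] unfolding r .
      have "(\<Sum>j\<in>?J. lk h (n + of_int j *\<^sub>R (- a))) = (\<Sum>j\<in>?J. - lk h (n + of_int j *\<^sub>R (- a)))"
      proof (rule sum.reindex_bij_witness[of _ "\<lambda>j. e - j" "\<lambda>j. e - j"])
        fix j assume "j \<in> ?J"
        then show ej: "e - j \<in> ?J" unfolding mem_Collect_eq in_keys_iff flip by simp
        show "e - j \<in> ?J" by (rule ej)
        show "- lk h (n + of_int (e - j) *\<^sub>R (- a)) = lk h (n + of_int j *\<^sub>R (- a))" unfolding flip by simp
      qed simp_all
      then have "line_sum (- a) (qpow (2 * real 0)) h n + line_sum (- a) (qpow (2 * real 0)) h n = 0"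
        unfolding sum by (simp add: sum_negf)
      then show ?thesis by (rule fract_double_zero)
    next
      case nP: False
      have "n + of_int j *\<^sub>R (- a) \<notin> ky h" for j :: int
      proof
        assume "n + of_int j *\<^sub>R (- a) \<in> ky h"
        then have "n + of_int j *\<^sub>R (- a) \<in> Pw" using h(1) by (auto simp: Palg_def)
        moreover have "of_int j *\<^sub>R a \<in> Pw" using R_Pw[OF aR] by (intro Pw_scale) auto
        ultimately have "(n + of_int j *\<^sub>R (- a)) + of_int j *\<^sub>R a \<in> Pw" by (rule Pw_add)
        then show False using nP by simp
      qed
      then show ?thesis by (simp add: line_sum_def)
    qed
  qed
qed

text \<open>The factors 1 - t^2 X^-a for distinct positive roots are pairwise coprime, since no two
  of these roots are proportional, so divisibility by each gives divisibility by their
  product.\<close>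

lemma antisym_dvd:
  assumes h: "h \<in> Palg" "\<And>s. s \<in> S \<Longrightarrow> wact (rrefl s) h * Xcal k = h * wact (rrefl s) (Xcal k)"
  shows "\<exists>g\<in>Sym. Xcal k * g = h"
proof -
  let ?c = "qpow (2 * real k)"
  have "\<exists>g. (\<Prod>a\<in>A. 1 - sg (- a) ?c) * g = h" if "finite A" "A \<subseteq> Rp" for A
    using that
  proof (induction A rule: finite_induct)
    case (insert a A)
    then obtain g where g: "(\<Prod>a\<in>A. 1 - sg (- a) ?c) * g = h" by auto
    have a: "a \<in> Rp" "A \<subseteq> Rp" using insert by auto
    have "\<exists>g'. (1 - sg (- a) ?c) * g' = g"
    proof (rule strip_binomials[OF insert(1), where b = "\<lambda>_. 0" and d = "\<lambda>_. 1" and b' = uminus and d' = "\<lambda>_. - ?c"])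
      show "- a \<noteq> 0" "?c \<noteq> 0" using a by auto
      have "(\<Prod>i\<in>A. sg 0 1 + sg (- i) (- ?c)) * g = h" unfolding g[symmetric] by (simp add: single_uminus)
      then show "\<exists>g'. (1 - sg (- a) ?c) * g' = (\<Prod>i\<in>A. sg 0 1 + sg (- i) (- ?c)) * g"
        using antisym_root_dvd[OF h a(1)] by simp
      fix b assume b: "b \<in> A"
      have "- b - 0 \<noteq> r *\<^sub>R (- a)" for r
      proof
        assume "- b - 0 = r *\<^sub>R (- a)"
        then have "b = r *\<^sub>R a" by simp
        then have "b = a \<or> b = - a" using root_multiple[of a b r] a b Rp_R by auto
        then show False using insert(2) b a Rp_uminus by auto
      qed
      then show "(1::K) \<noteq> 0 \<and> - ?c \<noteq> 0 \<and> 0 \<noteq> - b \<and> ((\<forall>r. - b - 0 \<noteq> r *\<^sub>R - a) \<or> (\<exists>j::int. 0 - - b = of_int j *\<^sub>R - a \<and> 1 + - ?c * ?c powi j \<noteq> 0))"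
        using a(2) b by (metis Rp_nz neg_equal_0_iff_equal subsetD zero_neq_one qpow_nonzero)
    qed
    then obtain g' where "(1 - sg (- a) ?c) * g' = g" by blast
    then have "(\<Prod>a\<in>A. 1 - sg (- a) ?c) * ((1 - sg (- a) ?c) * g') = h" using g by simp
    moreover have "(\<Prod>a\<in>insert a A. 1 - sg (- a) ?c) * g' = (\<Prod>a\<in>A. 1 - sg (- a) ?c) * ((1 - sg (- a) ?c) * g')"
      by (simp only: prod.insert[OF insert(1,2)] mult_ac)
    ultimately show ?case by metis
  qed auto
  from this[OF finRp subset_refl] obtain g0 where g0: "(\<Prod>a\<in>Rp. 1 - sg (- a) ?c) * g0 = h" by blast
  define g where "g = cst (inverse (qpow (- real k) ^ card Rp)) * sg (- rho) 1 * g0"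
  have Xg: "Xcal k * g = h"
  proof -
    have c1: "cst (qpow (- real k) ^ card Rp) * cst (inverse (qpow (- real k) ^ card Rp)) = 1" by (simp flip: cst_mult)
    have c2: "sg rho 1 * sg (- rho) (1::K) = 1" by (simp add: mult_single)
    have "Xcal k * g = (cst (qpow (- real k) ^ card Rp) * cst (inverse (qpow (- real k) ^ card Rp))) * (sg rho 1 * sg (- rho) 1) * ((\<Prod>a\<in>Rp. 1 - sg (- a) ?c) * g0)"
      unfolding Xcal_factor g_def by (simp only: mult_ac)
    then show ?thesis unfolding c1 c2 g0 by simp
  qed
  \<comment> \<open>The quotient was found among all finitely supported functions. Multiplication by
    \<open>Xcal k\<close>, supported on weights, respects cosets of the weight lattice, so the part
    off the lattice is annihilated and must vanish.\<close>
  define g2 where "g2 = (\<Sum>n\<in>ky g - Pw. sg n (lk g n))"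
  define g1 where "g1 = (\<Sum>n\<in>ky g \<inter> Pw. sg n (lk g n))"
  have g12: "g = g1 + g2"
  proof -
    have "g = (\<Sum>n\<in>ky g. sg n (lk g n))" by (rule pm_decomp) auto
    also have "ky g = (ky g \<inter> Pw) \<union> (ky g - Pw)" by blast
    also have "(\<Sum>n\<in>\<dots>. sg n (lk g n)) = g1 + g2" unfolding g1_def g2_def by (rule sum.union_disjoint) auto
    finally show ?thesis .
  qed
  have g1P: "g1 \<in> Palg" unfolding g1_def by (intro Palg_sum Palg_single) auto
  have k2: "ky g2 \<subseteq> - Pw" unfolding g2_def by (rule keys_sum_sub) auto
  have "Xcal k * g2 = 0"
  proof -
    have "ky (Xcal k * g2) \<subseteq> - Pw"
    proof (rule keys_mult_sub)
      fix a b assume "a \<in> ky (Xcal k)" "b \<in> ky g2"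
      then have ab: "a \<in> Pw" "b \<notin> Pw" using Xcal_Palg k2 by (auto simp: Palg_def)
      then have "a + b \<notin> Pw" using Pw_diff[of "a + b" a] by auto
      then show "a + b \<in> - Pw" by simp
    qed
    moreover have "Xcal k * g2 = h - Xcal k * g1" using Xg unfolding g12 distrib_left by (simp add: eq_diff_eq add.commute)
    then have "Xcal k * g2 \<in> Palg" using h(1) g1P Xcal_Palg by (simp add: Palg_diff Palg_mult)
    ultimately have "ky (Xcal k * g2) = {}" unfolding Palg_def by blast
    then show ?thesis by simp
  qed
  then have "g2 = 0" using Xcal_cancel[of k g2 0] by simp
  then have gP: "g \<in> Palg" using g12 g1P by simp
  have "wact w g = g" if w: "w \<in> Wg" for w
  proof (rule wact_Xcal_cancel[OF w])
    have "Xcal k * (wact w (Xcal k) * wact w g) = wact w h * Xcal k"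
      unfolding Xg[symmetric] wact_mult[OF w] by (rule mult.commute)
    also have "\<dots> = h * wact w (Xcal k)" by (rule antisym_all[OF h(2) w])
    also have "\<dots> = Xcal k * (wact w (Xcal k) * g)" unfolding Xg[symmetric] by (simp only: mult_ac)
    finally show "wact w (Xcal k) * wact w g = wact w (Xcal k) * g" by (rule Xcal_cancel)
  qed
  then have "g \<in> Sym" using gP by (simp add: Sym_def)
  then show ?thesis using Xg by blast
qed

text \<open>Any choice of roots other than all of \<open>Rp\<close> would need an exponent of
  \<open>g\<close> strictly above n.\<close>

lemma hprod_top:
  assumes "\<And>y. y \<in> ky g \<Longrightarrow> rle n y \<Longrightarrow> y = n"
  shows "lk (hprod (\<lambda>a. a) u v * g) (n + rho) = u ^ card Rp * lk g n"
proof -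
  have "lk (hprod (\<lambda>a. a) u v * g) (n + rho)
    = (\<Sum>A\<in>Pow Rp. u ^ card A * (- v) ^ card (Rp - A) * lk g (n + (\<Sum>a\<in>Rp - A. a)))"
    unfolding hprod_expand sum_distrib_right lookup_sum
  proof (rule sum.cong[OF refl])
    fix A assume "A \<in> Pow Rp"
    then have "(1/2) *\<^sub>R ((\<Sum>a\<in>A. a) - (\<Sum>a\<in>Rp - A. a)) = rho - (\<Sum>a\<in>Rp - A. a)"
      using half_sum_eq[of A "\<lambda>a. a"] by (simp add: rho_def)
    then show "lk (cst (u ^ card A * (- v) ^ card (Rp - A)) * Xm ((1/2) *\<^sub>R ((\<Sum>a\<in>A. a) - (\<Sum>a\<in>Rp - A. a))) * g) (n + rho)
      = u ^ card A * (- v) ^ card (Rp - A) * lk g (n + (\<Sum>a\<in>Rp - A. a))"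
      by (simp add: cst_Xm lookup_single_mult)
  qed
  also have "\<dots> = (\<Sum>A\<in>Pow Rp. if A = Rp then u ^ card Rp * lk g n else 0)"
  proof (rule sum.cong[OF refl])
    fix A assume A: "A \<in> Pow Rp"
    show "u ^ card A * (- v) ^ card (Rp - A) * lk g (n + (\<Sum>a\<in>Rp - A. a)) = (if A = Rp then u ^ card Rp * lk g n else 0)"
    proof (cases "A = Rp")
      case False
      let ?s = "\<Sum>a\<in>Rp - A. a"
      have sQ: "?s \<in> Qp" by (rule Qp_sum) (auto simp: Rp_iff)
      have "htv \<bullet> ?s = (\<Sum>a\<in>Rp - A. htv \<bullet> a)" by (rule inner_sum_right)
      also have "\<dots> > 0" by (rule sum_pos) (use A False htv_Rp in auto)
      finally have "?s \<noteq> 0" by auto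
      then have "n + ?s \<notin> ky g" using assms[of "n + ?s"] sQ by (auto simp: rle_def)
      then show ?thesis using False by (simp add: in_keys_iff)
    qed simp
  qed
  also have "\<dots> = u ^ card Rp * lk g n" using finRp by simp
  finally show ?thesis .
qed

text \<open>A maximal exponent of g above n survives in the product, shifted by rho. Bounds on the
  product therefore give bounds on g.\<close>

lemma hprod_lead:
  assumes u: "u \<noteq> 0" and X: "hprod (\<lambda>a. a) u v * g \<in> L (sat x)" and n: "n \<in> ky g"
  shows "rle (n + rho) x"
proof -
  let ?B = "{n' \<in> ky g. rle n n'}"
  have "finite ?B" "?B \<noteq> {}" using n by auto
  then have "Max ((\<bullet>) htv ` ?B) \<in> (\<bullet>) htv ` ?B" by (intro Max_in) auto
  then obtain n' where n': "n' \<in> ?B" "htv \<bullet> n' = Max ((\<bullet>) htv ` ?B)" by auto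
  have mx: "htv \<bullet> y \<le> htv \<bullet> n'" if "y \<in> ?B" for y using that n' by simp
  have "y = n'" if y: "y \<in> ky g" "rle n' y" for y
  proof (rule ccontr)
    assume "y \<noteq> n'"
    then have "htv \<bullet> (y - n') > 0" using htv_Qp_pos[of "y - n'"] y by (simp add: rle_def)
    moreover have "rle n y" using n' y rle_trans by blast
    ultimately show False using mx[of y] y by (simp add: inner_diff_right)
  qed
  then have "lk (hprod (\<lambda>a. a) u v * g) (n' + rho) \<noteq> 0" using hprod_top[of g n' u v] u n' by (simp add: in_keys_iff)
  then have "n' + rho \<in> sat x" using X L_lookup by blast
  then have "rle (n' + rho) x" by (rule sat_rle)
  moreover have "rle (n + rho) (n' + rho)" using n' by simp
  ultimately show ?thesis by (rule rle_trans[rotated])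
qed

lemma Xcal_sat: assumes "f \<in> L (sat x)" shows "Xcal k * f \<in> L (sat (x + rho))"
  unfolding L_def
proof (rule CollectI, rule keys_mult_sub)
  fix a b assume a: "a \<in> ky (Xcal k)" and b: "b \<in> ky f"
  have bh: "b \<in> sat x" using b assms by (auto simp: L_def)
  have "a \<in> (\<Union>A\<in>Pow Rp. {(1/2) *\<^sub>R ((\<Sum>a\<in>A. a) - (\<Sum>a\<in>Rp - A. a))})"
  proof -
    have "ky (Xcal k) \<subseteq> (\<Union>A\<in>Pow Rp. {(1/2) *\<^sub>R ((\<Sum>a\<in>A. a) - (\<Sum>a\<in>Rp - A. a))})"
      unfolding Xcal_hprod hprod_expand by (rule keys_sum_sub) (auto simp: cst_Xm)
    then show ?thesis using a by blast
  qed
  then obtain A where A: "A \<subseteq> Rp" "a = (1/2) *\<^sub>R ((\<Sum>a\<in>A. a) - (\<Sum>a\<in>Rp - A. a))" by auto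
  have aP: "a \<in> Pw" using half_root_Pw A by simp
  have half: "(1/2) *\<^sub>R (- y - y) = - y" "(1/2) *\<^sub>R (y + y) = y" for y :: 'v
  proof -
    have "- y - y = 2 *\<^sub>R (- y)" "y + y = 2 *\<^sub>R y" by (simp_all add: scaleR_2)
    then show "(1/2) *\<^sub>R (- y - y) = - y" "(1/2) *\<^sub>R (y + y) = y" by simp_all
  qed
  have "rle (w a) rho" if w: "w \<in> Wg" for w
  proof -
    \<comment> \<open>\<open>f\<close> picks the positive one of w r and -w r and permutes the
      positive roots, so 2 rho may be written with \<open>f\<close>. Then rho - w a becomes a sum of
      positive roots.\<close>
    define f where "f r = (if w r \<in> Rp then w r else - w r)" for r
    have fR: "f r \<in> Rp" if "r \<in> Rp" for r using R_cases[OF Wg_R[OF w Rp_R[OF that]]] by (auto simp: f_def)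
    have "inj_on f Rp"
    proof (rule inj_onI)
      fix r r' assume r: "r \<in> Rp" "r' \<in> Rp" "f r = f r'"
      have "w r = w r' \<or> w r = - w r'" using r(3) unfolding f_def by (metis minus_minus)
      then have "w r = w r' \<or> w r = w (- r')" by (simp only: Wg_uminus[OF w])
      then have "r = r' \<or> r = - r'" using Wg_eq_iff[OF w] by blast
      then show "r = r'" using r Rp_uminus by auto
    qed
    then have "bij_betw f Rp Rp" using fR by (metis bij_betw_def endo_inj_surj finRp image_subsetI)
    then have sf: "(\<Sum>r\<in>Rp. f r) = (\<Sum>r\<in>Rp. r)" by (rule sum.reindex_bij_betw)
    have "rho - w a = (1/2) *\<^sub>R ((\<Sum>r\<in>Rp. f r) - ((\<Sum>r\<in>A. w r) - (\<Sum>r\<in>Rp - A. w r)))"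
      unfolding sf A(2) rho_def by (simp add: Wg_scale[OF w] Wg_diff[OF w] Wg_sum[OF w] scaleR_right_diff_distrib)
    also have "(\<Sum>r\<in>Rp. f r) = (\<Sum>r\<in>A. f r) + (\<Sum>r\<in>Rp - A. f r)"
      using sum.subset_diff[OF A(1) finRp, of f] by (simp add: add.commute)
    also have "(1/2) *\<^sub>R ((\<Sum>r\<in>A. f r) + (\<Sum>r\<in>Rp - A. f r) - ((\<Sum>r\<in>A. w r) - (\<Sum>r\<in>Rp - A. w r)))
      = (\<Sum>r\<in>A. (1/2) *\<^sub>R (f r - w r)) + (\<Sum>r\<in>Rp - A. (1/2) *\<^sub>R (f r + w r))"
      by (simp add: scaleR_sum_right[symmetric] sum.distrib sum_subtractf scaleR_right_diff_distrib scaleR_add_right algebra_simps)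
    also have "\<dots> \<in> Qp"
    proof (intro Qp_add Qp_sum)
      fix r assume "r \<in> A"
      then have r: "r \<in> Rp" using A by blast
      have "(1/2) *\<^sub>R (f r - w r) = (if w r \<in> Rp then 0 else - w r)" by (simp add: f_def half)
      then show "(1/2) *\<^sub>R (f r - w r) \<in> Qp" using fR[OF r] by (auto simp: f_def Rp_iff split: if_splits)
    next
      fix r assume "r \<in> Rp - A"
      then have r: "r \<in> Rp" by blast
      have "(1/2) *\<^sub>R (f r + w r) = (if w r \<in> Rp then w r else 0)" by (simp add: f_def half)
      then show "(1/2) *\<^sub>R (f r + w r) \<in> Qp" by (auto simp: Rp_iff)
    qed
    finally show ?thesis by (simp add: rle_def)
  qed
  then show "a + b \<in> sat (x + rho)" using aP bh rle_add[of "w b" x "w a" rho for w]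
    by (auto simp: sat_def Pw_add Wg_add add.commute)
qed

subsection \<open>Antisymmetrisation\<close>

abbreviation delta :: "'v \<Rightarrow>\<^sub>0 K" where "delta \<equiv> Xcal 0"

text \<open>The sign character, read off from the Weyl denominator \<open>delta\<close>;
  \<open>cst_delta_inj\<close> makes the value unique.\<close>

definition sgn_W :: "('v \<Rightarrow> 'v) \<Rightarrow> K" where
  "sgn_W w = (SOME c. c * c = 1 \<and> wact w delta = cst c * delta)"

lemma cst_delta_inj: "cst c * delta = cst d * delta \<Longrightarrow> c = d"
proof -
  assume "cst c * delta = cst d * delta"
  then have "delta * cst c = delta * cst d" by (simp only: mult.commute)
  then have "cst c = cst d" by (rule Xcal_cancel)
  then have "lk (cst c) 0 = lk (cst d) 0" by simp
  then show "c = d" by (simp add: cst_def)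
qed

lemma sgn_W: assumes "w \<in> Wg" shows "sgn_W w * sgn_W w = 1" "wact w delta = cst (sgn_W w) * delta"
proof -
  have "\<exists>c. c * c = 1 \<and> wact w delta = cst c * delta"
    using assms
  proof (induction w rule: Wg_induct)
    case id show ?case by (rule exI[of _ 1]) simp
  next
    case (step s w)
    then obtain c where c: "c * c = 1" "wact w delta = cst c * delta" by blast
    have "wact (rrefl s \<circ> w) delta = cst (- c) * delta"
      unfolding wact_comp[symmetric] c(2) by (simp add: act_cmul Xcal_0_simple step cst_uminus)
    moreover have "(- c) * (- c) = 1" using c(1) by simp
    ultimately show ?case by blast
  qed
  from someI_ex[OF this] show "sgn_W w * sgn_W w = 1" "wact w delta = cst (sgn_W w) * delta" by (simp_all add: sgn_W_def)
qed

lemma sgn_W_comp: assumes "s \<in> S" "w \<in> Wg" shows "sgn_W (rrefl s \<circ> w) = - sgn_W w"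
proof (rule cst_delta_inj)
  have "cst (sgn_W (rrefl s \<circ> w)) * delta = wact (rrefl s) (wact w delta)"
    unfolding wact_comp using sgn_W(2)[OF comp_Wg[OF simple_Wg]] assms by simp
  then show "cst (sgn_W (rrefl s \<circ> w)) * delta = cst (- sgn_W w) * delta"
    by (simp add: sgn_W(2) assms act_cmul Xcal_0_simple cst_uminus)
qed

definition anti :: "('v \<Rightarrow>\<^sub>0 K) \<Rightarrow> ('v \<Rightarrow>\<^sub>0 K)" where
  "anti f = (\<Sum>w\<in>Wg. cst (sgn_W w) * wact w f)"

lemma anti_simple: assumes "s \<in> S" shows "wact (rrefl s) (anti f) = - anti f"
proof -
  have "wact (rrefl s) (anti f) = (\<Sum>w\<in>Wg. - (cst (sgn_W (rrefl s \<circ> w)) * wact (rrefl s \<circ> w) f))"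
    unfolding anti_def act_sum
    by (rule sum.cong[OF refl]) (simp add: act_cmul wact_comp sgn_W_comp assms cst_uminus)
  also have "\<dots> = - anti f"
    unfolding anti_def sum_negf
    by (simp add: sum.reindex_bij_betw[OF Wg_comp_bij[OF simple_Wg[OF assms]], of "\<lambda>w. cst (sgn_W w) * wact w f"])
  finally show ?thesis .
qed

lemma anti_L: assumes "f \<in> L Z" "\<And>w n. w \<in> Wg \<Longrightarrow> n \<in> Z \<Longrightarrow> w n \<in> Z" shows "anti f \<in> L Z"
proof -
  have "wact w f \<in> L Z" if w: "w \<in> Wg" for w
  proof -
    have "n \<in> Z" if "n \<in> ky (wact w f)" for n
    proof -
      have "lk f (inv w n) \<noteq> 0" using lookup_wact[OF w, of f "inv w n"] that w by (simp add: in_keys_iff)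
      then show ?thesis using assms(2)[OF w, of "inv w n"] L_lookup[OF assms(1)] w by simp
    qed
    then show ?thesis by (auto simp: L_def)
  qed
  then show ?thesis unfolding anti_def by (intro L_sum L_cst)
qed

lemma anti_dvd: assumes "f \<in> Palg" shows "\<exists>g\<in>Sym. delta * g = anti f"
proof (rule antisym_dvd)
  show "anti f \<in> Palg" using assms anti_L[of f Pw] Wg_Pw by (simp add: Palg_L)
  fix s assume "s \<in> S"
  then show "wact (rrefl s) (anti f) * delta = anti f * wact (rrefl s) delta"
    by (simp add: anti_simple Xcal_0_simple)
qed

lemma anti_sat_dvd:
  assumes "f \<in> L (sat x)"
  obtains g where "g \<in> Sym" "delta * g = anti f" "\<And>n. n \<in> ky g \<Longrightarrow> rle (n + rho) x"
proof -
  obtain g where g: "g \<in> Sym" "delta * g = anti f" using anti_dvd[OF L_sat_Palg[OF assms]] by blast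
  have "delta * g \<in> L (sat x)" unfolding g(2) by (rule anti_L[OF assms]) (rule sat_W)
  then have "rle (n + rho) x" if "n \<in> ky g" for n
    using hprod_lead[OF _ _ that, of 1 1 x] by (simp add: Xcal_hprod)
  then show ?thesis using that g by blast
qed

lemma anti_mult: assumes "\<And>w. w \<in> Wg \<Longrightarrow> wact w P = P" shows "anti (P * f) = P * anti f"
  unfolding anti_def sum_distrib_left
  by (rule sum.cong[OF refl]) (simp add: wact_mult assms mult.left_commute)

lemma of_nat_cst: "of_nat n = cst (of_nat n)"
  by (induction n) (simp_all add: cst_add)

lemma anti_delta: "anti delta = cst (of_nat (card Wg)) * delta"
proof -
  have "anti delta = (\<Sum>w\<in>Wg. delta)"
    unfolding anti_def by (rule sum.cong[OF refl]) (simp add: sgn_W(2), simp add: sgn_W(1) flip: mult.assoc cst_mult)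
  then show ?thesis by (simp add: of_nat_cst)
qed

lemma csig_delta: "csig delta = delta"
  by (simp add: Xcal_hprod hprod_def csig_prod csig_diff)

lemma bar_anti: "bar (anti f) = anti (bar f)"
  unfolding anti_def bar_sum by (rule sum.cong[OF refl]) (simp add: bar_mult wact_bar)

lemma bar_delta_cancel: "bar delta * f = bar delta * g \<Longrightarrow> f = g"
proof -
  assume "bar delta * f = bar delta * g"
  then have "bar (bar delta * f) = bar (bar delta * g)" by simp
  then have "bar f = bar g" unfolding bar_mult bar_bar by (rule Xcal_cancel)
  then show "f = g" by (metis bar_bar)
qed

lemma anti_bar_delta: "anti (bar delta * F) = bar delta * (\<Sum>w\<in>Wg. wact w F)"
  unfolding anti_def sum_distrib_left
proof (rule sum.cong[OF refl])
  fix w assume w: "w \<in> Wg"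
  have "wact w (bar delta) = cst (sgn_W w) * bar delta" by (simp add: wact_bar w sgn_W(2) bar_mult)
  then have "cst (sgn_W w) * wact w (bar delta * F) = (cst (sgn_W w) * cst (sgn_W w)) * (bar delta * wact w F)"
    by (simp add: wact_mult w mult_ac)
  then show "cst (sgn_W w) * wact w (bar delta * F) = bar delta * wact w F"
    by (simp add: sgn_W(1)[OF w] flip: cst_mult)
qed

lemma CT_average: "lk (\<Sum>w\<in>Wg. wact w F) 0 = of_nat (card Wg) * lk F 0"
  by (simp add: lookup_sum CT_act wlin_tW)

subsection \<open>The weight function and Macdonald's inner product\<close>

lemma Delta_wact: assumes "w \<in> Wg" shows "wact w (Delta k) = Delta k"
proof -
  have b: "bij_betw w R R"
    unfolding bij_betw_def
  proof
    show "inj_on w R" using Wg_eq_iff[OF assms] by (auto intro: inj_onI)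
    then show "w ` R = R" by (rule endo_inj_surj[OF finR, rotated]) (use Wg_R[OF assms] in blast)
  qed
  have "wact w (Delta k) = (\<Prod>a\<in>R. \<Prod>i<k. 1 - sg (w a) (qpow (2 * real i)))"
    unfolding Delta_def wact_prod[OF assms] by (simp add: act_diff assms wlin_tW)
  also have "\<dots> = Delta k" unfolding Delta_def by (rule prod.reindex_bij_betw[OF b])
  finally show ?thesis .
qed

lemma bar_Delta: "bar (Delta k) = Delta k"
proof -
  have b: "bij_betw uminus R R" by (rule bij_betw_byWitness[of _ uminus]) (use R_uminus in auto)
  have "bar (Delta k) = (\<Prod>a\<in>R. \<Prod>i<k. 1 - sg (- a) (qpow (2 * real i)))"
    unfolding Delta_def bar_prod by (simp add: bar_diff)
  also have "\<dots> = Delta k" unfolding Delta_def by (rule prod.reindex_bij_betw[OF b])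
  finally show ?thesis .
qed

lemma Delta_eq: "Delta k = (\<Prod>a\<in>Rp. (\<Prod>i<k. 1 - sg a (qpow (2 * real i))) * (\<Prod>i<k. 1 - sg (- a) (qpow (2 * real i))))"
proof -
  have "Rp \<inter> uminus ` Rp = {}" using Rp_uminus by auto
  then show ?thesis
    unfolding Delta_def by (subst R_eq) (simp add: prod.union_disjoint prod.reindex prod.distrib)
qed

text \<open>Compared with \<open>Delta_eq\<close>, the powers of q^2 at positive roots run through
  1, ..., k in place of 0, ..., k - 1.\<close>

lemma mu_eq: "mu k = (\<Prod>a\<in>Rp. (\<Prod>i<k. 1 - sg (- a) (qpow (2 * real i))) * (\<Prod>i<k. 1 - sg a (qpow (2 * real (Suc i)))))"
proof -
  let ?B = "Rp \<times> {..<k}"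
  let ?f = "\<lambda>(a::'v, i::nat). (a, real i)" and ?g = "\<lambda>(a::'v, i::nat). (- a, real (Suc i))"
  have D: "Dk k = ?f ` ?B \<union> ?g ` ?B"
  proof (rule set_eqI)
    fix b :: "'v \<times> real"
    obtain a c where b: "b = (a, c)" by (cases b)
    have "b \<in> Dk k \<longleftrightarrow> (\<exists>i<k. a \<in> Rp \<and> c = real i) \<or> (\<exists>i<k. - a \<in> Rp \<and> c = real (Suc i))"
    proof
      assume "b \<in> Dk k"
      then have h: "c \<in> \<int>" "a \<in> Rp \<and> 0 \<le> c \<and> c < real k \<or> - a \<in> Rp \<and> 0 < c \<and> c \<le> real k"
        by (auto simp: Dk_iff Rhat_def b)
      then have "c \<in> \<nat>" by (auto simp: Nats_altdef2)
      then obtain i where i: "c = real i" by (auto elim: Nats_cases)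
      show "(\<exists>i<k. a \<in> Rp \<and> c = real i) \<or> (\<exists>i<k. - a \<in> Rp \<and> c = real (Suc i))"
        using h(2)
      proof
        assume "- a \<in> Rp \<and> 0 < c \<and> c \<le> real k"
        then have "- a \<in> Rp" "i - 1 < k" "c = real (Suc (i - 1))" using i by auto
        then show ?thesis by blast
      qed (use i in auto)
    next
      assume h: "(\<exists>i<k. a \<in> Rp \<and> c = real i) \<or> (\<exists>i<k. - a \<in> Rp \<and> c = real (Suc i))"
      have "a \<in> R" using h Rp_R R_uminus[of "- a"] by auto
      then show "b \<in> Dk k" using h by (auto simp: Dk_iff Rhat_def b)
    qed
    also have "\<dots> \<longleftrightarrow> b \<in> ?f ` ?B \<union> ?g ` ?B"
    proof -
      have "b \<in> ?g ` ?B \<longleftrightarrow> (\<exists>i<k. - a \<in> Rp \<and> c = real (Suc i))"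
      proof
        assume "\<exists>i<k. - a \<in> Rp \<and> c = real (Suc i)"
        then obtain i where "i < k" "- a \<in> Rp" "c = real (Suc i)" by blast
        then show "b \<in> ?g ` ?B" by (intro image_eqI[of _ _ "(- a, i)"]) (auto simp: b)
      qed (auto simp: b)
      moreover have "b \<in> ?f ` ?B \<longleftrightarrow> (\<exists>i<k. a \<in> Rp \<and> c = real i)" by (auto simp: b)
      ultimately show ?thesis by blast
    qed
    finally show "b \<in> Dk k \<longleftrightarrow> b \<in> ?f ` ?B \<union> ?g ` ?B" .
  qed
  have dis: "?f ` ?B \<inter> ?g ` ?B = {}" using Rp_uminus by fastforce
  have inj: "inj_on ?f ?B" "inj_on ?g ?B" by (auto simp: inj_on_def)
  have fin: "finite (?f ` ?B)" "finite (?g ` ?B)" by auto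
  have "mu k = (\<Prod>b\<in>?f ` ?B. 1 - Xh (- b)) * (\<Prod>b\<in>?g ` ?B. 1 - Xh (- b))"
    unfolding mu_def D by (rule prod.union_disjoint[OF fin dis])
  also have "(\<Prod>b\<in>?f ` ?B. 1 - Xh (- b)) = (\<Prod>a\<in>Rp. \<Prod>i<k. 1 - sg (- a) (qpow (2 * real i)))"
    unfolding prod.reindex[OF inj(1)] prod.cartesian_product by (rule prod.cong) (auto simp: Xh_def)
  also have "(\<Prod>b\<in>?g ` ?B. 1 - Xh (- b)) = (\<Prod>a\<in>Rp. \<Prod>i<k. 1 - sg a (qpow (2 * real (Suc i))))"
    unfolding prod.reindex[OF inj(2)] prod.cartesian_product by (rule prod.cong) (auto simp: Xh_def)
  finally show ?thesis by (simp only: prod.distrib)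
qed

lemma bar_Xcal_factor: "bar (Xcal k) = cst (qpow (- real k) ^ card Rp) * sg (- rho) 1 * (\<Prod>a\<in>Rp. 1 - sg a (qpow (2 * real k)))"
  unfolding Xcal_factor bar_mult bar_prod by (simp add: bar_diff)

lemma qpow_card: "qpow (real k) ^ card Rp * qpow (- real k) ^ card Rp = 1"
  using qpow_uminus[of "real k"] by (simp flip: power_mult_distrib)

text \<open>The factors 1 - X^a of \<open>bar delta\<close> supply the missing power 0, and the
  surplus factors 1 - q^(2k) X^a of \<open>mu k\<close> form \<open>bar (Xcal k)\<close> up to a
  monomial and a scalar.\<close>

lemma delta_mu: "bar delta * mu k = cst (qpow (real k) ^ card Rp) * (Delta k * bar (Xcal k))"
proof -
  let ?q = "\<lambda>i. qpow (2 * real i)"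
  have "(1 - sg a (?q 0)) * ((\<Prod>i<k. 1 - sg (- a) (?q i)) * (\<Prod>i<k. 1 - sg a (?q (Suc i))))
     = ((\<Prod>i<k. 1 - sg a (?q i)) * (\<Prod>i<k. 1 - sg (- a) (?q i))) * (1 - sg a (?q k))" for a :: 'v
  proof -
    have e: "(1 - sg a (?q 0)) * (\<Prod>i<k. 1 - sg a (?q (Suc i))) = (\<Prod>i<k. 1 - sg a (?q i)) * (1 - sg a (?q k))"
      by (rule trans[OF prod.lessThan_Suc_shift[of "\<lambda>i. 1 - sg a (?q i)" k, symmetric] prod.lessThan_Suc[of "\<lambda>i. 1 - sg a (?q i)" k]])
    have "x * (y * z) = (x * z) * y" for x y z :: "'v \<Rightarrow>\<^sub>0 K" by (simp only: mult_ac)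
    then have "(1 - sg a (?q 0)) * ((\<Prod>i<k. 1 - sg (- a) (?q i)) * (\<Prod>i<k. 1 - sg a (?q (Suc i))))
      = ((\<Prod>i<k. 1 - sg a (?q i)) * (1 - sg a (?q k))) * (\<Prod>i<k. 1 - sg (- a) (?q i))" unfolding e[symmetric] .
    then show ?thesis by (simp only: mult_ac)
  qed
  then have "(\<Prod>a\<in>Rp. 1 - sg a (?q 0)) * mu k = Delta k * (\<Prod>a\<in>Rp. 1 - sg a (?q k))"
    unfolding mu_eq Delta_eq prod.distrib[symmetric] by simp
  moreover have "bar delta = sg (- rho) 1 * (\<Prod>a\<in>Rp. 1 - sg a (?q 0))"
    unfolding bar_Xcal_factor by simp
  ultimately have "bar delta * mu k = sg (- rho) 1 * (Delta k * (\<Prod>a\<in>Rp. 1 - sg a (?q k)))"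
    by (simp only: mult.assoc)
  also have "\<dots> = cst (qpow (real k) ^ card Rp) * cst (qpow (- real k) ^ card Rp) * (sg (- rho) 1 * (Delta k * (\<Prod>a\<in>Rp. 1 - sg a (?q k))))"
    by (simp add: qpow_card flip: cst_mult)
  also have "\<dots> = cst (qpow (real k) ^ card Rp) * (Delta k * bar (Xcal k))"
    unfolding bar_Xcal_factor by (simp only: mult_ac)
  finally show ?thesis .
qed

text \<open>The new factors 1 - q^(2k) X^a over all roots are split between \<open>Xcal k\<close>
  and its bar; this is how the parameter rises by 1.\<close>

lemma Delta_Suc: "Delta k * (bar (Xcal k) * Xcal k) = cst (qpow (- real k) ^ card Rp * qpow (- real k) ^ card Rp) * Delta (Suc k)"
proof -
  let ?c = "cst (qpow (- real k) ^ card Rp)" and ?q = "\<lambda>i. qpow (2 * real i)"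
  have r: "sg (- rho) (1::K) * sg rho 1 = 1" by (simp add: mult_single)
  have "Delta (Suc k) = Delta k * ((\<Prod>a\<in>Rp. 1 - sg a (?q k)) * (\<Prod>a\<in>Rp. 1 - sg (- a) (?q k)))"
    unfolding Delta_eq prod.distrib[symmetric] by (rule prod.cong[OF refl]) (simp only: prod.lessThan_Suc mult_ac)
  moreover have "bar (Xcal k) * Xcal k = ?c * ?c * (sg (- rho) 1 * sg rho 1) * ((\<Prod>a\<in>Rp. 1 - sg a (?q k)) * (\<Prod>a\<in>Rp. 1 - sg (- a) (?q k)))"
    unfolding bar_Xcal_factor unfolding Xcal_factor by (simp only: mult_ac)
  ultimately show ?thesis unfolding r cst_mult by (simp only: mult_ac mult_1_left mult_1_right)
qed

lemma card_Wg_nz: "(of_nat (card Wg) :: K) \<noteq> 0" using fract_of_nat_nonzero[OF card_Wg_pos] .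

text \<open>Averaging the integrand over \<open>W\<close> turns the weight \<open>mu k\<close> into \<open>Delta k\<close>; the quotient of the two weights
  is antisymmetric up to \<open>Xcal k\<close>, whence the antisymmetriser on the other argument.\<close>
lemma form_ip:
  assumes P: "P \<in> Sym" and h: "delta * h'' = anti (csig h * Xcal k)"
  shows "form k P h = qpow (real k) ^ card Rp * ip k P h''"
proof -
  let ?T = "cst (qpow (real k) ^ card Rp)"
  let ?F = "P * star h * mu k"
  have "bar delta * ?F = P * star h * (bar delta * mu k)" by (simp only: mult_ac)
  also have "\<dots> = (?T * (P * Delta k)) * bar (csig h * Xcal k)"
    unfolding delta_mu star_def bar_mult by (simp only: mult_ac)
  finally have "bar delta * (\<Sum>w\<in>Wg. wact w ?F) = anti ((?T * (P * Delta k)) * bar (csig h * Xcal k))"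
    unfolding anti_bar_delta[symmetric] by simp
  also have "\<dots> = (?T * (P * Delta k)) * anti (bar (csig h * Xcal k))"
    by (rule anti_mult) (use P in \<open>simp add: wact_mult Sym_wact Delta_wact wlin_tW act_cmul\<close>)
  also have "\<dots> = (?T * (P * Delta k)) * bar (delta * h'')" by (simp only: bar_anti[symmetric] h)
  also have "\<dots> = bar delta * (?T * (P * bar h'' * Delta k))" unfolding bar_mult by (simp only: mult_ac)
  finally have "(\<Sum>w\<in>Wg. wact w ?F) = ?T * (P * bar h'' * Delta k)" by (rule bar_delta_cancel)
  then have "of_nat (card Wg) * lk ?F 0 = qpow (real k) ^ card Rp * lk (P * bar h'' * Delta k) 0"
    using CT_average[of ?F] by simp
  then show ?thesis using card_Wg_nz by (simp add: form_def ip_def field_simps)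
qed

text \<open>The extra \<open>Xcal k\<close> completes the \<open>bar (Xcal k)\<close> left by
  \<open>delta_mu\<close>, so the averaged weight becomes \<open>Delta (Suc k)\<close> and the
  antisymmetriser acts on \<open>csig h\<close> alone.\<close>

lemma form_Xcal_ip:
  assumes P: "P \<in> Sym" and h: "delta * h'' = anti (csig h)"
  shows "form k (Xcal k * P) h = qpow (- real k) ^ card Rp * ip (Suc k) P h''"
proof -
  let ?t = "qpow (real k) ^ card Rp" and ?u = "qpow (- real k) ^ card Rp"
  let ?F = "Xcal k * P * star h * mu k"
  have "bar delta * ?F = Xcal k * P * star h * (bar delta * mu k)" by (simp only: mult_ac)
  also have "\<dots> = (cst ?t * P) * ((Delta k * (bar (Xcal k) * Xcal k)) * star h)"
    unfolding delta_mu by (simp only: mult_ac)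
  also have "\<dots> = (cst ?t * cst ?u) * cst ?u * (P * Delta (Suc k) * star h)"
    unfolding Delta_Suc cst_mult by (simp only: mult_ac)
  also have "\<dots> = (cst ?u * (P * Delta (Suc k))) * bar (csig h)"
    unfolding star_def by (simp add: qpow_card mult_ac flip: cst_mult)
  finally have "bar delta * (\<Sum>w\<in>Wg. wact w ?F) = anti ((cst ?u * (P * Delta (Suc k))) * bar (csig h))"
    unfolding anti_bar_delta[symmetric] by simp
  also have "\<dots> = (cst ?u * (P * Delta (Suc k))) * anti (bar (csig h))"
    by (rule anti_mult) (use P in \<open>simp add: wact_mult Sym_wact Delta_wact wlin_tW act_cmul\<close>)
  also have "\<dots> = (cst ?u * (P * Delta (Suc k))) * bar (delta * h'')" by (simp only: bar_anti[symmetric] h)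
  also have "\<dots> = bar delta * (cst ?u * (P * bar h'' * Delta (Suc k)))" unfolding bar_mult by (simp only: mult_ac)
  finally have "(\<Sum>w\<in>Wg. wact w ?F) = cst ?u * (P * bar h'' * Delta (Suc k))" by (rule bar_delta_cancel)
  then have "of_nat (card Wg) * lk ?F 0 = ?u * lk (P * bar h'' * Delta (Suc k)) 0"
    using CT_average[of ?F] by simp
  then show ?thesis using card_Wg_nz by (simp add: form_def ip_def field_simps)
qed

lemma ip_add_left: "ip k (f + f') g = ip k f g + ip k f' g"
  by (simp add: ip_def distrib_right lookup_add add_divide_distrib)
lemma ip_diff_left: "ip k (f - f') g = ip k f g - ip k f' g"
  by (simp add: ip_def left_diff_distrib lookup_minus diff_divide_distrib)
lemma ip_cmul_left: "ip k (cst c * f) g = c * ip k f g"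
  by (simp add: ip_def mult.assoc)
lemma ip_commute: "ip k f g = ip k g f"
proof -
  have "lk (f * bar g * Delta k) 0 = lk (bar (f * bar g * Delta k)) 0" by simp
  also have "bar (f * bar g * Delta k) = g * bar f * Delta k" by (simp add: bar_mult bar_Delta mult_ac)
  finally show ?thesis by (simp add: ip_def)
qed
lemma ip_0_left [simp]: "ip k 0 g = 0" by (simp add: ip_def)
lemma ip_sum_left: "ip k (sum f I) g = (\<Sum>i\<in>I. ip k (f i) g)"
  by (induction I rule: infinite_finite_induct) (auto simp: ip_add_left)
lemma ip_sum_right: "ip k f (sum g I) = (\<Sum>i\<in>I. ip k f (g i))"
  by (simp add: ip_commute[of k f] ip_sum_left)
lemma ip_cmul_right: "ip k f (cst c * g) = c * ip k f g"
  by (simp add: ip_commute[of k f] ip_cmul_left)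

subsection \<open>Orbit sums\<close>

lemma rlt_trans1: "rle a b \<Longrightarrow> rlt b c \<Longrightarrow> rlt a c"
  unfolding rlt_def using rle_trans rle_antisym by blast
lemma rlt_add_cancel [simp]: "rlt (a + c) (b + c) \<longleftrightarrow> rlt a b" by (simp add: rlt_def)

lemma lookup_msym: "lk (msym l) n = (if n \<in> (\<lambda>w. w l) ` Wg then 1 else 0)"
  by (simp add: msym_def lookup_sum Xm_def lookup_single when_def)

lemma msym_Sym: assumes "l \<in> Pw" shows "msym l \<in> Sym"
  unfolding Sym_def
proof (intro CollectI conjI ballI)
  show "msym l \<in> Palg" unfolding msym_def using assms Wg_Pw by (intro Palg_sum Xm_Palg) auto
  fix v assume v: "v \<in> Wg"
  have img: "v ` (\<lambda>w. w l) ` Wg = (\<lambda>w. w l) ` Wg"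
  proof
    show "v ` (\<lambda>w. w l) ` Wg \<subseteq> (\<lambda>w. w l) ` Wg"
    proof
      fix x assume "x \<in> v ` (\<lambda>w. w l) ` Wg"
      then obtain w where w: "w \<in> Wg" "x = v (w l)" by blast
      then show "x \<in> (\<lambda>w. w l) ` Wg" using comp_Wg[OF v w(1)] by (intro image_eqI[of _ _ "v \<circ> w"]) simp_all
    qed
    show "(\<lambda>w. w l) ` Wg \<subseteq> v ` (\<lambda>w. w l) ` Wg"
    proof
      fix x assume "x \<in> (\<lambda>w. w l) ` Wg"
      then obtain w where w: "w \<in> Wg" "x = w l" by blast
      have "(inv v \<circ> w) l \<in> (\<lambda>w. w l) ` Wg" using comp_Wg[OF inv_Wg[OF v] w(1)] by blast
      then show "x \<in> v ` (\<lambda>w. w l) ` Wg" using w v by (intro image_eqI[of _ _ "(inv v \<circ> w) l"]) auto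
    qed
  qed
  have inj: "inj_on v ((\<lambda>w. w l) ` Wg)" using Wg_eq_iff[OF v] by (auto intro: inj_onI)
  have "wact v (msym l) = (\<Sum>n\<in>(\<lambda>w. w l) ` Wg. Xm (v n))" unfolding msym_def act_sum by (simp add: Xm_def)
  also have "\<dots> = (\<Sum>n\<in>v ` (\<lambda>w. w l) ` Wg. Xm n)" unfolding sum.reindex[OF inj] by simp
  finally show "wact v (msym l) = msym l" unfolding img msym_def .
qed

lemma keys_msym: "l \<in> Ppos \<Longrightarrow> n \<in> ky (msym l) \<Longrightarrow> rle n l"
  using dominant_max by (auto simp: in_keys_iff lookup_msym split: if_splits)

lemma lookup_msym_Ppos: "l \<in> Ppos \<Longrightarrow> n \<in> Ppos \<Longrightarrow> lk (msym l) n = (if n = l then 1 else 0)"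
proof -
  assume l: "l \<in> Ppos" and n: "n \<in> Ppos"
  have "l \<in> (\<lambda>w. w l) ` Wg" by (rule image_eqI[of _ _ id]) auto
  moreover have "n = l" if "n \<in> (\<lambda>w. w l) ` Wg" using that dominant_unique[OF l] n by auto
  ultimately show ?thesis by (auto simp: lookup_msym)
qed

lemma csig_msym: "csig (msym l) = msym l" by (simp add: msym_def csig_sum Xm_def)

lemma Sym_rep:
  assumes "f \<in> Sym" "n \<in> ky f"
  obtains n' w where "n' \<in> ky f" "n' \<in> Ppos" "w \<in> Wg" "n = w n'" "rle n n'"
proof -
  have "n \<in> Pw" using assms by (auto simp: Sym_def Palg_def)
  then obtain w where w: "w \<in> Wg" "w n \<in> Ppos" using dominant_rep by blast
  have "w n \<in> ky f" using Sym_lookup[OF assms(1) w(1)] assms(2) by (simp add: in_keys_iff)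
  moreover have "rle (inv w (w n)) (w n)" by (rule dominant_max[OF w(2) inv_Wg[OF w(1)]])
  then have "rle n (w n)" using w by simp
  ultimately show ?thesis using that[of "w n" "inv w"] w inv_Wg by simp
qed

lemma Sym_sat: assumes "f \<in> Sym" "\<And>n. n \<in> ky f \<Longrightarrow> rle n x" shows "f \<in> L (sat x)"
  unfolding L_def sat_def
proof (intro CollectI subsetI conjI ballI)
  fix n assume n: "n \<in> ky f"
  show "n \<in> Pw" using assms(1) n by (auto simp: Sym_def Palg_def)
  fix w assume "w \<in> Wg"
  then have "w n \<in> ky f" using Sym_lookup[OF assms(1)] n by (simp add: in_keys_iff)
  then show "rle (w n) x" by (rule assms(2))
qed

lemma Sym_expand: assumes "f \<in> Sym" shows "f = (\<Sum>n\<in>ky f \<inter> Ppos. cst (lk f n) * msym n)"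
proof (rule poly_mapping_eqI)
  fix n
  have s: "lk (\<Sum>n\<in>ky f \<inter> Ppos. cst (lk f n) * msym n) n = (\<Sum>y\<in>ky f \<inter> Ppos. lk f y * lk (msym y) n)"
    by (simp add: lookup_sum)
  show "lk f n = lk (\<Sum>n\<in>ky f \<inter> Ppos. cst (lk f n) * msym n) n"
  proof (cases "n \<in> ky f")
    case True
    obtain n' w where n': "n' \<in> ky f" "n' \<in> Ppos" "w \<in> Wg" "n = w n'" by (rule Sym_rep[OF assms True])
    have "(\<Sum>y\<in>ky f \<inter> Ppos. lk f y * lk (msym y) n) = (\<Sum>y\<in>ky f \<inter> Ppos. if y = n' then lk f n' else 0)"
    proof (rule sum.cong[OF refl])
      fix y assume y: "y \<in> ky f \<inter> Ppos"
      have "lk (msym y) n = lk (msym y) n'" using Sym_lookup[OF msym_Sym n'(3)] y Ppos_Pw n'(4) by blast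
      then show "lk f y * lk (msym y) n = (if y = n' then lk f n' else 0)"
        using lookup_msym_Ppos[of y n'] y n' by auto
    qed
    also have "\<dots> = lk f n'" using n' by simp
    finally show ?thesis unfolding s using Sym_lookup[OF assms n'(3)] n'(4) by simp
  next
    case False
    have "lk (msym y) n = 0" if y: "y \<in> ky f \<inter> Ppos" for y
    proof (rule ccontr)
      assume "lk (msym y) n \<noteq> 0"
      then obtain w where "w \<in> Wg" "n = w y" by (auto simp: lookup_msym split: if_splits)
      then show False using Sym_lookup[OF assms, of w y] y False by (simp add: in_keys_iff)
    qed
    then show ?thesis unfolding s using False by (simp add: in_keys_iff)
  qed
qed

lemma ip_Sym_zero: assumes "f \<in> Sym" "\<And>n. n \<in> ky f \<Longrightarrow> n \<in> Ppos \<Longrightarrow> ip k g (msym n) = 0" shows "ip k g f = 0"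
proof -
  have "ip k g f = (\<Sum>n\<in>ky f \<inter> Ppos. lk f n * ip k g (msym n))"
    using arg_cong[OF Sym_expand[OF assms(1)], of "ip k g"] by (simp add: ip_sum_right ip_cmul_right)
  also have "\<dots> = 0" by (rule sum.neutral) (use assms(2) in auto)
  finally show ?thesis .
qed

subsection \<open>Comparison of the two inner products\<close>

text \<open>For arbitrary h, pairing symmetric elements with h is represented by a symmetric
  \<open>h''\<close> with the same dominance bound. Multiplication by \<open>Xcal k\<close> raises
  the bound by rho and division by \<open>delta\<close> lowers it again.\<close>

lemma form_sat_ip:
  assumes "h \<in> L (sat x)"
  obtains h'' where "h'' \<in> Sym" "\<And>n. n \<in> ky h'' \<Longrightarrow> rle n x"
    "\<And>P. P \<in> Sym \<Longrightarrow> form k P h = qpow (real k) ^ card Rp * ip k P h''"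
proof -
  have "Xcal k * csig h \<in> L (sat (x + rho))" by (rule Xcal_sat[OF L_csig[OF assms]])
  then obtain g where g: "g \<in> Sym" "delta * g = anti (csig h * Xcal k)" "\<And>n. n \<in> ky g \<Longrightarrow> rle (n + rho) (x + rho)"
    using anti_sat_dvd unfolding mult.commute[of "csig h"] by metis
  show ?thesis using that[OF g(1)] form_ip[OF _ g(2)] g(3) by simp
qed

text \<open>Here only the division by \<open>delta\<close> takes place, so the representing element
  lies lower by rho.\<close>

lemma form_Xcal_sat_ip:
  assumes "h \<in> L (sat x)"
  obtains h'' where "h'' \<in> Sym" "\<And>n. n \<in> ky h'' \<Longrightarrow> rle (n + rho) x"
    "\<And>P. P \<in> Sym \<Longrightarrow> form k (Xcal k * P) h = qpow (- real k) ^ card Rp * ip (Suc k) P h''"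
proof -
  obtain g where g: "g \<in> Sym" "delta * g = anti (csig h)" "\<And>n. n \<in> ky g \<Longrightarrow> rle (n + rho) x"
    using anti_sat_dvd[OF L_csig[OF assms]] by metis
  show ?thesis using that[OF g(1)] form_Xcal_ip[OF _ g(2)] g(3) by simp
qed

lemma Sym_below_0: assumes "f \<in> Sym" "\<And>n. n \<in> ky f \<Longrightarrow> rle n 0" shows "f = cst (lk f 0)"
proof (rule poly_mapping_eqI)
  fix n
  have "n = 0" if n: "n \<in> ky f"
  proof -
    obtain n' w where n': "n' \<in> ky f" "n' \<in> Ppos" "w \<in> Wg" "n = w n'" by (rule Sym_rep[OF assms(1) n])
    have "- n' \<in> Qp" using assms(2)[OF n'(1)] by (simp add: rle_def)
    then have "n' \<bullet> (- n') \<ge> 0" by (rule Ppos_Qp[OF n'(2)])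
    moreover have "n' \<bullet> n' \<ge> 0" by simp
    ultimately have "n' \<bullet> n' = 0" by (simp add: inner_minus_right)
    then show "n = 0" using n' by simp
  qed
  then show "lk f n = lk (cst (lk f 0)) n" by (auto simp: cst_def lookup_single when_def in_keys_iff)
qed

text \<open>For symmetric h the antisymmetriser acts only on \<open>Xcal k\<close>, and the quotient
  \<open>D\<close> of the result by \<open>delta\<close> is constant, having no exponents outside
  the cone below 0. If the resulting C were 0, then 1 would be orthogonal to X^0, against
  nondegeneracy.\<close>

lemma form_Sym:
  obtains C where "C \<noteq> 0" "\<And>P h. P \<in> Sym \<Longrightarrow> h \<in> Sym \<Longrightarrow> form k P h = C * ip k P (csig h)"
proof -
  have "(1::'v \<Rightarrow>\<^sub>0 K) \<in> L (sat 0)" unfolding single_one[symmetric] by (rule L_single) (simp add: sat_def)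
  from Xcal_sat[OF this] have "Xcal k \<in> L (sat rho)" by simp
  then obtain D where D: "D \<in> Sym" "delta * D = anti (Xcal k)" "\<And>n. n \<in> ky D \<Longrightarrow> rle (n + rho) rho"
    by (rule anti_sat_dvd) blast
  have "rle n 0" if "n \<in> ky D" for n using D(3)[OF that] rle_add_cancel[of n rho 0] by simp
  then have Dc: "D = cst (lk D 0)" by (rule Sym_below_0[OF D(1)])
  let ?C = "qpow (real k) ^ card Rp * lk D 0"
  have f: "form k P h = ?C * ip k P (csig h)" if P: "P \<in> Sym" and h: "h \<in> Sym" for P h
  proof -
    have "anti (csig h * Xcal k) = csig h * (delta * D)"
      unfolding D(2) by (rule anti_mult) (rule Sym_wact[OF Sym_csig[OF h]])
    also have "\<dots> = csig h * (delta * cst (lk D 0))" by (simp only: Dc[symmetric])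
    finally have "delta * (cst (lk D 0) * csig h) = anti (csig h * Xcal k)" by (simp only: mult_ac)
    from form_ip[OF P this] show ?thesis by (simp add: ip_cmul_right)
  qed
  have "?C \<noteq> 0"
  proof
    assume C: "?C = 0"
    have "(1::'v \<Rightarrow>\<^sub>0 K) = 0"
    proof (rule form_nondegenerate[of _ k])
      fix n assume "n \<in> ky (1::'v \<Rightarrow>\<^sub>0 K)"
      then have "Xm n = (1::'v \<Rightarrow>\<^sub>0 K)" by (simp add: Xm_def split: if_splits)
      then show "form k 1 (Xm n) = 0" using f[of 1 1] C by simp
    qed
    then show False by simp
  qed
  then show ?thesis using that f by blast
qed

text \<open>Pairing f with a monomial conjugate to a dominant n' is, up to a unit, Macdonald's
  pairing with a symmetric element supported below n'. Nondegeneracy of \<open>form\<close> thus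
  transfers together with a downward bound on the tests.\<close>

lemma Sym_nondegenerate:
  assumes f: "f \<in> Sym" and z: "\<And>n y. n \<in> ky f \<Longrightarrow> y \<in> Ppos \<Longrightarrow> rle y n \<Longrightarrow> ip k f (msym y) = 0"
  shows "f = 0"
proof (rule form_nondegenerate[of _ k])
  fix n assume "n \<in> ky f"
  then obtain n' w where n': "n' \<in> ky f" "n' \<in> Ppos" "w \<in> Wg" "n = w n'" by (rule Sym_rep[OF f])
  have "Xm n \<in> L (sat n')" unfolding Xm_def n'(4) by (rule L_single, rule sat_W[OF n'(3) sat_dominant[OF n'(2)]])
  then obtain h where h: "h \<in> Sym" "\<And>n. n \<in> ky h \<Longrightarrow> rle n n'"
    "\<And>P. P \<in> Sym \<Longrightarrow> form k P (Xm n) = qpow (real k) ^ card Rp * ip k P h" by (rule form_sat_ip) (rule that; assumption)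
  have "ip k f h = 0" using ip_Sym_zero[OF h(1)] z[OF n'(1)] h(2) by blast
  then show "form k f (Xm n) = 0" using h(3)[OF f] by simp
qed

subsection \<open>Macdonald polynomials and the shift operators\<close>

text \<open>Scalar multiples of the Macdonald polynomial at \<open>x\<close>, zero included.\<close>
definition orth :: "nat \<Rightarrow> 'v \<Rightarrow> ('v \<Rightarrow>\<^sub>0 K) \<Rightarrow> bool" where
  "orth k x f \<longleftrightarrow> f \<in> Sym \<and> (\<forall>n\<in>ky f. rle n x) \<and> (\<forall>y\<in>Ppos. rlt y x \<longrightarrow> ip k f (msym y) = 0)"

lemma orth_Sym: "orth k x f \<Longrightarrow> f \<in> Sym" and orth_rle: "orth k x f \<Longrightarrow> n \<in> ky f \<Longrightarrow> rle n x"
  and orth_ip: "orth k x f \<Longrightarrow> y \<in> Ppos \<Longrightarrow> rlt y x \<Longrightarrow> ip k f (msym y) = 0"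
  by (simp_all add: orth_def)

lemma orth_L: "orth k x f \<Longrightarrow> f \<in> L (sat x)" by (simp add: Sym_sat orth_def)
lemma orth_cmul: "orth k x f \<Longrightarrow> orth k x (cst c * f)"
  by (auto simp: orth_def Sym_cmul ip_cmul_left in_keys_iff)

lemma orth_ip_zero: "orth k x f \<Longrightarrow> h \<in> Sym \<Longrightarrow> (\<And>n. n \<in> ky h \<Longrightarrow> rlt n x) \<Longrightarrow> ip k f h = 0"
  by (rule ip_Sym_zero) (auto simp: orth_def)

text \<open>The cross-multiplied difference has no coefficient at x, so its support lies strictly
  below x, where both elements are orthogonal to all orbit sums. Cross-multiplication accommodates
  vanishing leading coefficients.\<close>

lemma orth_unique: assumes f: "orth k x f" and g: "orth k x g" shows "cst (lk g x) * f = cst (lk f x) * g"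
proof -
  let ?d = "cst (lk g x) * f - cst (lk f x) * g"
  have "?d = 0"
  proof (rule Sym_nondegenerate[of _ k])
    show "?d \<in> Sym" using f g by (simp add: Sym_diff Sym_cmul orth_Sym)
    fix n y assume n: "n \<in> ky ?d" and y: "y \<in> Ppos" "rle y n"
    have "n \<noteq> x" using n by (auto simp: in_keys_iff lookup_minus)
    moreover have "n \<in> ky f \<or> n \<in> ky g" using n by (auto simp: in_keys_iff lookup_minus)
    then have "rle n x" using f g orth_rle by blast
    ultimately have "rlt y x" using y(2) rlt_trans1 unfolding rlt_def by blast
    then show "ip k ?d (msym y) = 0" using f g y(1) by (simp add: ip_diff_left ip_cmul_left orth_ip)
  qed
  then show ?thesis by simp
qed

lemma Ycal_shift:
  assumes f: "f \<in> Sym" and x: "\<And>n. n \<in> ky f \<Longrightarrow> rle n x"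
  obtains g where "g \<in> Sym" "Xcal k * g = Ycal k f" "\<And>n. n \<in> ky g \<Longrightarrow> rle (n + rho) x"
proof -
  note fP = Sym_Palg[OF f]
  have fL: "f \<in> L (sat x)" by (rule Sym_sat[OF f x])
  have YP: "Ycal k f \<in> Palg" using L_sat_Palg[OF Ycal_sat[OF fL]] .
  have "wact (rrefl s) (Ycal k f) * Xcal k = Ycal k f * wact (rrefl s) (Xcal k)" if s: "s \<in> S" for s
  proof (rule Ts_antisym_imp[OF s YP], rule Ycal_antisymmetric[OF s fP])
    show "Ts k s f = cst (qpow (real k)) * f" using Ts_sym_iff[OF s fP] Sym_wact[OF f simple_Wg[OF s]] by simp
  qed
  from antisym_dvd[OF YP this] obtain g where g: "g \<in> Sym" "Xcal k * g = Ycal k f" by blast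
  have "rle (n + rho) x" if "n \<in> ky g" for n
    using hprod_lead[OF qpow_nonzero _ that, of "- real k" "qpow (real k)" x] Ycal_sat[OF fL, of k] g(2)
    by (simp add: Xcal_hprod)
  then show ?thesis using that g by blast
qed

lemma csig_csig: "csig (csig f) = f" by (rule poly_mapping_eqI) (simp add: sigma_sigma)

text \<open>The test elements \<open>delta * csig Q\<close> recover \<open>ip (Suc k)\<close>:
  antisymmetrising Q \<open>delta\<close> returns it multiplied by the order of W.\<close>

lemma form_Xcal_delta:
  assumes "P \<in> Sym" "Q \<in> Sym"
  shows "form k (Xcal k * P) (delta * csig Q) = qpow (- real k) ^ card Rp * (of_nat (card Wg) * ip (Suc k) P Q)"
proof -
  have "anti (csig (delta * csig Q)) = anti (Q * delta)" by (simp add: csig_mult csig_delta csig_csig mult.commute)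
  also have "\<dots> = Q * anti delta" by (rule anti_mult) (rule Sym_wact[OF assms(2)])
  finally have "delta * (cst (of_nat (card Wg)) * Q) = anti (csig (delta * csig Q))"
    unfolding anti_delta by (simp only: mult_ac)
  from form_Xcal_ip[OF assms(1) this] show ?thesis by (simp add: ip_cmul_right)
qed

lemma delta_csig_sat: assumes "Q \<in> Sym" "\<And>n. n \<in> ky Q \<Longrightarrow> rle n y" shows "delta * csig Q \<in> L (sat (y + rho))"
  using assms by (intro Xcal_sat L_csig Sym_sat)

text \<open>Self-adjointness moves \<open>Ycal\<close> to the test element, whose support stays in
  the saturated set of y + rho. The symmetric element representing it lies strictly below x, where f
  is orthogonal to everything.\<close>

lemma shift_ip_zero:
  assumes f: "orth k x f" and g: "g \<in> Sym" "Xcal k * g = Ycal k f"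
    and Q: "Q \<in> Sym" "\<And>n. n \<in> ky Q \<Longrightarrow> rle n y" and y: "rlt (y + rho) x"
  shows "ip (Suc k) g Q = 0"
proof -
  note fP = Sym_Palg[OF orth_Sym[OF f]]
  have h: "delta * csig Q \<in> L (sat (y + rho))" by (rule delta_csig_sat[OF Q(1)]) (rule Q(2))
  obtain h'' where h'': "h'' \<in> Sym" "\<And>n. n \<in> ky h'' \<Longrightarrow> rle n (y + rho)"
    "\<And>P. P \<in> Sym \<Longrightarrow> form k P (Ycal k (delta * csig Q)) = qpow (real k) ^ card Rp * ip k P h''"
    by (rule form_sat_ip[OF Ycal_sat[OF h, of k], of k]) (rule that; assumption)
  have "ip k f h'' = 0" by (rule orth_ip_zero[OF f h''(1)]) (use h''(2) y rlt_trans1 in blast)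
  then have "form k (Xcal k * g) (delta * csig Q) = 0"
    unfolding g(2) by (simp add: form_Ycal[OF fP L_sat_Palg[OF h]] h''(3)[OF orth_Sym[OF f]])
  then show ?thesis using form_Xcal_delta[OF g(1) Q(1), of k] card_Wg_nz by simp
qed

lemma shift_orth:
  assumes f: "orth k (l + rho) f" and g: "g \<in> Sym" "Xcal k * g = Ycal k f" "\<And>n. n \<in> ky g \<Longrightarrow> rle (n + rho) (l + rho)"
  shows "orth (Suc k) l g"
  unfolding orth_def
proof (intro conjI ballI impI)
  fix y assume y: "y \<in> Ppos" "rlt y l"
  show "ip (Suc k) g (msym y) = 0"
    by (rule shift_ip_zero[OF f g(1,2), of _ y]) (use y keys_msym msym_Sym Ppos_Pw in auto)
qed (use g in auto)

lemma qpow_shift: "qpow (real k + c) = qpow (real k) * qpow c" "qpow (- real k + c) = qpow (- real k) * qpow c"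
    "qpow (real k - c) = qpow (real k) * qpow (- c)" "qpow (- real k - c) = qpow (- real k) * qpow (- c)"
  using qpow_add[of "real k" c] qpow_add[of "- real k" c] qpow_add[of "real k" "- c"] qpow_add[of "- real k" "- c"]
  by simp_all

text \<open>At the leading exponent l + rho the spectral shift k rho becomes (k + 1) rho, the form
  in which \<open>ck\<close> and \<open>ckhat\<close> are stated.\<close>

lemma rho_Suc: "l + (real k + 1) *\<^sub>R rho = l + rho + real k *\<^sub>R rho" by (simp add: scaleR_left_distrib)

lemma ck_alt: "ck k l = (\<Prod>a\<in>Rp. qpow (- real k) * qpow (coroot a \<bullet> (l + rho + real k *\<^sub>R rho))
    - qpow (real k) * qpow (- (coroot a \<bullet> (l + rho + real k *\<^sub>R rho))))"
  unfolding ck_def rho_Suc qpow_shift ..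

lemma ckhat_alt: "ckhat k l = (\<Prod>a\<in>Rp. qpow (real k) * qpow (coroot a \<bullet> (l + rho + real k *\<^sub>R rho))
    - qpow (- real k) * qpow (- (coroot a \<bullet> (l + rho + real k *\<^sub>R rho))))"
  unfolding ckhat_def rho_Suc qpow_shift ..

lemma rho_coroot_Rp: assumes "a \<in> Rp" shows "rho \<bullet> coroot a \<ge> 1"
proof -
  have "rho \<bullet> s > 0" if "s \<in> S" for s
  proof -
    have "2 * (rho \<bullet> s) / (s \<bullet> s) = 1" using rho_coroot[OF that] unfolding coroot_inner .
    then have "2 * (rho \<bullet> s) = s \<bullet> s" unfolding divide_eq_1_iff by blast
    moreover have "s \<bullet> s > 0" using that by simp
    ultimately show ?thesis by linarith
  qed note rs = this
  have om: "omega s \<bullet> a \<ge> 0" if "s \<in> S" for s using assms that by (auto simp: Rp_iff Qp_iff Nats_altdef2)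
  have "\<exists>s\<in>S. omega s \<bullet> a > 0"
  proof (rule ccontr)
    assume "\<not> ?thesis"
    then have "omega s \<bullet> a = omega s \<bullet> 0" if "s \<in> S" for s using om[OF that] that by force
    then show False using omega_ext[of a 0] assms by auto
  qed
  then obtain s where s: "s \<in> S" "omega s \<bullet> a > 0" by blast
  have "rho \<bullet> a = (\<Sum>s\<in>S. (omega s \<bullet> a) * (rho \<bullet> s))"
    by (subst expandS[of a]) (simp add: inner_sum_right)
  also have "\<dots> > 0" by (rule sum_pos2[OF finS s(1)]) (use s rs om in \<open>auto intro!: mult_nonneg_nonneg mult_pos_pos simp: less_imp_le\<close>)
  finally have "rho \<bullet> coroot a > 0" using assms by (simp add: coroot_inner)
  moreover obtain z where "rho \<bullet> coroot a = of_int z" using Pw_int[OF rho_Pw Rp_R[OF assms]] by (auto elim: Ints_cases)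
  ultimately show ?thesis by simp
qed

text \<open>As (coroot a, rho) is at least 1, each exponent r in the product is positive, and q^r
  differs from q^-r. The induction on k needs this to normalise the shifted element.\<close>

lemma ck_nonzero: assumes "l \<in> Ppos" shows "ck k l \<noteq> 0"
  unfolding ck_def
proof (subst prod_zero_iff[OF finRp], rule notI, elim bexE)
  fix a assume a: "a \<in> Rp" and z: "qpow (- real k + coroot a \<bullet> (l + (real k + 1) *\<^sub>R rho)) - qpow (real k - coroot a \<bullet> (l + (real k + 1) *\<^sub>R rho)) = 0"
  define r where "r = - real k + coroot a \<bullet> (l + (real k + 1) *\<^sub>R rho)"
  have la: "coroot a \<bullet> l \<ge> 0" using Ppos_Rp[OF assms a] by (simp only: inner_commute[of "coroot a" l]) (simp add: coroot_inner)
  have m: "(real k + 1) * (coroot a \<bullet> rho) \<ge> (real k + 1) * 1"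
    by (rule mult_left_mono) (use rho_coroot_Rp[OF a] in \<open>simp_all add: inner_commute\<close>)
  have "0 < - x + (y + z)" if "0 \<le> y" "(x + 1) * 1 \<le> z" for x y z :: real using that by simp
  from this[OF la m] have r: "r > 0" unfolding r_def inner_add_right inner_scaleR_right .
  have "coroot a \<bullet> (l + (real k + 1) *\<^sub>R rho) \<in> \<int>"
    using Pw_int[OF Ppos_Pw[OF assms] Rp_R[OF a]] Pw_int[OF rho_Pw Rp_R[OF a]]
    by (simp add: inner_add_right inner_commute Ints_add Ints_mult)
  then have mz: "mz r" by (simp add: r_def mz_Ints Ints_add)
  have "real k - coroot a \<bullet> (l + (real k + 1) *\<^sub>R rho) = - r" by (simp add: r_def)
  then have "qpow r = qpow (- r)" using z unfolding r_def[symmetric] by simp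
  then have "qpow (r + r) = 1" using qpow_add[OF mz, of r] qpow_uminus[OF mz] by simp
  then show False using qpow_eq_1[OF mz_add[OF mz mz]] r by simp
qed

text \<open>\<open>ck\<close> is the eigenvalue of \<open>Ycal\<close> on the leading coefficient;
  dividing by the leading coefficient q^(-k|R+|) of \<open>Xcal k\<close> yields the
  prefactor.\<close>

lemma shift_lead:
  assumes l: "l \<in> Ppos" and f: "f \<in> L (sat (l + rho))"
    and g: "Xcal k * g = Ycal k f" "\<And>n. n \<in> ky g \<Longrightarrow> rle (n + rho) (l + rho)"
  shows "lk g l = qpow (real k) ^ card Rp * ck k l * lk f (l + rho)"
proof -
  have "qpow (- real k) ^ card Rp * lk g l = lk (Xcal k * g) (l + rho)"
    unfolding Xcal_hprod by (rule hprod_top[symmetric]) (use g(2) rle_antisym in auto)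
  also have "\<dots> = ck k l * lk f (l + rho)"
    unfolding g(1) Ycal_evY lead_hprod[OF Ppos_add[OF l rho_Ppos] f] ck_alt ..
  finally have "qpow (real k) ^ card Rp * qpow (- real k) ^ card Rp * lk g l = qpow (real k) ^ card Rp * (ck k l * lk f (l + rho))"
    by (simp only: mult.assoc)
  then show ?thesis unfolding qpow_card by (simp add: mult.assoc)
qed

lemma msym_orthogonal: assumes "l \<in> Ppos" and y: "y \<in> Ppos" "y \<noteq> l" shows "ip 0 (msym l) (msym y) = 0"
proof -
    have "lk (msym l * bar (msym y)) 0 = 0"
      unfolding CT_mult
    proof (rule sum.neutral, rule ballI)
      fix n assume "n \<in> ky (msym l)"
      then obtain w where w: "w \<in> Wg" "n = w l" by (auto simp: in_keys_iff lookup_msym split: if_splits)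
      have "lk (msym y) n = lk (msym y) l" unfolding w(2) by (rule Sym_lookup[OF msym_Sym[OF Ppos_Pw[OF y(1)]] w(1)])
      then show "lk (msym l) n * lk (bar (msym y)) (- n) = 0" using lookup_msym_Ppos[OF y(1) assms(1)] y(2) by simp
    qed
    then show ?thesis by (simp add: ip_def Delta_def)
qed

lemma orth_0_msym: assumes "l \<in> Ppos" shows "orth 0 l (msym l)"
  using assms msym_orthogonal[OF assms] msym_Sym Ppos_Pw keys_msym by (auto simp: orth_def rlt_def)

text \<open>Orthogonality is claimed for all distinct dominant weights, comparable or not. In the
  step, elements at l for k + 1 arise by shifting those at l + rho for k.\<close>

lemma macdonald_family:
  "(\<forall>l\<in>Ppos. \<exists>f. orth k l f \<and> lk f l = 1)
   \<and> (\<forall>l\<in>Ppos. \<forall>y\<in>Ppos. l \<noteq> y \<longrightarrow> (\<forall>f g. orth k l f \<longrightarrow> orth k y g \<longrightarrow> ip k f g = 0))"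
proof (induction k)
  case 0
  show ?case
  proof (intro conjI ballI impI allI)
    fix l assume "l \<in> Ppos"
    then show "\<exists>f. orth 0 l f \<and> lk f l = 1" using orth_0_msym[of l] lookup_msym_Ppos[of l l] by auto
  next
    fix l y f g assume l: "l \<in> Ppos" "y \<in> Ppos" "l \<noteq> y" and o: "orth 0 l f" "orth 0 y g"
    have "f = cst (lk f l) * msym l" "g = cst (lk g y) * msym y"
      using orth_unique[OF o(1) orth_0_msym[OF l(1)]] orth_unique[OF o(2) orth_0_msym[OF l(2)]] l lookup_msym_Ppos by simp_all
    then show "ip 0 f g = 0" using msym_orthogonal[OF l(1,2)] l(3)[symmetric] ip_cmul_left ip_cmul_right by (metis mult_zero_right)
  qed
next
  case (Suc k)
  have shift: "\<exists>F g. orth k (l + rho) F \<and> g \<in> Sym \<and> Xcal k * g = Ycal k F \<and> orth (Suc k) l g \<and> lk g l \<noteq> 0" if l: "l \<in> Ppos" for l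
  proof -
    obtain F where F: "orth k (l + rho) F" "lk F (l + rho) = 1" using Suc Ppos_add[OF l rho_Ppos] by blast
    obtain g where g: "g \<in> Sym" "Xcal k * g = Ycal k F" "\<And>n. n \<in> ky g \<Longrightarrow> rle (n + rho) (l + rho)"
      by (rule Ycal_shift[OF orth_Sym[OF F(1)], where x = "l + rho" and k = k]) (erule orth_rle[OF F(1)], (rule that; assumption))
    have "lk g l \<noteq> 0" using shift_lead[OF l orth_L[OF F(1)] g(2,3)] F(2) ck_nonzero[OF l] by simp
    then show ?thesis using F(1) g(1,2) shift_orth[OF F(1) g] by blast
  qed
  show ?case
  proof (intro conjI ballI impI allI)
    fix l assume "l \<in> Ppos"
    then obtain g where "orth (Suc k) l g" "lk g l \<noteq> 0" using shift by blast
    then show "\<exists>f. orth (Suc k) l f \<and> lk f l = 1"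
      by (intro exI[of _ "cst (inverse (lk g l)) * g"]) (simp add: orth_cmul)
  next
    fix l y p q assume l: "l \<in> Ppos" "y \<in> Ppos" "l \<noteq> y" and o: "orth (Suc k) l p" "orth (Suc k) y q"
    obtain F f where F: "orth k (l + rho) F" "f \<in> Sym" "Xcal k * f = Ycal k F" "orth (Suc k) l f" "lk f l \<noteq> 0"
      using shift[OF l(1)] by blast
    obtain g where G: "g \<in> Sym" "orth (Suc k) y g" "lk g y \<noteq> 0" using shift[OF l(2)] by blast
    let ?h = "delta * csig g"
    have hL: "?h \<in> L (sat (y + rho))" by (rule delta_csig_sat[OF G(1) orth_rle[OF G(2)]])
    obtain h where h: "h \<in> Sym" "\<And>n. n \<in> ky h \<Longrightarrow> rle n (y + rho)"
      "\<And>P. P \<in> Sym \<Longrightarrow> form k P (Ycal k ?h) = qpow (real k) ^ card Rp * ip k P h"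
      by (rule form_sat_ip[OF Ycal_sat[OF hL, of k], of k]) (rule that; assumption)
    \<comment> \<open>Pairing with \<open>h\<close> represents pairing with \<open>Ycal\<close> of
      the test element made from g. Shifting the orbit sum at n shows that \<open>h\<close>
      satisfies \<open>orth\<close> at y + rho; orthogonality for k then applies to the distinct
      weights l + rho and y + rho.\<close>
    have "ip k h (msym n) = 0" if n: "n \<in> Ppos" "rlt n (y + rho)" for n
    proof -
      note nS = msym_Sym[OF Ppos_Pw[OF n(1)]]
      obtain e where e: "e \<in> Sym" "Xcal k * e = Ycal k (msym n)" "\<And>x. x \<in> ky e \<Longrightarrow> rle (x + rho) n"
        by (rule Ycal_shift[OF nS, where x = n and k = k]) (erule keys_msym[OF n(1)], (rule that; assumption))
      have "ip (Suc k) g e = 0"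
      proof (rule orth_ip_zero[OF G(2) e(1)])
        fix x assume "x \<in> ky e"
        then have "rlt (x + rho) (y + rho)" using e(3) n(2) rlt_trans1 by blast
        then show "rlt x y" by simp
      qed
      then have "form k (Ycal k (msym n)) ?h = 0" unfolding e(2)[symmetric] form_Xcal_delta[OF e(1) G(1)] by (simp add: ip_commute)
      then have "form k (msym n) (Ycal k ?h) = 0" using form_Ycal[OF Sym_Palg[OF nS] L_sat_Palg[OF hL], of k] by simp
      then show ?thesis using h(3)[OF nS] by (simp add: ip_commute)
    qed
    then have "orth k (y + rho) h" using h by (simp add: orth_def)
    then have "ip k F h = 0" using Suc Ppos_add[OF l(1) rho_Ppos] Ppos_add[OF l(2) rho_Ppos] l(3) F(1)
      by (metis add_right_cancel)
    then have "form k (Ycal k F) ?h = 0"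
      using form_Ycal[OF Sym_Palg[OF orth_Sym[OF F(1)]] L_sat_Palg[OF hL], of k] h(3)[OF orth_Sym[OF F(1)]] by simp
    then have fg: "ip (Suc k) f g = 0" unfolding F(3)[symmetric] form_Xcal_delta[OF F(2) G(1)] using card_Wg_nz by simp
    have "lk f l * (lk g y * ip (Suc k) p q) = ip (Suc k) (cst (lk f l) * p) (cst (lk g y) * q)"
      by (simp add: ip_cmul_left ip_cmul_right)
    also have "\<dots> = 0" unfolding orth_unique[OF o(1) F(4)] orth_unique[OF o(2) G(2)] by (simp add: ip_cmul_left ip_cmul_right fg)
    finally show "ip (Suc k) p q = 0" using F(5) G(3) by simp
  qed
qed

lemma orth_exists: "l \<in> Ppos \<Longrightarrow> \<exists>f. orth k l f \<and> lk f l = 1"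
  and orth_orthogonal: "l \<in> Ppos \<Longrightarrow> y \<in> Ppos \<Longrightarrow> l \<noteq> y \<Longrightarrow> orth k l f \<Longrightarrow> orth k y g \<Longrightarrow> ip k f g = 0"
  using macdonald_family[of k] by blast+

lemma orth_monic_unique: "orth k l f \<Longrightarrow> orth k l g \<Longrightarrow> lk f l = 1 \<Longrightarrow> lk g l = 1 \<Longrightarrow> f = g"
  using orth_unique[of k l f g] by simp

lemma qpow_real_card: "qpow (real k * real (card Rp)) = qpow (real k) ^ card Rp"
    "qpow (- real k * real (card Rp)) = qpow (- real k) ^ card Rp"
proof -
  have "real k * real (card Rp) = real (card Rp) * real k" "- real k * real (card Rp) = real (card Rp) * - real k"
    by (rule mult.commute)+
  then show "qpow (real k * real (card Rp)) = qpow (real k) ^ card Rp" "qpow (- real k * real (card Rp)) = qpow (- real k) ^ card Rp"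
    using qpow_power[of "real k" "card Rp"] qpow_power[of "- real k" "card Rp"] by (simp_all only: mz_uminus mz_nat)
qed

lemma shift_eq:
  assumes l: "l \<in> Ppos" and f: "orth k (l + rho) f" "lk f (l + rho) = 1" and p: "orth (Suc k) l p" "lk p l = 1"
  shows "Gop k f = cst (qpow (real k) ^ card Rp * ck k l) * p"
proof -
  obtain g where g: "g \<in> Sym" "Xcal k * g = Ycal k f" "\<And>n. n \<in> ky g \<Longrightarrow> rle (n + rho) (l + rho)"
    by (rule Ycal_shift[OF orth_Sym[OF f(1)], where x = "l + rho" and k = k]) (erule orth_rle[OF f(1)], (rule that; assumption))
  have "lk g l = qpow (real k) ^ card Rp * ck k l" using shift_lead[OF l orth_L[OF f(1)] g(2,3)] f(2) by simp
  moreover have "g = cst (lk g l) * p" using orth_unique[OF shift_orth[OF f(1) g] p(1)] p(2) by simp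
  moreover have "Gop k f = g"
    unfolding Gop_def
  proof (rule the_equality)
    show "g \<in> Palg \<and> Xcal k * g = Ycal k f" using g Sym_Palg by blast
    fix g' assume "g' \<in> Palg \<and> Xcal k * g' = Ycal k f"
    then have "Xcal k * g' = Xcal k * g" unfolding g(2) by blast
    then show "g' = g" by (rule Xcal_cancel)
  qed
  ultimately show ?thesis by simp
qed

text \<open>A dominant y with y + rho below l cannot satisfy y + rho = l, because l - rho is not
  dominant. All these inequalities are strict, so the shifted element is orthogonal to every orbit
  sum that could detect it.\<close>

lemma shift_zero:
  assumes l: "l \<in> Ppos" "l - rho \<notin> Ppos" and f: "orth k l f" shows "Gop k f = 0"
proof -
  obtain g where g: "g \<in> Sym" "Xcal k * g = Ycal k f" "\<And>n. n \<in> ky g \<Longrightarrow> rle (n + rho) l"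
    by (rule Ycal_shift[OF orth_Sym[OF f(1)], where x = l and k = k]) (erule orth_rle[OF f(1)], (rule that; assumption))
  have "g = 0"
  proof (rule Sym_nondegenerate[OF g(1), of "Suc k"])
    fix n y assume n: "n \<in> ky g" and y: "y \<in> Ppos" "rle y n"
    have "y + rho \<noteq> l" using y(1) l(2) by auto
    moreover have "rle (y + rho) l" using g(3)[OF n] y(2) rle_trans[of "y + rho" "n + rho" l] by simp
    ultimately have "rlt (y + rho) l" by (simp add: rlt_def)
    then show "ip (Suc k) g (msym y) = 0"
      by (rule shift_ip_zero[OF f g(1,2) msym_Sym[OF Ppos_Pw[OF y(1)]], rotated]) (rule keys_msym[OF y(1)])
  qed
  then have "Ycal k f = 0" using g(2) by simp
  then show ?thesis unfolding Gop_def by (intro the_equality) (use Xcal_cancel[of k _ 0] in auto)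
qed

text \<open>Adjointness of \<open>Ycalhat\<close> turns pairing with a lower orbit sum into an
  \<open>ip (Suc k)\<close> pairing of p with an element below l. Here \<open>Xcal k\<close>
  multiplies and is not divided out, so its leading coefficient q^(-k|R+|) enters directly.\<close>

lemma shift_hat_eq:
  assumes l: "l \<in> Ppos" and p: "orth (Suc k) l p" "lk p l = 1" and f: "orth k (l + rho) f" "lk f (l + rho) = 1"
  shows "Ghat k p = cst (qpow (- real k) ^ card Rp * ckhat k l) * f"
proof -
  note pS = orth_Sym[OF p(1)]
  have XL: "Xcal k * p \<in> L (sat (l + rho))" by (rule Xcal_sat[OF orth_L[OF p(1)]])
  note XP = L_sat_Palg[OF XL]
  have GL: "Ghat k p \<in> L (sat (l + rho))" unfolding Ghat_def by (rule Ycalhat_sat[OF XL])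
  note GP = L_sat_Palg[OF GL]
  have GS: "Ghat k p \<in> Sym"
  proof (rule Sym_simple[OF GP])
    fix s assume s: "s \<in> S"
    have "Ts k s (Ghat k p) = cst (qpow (real k)) * Ghat k p"
      unfolding Ghat_def by (rule Ycalhat_symmetric[OF s XP Ts_Xcal_Sym[OF s pS]])
    then show "wact (rrefl s) (Ghat k p) = Ghat k p" using Ts_sym_iff[OF s GP] by simp
  qed
  obtain C where C: "C \<noteq> 0" "\<And>P h. P \<in> Sym \<Longrightarrow> h \<in> Sym \<Longrightarrow> form k P h = C * ip k P (csig h)"
    by (rule form_Sym[of k]) (rule that; assumption)
  have "orth k (l + rho) (Ghat k p)"
    unfolding orth_def
  proof (intro conjI ballI impI GS)
    fix n assume "n \<in> ky (Ghat k p)"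
    then have "n \<in> sat (l + rho)" using GL by (auto simp: L_def)
    then show "rle n (l + rho)" by (rule sat_rle)
  next
    fix y assume y: "y \<in> Ppos" "rlt y (l + rho)"
    note yS = msym_Sym[OF Ppos_Pw[OF y(1)]]
    have yL: "msym y \<in> L (sat y)" by (rule Sym_sat[OF yS keys_msym[OF y(1)]])
    obtain h where h: "h \<in> Sym" "\<And>n. n \<in> ky h \<Longrightarrow> rle (n + rho) y"
      "\<And>P. P \<in> Sym \<Longrightarrow> form k (Xcal k * P) (Ycalhat k (msym y)) = qpow (- real k) ^ card Rp * ip (Suc k) P h"
      by (rule form_Xcal_sat_ip[OF Ycalhat_sat[OF yL, of k], of k]) (rule that; assumption)
    have "ip (Suc k) p h = 0"
    proof (rule orth_ip_zero[OF p(1) h(1)])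
      fix n assume "n \<in> ky h"
      then have "rlt (n + rho) (l + rho)" using h(2) y(2) rlt_trans1 by blast
      then show "rlt n l" by simp
    qed
    then have "form k (Ghat k p) (msym y) = 0"
      unfolding Ghat_def form_Ycalhat[OF XP Sym_Palg[OF yS]] h(3)[OF pS] by simp
    then show "ip k (Ghat k p) (msym y) = 0" using C(2)[OF GS yS] C(1) by (simp add: csig_msym)
  qed
  from orth_unique[OF this f(1)] f(2) have "Ghat k p = cst (lk (Ghat k p) (l + rho)) * f" by simp
  moreover have "lk (Ghat k p) (l + rho) = qpow (- real k) ^ card Rp * ckhat k l"
  proof -
    have "lk (Xcal k * p) (l + rho) = qpow (- real k) ^ card Rp * lk p l"
      unfolding Xcal_hprod by (rule hprod_top) (use orth_rle[OF p(1)] rle_antisym in blast)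
    then show ?thesis
      unfolding Ghat_def Ycalhat_evY lead_hprod[OF Ppos_add[OF l rho_Ppos] XL] ckhat_alt using p(2) by (simp add: mult.commute)
  qed
  ultimately show ?thesis by simp
qed

section \<open>The definite description in \<open>Pfam\<close>\<close>

definition macfam :: "nat \<Rightarrow> ('v \<Rightarrow> ('v \<Rightarrow>\<^sub>0 K)) \<Rightarrow> bool" where
  "macfam k F \<longleftrightarrow> (\<forall>l. l \<notin> Ppos \<longrightarrow> F l = 0)
     \<and> (\<forall>l\<in>Ppos. F l \<in> Sym
          \<and> (\<exists>c::'v \<Rightarrow> K. finite {nu. c nu \<noteq> 0} \<and> (\<forall>nu. c nu \<noteq> 0 \<longrightarrow> nu \<in> Ppos \<and> rlt nu l)
               \<and> F l - msym l = (\<Sum>nu\<in>{nu. c nu \<noteq> 0}. cst (c nu) * msym nu)))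
     \<and> (\<forall>l\<in>Ppos. \<forall>l'\<in>Ppos. l \<noteq> l' \<longrightarrow> ip k (F l) (F l') = 0)"

text \<open>The definition gives orthogonality within the family, while \<open>orth\<close> asks for
  orthogonality to orbit sums. Induction on the number of dominant weights below y passes from F y
  to its leading orbit sum.\<close>

lemma macfam_orth:
  assumes F: "macfam k F" and l: "l \<in> Ppos" shows "orth k l (F l)" "lk (F l) l = 1"
proof -
  have S: "F x \<in> Sym" if "x \<in> Ppos" for x using F that by (simp add: macfam_def)
  have ex: "\<exists>c::'v \<Rightarrow> K. finite {nu. c nu \<noteq> 0} \<and> (\<forall>nu. c nu \<noteq> 0 \<longrightarrow> nu \<in> Ppos \<and> rlt nu x)
     \<and> F x - msym x = (\<Sum>nu\<in>{nu. c nu \<noteq> 0}. cst (c nu) * msym nu)" if "x \<in> Ppos" for x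
    using F that by (simp add: macfam_def)
  obtain c :: "'v \<Rightarrow> K" where c: "\<And>nu. c nu \<noteq> 0 \<Longrightarrow> nu \<in> Ppos \<and> rlt nu l"
    "F l - msym l = (\<Sum>nu\<in>{nu. c nu \<noteq> 0}. cst (c nu) * msym nu)" using ex[OF l] by blast
  have Fl: "lk (F l) n = lk (msym l) n + (\<Sum>nu\<in>{nu. c nu \<noteq> 0}. c nu * lk (msym nu) n)" for n
    using arg_cong[OF c(2), of "\<lambda>f. lk f n"] by (simp add: lookup_minus lookup_sum algebra_simps)
  have "(\<Sum>nu\<in>{nu. c nu \<noteq> 0}. c nu * lk (msym nu) l) = 0"
    by (rule sum.neutral) (use c(1) lookup_msym_Ppos[OF _ l] in \<open>auto simp: rlt_def\<close>)
  then show "lk (F l) l = 1" using Fl[of l] lookup_msym_Ppos[OF l l] by simp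
  have keys: "rle n l" if n: "n \<in> ky (F l)" for n
  proof (rule ccontr)
    assume nl: "\<not> rle n l"
    have "lk (msym l) n = 0" using keys_msym[OF l] nl by (auto simp: in_keys_iff)
    moreover have "(\<Sum>nu\<in>{nu. c nu \<noteq> 0}. c nu * lk (msym nu) n) = 0"
    proof (rule sum.neutral, rule ballI)
      fix nu assume "nu \<in> {nu. c nu \<noteq> 0}"
      then have nu: "nu \<in> Ppos" "rle nu l" using c(1) by (auto simp: rlt_def)
      have "n \<notin> ky (msym nu)" using keys_msym[OF nu(1)] nu(2) nl rle_trans by blast
      then show "c nu * lk (msym nu) n = 0" by (simp add: in_keys_iff)
    qed
    ultimately show False using Fl[of n] n by (simp add: in_keys_iff)
  qed
  have "ip k (F l) (msym y) = 0" if "y \<in> Ppos" "rlt y l" for y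
    using that
  proof (induction "card {x \<in> Ppos. rlt x y}" arbitrary: y rule: less_induct)
    case less
    obtain d :: "'v \<Rightarrow> K" where d: "\<And>nu. d nu \<noteq> 0 \<Longrightarrow> nu \<in> Ppos \<and> rlt nu y"
      "F y - msym y = (\<Sum>nu\<in>{nu. d nu \<noteq> 0}. cst (d nu) * msym nu)" using ex[OF less(2)] by blast
    have z: "ip k (F l) (msym nu) = 0" if nu: "nu \<in> {nu. d nu \<noteq> 0}" for nu
    proof (rule less(1))
      have nu': "nu \<in> Ppos" "rlt nu y" using d(1) nu by auto
      have fin: "finite {x \<in> Ppos. rlt x y}"
      proof (rule finite_subset[OF _ finite_sat[OF less(2)]], rule subsetI)
        fix x assume "x \<in> {x \<in> Ppos. rlt x y}"
        then have "x \<in> sat x" "rle x y" using sat_dominant by (auto simp: rlt_def)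
        then show "x \<in> sat y" using sat_mono by blast
      qed
      have "{x \<in> Ppos. rlt x nu} \<subset> {x \<in> Ppos. rlt x y}"
      proof
        show "{x \<in> Ppos. rlt x nu} \<subseteq> {x \<in> Ppos. rlt x y}" using nu'(2) rlt_trans1 by (auto simp: rlt_def)
        show "{x \<in> Ppos. rlt x nu} \<noteq> {x \<in> Ppos. rlt x y}" using nu' by (auto simp: rlt_def)
      qed
      then show "card {x \<in> Ppos. rlt x nu} < card {x \<in> Ppos. rlt x y}" by (rule psubset_card_mono[OF fin])
      show "nu \<in> Ppos" by (rule nu'(1))
      show "rlt nu l" using nu'(2) less(3) rlt_trans1 by (auto simp: rlt_def)
    qed
    have "ip k (F l) (F y - msym y) = 0"
      unfolding d(2) ip_sum_right ip_cmul_right by (rule sum.neutral) (use z in simp)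
    moreover have "l \<noteq> y" using less(3) by (auto simp: rlt_def)
    then have "ip k (F l) (F y) = 0" using F l less(2) unfolding macfam_def by blast
    ultimately show ?case by (simp add: ip_commute[of k "F l"] ip_diff_left)
  qed
  then show "orth k l (F l)" using S[OF l] keys by (simp add: orth_def)
qed

lemma macfam_exists: "\<exists>F. macfam k F"
proof -
  have "\<forall>l. \<exists>f. l \<in> Ppos \<longrightarrow> orth k l f \<and> lk f l = 1" using orth_exists by blast
  then obtain E where E: "\<And>l. l \<in> Ppos \<Longrightarrow> orth k l (E l)" "\<And>l. l \<in> Ppos \<Longrightarrow> lk (E l) l = 1" by metis
  define F where "F l = (if l \<in> Ppos then E l else 0)" for l
  have "macfam k F"
    unfolding macfam_def
  proof (intro conjI ballI allI impI)
    fix l assume l: "l \<in> Ppos"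
    show "F l \<in> Sym" using orth_Sym[OF E(1)[OF l]] l by (simp add: F_def)
    let ?d = "E l - msym l"
    have dS: "?d \<in> Sym" using orth_Sym[OF E(1)[OF l]] msym_Sym[OF Ppos_Pw[OF l]] by (rule Sym_diff)
    define c where "c n = (if n \<in> Ppos then lk ?d n else 0)" for n
    have cs: "{n. c n \<noteq> 0} = ky ?d \<inter> Ppos" by (auto simp: c_def in_keys_iff)
    have "?d = (\<Sum>n\<in>{n. c n \<noteq> 0}. cst (c n) * msym n)"
      unfolding cs by (subst Sym_expand[OF dS], rule sum.cong) (auto simp: c_def)
    moreover have "n \<in> Ppos \<and> rlt n l" if "c n \<noteq> 0" for n
    proof -
      have n: "n \<in> Ppos" "lk (E l) n - lk (msym l) n \<noteq> 0" using that by (auto simp: c_def lookup_minus split: if_splits)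
      have "n \<noteq> l" using n(2) E(2)[OF l] lookup_msym_Ppos[OF l l] by auto
      moreover have "n \<in> ky (E l) \<or> n \<in> ky (msym l)" using n(2) by (auto simp: in_keys_iff)
      then have "rle n l" using orth_rle[OF E(1)[OF l]] keys_msym[OF l] by blast
      ultimately show ?thesis using n(1) by (simp add: rlt_def)
    qed
    moreover have "finite {n. c n \<noteq> 0}" unfolding cs by simp
    ultimately show "\<exists>c::'v \<Rightarrow> K. finite {nu. c nu \<noteq> 0} \<and> (\<forall>nu. c nu \<noteq> 0 \<longrightarrow> nu \<in> Ppos \<and> rlt nu l)
               \<and> F l - msym l = (\<Sum>nu\<in>{nu. c nu \<noteq> 0}. cst (c nu) * msym nu)"
      using l by (intro exI[of _ c]) (simp add: F_def)
    fix y assume "y \<in> Ppos" "l \<noteq> y"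
    then show "ip k (F l) (F y) = 0" using orth_orthogonal[OF l _ _ E(1)[OF l] E(1)] l by (simp add: F_def)
  qed (simp add: F_def)
  then show ?thesis by blast
qed

lemma Pfam_orth: assumes "l \<in> Ppos" shows "orth k l (Pfam k l)" "lk (Pfam k l) l = 1"
proof -
  obtain F where F: "macfam k F" using macfam_exists by blast
  have "Pfam k = F"
    unfolding Pfam_def macfam_def[symmetric]
  proof (rule the_equality)
    show "macfam k F" by (rule F)
    fix G assume G: "macfam k G"
    show "G = F"
    proof
      fix l show "G l = F l"
      proof (cases "l \<in> Ppos")
        case True
        show ?thesis
          by (rule orth_monic_unique[OF macfam_orth(1)[OF G True] macfam_orth(1)[OF F True] macfam_orth(2)[OF G True] macfam_orth(2)[OF F True]])
      next
        case False
        then show ?thesis using F G by (simp add: macfam_def)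
      qed
    qed
  qed
  then show "orth k l (Pfam k l)" "lk (Pfam k l) l = 1" using macfam_orth[OF F assms] by simp_all
qed

lemma shift_identities:
  "(\<forall>l\<in>Ppos. Gop k (Pfam k (l + rho)) = cst (qpow (real k * real (card Rp)) * ck k l) * Pfam (k + 1) l)
   \<and> (\<forall>l\<in>Ppos. l - rho \<notin> Ppos \<longrightarrow> Gop k (Pfam k l) = 0)
   \<and> (\<forall>l\<in>Ppos. Ghat k (Pfam (k + 1) l) = cst (qpow (- real k * real (card Rp)) * ckhat k l) * Pfam k (l + rho))"
proof (intro conjI ballI impI)
  fix l assume l: "l \<in> Ppos"
  note a = Pfam_orth[OF Ppos_add[OF l rho_Ppos], of k] and b = Pfam_orth[OF l, of "Suc k"]
  show "Gop k (Pfam k (l + rho)) = cst (qpow (real k * real (card Rp)) * ck k l) * Pfam (k + 1) l"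
    using shift_eq[OF l a b] by (simp only: qpow_real_card Suc_eq_plus1)
  show "Ghat k (Pfam (k + 1) l) = cst (qpow (- real k * real (card Rp)) * ckhat k l) * Pfam k (l + rho)"
    using shift_hat_eq[OF l b a] by (simp only: qpow_real_card Suc_eq_plus1)
next
  fix l assume l: "l \<in> Ppos" "l - rho \<notin> Ppos"
  show "Gop k (Pfam k l) = 0" by (rule shift_zero[OF l Pfam_orth(1)[OF l(1)]])
qed

end

theorem theorem7p4:
  fixes R S :: "'v::euclidean_space set" and m k :: nat
  assumes "root_datum R S m"
  shows "(\<forall>l\<in>mac.Ppos S.
            mac.Gop R S m k (mac.Pfam R S m k (l + mac.rho R S))
              = mac.cst (mac.qpow m (real k * real (card (mac.Rp R S))) * mac.ck R S m k l)
                * mac.Pfam R S m (k + 1) l)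
       \<and> (\<forall>l\<in>mac.Ppos S. l - mac.rho R S \<notin> mac.Ppos S \<longrightarrow> mac.Gop R S m k (mac.Pfam R S m k l) = 0)
       \<and> (\<forall>l\<in>mac.Ppos S.
            mac.Ghat R S m k (mac.Pfam R S m (k + 1) l)
              = mac.cst (mac.qpow m (- real k * real (card (mac.Rp R S))) * mac.ckhat R S m k l)
                * mac.Pfam R S m k (l + mac.rho R S))"
proof -
  interpret rd R S m by (rule rd.intro) (rule assms)
  show ?thesis by (rule shift_identities)
qed

end
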